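(* Let $E$ be a graded Lie algebra over $\mathbb{Z}$ admitting a quadratic, finite presentation $E=\mathbf{L}/I$, where $\mathbf{L}=\mathbf{L}_Y$ is the free Lie algebra over $\mathbb{Z}$ on a finite set $Y$ (in degree $1$) and $I$ is a graded ideal generated by $J:=I\cap\mathbf{L}^2$. Let $S=\mathbb{Z}[Y]$. Then $$S\otimes\Big(\textstyle\bigwedge^3_Y\oplus J\Big)\xrightarrow{\ d_3+(\mathrm{id}\otimes\partial)\ }S\otimes\textstyle\bigwedge^2_Y\longrightarrow B(E)\to0$$ is a homogeneous, finite $S$-presentation (i.e. an exact sequence of graded $S$-modules) of the infinitesimal Alexander invariant $B(E)=E'/E''$, where the second map is the $S$-linear map sending $x\wedge y$ to the class of $[x,y]$, and: - $\deg(\bigwedge^k_Y)=k$ and $\deg(J)=2$; - $\partial$ is the inclusion of $J$ into $\bigwedge^2_Y$ (identified with $\mathbf{L}^2$); - $d_3$ is the $S$-linear map with $d_3(x\wedge y\wedge z)=x\otimes y\wedge z-y\otimes x\wedge z+z\otimes x\wedge y$ for $x,y,z\in Y$.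
   Context: $\mathbf{L}_Y$ is graded by bracket length; $\mathbf{L}^k$ denotes its degree $k$ part. $\bigwedge^*_Y$ is the exterior algebra over $\mathbb{Z}$ on the free abelian group on $Y$; one identifies $\mathbf{L}_Y^1=\bigwedge^1_Y$ and $\mathbf{L}_Y^2=\bigwedge_Y^2$, with $[x,y]$ corresponding to $x\wedge y$. $S=\mathbb{Z}[Y]$ is the symmetric (polynomial) algebra with variables in degree $1$; it is the universal enveloping algebra of the abelian Lie algebra $\mathbf{L}_Y/\mathbf{L}_Y'$. For a Lie algebra $E$, $E'=[E,E]$ and $E''=[E',E']$. The infinitesimal Alexander invariant of $E=\mathbf{L}_Y/I$ ($I$ homogeneous, generated in degree $\ge2$) is the graded $S$-module $B(E)=E'/E''$, with grading inherited from $E$ and with $S$-action given by the adjoint representation: $y\in Y$ acts by $u\bmod E''\mapsto[y,u]\bmod E''$, via the exact sequence $0\to E'/E''\to E/E''\to E/E'\to0$. *)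

theory Defs
  imports "HOL-Algebra.QuotRing" "HOL-Algebra.Module" "HOL-Algebra.Free_Abelian_Groups"
    "HOL-Library.Multiset" "HOL-Library.Poly_Mapping"
begin

section \<open>Graded abelian groups and graded modules\<close>

definition graded_group :: "('a, 'm) ring_scheme \<Rightarrow> (nat \<Rightarrow> 'a set) \<Rightarrow> bool" where
  "graded_group M D \<longleftrightarrow>
     abelian_group M \<and>
     (\<forall>k. subgroup (D k) (add_monoid M)) \<and>
     (\<forall>x \<in> carrier M. \<exists>!f. (\<forall>k. f k \<in> D k) \<and> finite {k. f k \<noteq> \<zero>\<^bsub>M\<^esub>} \<and>
        x = (\<Oplus>\<^bsub>M\<^esub>k \<in> {k. f k \<noteq> \<zero>\<^bsub>M\<^esub>}. f k))"

definition graded_module ::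
    "('r, 'n) ring_scheme \<Rightarrow> (nat \<Rightarrow> 'r set) \<Rightarrow> ('r, 'a, 'm) module_scheme \<Rightarrow> (nat \<Rightarrow> 'a set) \<Rightarrow> bool"
where
  "graded_module R RD M D \<longleftrightarrow>
     module R M \<and> graded_group R RD \<and> graded_group M D \<and>
     (\<forall>i j. \<forall>r \<in> RD i. \<forall>x \<in> D j. r \<odot>\<^bsub>M\<^esub> x \<in> D (i + j))"

definition module_hom ::
    "('r, 'n) ring_scheme \<Rightarrow> ('r, 'a, 'm) module_scheme \<Rightarrow> ('r, 'b, 'k) module_scheme \<Rightarrow> ('a \<Rightarrow> 'b) set"
where
  "module_hom R M N =
     {h \<in> carrier M \<rightarrow> carrier N.
        (\<forall>x \<in> carrier M. \<forall>y \<in> carrier M. h (x \<oplus>\<^bsub>M\<^esub> y) = h x \<oplus>\<^bsub>N\<^esub> h y) \<and>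
        (\<forall>r \<in> carrier R. \<forall>x \<in> carrier M. h (r \<odot>\<^bsub>M\<^esub> x) = r \<odot>\<^bsub>N\<^esub> h x)}"

definition homogeneous_map :: "(nat \<Rightarrow> 'a set) \<Rightarrow> (nat \<Rightarrow> 'b set) \<Rightarrow> ('a \<Rightarrow> 'b) \<Rightarrow> bool" where
  "homogeneous_map D D' h \<longleftrightarrow> (\<forall>k. h ` D k \<subseteq> D' k)"

definition finite_graded_free ::
    "('r, 'n) ring_scheme \<Rightarrow> ('r, 'a, 'm) module_scheme \<Rightarrow> (nat \<Rightarrow> 'a set) \<Rightarrow> bool"
where
  "finite_graded_free R M D \<longleftrightarrow>
     (\<exists>B. finite B \<and> B \<subseteq> carrier M \<and> B \<subseteq> (\<Union>k. D k) \<and>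
        (\<forall>x \<in> carrier M. \<exists>!c. c \<in> B \<rightarrow>\<^sub>E carrier R \<and> x = (\<Oplus>\<^bsub>M\<^esub>b \<in> B. c b \<odot>\<^bsub>M\<^esub> b)))"

text \<open>The grading of an abelian group that is concentrated in degree \<open>d\<close>.\<close>

definition concentrated :: "('a, 'm) monoid_scheme \<Rightarrow> nat \<Rightarrow> nat \<Rightarrow> 'a set" where
  "concentrated G d k = (if k = d then carrier G else {\<one>\<^bsub>G\<^esub>})"


section \<open>The polynomial ring \<open>\<int>[Y]\<close>\<close>

text \<open>Monomials are finite multisets of variables, so that multiplication of monomials is
  addition of multisets and the degree is the size.\<close>

definition int_poly :: "'y set \<Rightarrow> ('y multiset \<Rightarrow>\<^sub>0 int) ring" where
  "int_poly Y =
     \<lparr>carrier = {p. \<forall>m \<in> Poly_Mapping.keys p. set_mset m \<subseteq> Y},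
      monoid.mult = (*), one = 1, ring.zero = 0, add = (+)\<rparr>"

definition int_poly_part :: "'y set \<Rightarrow> nat \<Rightarrow> ('y multiset \<Rightarrow>\<^sub>0 int) set" where
  "int_poly_part Y k = {p \<in> carrier (int_poly Y). \<forall>m \<in> Poly_Mapping.keys p. size m = k}"

definition var :: "'y \<Rightarrow> 'y multiset \<Rightarrow>\<^sub>0 int" where
  "var y = frag_of {#y#}"


section \<open>The exterior algebra on the free abelian group on \<open>Y\<close>\<close>

text \<open>The tensor algebra of the free abelian group on \<open>Y\<close> is the free abelian group on the words
  in \<open>Y\<close>, multiplied by concatenation.\<close>

definition tensor_algebra :: "'y set \<Rightarrow> ('y list \<Rightarrow>\<^sub>0 int) ring" where
  "tensor_algebra Y =
     \<lparr>carrier = {f. Poly_Mapping.keys f \<subseteq> lists Y},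
      monoid.mult = (\<lambda>f g. frag_extend (\<lambda>u. frag_extend (\<lambda>v. frag_of (u @ v)) g) f),
      one = frag_of [], ring.zero = 0, add = (+)\<rparr>"

definition tensor_part :: "'y set \<Rightarrow> nat \<Rightarrow> ('y list \<Rightarrow>\<^sub>0 int) set" where
  "tensor_part Y k = {f \<in> carrier (tensor_algebra Y). \<forall>w \<in> Poly_Mapping.keys f. length w = k}"

definition exterior_ideal :: "'y set \<Rightarrow> ('y list \<Rightarrow>\<^sub>0 int) set" where
  "exterior_ideal Y =
     Idl\<^bsub>tensor_algebra Y\<^esub> {v \<otimes>\<^bsub>tensor_algebra Y\<^esub> v | v. v \<in> tensor_part Y 1}"

definition exterior_algebra :: "'y set \<Rightarrow> ('y list \<Rightarrow>\<^sub>0 int) set ring" where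
  "exterior_algebra Y = tensor_algebra Y Quot exterior_ideal Y"

definition exterior_power :: "'y set \<Rightarrow> nat \<Rightarrow> ('y list \<Rightarrow>\<^sub>0 int) set monoid" where
  "exterior_power Y k =
     add_monoid ((exterior_algebra Y)
       \<lparr>carrier := (\<lambda>f. exterior_ideal Y +>\<^bsub>tensor_algebra Y\<^esub> f) ` tensor_part Y k\<rparr>)"

definition ext_gen :: "'y set \<Rightarrow> 'y \<Rightarrow> ('y list \<Rightarrow>\<^sub>0 int) set" where
  "ext_gen Y y = exterior_ideal Y +>\<^bsub>tensor_algebra Y\<^esub> frag_of [y]"

definition wedge2 :: "'y set \<Rightarrow> 'y \<Rightarrow> 'y \<Rightarrow> ('y list \<Rightarrow>\<^sub>0 int) set" where
  "wedge2 Y x y = ext_gen Y x \<otimes>\<^bsub>exterior_algebra Y\<^esub> ext_gen Y y"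

definition wedge3 :: "'y set \<Rightarrow> 'y \<Rightarrow> 'y \<Rightarrow> 'y \<Rightarrow> ('y list \<Rightarrow>\<^sub>0 int) set" where
  "wedge3 Y x y z = wedge2 Y x y \<otimes>\<^bsub>exterior_algebra Y\<^esub> ext_gen Y z"


section \<open>Lie algebras over \<open>\<int>\<close>\<close>

text \<open>A Lie algebra over \<open>\<int>\<close> is represented by a ring record whose multiplication is the bracket.
  The field \<open>one\<close> has no meaning. The quotient construction \<open>Quot\<close> for such records is
  the usual one for Lie ideals.\<close>

text \<open>Two-sided ideals. Unlike \<^const>\<open>ideal\<close> this does not presuppose an associative
  multiplication, since it is also used to impose the Lie identities on the free non-associative
  ring.\<close>

definition bracket_ideal :: "('a, 'm) ring_scheme \<Rightarrow> 'a set \<Rightarrow> bool" where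
  "bracket_ideal L I \<longleftrightarrow>
     subgroup I (add_monoid L) \<and>
     (\<forall>x \<in> carrier L. \<forall>a \<in> I. x \<otimes>\<^bsub>L\<^esub> a \<in> I \<and> a \<otimes>\<^bsub>L\<^esub> x \<in> I)"

definition bracket_ideal_gen :: "('a, 'm) ring_scheme \<Rightarrow> 'a set \<Rightarrow> 'a set" where
  "bracket_ideal_gen L A = \<Inter>{I. bracket_ideal L I \<and> A \<subseteq> I}"

text \<open>\<open>[H, H]\<close>, the additive span of all brackets of elements of \<open>H\<close>.\<close>

definition derived :: "('a, 'm) ring_scheme \<Rightarrow> 'a set \<Rightarrow> 'a set" where
  "derived L H = generate (add_monoid L) {x \<otimes>\<^bsub>L\<^esub> y | x y. x \<in> H \<and> y \<in> H}"

abbreviation derived1 :: "('a, 'm) ring_scheme \<Rightarrow> 'a set" where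
  "derived1 L \<equiv> derived L (carrier L)"

abbreviation derived2 :: "('a, 'm) ring_scheme \<Rightarrow> 'a set" where
  "derived2 L \<equiv> derived L (derived1 L)"


subsection \<open>The free Lie algebra\<close>

datatype (set_tree: 'y) bracket_tree = Leaf 'y | Br "'y bracket_tree" "'y bracket_tree"

fun leaves :: "'y bracket_tree \<Rightarrow> nat" where
  "leaves (Leaf y) = 1"
| "leaves (Br s t) = leaves s + leaves t"

text \<open>The free non-associative ring on \<open>Y\<close>; the value of \<open>one\<close> is irrelevant.\<close>

definition free_nonassoc :: "'y set \<Rightarrow> ('y bracket_tree \<Rightarrow>\<^sub>0 int) ring" where
  "free_nonassoc Y =
     \<lparr>carrier = {f. \<forall>t \<in> Poly_Mapping.keys f. set_tree t \<subseteq> Y},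
      monoid.mult = (\<lambda>f g. frag_extend (\<lambda>s. frag_extend (\<lambda>t. frag_of (Br s t)) g) f),
      one = 0, ring.zero = 0, add = (+)\<rparr>"

definition lie_relations :: "'y set \<Rightarrow> ('y bracket_tree \<Rightarrow>\<^sub>0 int) set" where
  "lie_relations Y = bracket_ideal_gen (free_nonassoc Y)
     ({f \<otimes>\<^bsub>free_nonassoc Y\<^esub> f | f. f \<in> carrier (free_nonassoc Y)} \<union>
      {f \<otimes>\<^bsub>free_nonassoc Y\<^esub> (g \<otimes>\<^bsub>free_nonassoc Y\<^esub> h)
         \<oplus>\<^bsub>free_nonassoc Y\<^esub> g \<otimes>\<^bsub>free_nonassoc Y\<^esub> (h \<otimes>\<^bsub>free_nonassoc Y\<^esub> f)
         \<oplus>\<^bsub>free_nonassoc Y\<^esub> h \<otimes>\<^bsub>free_nonassoc Y\<^esub> (f \<otimes>\<^bsub>free_nonassoc Y\<^esub> g) | f g h.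
         f \<in> carrier (free_nonassoc Y) \<and> g \<in> carrier (free_nonassoc Y) \<and>
         h \<in> carrier (free_nonassoc Y)})"

definition free_lie :: "'y set \<Rightarrow> ('y bracket_tree \<Rightarrow>\<^sub>0 int) set ring" where
  "free_lie Y = free_nonassoc Y Quot lie_relations Y"

definition lie_gen :: "'y set \<Rightarrow> 'y \<Rightarrow> ('y bracket_tree \<Rightarrow>\<^sub>0 int) set" where
  "lie_gen Y y = lie_relations Y +>\<^bsub>free_nonassoc Y\<^esub> frag_of (Leaf y)"

text \<open>The part of degree \<open>k\<close>, spanned by the bracketings of \<open>k\<close> elements of \<open>Y\<close>.\<close>

definition free_lie_part :: "'y set \<Rightarrow> nat \<Rightarrow> ('y bracket_tree \<Rightarrow>\<^sub>0 int) set set" where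
  "free_lie_part Y k =
     (\<lambda>f. lie_relations Y +>\<^bsub>free_nonassoc Y\<^esub> f) `
       {f \<in> carrier (free_nonassoc Y). \<forall>t \<in> Poly_Mapping.keys f. leaves t = k}"

text \<open>A graded ideal \<open>I\<close> that is generated by its part of degree two.\<close>

definition quadratic_ideal :: "'y set \<Rightarrow> ('y bracket_tree \<Rightarrow>\<^sub>0 int) set set \<Rightarrow> bool" where
  "quadratic_ideal Y I \<longleftrightarrow>
     bracket_ideal (free_lie Y) I \<and>
     graded_group ((free_lie Y)\<lparr>carrier := I\<rparr>) (\<lambda>k. I \<inter> free_lie_part Y k) \<and>
     I = bracket_ideal_gen (free_lie Y) (I \<inter> free_lie_part Y 2)"

definition lie_degree2 :: "'y set \<Rightarrow> ('y bracket_tree \<Rightarrow>\<^sub>0 int) set monoid" where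
  "lie_degree2 Y = add_monoid ((free_lie Y)\<lparr>carrier := free_lie_part Y 2\<rparr>)"

definition quadratic_relators ::
    "'y set \<Rightarrow> ('y bracket_tree \<Rightarrow>\<^sub>0 int) set set \<Rightarrow> ('y bracket_tree \<Rightarrow>\<^sub>0 int) set monoid"
where
  "quadratic_relators Y I = add_monoid ((free_lie Y)\<lparr>carrier := I \<inter> free_lie_part Y 2\<rparr>)"

definition presented_lie ::
    "'y set \<Rightarrow> ('y bracket_tree \<Rightarrow>\<^sub>0 int) set set \<Rightarrow> ('y bracket_tree \<Rightarrow>\<^sub>0 int) set set ring"
where
  "presented_lie Y I = free_lie Y Quot I"

definition presented_gen ::
    "'y set \<Rightarrow> ('y bracket_tree \<Rightarrow>\<^sub>0 int) set set \<Rightarrow> 'y \<Rightarrow> ('y bracket_tree \<Rightarrow>\<^sub>0 int) set set"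
where
  "presented_gen Y I y = I +>\<^bsub>free_lie Y\<^esub> lie_gen Y y"

definition presented_part ::
    "'y set \<Rightarrow> ('y bracket_tree \<Rightarrow>\<^sub>0 int) set set \<Rightarrow> nat \<Rightarrow> ('y bracket_tree \<Rightarrow>\<^sub>0 int) set set set"
where
  "presented_part Y I k = (\<lambda>u. I +>\<^bsub>free_lie Y\<^esub> u) ` free_lie_part Y k"


section \<open>The infinitesimal Alexander invariant\<close>

definition alexander_class :: "('e, 'm) ring_scheme \<Rightarrow> 'e \<Rightarrow> 'e set" where
  "alexander_class E u = derived2 E +>\<^bsub>E\<^esub> u"

definition alexander_group :: "('e, 'm) ring_scheme \<Rightarrow> 'e set ring" where
  "alexander_group E =
     \<lparr>carrier = alexander_class E ` derived1 E,
      monoid.mult = undefined, one = undefined, ring.zero = derived2 E, add = set_add E\<rparr>"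

text \<open>The adjoint action of \<open>e\<close> on cosets of \<open>E''\<close>: the class of \<open>u\<close> is sent to that of \<open>[e, u]\<close>.\<close>

definition alexander_ad :: "('e, 'm) ring_scheme \<Rightarrow> 'e \<Rightarrow> 'e set \<Rightarrow> 'e set" where
  "alexander_ad E e X = (\<Union>u \<in> X. alexander_class E (e \<otimes>\<^bsub>E\<^esub> u))"

text \<open>A monomial acts by composing the actions of its variables (\<open>g y\<close> is the image of the
  variable \<open>y\<close> in \<open>E\<close>). These commute on \<open>E'/E''\<close>, so the order of the factors, chosen here by
  \<open>SOME\<close>, does not matter.\<close>

definition alexander_monomial_action ::
    "('e, 'm) ring_scheme \<Rightarrow> ('y \<Rightarrow> 'e) \<Rightarrow> 'y multiset \<Rightarrow> 'e set \<Rightarrow> 'e set"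
where
  "alexander_monomial_action E g m X =
     foldr (\<lambda>y. alexander_ad E (g y)) (SOME ys. mset ys = m) X"

definition alexander_invariant ::
    "('e, 'm) ring_scheme \<Rightarrow> ('y \<Rightarrow> 'e) \<Rightarrow> ('y multiset \<Rightarrow>\<^sub>0 int, 'e set) module"
where
  "alexander_invariant E g =
     ring.extend (alexander_group E) (module.fields
       (\<lambda>p X. \<Oplus>\<^bsub>alexander_group E\<^esub>m \<in> Poly_Mapping.keys p.
          [Poly_Mapping.lookup p m] \<cdot>\<^bsub>alexander_group E\<^esub> alexander_monomial_action E g m X))"

definition alexander_part ::
    "('e, 'm) ring_scheme \<Rightarrow> (nat \<Rightarrow> 'e set) \<Rightarrow> nat \<Rightarrow> 'e set set"
where
  "alexander_part E D k = alexander_class E ` (derived1 E \<inter> D k)"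


section \<open>Extension of scalars \<open>R \<otimes>\<^sub>\<int> G\<close> of an abelian group \<open>G\<close>\<close>

definition tensor_relations ::
    "('r, 'n) ring_scheme \<Rightarrow> ('g, 'm) monoid_scheme \<Rightarrow> ('r \<times> 'g \<Rightarrow>\<^sub>0 int) set"
where
  "tensor_relations R G =
     generate (free_Abelian_group (carrier R \<times> carrier G))
       ({frag_of (r \<oplus>\<^bsub>R\<^esub> s, g) - frag_of (r, g) - frag_of (s, g) | r s g.
           r \<in> carrier R \<and> s \<in> carrier R \<and> g \<in> carrier G} \<union>
        {frag_of (r, g \<otimes>\<^bsub>G\<^esub> h) - frag_of (r, g) - frag_of (r, h) | r g h.
           r \<in> carrier R \<and> g \<in> carrier G \<and> h \<in> carrier G})"

definition tensor_class ::
    "('r, 'n) ring_scheme \<Rightarrow> ('g, 'm) monoid_scheme \<Rightarrow> ('r \<times> 'g \<Rightarrow>\<^sub>0 int) \<Rightarrow> ('r \<times> 'g \<Rightarrow>\<^sub>0 int) set"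
where
  "tensor_class R G f =
     tensor_relations R G #>\<^bsub>free_Abelian_group (carrier R \<times> carrier G)\<^esub> f"

definition tensor ::
    "('r, 'n) ring_scheme \<Rightarrow> ('g, 'm) monoid_scheme \<Rightarrow> 'r \<Rightarrow> 'g \<Rightarrow> ('r \<times> 'g \<Rightarrow>\<^sub>0 int) set"
where
  "tensor R G r g = tensor_class R G (frag_of (r, g))"

definition scalar_extension ::
    "('r, 'n) ring_scheme \<Rightarrow> ('g, 'm) monoid_scheme \<Rightarrow> ('r, ('r \<times> 'g \<Rightarrow>\<^sub>0 int) set) module"
where
  "scalar_extension R G =
     \<lparr>carrier = tensor_class R G ` carrier (free_Abelian_group (carrier R \<times> carrier G)),
      monoid.mult = undefined, one = undefined,
      ring.zero = tensor_relations R G,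
      add = set_mult (free_Abelian_group (carrier R \<times> carrier G)),
      smult = (\<lambda>r X. \<Union>f \<in> X. tensor_class R G
                 (frag_extend (\<lambda>(s, g). frag_of (r \<otimes>\<^bsub>R\<^esub> s, g)) f))\<rparr>"

text \<open>The tensor product grading: degree \<open>k\<close> is spanned by the \<open>r \<otimes> g\<close> with
  \<open>deg r + deg g = k\<close>.\<close>

definition scalar_extension_part ::
    "('r, 'n) ring_scheme \<Rightarrow> (nat \<Rightarrow> 'r set) \<Rightarrow> ('g, 'm) monoid_scheme \<Rightarrow> (nat \<Rightarrow> 'g set) \<Rightarrow>
     nat \<Rightarrow> ('r \<times> 'g \<Rightarrow>\<^sub>0 int) set set"
where
  "scalar_extension_part R RD G GD k =
     generate (add_monoid (scalar_extension R G))
       {tensor R G r g | r g. \<exists>i j. r \<in> RD i \<and> g \<in> GD j \<and> i + j = k}"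

end

theory Submission
  imports Defs
begin

text \<open>Since the adjoint action makes \<open>B(E)\<close> a module over the commutative ring \<open>S\<close>, every iterated
  bracket is modulo \<open>E''\<close> an \<open>S\<close>-multiple of some \<open>[x, y]\<close>, so \<open>\<psi>\<close> is onto; it kills the image of
  \<open>d\<^sub>3\<close> by the Jacobi identity and the image of \<open>J\<close> by definition of \<open>E\<close>. For injectivity on the
  cokernel \<open>M\<close> of \<open>d\<^sub>3 + \<partial>\<close>, consider the bracket \<open>[(a, m), (b, n)] = (0, a \<and> b + a n - b m)\<close> on
  \<open>\<int>\<^sup>Y \<oplus> M\<close>. It satisfies the Jacobi identity precisely because \<open>d\<^sub>3\<close> vanishes in \<open>M\<close>, so \<open>y \<mapsto> (y,
  0)\<close> extends to a homomorphism from the free Lie ring; it kills \<open>I\<close>, maps \<open>E'\<close> to \<open>M\<close> and \<open>E''\<close>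
  to \<open>0\<close>, and the induced map \<open>B(E) \<rightarrow> M\<close> is a left inverse of the one induced by \<open>\<psi>\<close>. In
  particular exactness of the Koszul complex is not needed.

  Over \<open>S\<close>, the two free modules have homogeneous bases because \<open>\<And>\<^sup>2\<close>, \<open>\<And>\<^sup>3\<close> and the subgroup \<open>J\<close>
  of \<open>\<And>\<^sup>2\<close> are free abelian of finite rank, and \<open>B(E)\<close> inherits its grading as the quotient by the
  image of a homogeneous map.\<close>

section \<open>Homomorphisms and free abelian groups\<close>

text \<open>Neither the cokernel \<open>M\<close> nor the homomorphism into the model is formed. The
  kernel which that homomorphism ought to have is described inside the free non-associative ring,
  through polynomial coordinates of a representative in the extension of the exterior square, and is
  shown to be an ideal containing the Lie relations and the relators. Being zero in \<open>M\<close>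
  then means that some element of the image of \<open>D\<close> has the given coordinates. This
  requires enough coordinates: the exterior square has to be free on the ordered products of
  letters, which is seen by using two-by-two minors as dual functionals. The same minors, read off
  from the coefficients of the trees for [x, y] and [y, x], show that the exterior square embeds
  into the degree two part of the free Lie ring, and so justify the identification under which
  \<open>J\<close> becomes a subgroup of the exterior square. A letter \<open>y\<close> acts on the
  second component of the model as multiplication by the variable \<open>y\<close>; commutativity of
  the polynomial ring is what cancels all terms of the Jacobi sum except those of
  \<open>d3\<close>.\<close>

lemma group_homI: "group G \<Longrightarrow> group H \<Longrightarrow> h \<in> hom G H \<Longrightarrow> group_hom G H h"
  by (simp add: group_hom_def group_hom_axioms_def)

text \<open>Needed because the additive group of a record and a subgroup or quotient built elsewhere
  may agree in carrier, product and unit without being the same record.\<close>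

lemma comm_group_cong:
  assumes "comm_group G" "carrier H = carrier G" "monoid.mult H = monoid.mult G" "one H = one G"
  shows "comm_group H"
proof -
  interpret comm_group G by fact
  show ?thesis
    by (rule comm_groupI) (use assms m_assoc m_comm in \<open>auto intro: l_inv_ex\<close>)
qed

lemma hom_cong_codomain:
  "carrier H = carrier K \<Longrightarrow> monoid.mult H = monoid.mult K \<Longrightarrow> hom G H = hom G K"
  by (simp add: hom_def)

lemma hom_cong_domain:
  "carrier H = carrier K \<Longrightarrow> monoid.mult H = monoid.mult K \<Longrightarrow> hom H G = hom K G"
  by (simp add: hom_def)

lemma subgroup_vimage:
  assumes "group G" "group H" "h \<in> hom G H" "subgroup K H"
  shows "subgroup {x \<in> carrier G. h x \<in> K} G"
proof -
  interpret h: group_hom G H h by (rule group_homI) fact+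
  interpret K: subgroup K H by fact
  show ?thesis
  proof (rule h.G.subgroupI)
    show "{x \<in> carrier G. h x \<in> K} \<noteq> {}"
      using h.hom_one K.one_closed h.G.one_closed by (metis (no_types, lifting) empty_iff mem_Collect_eq)
  qed auto
qed

lemma hom_trivial_on_generate:
  assumes "group G" "group H" "h \<in> hom G H" "A \<subseteq> carrier G" "\<And>a. a \<in> A \<Longrightarrow> h a = \<one>\<^bsub>H\<^esub>"
    "x \<in> generate G A"
  shows "h x = \<one>\<^bsub>H\<^esub>"
proof -
  interpret group_hom G H h by (rule group_homI) fact+
  have "generate G A \<subseteq> kernel G H h"
    by (rule G.generate_subgroup_incl) (use assms subgroup_kernel in \<open>auto simp: kernel_def\<close>)
  with assms(6) show ?thesis by (auto simp: kernel_def)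
qed

lemma hom_eq_on_generate:
  assumes GH: "group G" "group H" and hk: "h \<in> hom G H" "k \<in> hom G H" "A \<subseteq> carrier G"
    "\<And>a. a \<in> A \<Longrightarrow> h a = k a" "x \<in> generate G A"
  shows "h x = k x"
proof -
  interpret h: group_hom G H h by (rule group_homI) fact+
  interpret k: group_hom G H k by (rule group_homI) fact+
  have "subgroup {x \<in> carrier G. h x = k x} G"
    by (rule h.G.subgroupI) (auto intro!: exI[of _ "\<one>\<^bsub>G\<^esub>"])
  then have "generate G A \<subseteq> {x \<in> carrier G. h x = k x}"
    by (rule h.G.generate_subgroup_incl[rotated]) (use assms in auto)
  with assms(7) show ?thesis by auto
qed

section \<open>Maps out of a free abelian group\<close>

lemma hom_free_Abelian_zero:
  assumes "group H" "h \<in> hom (free_Abelian_group S) H"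
  shows "h 0 = \<one>\<^bsub>H\<^esub>"
  using hom_one[OF assms(2) _ assms(1)] by simp

lemma free_Abelian_induct [consumes 1, case_names zero diff frag_of]:
  assumes "x \<in> carrier (free_Abelian_group S)" "P 0"
    "\<And>x y. x \<in> carrier (free_Abelian_group S) \<Longrightarrow> y \<in> carrier (free_Abelian_group S) \<Longrightarrow> P x \<Longrightarrow> P y \<Longrightarrow> P (x - y)"
    "\<And>a. a \<in> S \<Longrightarrow> P (frag_of a)"
  shows "P x"
  using free_Abelian_group_induct[of x S P] assms by simp

text \<open>The extension of \<open>h\<close> to a homomorphism on formal integer combinations, with
  \<open>G\<close> written multiplicatively. The generating set does not occur, so one function
  serves for every \<open>free_Abelian_group S\<close> on which \<open>h\<close> has values in
  \<open>G\<close>.\<close>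

definition zlift :: "('g, 'm) monoid_scheme \<Rightarrow> ('a \<Rightarrow> 'g) \<Rightarrow> ('a \<Rightarrow>\<^sub>0 int) \<Rightarrow> 'g" where
  "zlift G h f = (\<Otimes>\<^bsub>G\<^esub>x \<in> Poly_Mapping.keys f. h x [^]\<^bsub>G\<^esub> Poly_Mapping.lookup f x)"

context comm_group
begin

text \<open>Indices outside the support contribute a zeroth power. Two combinations can thus be
  multiplied out over one common index set, which is how \<open>zlift_hom\<close> is
  obtained.\<close>

lemma zlift_superset:
  assumes "h \<in> A \<rightarrow> carrier G" "Poly_Mapping.keys f \<subseteq> A" "finite A"
  shows "zlift G h f = (\<Otimes>x \<in> A. h x [^] Poly_Mapping.lookup f x)"
  unfolding zlift_def using assms
  by (intro finprod_mono_neutral_cong_left) (auto simp: in_keys_iff)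

lemma zlift_hom:
  assumes "h \<in> S \<rightarrow> carrier G"
  shows "zlift G h \<in> hom (free_Abelian_group S) G"
proof (rule homI)
  fix x assume "x \<in> carrier (free_Abelian_group S)"
  then show "zlift G h x \<in> carrier G"
    using assms unfolding zlift_def by (intro finprod_closed) auto
next
  fix x y assume "x \<in> carrier (free_Abelian_group S)" "y \<in> carrier (free_Abelian_group S)"
  then have xy: "Poly_Mapping.keys x \<subseteq> S" "Poly_Mapping.keys y \<subseteq> S" by auto
  let ?A = "Poly_Mapping.keys x \<union> Poly_Mapping.keys y"
  have h: "h \<in> ?A \<rightarrow> carrier G" using assms xy by auto
  have "zlift G h (x + y) = (\<Otimes>i \<in> ?A. h i [^] Poly_Mapping.lookup (x + y) i)"
    using h by (intro zlift_superset) (auto dest: subsetD[OF keys_add])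
  also have "\<dots> = (\<Otimes>i \<in> ?A. h i [^] Poly_Mapping.lookup x i \<otimes> h i [^] Poly_Mapping.lookup y i)"
    using h by (intro finprod_cong') (auto simp: lookup_add int_pow_mult Pi_iff)
  also have "\<dots> = zlift G h x \<otimes> zlift G h y"
    using h by (subst finprod_multf) (auto simp: zlift_superset[of h ?A])
  finally show "zlift G h (x \<otimes>\<^bsub>free_Abelian_group S\<^esub> y) = zlift G h x \<otimes> zlift G h y"
    by simp
qed

lemma zlift_frag_of:
  assumes "h a \<in> carrier G"
  shows "zlift G h (frag_of a) = h a"
proof -
  have "zlift G h (frag_of a) = (\<Otimes>i \<in> {a}. h i [^] (1::int))"
    unfolding zlift_def using assms by (intro finprod_cong') auto
  also have "\<dots> = h a" using assms by simp
  finally show ?thesis .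
qed

end

section \<open>Modules\<close>

lemma module_homI:
  assumes "h \<in> hom (add_monoid M) (add_monoid N)"
    "\<And>r x. r \<in> carrier R \<Longrightarrow> x \<in> carrier M \<Longrightarrow> h (r \<odot>\<^bsub>M\<^esub> x) = r \<odot>\<^bsub>N\<^esub> h x"
  shows "h \<in> module_hom R M N"
  using assms by (auto simp: module_hom_def hom_def)

lemma module_hom_hom: "h \<in> module_hom R M N \<Longrightarrow> h \<in> hom (add_monoid M) (add_monoid N)"
  by (auto simp: module_hom_def hom_def)

lemma module_hom_closed: "h \<in> module_hom R M N \<Longrightarrow> x \<in> carrier M \<Longrightarrow> h x \<in> carrier N"
  by (auto simp: module_hom_def)

lemma module_hom_add:
  "h \<in> module_hom R M N \<Longrightarrow> x \<in> carrier M \<Longrightarrow> y \<in> carrier M \<Longrightarrow> h (x \<oplus>\<^bsub>M\<^esub> y) = h x \<oplus>\<^bsub>N\<^esub> h y"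
  by (auto simp: module_hom_def)

lemma module_hom_smult:
  "h \<in> module_hom R M N \<Longrightarrow> r \<in> carrier R \<Longrightarrow> x \<in> carrier M \<Longrightarrow> h (r \<odot>\<^bsub>M\<^esub> x) = r \<odot>\<^bsub>N\<^esub> h x"
  by (auto simp: module_hom_def)

lemma hom_zero:
  assumes "abelian_group M" "abelian_group N" "h \<in> hom (add_monoid M) (add_monoid N)"
  shows "h \<zero>\<^bsub>M\<^esub> = \<zero>\<^bsub>N\<^esub>"
  using hom_one[OF assms(3)] abelian_group.a_group[OF assms(1)] abelian_group.a_group[OF assms(2)] by simp

lemma hom_a_inv:
  assumes "abelian_group M" "abelian_group N" "h \<in> hom (add_monoid M) (add_monoid N)" "x \<in> carrier M"
  shows "h (\<ominus>\<^bsub>M\<^esub> x) = \<ominus>\<^bsub>N\<^esub> h x"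
proof -
  interpret group_hom "add_monoid M" "add_monoid N" h
    using assms by (intro group_homI) (auto simp: abelian_group.a_group)
  show ?thesis using hom_inv[of x] assms by (simp add: a_inv_def)
qed

lemma hom_a_minus:
  assumes "abelian_group M" "abelian_group N" "h \<in> hom (add_monoid M) (add_monoid N)" "x \<in> carrier
      M" "y \<in> carrier M"
  shows "h (x \<ominus>\<^bsub>M\<^esub> y) = h x \<ominus>\<^bsub>N\<^esub> h y"
proof -
  have "h (x \<oplus>\<^bsub>M\<^esub> \<ominus>\<^bsub>M\<^esub> y) = h x \<oplus>\<^bsub>N\<^esub> h (\<ominus>\<^bsub>M\<^esub> y)"
    using assms(3-5) abelian_group.a_inv_closed[OF assms(1)] by (auto simp: hom_def)
  with hom_a_inv[OF assms(1,2,3)] show ?thesis using assms by (simp add: a_minus_def)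
qed

text \<open>The shape that a biadditivity relator takes under a map that respects the relation;
  \<open>tensor_universal\<close> uses it to see that the relators are killed.\<close>

lemma (in abelian_group) add_diff_diff:
  "x \<in> carrier G \<Longrightarrow> y \<in> carrier G \<Longrightarrow> x \<oplus> y \<ominus> x \<ominus> y = \<zero>"
  by (simp add: a_minus_def a_assoc r_neg r_neg2 a_comm[of x "\<ominus> x \<oplus> \<ominus> y"] a_comm[of y "\<ominus> y"])
    (metis a_comm a_inv_closed a_lcomm add.m_closed l_neg r_zero)

lemma (in abelian_group) minus_eq_zero_iff:
  assumes "x \<in> carrier G" "y \<in> carrier G"
  shows "x \<ominus> y = \<zero> \<longleftrightarrow> x = y"
  using assms add.inv_equality[of x "\<ominus> y"] by (auto simp: a_minus_def r_neg)

lemma (in abelian_group) diff_add_diff: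
  "x \<in> carrier G \<Longrightarrow> y \<in> carrier G \<Longrightarrow> z \<in> carrier G \<Longrightarrow> w \<in> carrier G \<Longrightarrow>
   (x \<ominus> y) \<oplus> (z \<ominus> w) = (x \<oplus> z) \<ominus> (y \<oplus> w)"
  by (simp add: a_minus_def a_ac minus_add)

section \<open>Extension of scalars\<close>

locale scalar_ext = R?: cring R + G?: comm_group G for R (structure) and G (structure)
begin

abbreviation FA where "FA \<equiv> free_Abelian_group (carrier R \<times> carrier G)"
abbreviation TR where "TR \<equiv> tensor_relations R G"
abbreviation RG where "RG \<equiv> scalar_extension R G"

sublocale FA: comm_group FA by (rule abelian_free_Abelian_group)

text \<open>The generating set inside \<open>tensor_relations\<close>, named so that closure
  properties can be checked on generators.\<close>

definition "relators =
  {frag_of (r \<oplus> s, g) - frag_of (r, g) - frag_of (s, g) | r s g.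
           r \<in> carrier R \<and> s \<in> carrier R \<and> g \<in> carrier G} \<union>
        {frag_of (r, g \<otimes>\<^bsub>G\<^esub> h) - frag_of (r, g) - frag_of (r, h) | r g h.
           r \<in> carrier R \<and> g \<in> carrier G \<and> h \<in> carrier G}"

lemma relators_carrier: "relators \<subseteq> carrier FA"
  unfolding relators_def
  by (auto dest!: subsetD[OF keys_diff])

lemma TR_def: "TR = generate FA relators"
  by (simp add: tensor_relations_def relators_def)

lemma TR_subgroup: "subgroup TR FA"
  unfolding TR_def by (rule FA.generate_is_subgroup[OF relators_carrier])

sublocale TR: normal TR FA
  using FA.subgroup_imp_normal[OF TR_subgroup] .

text \<open>Additively, \<open>scalar_extension\<close> is the factor group by \<open>TR\<close>
  under another record type; the group axioms and the projection homomorphism are imported along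
  these equations.\<close>

lemma RG_Mod: "carrier (add_monoid RG) = carrier (FA Mod TR)"
  "monoid.mult (add_monoid RG) = monoid.mult (FA Mod TR)" "one (add_monoid RG) = one (FA Mod TR)"
  by (auto simp: scalar_extension_def FactGroup_def tensor_class_def RCOSETS_def)

lemma abelian_group_RG: "abelian_group RG"
  by (rule comm_group_abelian_groupI, rule comm_group_cong[OF FA.abelian_FactGroup[OF TR_subgroup]])
    (simp_all only: RG_Mod)

sublocale RG: abelian_group RG by (rule abelian_group_RG)

lemma carrier_RG: "carrier RG = tensor_class R G ` carrier FA"
  by (simp add: scalar_extension_def)

lemma tensor_class_closed [intro]: "f \<in> carrier FA \<Longrightarrow> tensor_class R G f \<in> carrier RG"
  by (simp add: carrier_RG)

lemma tensor_class_hom: "tensor_class R G \<in> hom FA (add_monoid RG)"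
  unfolding hom_cong_codomain[OF RG_Mod(1,2)] tensor_class_def[abs_def] by (rule TR.r_coset_hom_Mod)

lemma tensor_class_add: "f \<in> carrier FA \<Longrightarrow> g \<in> carrier FA \<Longrightarrow>
   tensor_class R G (f + g) = tensor_class R G f \<oplus>\<^bsub>RG\<^esub> tensor_class R G g"
  using hom_mult[OF tensor_class_hom, of f g] by simp

lemma tensor_class_zero: "tensor_class R G 0 = \<zero>\<^bsub>RG\<^esub>"
  using hom_free_Abelian_zero[OF RG.a_group tensor_class_hom] by simp

lemma tensor_class_minus: "f \<in> carrier FA \<Longrightarrow> tensor_class R G (- f) = \<ominus>\<^bsub>RG\<^esub> tensor_class R G f"
proof -
  interpret h: group_hom FA "add_monoid RG" "tensor_class R G"
    by (rule group_homI[OF FA.is_group RG.a_group tensor_class_hom])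
  show "f \<in> carrier FA \<Longrightarrow> tensor_class R G (- f) = \<ominus>\<^bsub>RG\<^esub> tensor_class R G f"
    using h.hom_inv[of f] by (simp add: a_inv_def)
qed

lemma tensor_class_diff: "f \<in> carrier FA \<Longrightarrow> g \<in> carrier FA \<Longrightarrow>
   tensor_class R G (f - g) = tensor_class R G f \<ominus>\<^bsub>RG\<^esub> tensor_class R G g"
  using tensor_class_add[of f "- g"] tensor_class_minus[of g] by (simp add: a_minus_def)

lemma tensor_class_eq_iff:
  assumes "f \<in> carrier FA" "g \<in> carrier FA"
  shows "tensor_class R G f = tensor_class R G g \<longleftrightarrow> f - g \<in> TR"
proof -
  have "TR #>\<^bsub>FA\<^esub> f = TR #>\<^bsub>FA\<^esub> g \<longleftrightarrow> f \<in> TR #>\<^bsub>FA\<^esub> g"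
    using assms FA.repr_independence[OF _ assms(2) TR_subgroup] FA.rcos_self[OF assms(1)
        TR_subgroup] by blast
  also have "\<dots> \<longleftrightarrow> f \<otimes>\<^bsub>FA\<^esub> inv\<^bsub>FA\<^esub> g \<in> TR"
    using TR.rcos_module[OF FA.is_group assms(2,1)] by simp
  finally show ?thesis using assms by (simp add: tensor_class_def)
qed

lemma tensor_closed [intro, simp]: "r \<in> carrier R \<Longrightarrow> g \<in> carrier G \<Longrightarrow> tensor R G r g \<in> carrier RG"
  unfolding tensor_def by (rule tensor_class_closed) auto

lemma tensor_add_left:
  assumes "r \<in> carrier R" "s \<in> carrier R" "g \<in> carrier G"
  shows "tensor R G (r \<oplus> s) g = tensor R G r g \<oplus>\<^bsub>RG\<^esub> tensor R G s g"
proof -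
  have "frag_of (r \<oplus> s, g) - frag_of (r, g) - frag_of (s, g) \<in> TR"
    unfolding TR_def relators_def using assms by (intro generate.incl) blast
  then have "tensor_class R G (frag_of (r \<oplus> s, g)) = tensor_class R G (frag_of (r, g) + frag_of (s, g))"
    using assms by (subst tensor_class_eq_iff) (auto simp: algebra_simps dest!: subsetD[OF keys_add])
  then show ?thesis unfolding tensor_def using assms by (subst tensor_class_add[symmetric]) auto
qed

lemma tensor_add_right:
  assumes "r \<in> carrier R" "g \<in> carrier G" "h \<in> carrier G"
  shows "tensor R G r (g \<otimes>\<^bsub>G\<^esub> h) = tensor R G r g \<oplus>\<^bsub>RG\<^esub> tensor R G r h"
proof -
  have "frag_of (r, g \<otimes>\<^bsub>G\<^esub> h) - frag_of (r, g) - frag_of (r, h) \<in> TR"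
    unfolding TR_def relators_def using assms by (intro generate.incl) blast
  then have "tensor_class R G (frag_of (r, g \<otimes>\<^bsub>G\<^esub> h)) = tensor_class R G (frag_of (r, g) + frag_of (r, h))"
    using assms by (subst tensor_class_eq_iff) (auto simp: algebra_simps dest!: subsetD[OF keys_add])
  then show ?thesis unfolding tensor_def using assms by (subst tensor_class_add[symmetric]) auto
qed

lemma tensor_hom_right: "r \<in> carrier R \<Longrightarrow> (\<lambda>g. tensor R G r g) \<in> hom G (add_monoid RG)"
  by (rule homI) (auto simp: tensor_add_right)

lemma tensor_one_right: "r \<in> carrier R \<Longrightarrow> tensor R G r \<one>\<^bsub>G\<^esub> = \<zero>\<^bsub>RG\<^esub>"
  using hom_one[OF tensor_hom_right G.is_group RG.a_group] by simp

lemma RG_induct [consumes 1, case_names zero tensor diff]: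
  assumes "x \<in> carrier RG" "P \<zero>\<^bsub>RG\<^esub>"
    "\<And>r g. r \<in> carrier R \<Longrightarrow> g \<in> carrier G \<Longrightarrow> P (tensor R G r g)"
    "\<And>x y. x \<in> carrier RG \<Longrightarrow> y \<in> carrier RG \<Longrightarrow> P x \<Longrightarrow> P y \<Longrightarrow> P (x \<ominus>\<^bsub>RG\<^esub> y)"
  shows "P x"
proof -
  obtain f where f: "f \<in> carrier FA" "x = tensor_class R G f" using assms(1) carrier_RG by auto
  from f(1) have "P (tensor_class R G f)"
  proof (induction f rule: free_Abelian_induct)
    case zero show ?case using assms(2) tensor_class_zero by simp
  next
    case (diff f g)
    then show ?case using assms(4) tensor_class_diff[of f g] tensor_class_closed by simp
  next
    case (frag_of a)
    then show ?case using assms(3) by (cases a) (auto simp: tensor_def)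
  qed
  then show ?thesis using f by simp
qed

text \<open>Scalar multiplication on representatives, before passing to classes. In
  \<open>scalar_extension\<close> the field \<open>smult\<close> is a union over representatives, so
  independence of their choice has to be shown.\<close>

definition act :: "'a \<Rightarrow> ('a \<times> 'c \<Rightarrow>\<^sub>0 int) \<Rightarrow> ('a \<times> 'c \<Rightarrow>\<^sub>0 int)" where
  "act r = frag_extend (\<lambda>(s, g). frag_of (r \<otimes> s, g))"

lemma act_closed: "r \<in> carrier R \<Longrightarrow> f \<in> carrier FA \<Longrightarrow> act r f \<in> carrier FA"
  unfolding act_def by (auto dest!: subsetD[OF keys_frag_extend])

lemma act_hom: "r \<in> carrier R \<Longrightarrow> act r \<in> hom FA FA"
  using act_closed by (auto simp: hom_def act_def frag_extend_add dest!: subsetD[OF keys_add])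

text \<open>Multiplying the first components of a relator by \<open>r\<close> gives another relator,
  by distributivity in \<open>R\<close> for one family and immediately for the other. Hence scalar
  multiplication is well defined on classes.\<close>

lemma act_TR:
  assumes r: "r \<in> carrier R" and f: "f \<in> TR"
  shows "act r f \<in> TR"
proof -
  interpret h: group_hom FA FA "act r" using act_hom[OF r] by (intro group_homI) auto
  have sub: "subgroup {f \<in> carrier FA. act r f \<in> TR} FA"
  proof (rule FA.subgroupI)
    show "{f \<in> carrier FA. act r f \<in> TR} \<noteq> {}"
      using h.hom_one TR.one_closed FA.one_closed by (metis (no_types, lifting) empty_iff mem_Collect_eq)
  next
    fix a assume "a \<in> {f \<in> carrier FA. act r f \<in> TR}"
    then show "inv\<^bsub>FA\<^esub> a \<in> {f \<in> carrier FA. act r f \<in> TR}"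
      using h.hom_inv FA.inv_closed TR.m_inv_closed by (metis (no_types, lifting) mem_Collect_eq)
  next
    fix a b assume "a \<in> {f \<in> carrier FA. act r f \<in> TR}" "b \<in> {f \<in> carrier FA. act r f \<in> TR}"
    then show "a \<otimes>\<^bsub>FA\<^esub> b \<in> {f \<in> carrier FA. act r f \<in> TR}"
      using h.hom_mult FA.m_closed TR.m_closed by (metis (no_types, lifting) mem_Collect_eq)
  qed blast
  have "relators \<subseteq> {f \<in> carrier FA. act r f \<in> TR}"
  proof
    fix f assume f: "f \<in> relators"
    then have "f \<in> carrier FA" using relators_carrier by blast
    moreover have "act r f \<in> relators"
      using f unfolding relators_def act_def
    proof (elim UnE CollectE exE conjE)
      fix a b g assume *: "f = frag_of (a \<oplus> b, g) - frag_of (a, g) - frag_of (b, g)"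
        "a \<in> carrier R" "b \<in> carrier R" "g \<in> carrier G"
      show "frag_extend (\<lambda>(s, g). frag_of (r \<otimes> s, g)) f \<in> {frag_of (r \<oplus> s, g) - frag_of (r, g) -
          frag_of (s, g) | r s g.
           r \<in> carrier R \<and> s \<in> carrier R \<and> g \<in> carrier G} \<union>
        {frag_of (r, g \<otimes>\<^bsub>G\<^esub> h) - frag_of (r, g) - frag_of (r, h) | r g h.
           r \<in> carrier R \<and> g \<in> carrier G \<and> h \<in> carrier G}"
        by (rule UnI1, rule CollectI, rule exI[of _ "r \<otimes> a"], rule exI[of _ "r \<otimes> b"], rule exI[of _ g])
          (use * r in \<open>simp add: frag_extend_diff R.r_distr\<close>)
    next
      fix a g h assume *: "f = frag_of (a, g \<otimes>\<^bsub>G\<^esub> h) - frag_of (a, g) - frag_of (a, h)"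
        "a \<in> carrier R" "g \<in> carrier G" "h \<in> carrier G"
      show "frag_extend (\<lambda>(s, g). frag_of (r \<otimes> s, g)) f \<in> {frag_of (r \<oplus> s, g) - frag_of (r, g) -
          frag_of (s, g) | r s g.
           r \<in> carrier R \<and> s \<in> carrier R \<and> g \<in> carrier G} \<union>
        {frag_of (r, g \<otimes>\<^bsub>G\<^esub> h) - frag_of (r, g) - frag_of (r, h) | r g h.
           r \<in> carrier R \<and> g \<in> carrier G \<and> h \<in> carrier G}"
        by (rule UnI2, rule CollectI, rule exI[of _ "r \<otimes> a"], rule exI[of _ g], rule exI[of _ h])
          (use * r in \<open>simp add: frag_extend_diff\<close>)
    qed
    ultimately show "f \<in> {f \<in> carrier FA. act r f \<in> TR}"
      unfolding TR_def by (auto intro: generate.incl)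
  qed
  then have "TR \<subseteq> {f \<in> carrier FA. act r f \<in> TR}"
    using FA.generate_subgroup_incl[OF _ sub] TR_def by simp
  with f show ?thesis by auto
qed

lemma smult_class:
  assumes r: "r \<in> carrier R" and f: "f \<in> carrier FA"
  shows "r \<odot>\<^bsub>RG\<^esub> tensor_class R G f = tensor_class R G (act r f)"
proof -
  have "tensor_class R G (act r g) = tensor_class R G (act r f)" if g: "g \<in> tensor_class R G f" for g
  proof -
    have gc: "g \<in> carrier FA"
      using g subgroup.elemrcos_carrier[OF TR_subgroup FA.is_group f] unfolding tensor_class_def by blast
    have "tensor_class R G f = tensor_class R G g"
      unfolding tensor_class_def
      by (rule FA.repr_independence[OF _ f TR_subgroup]) (use g in \<open>simp add: tensor_class_def\<close>)
    then have "g - f \<in> TR" using tensor_class_eq_iff[OF gc f] by simp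
    then have "act r g - act r f \<in> TR" using act_TR[OF r, of "g - f"] by (simp add: act_def
        frag_extend_diff)
    then show ?thesis using tensor_class_eq_iff[OF act_closed[OF r gc] act_closed[OF r f]] by simp
  qed
  moreover have "f \<in> tensor_class R G f"
    unfolding tensor_class_def using FA.rcos_self[OF f TR_subgroup] .
  ultimately have "(\<Union>g \<in> tensor_class R G f. tensor_class R G (act r g)) = tensor_class R G (act r f)"
    by blast
  then show ?thesis by (simp add: scalar_extension_def act_def)
qed

lemma smult_tensor:
  assumes "r \<in> carrier R" "s \<in> carrier R" "g \<in> carrier G"
  shows "r \<odot>\<^bsub>RG\<^esub> tensor R G s g = tensor R G (r \<otimes> s) g"
  unfolding tensor_def using assms by (subst smult_class) (auto simp: act_def)

lemma smult_hom: "r \<in> carrier R \<Longrightarrow> (\<lambda>x. r \<odot>\<^bsub>RG\<^esub> x) \<in> hom (add_monoid RG) (add_monoid RG)"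
proof (rule homI, goal_cases)
  case (1 x)
  then show ?case using carrier_RG smult_class act_closed tensor_class_closed by auto
next
  case (2 x y)
  then obtain f g where fg: "f \<in> carrier FA" "x = tensor_class R G f" "g \<in> carrier FA" "y =
      tensor_class R G g"
    using carrier_RG by auto
  have s1: "f + g \<in> carrier FA" using FA.m_closed[OF fg(1,3)] by simp
  have s2: "act r f + act r g = act r (f + g)" by (simp add: act_def frag_extend_add)
  have "r \<odot>\<^bsub>RG\<^esub> (x \<oplus>\<^bsub>RG\<^esub> y) = tensor_class R G (act r f + act r g)"
    unfolding s2 using fg 2 by (simp add: tensor_class_add[symmetric] smult_class s1 del:
        carrier_free_Abelian_group_iff)
  then show ?case using 2 fg by (simp add: tensor_class_add smult_class act_closed del:
      carrier_free_Abelian_group_iff)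
qed

text \<open>The laws that mix scalars are compatible with differences of module elements, so it is
  enough to check them on elementary tensors, where they are laws of \<open>R\<close>.\<close>

lemma module_RG: "module R RG"
proof (rule moduleI)
  show "cring R" by (rule R.is_cring)
  show "abelian_group RG" by (rule abelian_group_RG)
  show cl: "a \<odot>\<^bsub>RG\<^esub> x \<in> carrier RG" if "a \<in> carrier R" "x \<in> carrier RG" for a x
    using smult_hom[OF that(1)] that(2) by (auto simp: hom_def)
  show "a \<odot>\<^bsub>RG\<^esub> (x \<oplus>\<^bsub>RG\<^esub> y) = a \<odot>\<^bsub>RG\<^esub> x \<oplus>\<^bsub>RG\<^esub> a \<odot>\<^bsub>RG\<^esub> y"
    if "a \<in> carrier R" "x \<in> carrier RG" "y \<in> carrier RG" for a x y
    using smult_hom[OF that(1)] that(2,3) by (auto simp: hom_def)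
  have smd: "a \<odot>\<^bsub>RG\<^esub> (x \<ominus>\<^bsub>RG\<^esub> y) = a \<odot>\<^bsub>RG\<^esub> x \<ominus>\<^bsub>RG\<^esub> a \<odot>\<^bsub>RG\<^esub> y"
    if "a \<in> carrier R" "x \<in> carrier RG" "y \<in> carrier RG" for a x y
    using hom_a_minus[OF _ _ smult_hom[OF that(1)]] that(2,3) abelian_group_RG by auto
  have zero: "a \<odot>\<^bsub>RG\<^esub> \<zero>\<^bsub>RG\<^esub> = \<zero>\<^bsub>RG\<^esub>" if "a \<in> carrier R" for a
    using hom_zero[OF _ _ smult_hom[OF that(1)]] abelian_group_RG by auto
  show "(a \<oplus> b) \<odot>\<^bsub>RG\<^esub> x = a \<odot>\<^bsub>RG\<^esub> x \<oplus>\<^bsub>RG\<^esub> b \<odot>\<^bsub>RG\<^esub> x"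
    if ab: "a \<in> carrier R" "b \<in> carrier R" and "x \<in> carrier RG" for a b x
    using that(3)
  proof (induction x rule: RG_induct)
    case (tensor r g)
    then show ?case using ab by (simp add: smult_tensor R.l_distr tensor_add_left)
  next
    case (diff x y)
    then show ?case using ab cl
      by (simp add: smd RG.diff_add_diff)
  qed (use ab zero in auto)
  show "(a \<otimes> b) \<odot>\<^bsub>RG\<^esub> x = a \<odot>\<^bsub>RG\<^esub> (b \<odot>\<^bsub>RG\<^esub> x)"
    if ab: "a \<in> carrier R" "b \<in> carrier R" and "x \<in> carrier RG" for a b x
    using that(3)
  proof (induction x rule: RG_induct)
    case (tensor r g)
    then show ?case using ab by (simp add: smult_tensor R.m_assoc)
  next
    case (diff x y)
    then show ?case using ab cl by (simp add: smd)
  qed (use ab zero in auto)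
  show "\<one> \<odot>\<^bsub>RG\<^esub> x = x" if "x \<in> carrier RG" for x
    using that
  proof (induction x rule: RG_induct)
    case (tensor r g)
    then show ?case by (simp add: smult_tensor)
  next
    case (diff x y)
    then show ?case using cl by (simp add: smd)
  qed (use zero in auto)
qed

sublocale RG: module R RG by (rule module_RG)

text \<open>Tensors with first factor one over a generating set of \<open>G\<close> span the
  extension as an \<open>R\<close>-module. Negation is covered by the scalar minus one.\<close>

lemma RG_generated_induct [consumes 3, case_names zero gen add smult]:
  assumes "x \<in> carrier RG" "generate G A = carrier G" "A \<subseteq> carrier G" "P \<zero>\<^bsub>RG\<^esub>"
    "\<And>a. a \<in> A \<Longrightarrow> P (tensor R G \<one> a)"
    "\<And>x y. x \<in> carrier RG \<Longrightarrow> y \<in> carrier RG \<Longrightarrow> P x \<Longrightarrow> P y \<Longrightarrow> P (x \<oplus>\<^bsub>RG\<^esub> y)"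
    "\<And>r x. r \<in> carrier R \<Longrightarrow> x \<in> carrier RG \<Longrightarrow> P x \<Longrightarrow> P (r \<odot>\<^bsub>RG\<^esub> x)"
  shows "P x"
proof -
  have neg: "P (\<ominus>\<^bsub>RG\<^esub> x)" if "x \<in> carrier RG" "P x" for x
    using assms(7)[of "\<ominus> \<one>" x] that RG.smult_l_minus[of \<one> x] by simp
  interpret h: group_hom G "add_monoid RG" "tensor R G \<one>"
    using tensor_hom_right[of \<one>] RG.a_group by (intro group_homI) (auto simp: G.is_group)
  have "subgroup {g \<in> carrier G. P (tensor R G \<one> g)} G"
  proof (rule G.subgroupI)
    show "{g \<in> carrier G. P (tensor R G \<one> g)} \<noteq> {}"
      using tensor_one_right[of \<one>] assms(4) by (auto intro!: exI[of _ "\<one>\<^bsub>G\<^esub>"])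
    show "inv\<^bsub>G\<^esub> a \<in> {g \<in> carrier G. P (tensor R G \<one> g)}" if "a \<in> {g \<in> carrier G. P (tensor R G \<one> g)}" for a
      using that h.hom_inv[of a] neg by (auto simp: a_inv_def)
  qed (use assms(6) in \<open>auto simp: tensor_add_right\<close>)
  then have "carrier G \<subseteq> {g \<in> carrier G. P (tensor R G \<one> g)}"
    using G.generate_subgroup_incl[of A "{g \<in> carrier G. P (tensor R G \<one> g)}"] assms(2,3,5) by blast
  then have g: "P (tensor R G \<one> g)" if "g \<in> carrier G" for g using that by auto
  from assms(1) show ?thesis
  proof (induction x rule: RG_induct)
    case (tensor r g)
    then show ?case using assms(7)[of r "tensor R G \<one> g"] g by (simp add: smult_tensor)
  next
    case (diff x y)
    show ?case unfolding a_minus_def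
      by (rule assms(6)[OF diff(1) RG.a_inv_closed[OF diff(2)] diff(3) neg[OF diff(2,4)]])
  next
    case zero
    show ?case by (rule assms(4))
  qed
qed

text \<open>The universal property of extension of scalars:
  \<open>(r, g) \<mapsto> r \<odot> \<phi> g\<close> is biadditive, hence kills the relators and
  descends. The linear maps of the presentation and the coordinates on the free modules are all
  built from it.\<close>

lemma tensor_universal:
  assumes N: "module R N" and \<phi>: "\<phi> \<in> hom G (add_monoid N)"
  shows "\<exists>h \<in> module_hom R RG N. \<forall>r \<in> carrier R. \<forall>g \<in> carrier G. h (tensor R G r g) = r \<odot>\<^bsub>N\<^esub> \<phi> g"
proof -
  interpret N: module R N by (rule N)
  interpret \<phi>: group_hom G "add_monoid N" \<phi> using \<phi> N.a_group by (intro group_homI) (auto simp: G.is_group)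
  have \<phi>c: "\<phi> g \<in> carrier N" if "g \<in> carrier G" for g using \<phi>.hom_closed[OF that] by simp
  let ?k = "\<lambda>(r, g). r \<odot>\<^bsub>N\<^esub> \<phi> g"
  have kc: "?k \<in> carrier R \<times> carrier G \<rightarrow> carrier (add_monoid N)" using \<phi>c by auto
  let ?z = "zlift (add_monoid N) ?k"
  have zh: "?z \<in> hom FA (add_monoid N)" by (rule comm_group.zlift_hom[OF N.a_comm_group kc])
  interpret z: group_hom FA "add_monoid N" ?z using zh by (intro group_homI) (auto simp: N.a_group)
  have zof: "?z (frag_of (r, g)) = r \<odot>\<^bsub>N\<^esub> \<phi> g" if "r \<in> carrier R" "g \<in> carrier G" for r g
    using comm_group.zlift_frag_of[OF N.a_comm_group, of ?k "(r, g)"] that \<phi>c by simp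
  have zd: "?z (f - g) = ?z f \<ominus>\<^bsub>N\<^esub> ?z g" if "f \<in> carrier FA" "g \<in> carrier FA" for f g
    using z.hom_mult[of f "- g"] z.hom_inv[of g] that by (simp add: a_inv_def a_minus_def)
  have rel: "?z f = \<zero>\<^bsub>N\<^esub>" if "f \<in> TR" for f
  proof -
    have "?z f = \<zero>\<^bsub>N\<^esub>" if "f \<in> relators" for f
      using that unfolding relators_def
    proof (elim UnE CollectE exE conjE)
      fix a b g assume *: "f = frag_of (a \<oplus> b, g) - frag_of (a, g) - frag_of (b, g)"
        "a \<in> carrier R" "b \<in> carrier R" "g \<in> carrier G"
      have "?z (frag_of (a \<oplus> b, g) - frag_of (a, g) - frag_of (b, g)) =
        ((a \<oplus> b) \<odot>\<^bsub>N\<^esub> \<phi> g \<ominus>\<^bsub>N\<^esub> a \<odot>\<^bsub>N\<^esub> \<phi> g) \<ominus>\<^bsub>N\<^esub> b \<odot>\<^bsub>N\<^esub> \<phi> g"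
        using * by (subst zd, force dest!: subsetD[OF keys_diff], simp)+ (simp add: zof)
      then show "?z f = \<zero>\<^bsub>N\<^esub>" using * \<phi>c
        by (simp add: N.smult_l_distr N.add_diff_diff)
    next
      fix a g h assume *: "f = frag_of (a, g \<otimes>\<^bsub>G\<^esub> h) - frag_of (a, g) - frag_of (a, h)"
        "a \<in> carrier R" "g \<in> carrier G" "h \<in> carrier G"
      have "?z (frag_of (a, g \<otimes>\<^bsub>G\<^esub> h) - frag_of (a, g) - frag_of (a, h)) =
        (a \<odot>\<^bsub>N\<^esub> \<phi> (g \<otimes>\<^bsub>G\<^esub> h) \<ominus>\<^bsub>N\<^esub> a \<odot>\<^bsub>N\<^esub> \<phi> g) \<ominus>\<^bsub>N\<^esub> a \<odot>\<^bsub>N\<^esub> \<phi> h"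
        using * by (subst zd, force dest!: subsetD[OF keys_diff], simp)+ (simp add: zof)
      then show "?z f = \<zero>\<^bsub>N\<^esub>" using * \<phi>c
        by (simp add: N.smult_r_distr N.add_diff_diff)
    qed
    then show ?thesis
      using hom_trivial_on_generate[OF FA.is_group N.a_group zh relators_carrier] that unfolding
          TR_def by simp
  qed
  obtain h where h: "h \<in> hom (FA Mod TR) (add_monoid N)" "\<And>f. f \<in> carrier FA \<Longrightarrow> h (TR #>\<^bsub>FA\<^esub> f) = ?z f"
  proof (rule FactGroup_universal[OF zh TR.normal_axioms])
    fix x y assume xy: "x \<in> carrier FA" "y \<in> carrier FA" "TR #>\<^bsub>FA\<^esub> x = TR #>\<^bsub>FA\<^esub> y"
    then have "?z (x - y) = \<zero>\<^bsub>N\<^esub>" using rel tensor_class_eq_iff unfolding tensor_class_def by blast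
    then have "?z x \<ominus>\<^bsub>N\<^esub> ?z y = \<zero>\<^bsub>N\<^esub>" using zd xy by metis
    then show "?z x = ?z y" using z.hom_closed[OF xy(1)] z.hom_closed[OF xy(2)] by (simp add:
        N.minus_eq_zero_iff)
  qed blast
  have hh: "h \<in> hom (add_monoid RG) (add_monoid N)" using h(1) by (simp only: hom_cong_domain[OF
      RG_Mod(1,2)])
  have ht: "h (tensor R G r g) = r \<odot>\<^bsub>N\<^esub> \<phi> g" if "r \<in> carrier R" "g \<in> carrier G" for r g
    using h(2)[of "frag_of (r, g)"] zof that unfolding tensor_def tensor_class_def by simp
  have hc: "h x \<in> carrier N" if "x \<in> carrier RG" for x using hh that by (auto simp: hom_def)
  have "h (r \<odot>\<^bsub>RG\<^esub> x) = r \<odot>\<^bsub>N\<^esub> h x" if r: "r \<in> carrier R" and x: "x \<in> carrier RG" for r x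
    using x
  proof (induction x rule: RG_induct)
    case zero
    then show ?case using hom_zero[OF abelian_group_RG N.abelian_group_axioms hh] r by simp
  next
    case (tensor s g)
    then show ?case using r \<phi>c by (simp add: smult_tensor ht N.smult_assoc1)
  next
    case (diff x y)
    have d: "h (x \<ominus>\<^bsub>RG\<^esub> y) = h x \<ominus>\<^bsub>N\<^esub> h y" if "x \<in> carrier RG" "y \<in> carrier RG" for x y
      using hom_a_minus[OF abelian_group_RG N.abelian_group_axioms hh] that by simp
    have "r \<odot>\<^bsub>RG\<^esub> (x \<ominus>\<^bsub>RG\<^esub> y) = r \<odot>\<^bsub>RG\<^esub> x \<ominus>\<^bsub>RG\<^esub> r \<odot>\<^bsub>RG\<^esub> y"
      using diff r by (simp add: a_minus_def RG.smult_r_distr RG.smult_r_minus)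
    then have "h (r \<odot>\<^bsub>RG\<^esub> (x \<ominus>\<^bsub>RG\<^esub> y)) = r \<odot>\<^bsub>N\<^esub> h x \<ominus>\<^bsub>N\<^esub> r \<odot>\<^bsub>N\<^esub> h y"
      using diff r d by simp
    also have "\<dots> = r \<odot>\<^bsub>N\<^esub> (h x \<ominus>\<^bsub>N\<^esub> h y)"
      using diff r hc by (simp add: a_minus_def N.smult_r_distr N.smult_r_minus)
    finally show ?case using d diff by simp
  qed
  then have "h \<in> module_hom R RG N" by (intro module_homI hh) auto
  with ht show ?thesis by blast
qed

text \<open>The uniqueness that goes with \<open>tensor_universal\<close>, since tensors over a
  generating set of \<open>G\<close> span the module.\<close>

lemma RG_hom_eqI:
  assumes "module R N" "h \<in> module_hom R RG N" "k \<in> module_hom R RG N"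
    "generate G A = carrier G" "A \<subseteq> carrier G"
    "\<And>a. a \<in> A \<Longrightarrow> h (tensor R G \<one> a) = k (tensor R G \<one> a)" "x \<in> carrier RG"
  shows "h x = k x"
  using assms(7,4,5)
proof (induction x rule: RG_generated_induct)
  case zero
  then show ?case using assms(1-3) hom_zero[OF abelian_group_RG _ module_hom_hom]
    by (metis module.axioms(2))
next
  case (gen a)
  then show ?case using assms by simp
next
  case (add x y)
  then show ?case using assms(2,3) by (simp add: module_hom_add)
next
  case (smult r x)
  then show ?case using assms(2,3) by (simp add: module_hom_smult)
qed

end

section \<open>The polynomial ring\<close>

lemma int_poly_simps [simp]:
  "x \<otimes>\<^bsub>int_poly Y\<^esub> y = x * y" "x \<oplus>\<^bsub>int_poly Y\<^esub> y = x + y" "\<one>\<^bsub>int_poly Y\<^esub> = 1" "\<zero>\<^bsub>int_poly Y\<^esub> = 0"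
  by (simp_all add: int_poly_def)

lemma carrier_int_poly: "carrier (int_poly Y) = carrier (free_Abelian_group {m. set_mset m \<subseteq> Y})"
  unfolding int_poly_def free_Abelian_group_def by (simp, blast)

lemma int_poly_iff: "p \<in> carrier (int_poly Y) \<longleftrightarrow> (\<forall>m \<in> Poly_Mapping.keys p. set_mset m \<subseteq> Y)"
  by (simp add: int_poly_def)

lemma cring_int_poly: "cring (int_poly Y)"
proof (rule cringI)
  show "abelian_group (int_poly Y)"
  proof (rule abelian_groupI, simp_all)
    fix x y assume "x \<in> carrier (int_poly Y)" "y \<in> carrier (int_poly Y)"
    then show "x + y \<in> carrier (int_poly Y)"
      by (auto simp: int_poly_iff dest!: subsetD[OF keys_add])
  next
    fix x assume "x \<in> carrier (int_poly Y)"
    then show "\<exists>y\<in>carrier (int_poly Y). y + x = 0"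
      by (intro bexI[of _ "- x"]) (auto simp: int_poly_iff)
  qed (auto simp: int_poly_iff algebra_simps)
  show "comm_monoid (int_poly Y)"
  proof (rule comm_monoidI, simp_all)
    fix x y assume *: "x \<in> carrier (int_poly Y)" "y \<in> carrier (int_poly Y)"
    show "x * y \<in> carrier (int_poly Y)"
      unfolding int_poly_iff
    proof
      fix m assume "m \<in> Poly_Mapping.keys (x * y)"
      then have "m \<in> {a + b |a b. a \<in> Poly_Mapping.keys x \<and> b \<in> Poly_Mapping.keys y}"
        by (rule subsetD[OF keys_mult])
      then obtain a b where "m = a + b" "a \<in> Poly_Mapping.keys x" "b \<in> Poly_Mapping.keys y" by blast
      then show "set_mset m \<subseteq> Y" using * by (simp add: int_poly_iff)
    qed
  qed (auto simp: int_poly_iff algebra_simps)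
qed (simp add: algebra_simps)

interpretation int_poly: cring "int_poly Y" for Y by (rule cring_int_poly)

lemma int_poly_closed [intro, simp]:
  "p \<in> carrier (int_poly Y) \<Longrightarrow> q \<in> carrier (int_poly Y) \<Longrightarrow> p + q \<in> carrier (int_poly Y)"
  "p \<in> carrier (int_poly Y) \<Longrightarrow> q \<in> carrier (int_poly Y) \<Longrightarrow> p * q \<in> carrier (int_poly Y)"
  "1 \<in> carrier (int_poly Y)" "0 \<in> carrier (int_poly Y)"
  using int_poly.a_closed[of p Y q] int_poly.m_closed[of p Y q] int_poly.one_closed
      int_poly.zero_closed by auto

lemma int_poly_a_inv [simp]: "p \<in> carrier (int_poly Y) \<Longrightarrow> \<ominus>\<^bsub>int_poly Y\<^esub> p = - p"
  by (rule int_poly.minus_equality) (auto simp: int_poly_iff)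

lemma int_poly_a_minus [simp]: "q \<in> carrier (int_poly Y) \<Longrightarrow> p \<ominus>\<^bsub>int_poly Y\<^esub> q = p - q"
  by (simp add: a_minus_def)

lemma int_poly_closed' [intro, simp]:
  "p \<in> carrier (int_poly Y) \<Longrightarrow> - p \<in> carrier (int_poly Y)"
  "p \<in> carrier (int_poly Y) \<Longrightarrow> q \<in> carrier (int_poly Y) \<Longrightarrow> p - q \<in> carrier (int_poly Y)"
  using int_poly.a_inv_closed[of p Y] int_poly.minus_closed[of p Y q] by auto

lemma var_closed [intro, simp]: "y \<in> Y \<Longrightarrow> var y \<in> carrier (int_poly Y)"
  by (simp add: int_poly_iff var_def)

lemma of_int_int_poly [intro, simp]: "of_int k \<in> carrier (int_poly Y)"
proof -
  have "of_nat n \<in> carrier (int_poly Y)" for n by (induction n) auto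
  then show ?thesis by (cases k) (simp_all del: of_nat_Suc)
qed

lemma frag_of_add_mset: "frag_of (add_mset y m) = var y * frag_of m"
  by (simp add: var_def mult_single)

lemma frag_of_zero_mset: "frag_of ({#} :: 'a multiset) = 1"
  by (rule single_one)

lemma int_poly_induct [consumes 1, case_names zero diff monom]:
  assumes "p \<in> carrier (int_poly Y)" "P 0"
    "\<And>p q. p \<in> carrier (int_poly Y) \<Longrightarrow> q \<in> carrier (int_poly Y) \<Longrightarrow> P p \<Longrightarrow> P q \<Longrightarrow> P (p - q)"
    "\<And>m. set_mset m \<subseteq> Y \<Longrightarrow> P (frag_of m)"
  shows "P p"
  using assms(1) unfolding carrier_int_poly
  by (induction rule: free_Abelian_induct) (use assms(2-) in \<open>simp_all only: carrier_int_poly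
      mem_Collect_eq\<close>)

text \<open>\<open>of_int k\<close> is the constant polynomial, supported on the empty monomial, so
  multiplying by it scales every coefficient.\<close>

lemma lookup_of_int_mult:
  fixes r :: "'a multiset \<Rightarrow>\<^sub>0 int"
  shows "Poly_Mapping.lookup (of_int k * r) m = k * Poly_Mapping.lookup r m"
proof -
  have "Poly_Mapping.single (0 :: 'a multiset) (of_int k :: int) = of_int k" by (rule single_of_int)
  then have "(of_int k :: 'a multiset \<Rightarrow>\<^sub>0 int) = Poly_Mapping.single 0 k" by simp
  then show ?thesis
    by (induction r rule: frag_induction[OF subset_UNIV])
      (auto simp: algebra_simps lookup_minus mult_single lookup_single when_def)
qed

text \<open>The codomain of coordinate functionals: \<open>module_hom\<close> takes module records,
  and a ring record has no field \<open>smult\<close>.\<close>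

definition self_module :: "('a, 'm) ring_scheme \<Rightarrow> ('a, 'a) module" where
  "self_module R = \<lparr>carrier = carrier R, monoid.mult = monoid.mult R, one = one R,
     ring.zero = ring.zero R, add = add R, smult = monoid.mult R\<rparr>"

lemma self_module_simps [simp]:
  "carrier (self_module R) = carrier R" "\<zero>\<^bsub>self_module R\<^esub> = \<zero>\<^bsub>R\<^esub>"
  "x \<oplus>\<^bsub>self_module R\<^esub> y = x \<oplus>\<^bsub>R\<^esub> y" "x \<odot>\<^bsub>self_module R\<^esub> y = x \<otimes>\<^bsub>R\<^esub> y"
  by (simp_all add: self_module_def)

lemma (in cring) module_self_module: "module R (self_module R)"
proof (rule moduleI)
  show "abelian_group (self_module R)"
    by (rule abelian_groupI) (auto simp: a_ac l_neg intro!: bexI[of _ "\<ominus> _"])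
qed (auto simp: is_cring l_distr r_distr m_assoc)

section \<open>Criteria for gradings\<close>

lemma hom_finsum:
  assumes "abelian_group M" "abelian_group N" "h \<in> hom (add_monoid M) (add_monoid N)"
    "f \<in> A \<rightarrow> carrier M"
  shows "h (\<Oplus>\<^bsub>M\<^esub>a \<in> A. f a) = (\<Oplus>\<^bsub>N\<^esub>a \<in> A. h (f a))"
proof -
  interpret M: abelian_group M by fact
  interpret N: abelian_group N by fact
  have hc: "h x \<in> carrier N" if "x \<in> carrier M" for x using assms(3) that by (auto simp: hom_def)
  show ?thesis
    using assms(4)
  proof (induction A rule: infinite_finite_induct)
    case (insert a A)
    then have "h (f a \<oplus>\<^bsub>M\<^esub> finsum M f A) = h (f a) \<oplus>\<^bsub>N\<^esub> h (finsum M f A)"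
      using assms(3) by (auto simp: hom_def)
    moreover have "f a \<in> carrier M" "f \<in> A \<rightarrow> carrier M" using insert.prems by auto
    ultimately show ?case using insert hc by (subst M.finsum_insert, simp, simp, simp, simp, subst
        N.finsum_insert) auto
  qed (use hom_zero[OF assms(1-3)] in \<open>simp_all\<close>)
qed

text \<open>The projections supply the decomposition. Elements that are the sum of their finitely
  many \<open>P k x\<close> include the homogeneous ones and are closed under addition, so they
  exhaust the generated group. Applying \<open>P k\<close> to any other decomposition isolates its
  \<open>k\<close>-th term, whence uniqueness.\<close>

lemma graded_groupI:
  assumes M: "abelian_group M" and D: "\<And>k. subgroup (D k) (add_monoid M)"
    and P: "\<And>k. P k \<in> hom (add_monoid M) (add_monoid M)"
    and P1: "\<And>k x. x \<in> D k \<Longrightarrow> P k x = x"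
    and P0: "\<And>k j x. x \<in> D j \<Longrightarrow> j \<noteq> k \<Longrightarrow> P k x = \<zero>\<^bsub>M\<^esub>"
    and gen: "carrier M \<subseteq> generate (add_monoid M) (\<Union>k. D k)"
  shows "graded_group M D"
proof -
  interpret M: abelian_group M by fact
  have Dc: "D k \<subseteq> carrier M" for k using subgroup.subset[OF D] by simp
  have Dz: "\<zero>\<^bsub>M\<^esub> \<in> D k" for k using subgroup.one_closed[OF D] by simp
  have Pc: "P k x \<in> carrier M" if "x \<in> carrier M" for x k using P[of k] that by (auto simp: hom_def)
  have Pz: "P k \<zero>\<^bsub>M\<^esub> = \<zero>\<^bsub>M\<^esub>" for k using P1[OF Dz] .
  have Da: "x \<oplus>\<^bsub>M\<^esub> y \<in> D k" if "x \<in> D k" "y \<in> D k" for x y k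
    using subgroup.m_closed[OF D that] by simp
  have sup: "finsum M f {k. f k \<noteq> \<zero>\<^bsub>M\<^esub>} = finsum M f A"
    if "finite A" "\<And>k. k \<notin> A \<Longrightarrow> f k = \<zero>\<^bsub>M\<^esub>" "\<And>k. f k \<in> carrier M" for f and A :: "nat set"
    using that by (intro M.add.finprod_mono_neutral_cong_left) auto
  define good where "good x \<longleftrightarrow> (\<forall>k. P k x \<in> D k) \<and> (\<exists>A. finite A \<and> (\<forall>k. k \<notin> A \<longrightarrow> P k x = \<zero>\<^bsub>M\<^esub>) \<and> x =
      finsum M (\<lambda>k. P k x) A)" for x
  have goodD: "good x" if "x \<in> D k" for x k
    unfolding good_def
  proof (intro conjI allI exI[of _ "{k}"])
    show "P j x \<in> D j" for j using P1 P0 that Dz by (cases "j = k") auto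
    have xc: "x \<in> carrier M" using that Dc by auto
    have "finsum M (\<lambda>k. P k x) {k} = P k x \<oplus>\<^bsub>M\<^esub> finsum M (\<lambda>k. P k x) {}"
      using Pc xc by (intro M.finsum_insert) auto
    then show "x = finsum M (\<lambda>k. P k x) {k}" using P1[OF that] xc by simp
  qed (use P0 that in auto)
  have good: "good x \<and> x \<in> carrier M" if "x \<in> generate (add_monoid M) (\<Union>k. D k)" for x
    using that
  proof (induction rule: generate.induct)
    case one
    show ?case using goodD[OF Dz] by simp
  next
    case (incl h)
    then show ?case using goodD Dc by auto
  next
    case (inv h)
    then obtain k where "h \<in> D k" by auto
    then have "inv\<^bsub>add_monoid M\<^esub> h \<in> D k" by (rule subgroup.m_inv_closed[OF D])
    then show ?case using goodD Dc by auto
  next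
    case (eng x y)
    then obtain A B where A: "finite A" "\<forall>k. k \<notin> A \<longrightarrow> P k x = \<zero>\<^bsub>M\<^esub>" "x = finsum M (\<lambda>k. P k x) A"
      and B: "finite B" "\<forall>k. k \<notin> B \<longrightarrow> P k y = \<zero>\<^bsub>M\<^esub>" "y = finsum M (\<lambda>k. P k y) B"
      unfolding good_def by blast
    have xy: "x \<in> carrier M" "y \<in> carrier M" using eng by auto
    have Pa: "P k (x \<oplus>\<^bsub>M\<^esub> y) = P k x \<oplus>\<^bsub>M\<^esub> P k y" for k using P[of k] xy by (auto simp: hom_def)
    have e1: "finsum M (\<lambda>k. P k x) A = finsum M (\<lambda>k. P k x) (A \<union> B)"
      using A(1,2) B(1) Pc xy by (intro M.add.finprod_mono_neutral_cong_left) auto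
    have e2: "finsum M (\<lambda>k. P k y) B = finsum M (\<lambda>k. P k y) (A \<union> B)"
      using A(1) B(1,2) Pc xy by (intro M.add.finprod_mono_neutral_cong_left) auto
    have e3: "finsum M (\<lambda>k. P k x \<oplus>\<^bsub>M\<^esub> P k y) (A \<union> B) =
        finsum M (\<lambda>k. P k x) (A \<union> B) \<oplus>\<^bsub>M\<^esub> finsum M (\<lambda>k. P k y) (A \<union> B)"
      using Pc xy by (intro M.finsum_addf) auto
    have "x \<oplus>\<^bsub>M\<^esub> y = finsum M (\<lambda>k. P k x \<oplus>\<^bsub>M\<^esub> P k y) (A \<union> B)"
      unfolding e3 by (rule arg_cong2[of _ _ _ _ "add M", OF trans[OF A(3) e1] trans[OF B(3) e2]])
    moreover have "P k x \<in> D k" "P k y \<in> D k" for k using eng unfolding good_def by auto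
    ultimately have "good (x \<oplus>\<^bsub>M\<^esub> y)"
      unfolding good_def Pa using A(1,2) B(1,2) Da
      by (intro conjI exI[of _ "A \<union> B"]) auto
    then show ?case using xy by simp
  qed
  show ?thesis
    unfolding graded_group_def
  proof (intro conjI allI ballI M D)
    fix x assume x: "x \<in> carrier M"
    with good gen have "good x" by auto
    then obtain A where A: "\<forall>k. P k x \<in> D k" "finite A" "\<forall>k. k \<notin> A \<longrightarrow> P k x = \<zero>\<^bsub>M\<^esub>"
      "x = finsum M (\<lambda>k. P k x) A" unfolding good_def by blast
    have fin: "finite {k. P k x \<noteq> \<zero>\<^bsub>M\<^esub>}" using A by (intro finite_subset[OF _ A(2)]) auto
    show "\<exists>!f. (\<forall>k. f k \<in> D k) \<and> finite {k. f k \<noteq> \<zero>\<^bsub>M\<^esub>} \<and> x = (\<Oplus>\<^bsub>M\<^esub>k\<in>{k. f k \<noteq> \<zero>\<^bsub>M\<^esub>}. f k)"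
    proof (rule ex1I[of _ "\<lambda>k. P k x"])
      show "(\<forall>k. P k x \<in> D k) \<and> finite {k. P k x \<noteq> \<zero>\<^bsub>M\<^esub>} \<and> x = (\<Oplus>\<^bsub>M\<^esub>k\<in>{k. P k x \<noteq> \<zero>\<^bsub>M\<^esub>}. P k x)"
        using A(1) fin trans[OF A(4) sup[of A "\<lambda>k. P k x", symmetric]] A(2,3) Pc x by blast
    next
      fix f assume f: "(\<forall>k. f k \<in> D k) \<and> finite {k. f k \<noteq> \<zero>\<^bsub>M\<^esub>} \<and> x = (\<Oplus>\<^bsub>M\<^esub>k\<in>{k. f k \<noteq> \<zero>\<^bsub>M\<^esub>}. f k)"
      then have fc: "f k \<in> carrier M" for k using Dc by auto
      show "f = (\<lambda>k. P k x)"
      proof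
        fix k
        \<comment> \<open>The index \<open>k\<close> is adjoined because it may lie outside the
          support of \<open>f\<close>.\<close>
        let ?A = "insert k {k. f k \<noteq> \<zero>\<^bsub>M\<^esub>}"
        have "finsum M f {k. f k \<noteq> \<zero>\<^bsub>M\<^esub>} = finsum M f ?A"
          by (rule sup) (use f fc in auto)
        then have "x = finsum M f ?A" using f by metis
        then have "P k x = P k (finsum M f ?A)" by (rule arg_cong)
        also have "\<dots> = finsum M (\<lambda>j. P k (f j)) ?A"
          by (rule hom_finsum[OF M M P]) (use fc in auto)
        also have "\<dots> = finsum M (\<lambda>j. P k (f j)) {k}"
          using f P0 Pc fc by (intro M.add.finprod_mono_neutral_cong_right) blast+
        also have "\<dots> = P k (f k) \<oplus>\<^bsub>M\<^esub> finsum M (\<lambda>j. P k (f j)) {}"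
          using Pc fc by (intro M.finsum_insert) auto
        finally show "f k = P k x" using P1[of "f k" k] f Pc fc by (metis M.finsum_empty M.r_zero)
      qed
    qed
  qed
qed

text \<open>Keeps the projections that \<open>graded_group\<close> hides behind a unique existence.
  Passing to quotients needs them as actual homomorphisms on both source and target.\<close>

definition graded_proj :: "('a, 'm) ring_scheme \<Rightarrow> (nat \<Rightarrow> 'a set) \<Rightarrow> (nat \<Rightarrow> 'a \<Rightarrow> 'a) \<Rightarrow> bool" where
  "graded_proj M D P \<longleftrightarrow> abelian_group M \<and> (\<forall>k. subgroup (D k) (add_monoid M)) \<and>
     (\<forall>k. P k \<in> hom (add_monoid M) (add_monoid M)) \<and> (\<forall>k. \<forall>x \<in> D k. P k x = x) \<and>
     (\<forall>k j. \<forall>x \<in> D j. j \<noteq> k \<longrightarrow> P k x = \<zero>\<^bsub>M\<^esub>) \<and> carrier M \<subseteq> generate (add_monoid M) (\<Union>k. D k)"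

lemma graded_proj_graded_group: "graded_proj M D P \<Longrightarrow> graded_group M D"
  by (rule graded_groupI[where P = P]) (auto simp: graded_proj_def)

text \<open>The part of a coefficient that contributes to degree \<open>k\<close> when it multiplies
  a basis element of degree \<open>d\<close>. Writing \<open>size m + d = k\<close> avoids truncated
  subtraction when \<open>k < d\<close>.\<close>

definition hpart :: "nat \<Rightarrow> nat \<Rightarrow> ('y multiset \<Rightarrow>\<^sub>0 int) \<Rightarrow> ('y multiset \<Rightarrow>\<^sub>0 int)" where
  "hpart d k = frag_extend (\<lambda>m. if size m + d = k then frag_of m else 0)"

lemma lookup_hpart: "Poly_Mapping.lookup (hpart d k p) m = (if size m + d = k then
    Poly_Mapping.lookup p m else 0)"
  unfolding hpart_def
  by (induction p rule: frag_induction[OF subset_UNIV]) (auto simp: frag_extend_diff lookup_minus)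

lemma keys_hpart: "Poly_Mapping.keys (hpart d k p) = {m \<in> Poly_Mapping.keys p. size m + d = k}"
  by (auto simp: in_keys_iff lookup_hpart split: if_splits)

lemma hpart_closed [simp, intro]: "p \<in> carrier (int_poly Y) \<Longrightarrow> hpart d k p \<in> carrier (int_poly Y)"
  by (auto simp: int_poly_iff keys_hpart)

lemma hpart_add: "hpart d k (p + q) = hpart d k p + hpart d k q"
  by (simp add: hpart_def frag_extend_add)

lemma hpart_id: "(\<And>m. m \<in> Poly_Mapping.keys p \<Longrightarrow> size m + d = k) \<Longrightarrow> hpart d k p = p"
  by (rule poly_mapping_eqI) (auto simp: lookup_hpart in_keys_iff)

lemma hpart_0: "(\<And>m. m \<in> Poly_Mapping.keys p \<Longrightarrow> size m + d \<noteq> k) \<Longrightarrow> hpart d k p = 0"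
  by (rule poly_mapping_eqI) (auto simp: lookup_hpart in_keys_iff)

lemma int_poly_part_iff: "p \<in> int_poly_part Y k \<longleftrightarrow> p \<in> carrier (int_poly Y) \<and> (\<forall>m \<in> Poly_Mapping.keys
    p. size m = k)"
  by (simp add: int_poly_part_def)

lemma int_poly_part_subgroup: "subgroup (int_poly_part Y k) (add_monoid (int_poly Y))"
proof (rule int_poly.add.subgroupI)
  have "0 \<in> int_poly_part Y k" by (simp add: int_poly_part_iff)
  then show "int_poly_part Y k \<noteq> {}" by blast
next
  fix a b assume "a \<in> int_poly_part Y k" "b \<in> int_poly_part Y k"
  then show "a \<oplus>\<^bsub>int_poly Y\<^esub> b \<in> int_poly_part Y k"
    by (auto simp: int_poly_part_iff dest!: subsetD[OF keys_add])
qed (auto simp: int_poly_part_iff)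

lemma frag_of_int_poly_part: "set_mset m \<subseteq> Y \<Longrightarrow> frag_of m \<in> int_poly_part Y (size m)"
  by (auto simp: int_poly_part_iff int_poly_iff)

lemma int_poly_generate: "carrier (int_poly Y) \<subseteq> generate (add_monoid (int_poly Y)) (\<Union>k. int_poly_part Y k)"
proof
  fix p assume "p \<in> carrier (int_poly Y)"
  then show "p \<in> generate (add_monoid (int_poly Y)) (\<Union>k. int_poly_part Y k)"
  proof (induction rule: int_poly_induct)
    case zero
    then show ?case using generate.one[of "add_monoid (int_poly Y)" "\<Union>k. int_poly_part Y k"]
      by (simp only: monoid.select_convs int_poly_simps(4))
  next
    case (diff p q)
    have sub: "(\<Union>k. int_poly_part Y k) \<subseteq> carrier (int_poly Y)" by (auto simp: int_poly_part_iff)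
    then have "subgroup (generate (add_monoid (int_poly Y)) (\<Union>k. int_poly_part Y k)) (add_monoid
        (int_poly Y))"
      by (rule int_poly.add.generate_is_subgroup)
    then have "additive_subgroup (generate (add_monoid (int_poly Y)) (\<Union>k. int_poly_part Y k)) (int_poly Y)"
      by (rule additive_subgroupI)
    then have "p \<oplus>\<^bsub>int_poly Y\<^esub> (\<ominus>\<^bsub>int_poly Y\<^esub> q) \<in> generate (add_monoid (int_poly Y)) (\<Union>k.
        int_poly_part Y k)"
      using diff(3,4) additive_subgroup.a_closed additive_subgroup.a_inv_closed
          int_poly.abelian_group_axioms
      by (metis additive_subgroup.a_subgroup int_poly.add.generate_m_inv_closed sub)
    moreover have "p \<oplus>\<^bsub>int_poly Y\<^esub> (\<ominus>\<^bsub>int_poly Y\<^esub> q) = p - q" using diff(2) by simp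
    ultimately show ?case by (simp only:)
  next
    case (monom m)
    then show ?case using frag_of_int_poly_part by (blast intro: generate.incl)
  qed
qed

lemma graded_group_int_poly: "graded_group (int_poly Y) (int_poly_part Y)"
proof (rule graded_groupI[where P = "\<lambda>k. hpart 0 k"])
  show "abelian_group (int_poly Y)" by (rule int_poly.abelian_group_axioms)
  show "hpart 0 k \<in> hom (add_monoid (int_poly Y)) (add_monoid (int_poly Y))" for k
    by (rule homI) (auto simp: hpart_add)
  show "carrier (int_poly Y) \<subseteq> generate (add_monoid (int_poly Y)) (\<Union>k. int_poly_part Y k)"
    by (rule int_poly_generate)
  show "subgroup (int_poly_part Y k) (add_monoid (int_poly Y))" for k
    by (rule int_poly_part_subgroup)
qed (auto simp: int_poly_part_iff intro: hpart_id hpart_0)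

text \<open>A free module with a finite homogeneous basis \<open>C\<close>, given together with the
  dual functionals \<open>K\<close>. Having the coordinates as module homomorphisms yields at once
  uniqueness of expansions and, through \<open>hpart\<close>, the projections onto the graded
  parts.\<close>

locale graded_basis = module "int_poly Y" M for Y and M (structure) +
  fixes D :: "nat \<Rightarrow> 'b set" and C :: "'b set" and K :: "'b \<Rightarrow> 'b \<Rightarrow> 'a multiset \<Rightarrow>\<^sub>0 int" and d :: "'b \<Rightarrow> nat"
  assumes fin: "finite C" and CM: "C \<subseteq> carrier M"
    and K: "\<And>c. c \<in> C \<Longrightarrow> K c \<in> module_hom (int_poly Y) M (self_module (int_poly Y))"
    and K_dual: "\<And>c c'. c \<in> C \<Longrightarrow> c' \<in> C \<Longrightarrow> K c c' = (if c = c' then 1 else 0)"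
    and expand: "\<And>x. x \<in> carrier M \<Longrightarrow> x = (\<Oplus>c \<in> C. K c x \<odot> c)"
    and D_sub: "\<And>k. subgroup (D k) (add_monoid M)"
    and D_smult: "\<And>i j r x. r \<in> int_poly_part Y i \<Longrightarrow> x \<in> D j \<Longrightarrow> r \<odot> x \<in> D (i + j)"
    and D_C: "\<And>c. c \<in> C \<Longrightarrow> c \<in> D (d c)"
    and K_D: "\<And>k x c m. x \<in> D k \<Longrightarrow> c \<in> C \<Longrightarrow> m \<in> Poly_Mapping.keys (K c x) \<Longrightarrow> size m + d c = k"
begin

lemma K_closed [simp, intro]: "c \<in> C \<Longrightarrow> x \<in> carrier M \<Longrightarrow> K c x \<in> carrier (int_poly Y)"
  using module_hom_closed[OF K] by simp

lemma K_add: "c \<in> C \<Longrightarrow> x \<in> carrier M \<Longrightarrow> y \<in> carrier M \<Longrightarrow> K c (x \<oplus> y) = K c x + K c y"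
  using module_hom_add[OF K] by simp

lemma K_smult: "c \<in> C \<Longrightarrow> r \<in> carrier (int_poly Y) \<Longrightarrow> x \<in> carrier M \<Longrightarrow> K c (r \<odot> x) = r * K c x"
  using module_hom_smult[OF K] by simp

lemma C_closed [simp, intro]: "c \<in> C \<Longrightarrow> c \<in> carrier M" using CM by auto

definition proj :: "nat \<Rightarrow> 'b \<Rightarrow> 'b" where
  "proj k x = (\<Oplus>c \<in> C. hpart (d c) k (K c x) \<odot> c)"

lemma proj_closed: "x \<in> carrier M \<Longrightarrow> proj k x \<in> carrier M"
  unfolding proj_def by (intro M.finsum_closed) auto

lemma D_carrier: "x \<in> D k \<Longrightarrow> x \<in> carrier M"
  using subgroup.subset[OF D_sub] by auto

lemma proj_hom: "proj k \<in> hom (add_monoid M) (add_monoid M)"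
proof (rule homI)
  fix x y assume "x \<in> carrier (add_monoid M)" "y \<in> carrier (add_monoid M)"
  then have xy: "x \<in> carrier M" "y \<in> carrier M" by auto
  have "proj k (x \<oplus> y) = (\<Oplus>c \<in> C. hpart (d c) k (K c x) \<odot> c \<oplus> hpart (d c) k (K c y) \<odot> c)"
    unfolding proj_def
  proof (rule M.finsum_cong')
    fix c assume c: "c \<in> C"
    have "hpart (d c) k (K c (x \<oplus> y)) = hpart (d c) k (K c x) \<oplus>\<^bsub>int_poly Y\<^esub> hpart (d c) k (K c y)"
      using xy c by (simp add: K_add hpart_add)
    then show "hpart (d c) k (K c (x \<oplus> y)) \<odot> c = hpart (d c) k (K c x) \<odot> c \<oplus> hpart (d c) k (K c y) \<odot> c"
      using xy c by (simp only: smult_l_distr hpart_closed K_closed C_closed)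
  qed (use xy in auto)
  also have "\<dots> = proj k x \<oplus> proj k y"
    unfolding proj_def using xy by (intro M.finsum_addf) auto
  finally show "proj k (x \<otimes>\<^bsub>add_monoid M\<^esub> y) = proj k x \<otimes>\<^bsub>add_monoid M\<^esub> proj k y" by simp
qed (simp add: proj_closed)

lemma smult_generate:
  assumes "p \<in> carrier (int_poly Y)" "c \<in> C"
  shows "p \<odot> c \<in> generate (add_monoid M) (\<Union>k. D k)"
  using assms(1)
proof (induction rule: int_poly_induct)
  case zero
  then show ?case using smult_l_null[of c] generate.one[of "add_monoid M"] assms(2) by simp
next
  case (diff p q)
  have sub: "(\<Union>k. D k) \<subseteq> carrier M" using D_carrier by auto
  have "(p - q) \<odot> c = p \<odot> c \<oplus> \<ominus> (q \<odot> c)"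
    using smult_l_distr[of p "- q" c] smult_l_minus[of q c] diff assms by simp
  moreover have "\<ominus> (q \<odot> c) \<in> generate (add_monoid M) (\<Union>k. D k)"
    using M.add.generate_m_inv_closed diff sub by blast
  ultimately show ?case using diff generate.eng[of "p \<odot> c" "add_monoid M"] by simp
next
  case (monom m)
  then show ?case using D_smult[OF frag_of_int_poly_part D_C] assms(2) by (blast intro: generate.incl)
qed

lemma generate_D: "carrier M \<subseteq> generate (add_monoid M) (\<Union>k. D k)"
proof
  fix x assume x: "x \<in> carrier M"
  have sub: "subgroup (generate (add_monoid M) (\<Union>k. D k)) (add_monoid M)"
    using D_carrier by (intro M.add.generate_is_subgroup) auto
  have "(\<Oplus>c \<in> A. K c x \<odot> c) \<in> generate (add_monoid M) (\<Union>k. D k)" if "A \<subseteq> C" for A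
    using finite_subset[OF that fin] that
  proof (induction A rule: finite_induct)
    case empty
    then show ?case using generate.one[of "add_monoid M"] by simp
  next
    case (insert c A)
    have "(\<Oplus>c \<in> insert c A. K c x \<odot> c) = K c x \<odot> c \<oplus> (\<Oplus>c \<in> A. K c x \<odot> c)"
      using insert x by (intro M.finsum_insert) auto
    then show ?case using insert x smult_generate[of "K c x" c] subgroup.m_closed[OF sub] by simp
  qed
  then have "(\<Oplus>c \<in> C. K c x \<odot> c) \<in> generate (add_monoid M) (\<Union>k. D k)" by blast
  then show "x \<in> generate (add_monoid M) (\<Union>k. D k)" by (subst expand[OF x])
qed

lemma graded_proj_D: "graded_proj M D proj"
  unfolding graded_proj_def
proof (intro conjI allI ballI impI)
  show "abelian_group M" by (rule M.abelian_group_axioms)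
  show "subgroup (D k) (add_monoid M)" for k by (rule D_sub)
  show "proj k \<in> hom (add_monoid M) (add_monoid M)" for k by (rule proj_hom)
  fix k x assume x: "x \<in> D k"
  then have "proj k x = (\<Oplus>c \<in> C. K c x \<odot> c)"
    unfolding proj_def using K_D D_carrier by (intro M.finsum_cong') (auto simp: hpart_id)
  then show "proj k x = x" using expand D_carrier[OF x] by simp
next
  fix k j x assume x: "x \<in> D j" "j \<noteq> k"
  then have "proj k x = (\<Oplus>c \<in> C. \<zero>)"
    unfolding proj_def
  proof (intro M.finsum_cong')
    fix c assume c: "c \<in> C"
    have "hpart (d c) k (K c x) = 0" using K_D x c by (intro hpart_0) blast
    then show "hpart (d c) k (K c x) \<odot> c = \<zero>" using smult_l_null c by simp
  qed auto
  then show "proj k x = \<zero>" by simp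
next
  show "carrier M \<subseteq> generate (add_monoid M) (\<Union>k. D k)" by (rule generate_D)
qed

lemma graded_group_D: "graded_group M D"
  by (rule graded_proj_graded_group[OF graded_proj_D])

lemma graded_module_D: "graded_module (int_poly Y) (int_poly_part Y) M D"
  unfolding graded_module_def using graded_group_D graded_group_int_poly module_axioms D_smult by blast

lemma finite_graded_free_D: "finite_graded_free (int_poly Y) M D"
  unfolding finite_graded_free_def
proof (intro exI[of _ C] conjI ballI)
  fix x assume x: "x \<in> carrier M"
  \<comment> \<open>Coefficient functions are compared in \<open>PiE\<close>, so the coordinates
    must be restricted to \<open>C\<close> to be the unique choice.\<close>
  show "\<exists>!a. a \<in> C \<rightarrow>\<^sub>E carrier (int_poly Y) \<and> x = (\<Oplus>b\<in>C. a b \<odot> b)"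
  proof (rule ex1I[of _ "restrict (\<lambda>c. K c x) C"])
    have "(\<Oplus>c \<in> C. restrict (\<lambda>c. K c x) C c \<odot> c) = (\<Oplus>c \<in> C. K c x \<odot> c)"
      using x by (intro M.finsum_cong') auto
    then show "restrict (\<lambda>c. K c x) C \<in> C \<rightarrow>\<^sub>E carrier (int_poly Y) \<and> x = (\<Oplus>b\<in>C. restrict (\<lambda>c. K c x)
        C b \<odot> b)"
      using x expand[OF x] by auto
  next
    fix a assume a: "a \<in> C \<rightarrow>\<^sub>E carrier (int_poly Y) \<and> x = (\<Oplus>b\<in>C. a b \<odot> b)"
    then have ac: "a c \<in> carrier (int_poly Y)" if "c \<in> C" for c using that by auto
    have "K c x = a c" if c: "c \<in> C" for c
    proof -
      have "K c x = (\<Oplus>\<^bsub>self_module (int_poly Y)\<^esub>b\<in>C. K c (a b \<odot> b))"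
        using a hom_finsum[OF M.abelian_group_axioms _ module_hom_hom[OF K[OF c]], of "\<lambda>b. a b \<odot> b" C]
          int_poly.module_self_module[of Y] ac by (auto simp: module_def)
      also have "\<dots> = (\<Oplus>\<^bsub>self_module (int_poly Y)\<^esub>b\<in>C. if c = b then a b else \<zero>\<^bsub>self_module (int_poly Y)\<^esub>)"
      proof (rule abelian_monoid.finsum_cong')
        show "abelian_monoid (self_module (int_poly Y))"
          using int_poly.module_self_module[of Y] by (simp add: module_def abelian_group_def)
      qed (use c ac in \<open>auto simp: K_smult K_dual\<close>)
      also have "\<dots> = a c"
        using abelian_monoid.finsum_singleton[of "self_module (int_poly Y)" c C a]
          int_poly.module_self_module[of Y] c ac fin by (auto simp: module_def abelian_group_def)
      finally show ?thesis .
    qed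
    then show "a = restrict (\<lambda>c. K c x) C" using a by (auto simp: fun_eq_iff PiE_def extensional_def)
  qed
qed (use fin D_C in auto)

end

section \<open>Finite bases of abelian groups\<close>

text \<open>The functional \<open>\<kappa> b\<close> is the coordinate of the basis element \<open>b\<close>.\<close>

definition zbasis :: "('g, 'm) monoid_scheme \<Rightarrow> 'g set \<Rightarrow> ('g \<Rightarrow> 'g \<Rightarrow> int) \<Rightarrow> bool" where
  "zbasis G B \<kappa> \<longleftrightarrow> finite B \<and> B \<subseteq> carrier G \<and> generate G B = carrier G \<and>
     (\<forall>b \<in> B. \<kappa> b \<in> hom G integer_group \<and> (\<forall>b' \<in> B. \<kappa> b b' = (if b = b' then 1 else 0)))"

locale poly_ext = comm_group G for G (structure) +
  fixes Y :: "'y set" and B :: "'a set" and \<kappa> :: "'a \<Rightarrow> 'a \<Rightarrow> int"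
  assumes zb: "zbasis G B \<kappa>"
begin

sublocale scalar_ext "int_poly Y" G by unfold_locales

lemma B: "finite B" "B \<subseteq> carrier G" "generate G B = carrier G"
  using zb by (auto simp: zbasis_def)

lemma \<kappa>: "b \<in> B \<Longrightarrow> \<kappa> b \<in> hom G integer_group"
  "b \<in> B \<Longrightarrow> b' \<in> B \<Longrightarrow> \<kappa> b b' = (if b = b' then 1 else 0)"
  using zb by (auto simp: zbasis_def)

text \<open>The functional is composed with the map from the integers to the polynomial ring and
  then extended linearly. It is stated for arbitrary functionals because it is later applied to
  minors for all pairs of letters, not just to the dual basis.\<close>

lemma coord_ex:
  assumes "\<phi> \<in> hom G integer_group"
  shows "\<exists>h \<in> module_hom (int_poly Y) RG (self_module (int_poly Y)).
    \<forall>r \<in> carrier (int_poly Y). \<forall>g \<in> carrier G. h (tensor (int_poly Y) G r g) = r * of_int (\<phi> g)"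
proof -
  have "(\<lambda>g. of_int (\<phi> g)) \<in> hom G (add_monoid (self_module (int_poly Y)))"
    using assms by (auto simp: hom_def)
  from tensor_universal[OF int_poly.module_self_module this] show ?thesis by simp
qed

definition coord :: "'a \<Rightarrow> (('y multiset \<Rightarrow>\<^sub>0 int) \<times> 'a \<Rightarrow>\<^sub>0 int) set \<Rightarrow> 'y multiset \<Rightarrow>\<^sub>0 int" where
  "coord b = (SOME h. h \<in> module_hom (int_poly Y) RG (self_module (int_poly Y)) \<and>
    (\<forall>r \<in> carrier (int_poly Y). \<forall>g \<in> carrier G. h (tensor (int_poly Y) G r g) = r * of_int (\<kappa> b g)))"

lemma coord:
  assumes "b \<in> B"
  shows "coord b \<in> module_hom (int_poly Y) RG (self_module (int_poly Y))"
    "\<And>r g. r \<in> carrier (int_poly Y) \<Longrightarrow> g \<in> carrier G \<Longrightarrow> coord b (tensor (int_poly Y) G r g) = r *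
        of_int (\<kappa> b g)"
  using someI_ex[OF coord_ex[OF \<kappa>(1)[OF assms], unfolded Bex_def]] unfolding coord_def by blast+

text \<open>Both sides are linear in \<open>x\<close>, so it suffices to take \<open>x\<close> of
  the form \<open>1 \<otimes> a\<close> with \<open>a\<close> a basis element, where the duality of
  \<open>\<kappa>\<close> leaves a single term.\<close>

lemma coord_expand:
  assumes "x \<in> carrier RG"
  shows "x = (\<Oplus>\<^bsub>RG\<^esub>b \<in> B. coord b x \<odot>\<^bsub>RG\<^esub> tensor (int_poly Y) G 1 b)"
proof -
  let ?t = "tensor (int_poly Y) G 1"
  have tc: "?t b \<in> carrier RG" if "b \<in> B" for b using B that tensor_closed[of 1 b] by auto
  have cc: "coord b x \<in> carrier (int_poly Y)" if "b \<in> B" "x \<in> carrier RG" for b x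
    using module_hom_closed[OF coord(1)[OF that(1)] that(2)] by simp
  show ?thesis
    using assms B(3,2)
  proof (induction x rule: RG_generated_induct)
    case zero
    have "coord b \<zero>\<^bsub>RG\<^esub> = 0" if "b \<in> B" for b
      using hom_zero[OF abelian_group_RG _ module_hom_hom[OF coord(1)[OF that]]]
          int_poly.module_self_module[of Y]
      by (auto simp: module_def)
    then have "(\<Oplus>\<^bsub>RG\<^esub>b \<in> B. coord b \<zero>\<^bsub>RG\<^esub> \<odot>\<^bsub>RG\<^esub> ?t b) = (\<Oplus>\<^bsub>RG\<^esub>b \<in> B. \<zero>\<^bsub>RG\<^esub>)"
      using tc RG.smult_l_null by (intro RG.finsum_cong') auto
    then show ?case by simp
  next
    case (gen a)
    have "(\<Oplus>\<^bsub>RG\<^esub>b \<in> B. coord b (?t a) \<odot>\<^bsub>RG\<^esub> ?t b) = (\<Oplus>\<^bsub>RG\<^esub>b \<in> B. if a = b then ?t b else \<zero>\<^bsub>RG\<^esub>)"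
      using tc gen B(2) RG.smult_l_null RG.smult_one by (intro RG.finsum_cong') (auto simp: coord(2)
          \<kappa>(2) subset_iff)
    also have "\<dots> = ?t a" using RG.finsum_singleton[of a B ?t] gen B(1) tc by auto
    finally show ?case by simp
  next
    case (add x y)
    have "(\<Oplus>\<^bsub>RG\<^esub>b \<in> B. coord b (x \<oplus>\<^bsub>RG\<^esub> y) \<odot>\<^bsub>RG\<^esub> ?t b) =
      (\<Oplus>\<^bsub>RG\<^esub>b \<in> B. coord b x \<odot>\<^bsub>RG\<^esub> ?t b \<oplus>\<^bsub>RG\<^esub> coord b y \<odot>\<^bsub>RG\<^esub> ?t b)"
    proof (rule RG.finsum_cong')
      fix b assume b: "b \<in> B"
      have "coord b (x \<oplus>\<^bsub>RG\<^esub> y) = coord b x \<oplus>\<^bsub>int_poly Y\<^esub> coord b y"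
        using module_hom_add[OF coord(1)[OF b]] add by simp
      then show "coord b (x \<oplus>\<^bsub>RG\<^esub> y) \<odot>\<^bsub>RG\<^esub> ?t b = coord b x \<odot>\<^bsub>RG\<^esub> ?t b \<oplus>\<^bsub>RG\<^esub> coord b y \<odot>\<^bsub>RG\<^esub> ?t b"
        using RG.smult_l_distr[OF cc cc tc] b add(1,2) by simp
    qed (use tc cc add(1,2) in auto)
    also have "\<dots> = (\<Oplus>\<^bsub>RG\<^esub>b \<in> B. coord b x \<odot>\<^bsub>RG\<^esub> ?t b) \<oplus>\<^bsub>RG\<^esub> (\<Oplus>\<^bsub>RG\<^esub>b \<in> B. coord b y \<odot>\<^bsub>RG\<^esub> ?t b)"
      using tc cc add(1,2) by (intro RG.finsum_addf) auto
    finally show ?case using add(3,4) by simp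
  next
    case (smult r x)
    have "(\<Oplus>\<^bsub>RG\<^esub>b \<in> B. coord b (r \<odot>\<^bsub>RG\<^esub> x) \<odot>\<^bsub>RG\<^esub> ?t b) =
      (\<Oplus>\<^bsub>RG\<^esub>b \<in> B. r \<odot>\<^bsub>RG\<^esub> (coord b x \<odot>\<^bsub>RG\<^esub> ?t b))"
    proof (rule RG.finsum_cong')
      fix b assume b: "b \<in> B"
      have "coord b (r \<odot>\<^bsub>RG\<^esub> x) = r \<otimes>\<^bsub>int_poly Y\<^esub> coord b x"
        using module_hom_smult[OF coord(1)[OF b]] smult by simp
      then show "coord b (r \<odot>\<^bsub>RG\<^esub> x) \<odot>\<^bsub>RG\<^esub> ?t b = r \<odot>\<^bsub>RG\<^esub> (coord b x \<odot>\<^bsub>RG\<^esub> ?t b)"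
        using RG.smult_assoc1[OF _ cc tc] b smult(1,2) by simp
    qed (use tc cc smult(1,2) in auto)
    also have "\<dots> = r \<odot>\<^bsub>RG\<^esub> (\<Oplus>\<^bsub>RG\<^esub>b \<in> B. coord b x \<odot>\<^bsub>RG\<^esub> ?t b)"
      using tc cc smult(1,2) B(1) by (intro RG.finsum_smult_ldistr[symmetric]) auto
    finally show ?case using smult(3) by simp
  qed
qed

lemma RG_eqI_coord:
  assumes "x \<in> carrier RG" "y \<in> carrier RG" "\<And>b. b \<in> B \<Longrightarrow> coord b x = coord b y"
  shows "x = y"
proof -
  let ?t = "tensor (int_poly Y) G 1"
  have tc: "?t b \<in> carrier RG" if "b \<in> B" for b using B that tensor_closed[of 1 b] by auto
  have cc: "coord b x \<in> carrier (int_poly Y)" if "b \<in> B" "x \<in> carrier RG" for b x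
    using module_hom_closed[OF coord(1)[OF that(1)] that(2)] by simp
  have "(\<Oplus>\<^bsub>RG\<^esub>b \<in> B. coord b x \<odot>\<^bsub>RG\<^esub> ?t b) = (\<Oplus>\<^bsub>RG\<^esub>b \<in> B. coord b y \<odot>\<^bsub>RG\<^esub> ?t b)"
    using assms tc cc by (intro RG.finsum_cong') auto
  then show ?thesis using coord_expand[OF assms(1)] coord_expand[OF assms(2)] by simp
qed

text \<open>The hypotheses say that every basis element is homogeneous and that its functional
  vanishes on the pieces of other degrees. Extending scalars then adds polynomial degree and degree
  in \<open>G\<close>, which is verified on the generating tensors of each graded part.\<close>

lemma graded_basis_RG:
  fixes GD :: "nat \<Rightarrow> 'a set" and d :: "'a \<Rightarrow> nat"
  assumes GD: "\<And>k. GD k \<subseteq> carrier G" and dB: "\<And>b. b \<in> B \<Longrightarrow> b \<in> GD (d b)"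
    and \<kappa>d: "\<And>b g j. b \<in> B \<Longrightarrow> g \<in> GD j \<Longrightarrow> \<kappa> b g \<noteq> 0 \<Longrightarrow> d b = j"
  shows "\<exists>K d'. graded_basis Y RG (scalar_extension_part (int_poly Y) (int_poly_part Y) G GD)
     (tensor (int_poly Y) G 1 ` B) K d'"
proof -
  let ?t = "tensor (int_poly Y) G 1"
  let ?F = "scalar_extension_part (int_poly Y) (int_poly_part Y) G GD"
  have tc: "?t b \<in> carrier RG" if "b \<in> B" for b using B that tensor_closed[of 1 b] by auto
  have ct: "coord b (?t b') = (if b = b' then 1 else 0)" if "b \<in> B" "b' \<in> B" for b b'
    using that B(2) coord(2)[OF that(1), of 1 b'] \<kappa>(2) by auto
  have inj: "inj_on ?t B"
  proof (rule inj_onI)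
    fix b b' assume "b \<in> B" "b' \<in> B" "?t b = ?t b'"
    then show "b = b'" using ct[of b b] ct[of b b'] by (auto split: if_splits)
  qed
  \<comment> \<open>The basis consists of the tensors \<open>1 \<otimes> b\<close>, while the
    functionals are indexed by \<open>b\<close>; \<open>u\<close> recovers the index.\<close>
  define u where "u = the_inv_into B ?t"
  have u: "u (?t b) = b" if "b \<in> B" for b unfolding u_def using the_inv_into_f_f[OF inj that] .
  define gen where "gen k = {tensor (int_poly Y) G r g |r g. \<exists>i j. r \<in> int_poly_part Y i \<and> g \<in> GD j
      \<and> i + j = k}" for k
  have F: "?F k = generate (add_monoid RG) (gen k)" for k
    by (simp only: scalar_extension_part_def gen_def)
  have gens: "gen k \<subseteq> carrier RG" for k
    unfolding gen_def using GD by (auto simp: int_poly_part_iff subset_iff)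
  have sub: "subgroup (?F k) (add_monoid RG)" for k
    unfolding F using gens by (intro RG.add.generate_is_subgroup) auto
  have "graded_basis Y RG ?F (?t ` B) (\<lambda>c. coord (u c)) (\<lambda>c. d (u c))"
  proof (intro graded_basis.intro module_RG graded_basis_axioms.intro)
    show "finite (?t ` B)" using B by simp
    show "?t ` B \<subseteq> carrier RG" using tc by auto
    show "coord (u c) \<in> module_hom (int_poly Y) RG (self_module (int_poly Y))" if "c \<in> ?t ` B" for c
      using that u coord(1) by auto
    show "coord (u c) c' = (if c = c' then 1 else 0)" if cc: "c \<in> ?t ` B" "c' \<in> ?t ` B" for c c'
    proof -
      obtain b b' where b: "b \<in> B" "c = ?t b" "b' \<in> B" "c' = ?t b'" using cc by blast
      then show ?thesis using u ct inj_on_eq_iff[OF inj b(1,3)] by auto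
    qed
    show "x = (\<Oplus>\<^bsub>RG\<^esub>c\<in>?t ` B. coord (u c) x \<odot>\<^bsub>RG\<^esub> c)" if "x \<in> carrier RG" for x
    proof -
      have cc: "coord b x \<in> carrier (int_poly Y)" if "b \<in> B" for b
        using module_hom_closed[OF coord(1)[OF that] \<open>x \<in> carrier RG\<close>] by simp
      have "(\<Oplus>\<^bsub>RG\<^esub>c\<in>?t ` B. coord (u c) x \<odot>\<^bsub>RG\<^esub> c) = (\<Oplus>\<^bsub>RG\<^esub>b\<in>B. coord (u (?t b)) x \<odot>\<^bsub>RG\<^esub> ?t b)"
        using tc cc u inj by (intro RG.add.finprod_reindex) auto
      also have "\<dots> = (\<Oplus>\<^bsub>RG\<^esub>b\<in>B. coord b x \<odot>\<^bsub>RG\<^esub> ?t b)"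
        using tc cc u by (intro RG.finsum_cong') auto
      finally show ?thesis using coord_expand[OF that] by simp
    qed
    show "subgroup (?F k) (add_monoid RG)" for k by (rule sub)
    show "r \<odot>\<^bsub>RG\<^esub> x \<in> ?F (i + j)" if r: "r \<in> int_poly_part Y i" and x: "x \<in> ?F j" for i j r x
    proof -
      have rc: "r \<in> carrier (int_poly Y)" using r by (simp add: int_poly_part_iff)
      interpret h: group_hom "add_monoid RG" "add_monoid RG" "\<lambda>x. r \<odot>\<^bsub>RG\<^esub> x"
        by (rule group_homI[OF RG.a_group RG.a_group smult_hom[OF rc]])
      have "r \<odot>\<^bsub>RG\<^esub> y \<in> ?F (i + j)"
        if yy: "y \<in> gen j" for y
      proof -
        obtain s g a b where y: "y = tensor (int_poly Y) G s g" "s \<in> int_poly_part Y a" "g \<in> GD b"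
            "a + b = j"
          using yy unfolding gen_def by blast
        have "r * s \<in> int_poly_part Y (i + a)"
        proof -
          have "\<forall>m \<in> Poly_Mapping.keys (r * s). size m = i + a"
            using r y(2) by (auto simp: int_poly_part_iff dest!: subsetD[OF keys_mult])
          then show ?thesis using r y(2) by (auto simp: int_poly_part_iff)
        qed
        moreover have "r \<odot>\<^bsub>RG\<^esub> y = tensor (int_poly Y) G (r * s) g"
          using smult_tensor[OF rc, of s g] y(2,3) GD[of b] unfolding y(1) int_poly_part_iff
          by (simp add: subset_iff)
        moreover have "(i + a) + b = i + j" using y(4) by simp
        ultimately show ?thesis
          unfolding F gen_def using y(3)
          by (intro generate.incl CollectI exI[of _ "r * s"] exI[of _ g] conjI exI[of _ "i + a"]
              exI[of _ b])
      qed
      moreover have "subgroup {y \<in> carrier RG. r \<odot>\<^bsub>RG\<^esub> y \<in> ?F (i + j)} (add_monoid RG)"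
        using subgroup_vimage[OF RG.a_group RG.a_group smult_hom[OF rc] sub[of "i + j"]] by simp
      ultimately have "?F j \<subseteq> {y \<in> carrier RG. r \<odot>\<^bsub>RG\<^esub> y \<in> ?F (i + j)}"
        unfolding F[of j] using gens[of j]
        by (intro RG.add.generate_subgroup_incl) blast+
      then show ?thesis using x by auto
    qed
    show "c \<in> ?F (d (u c))" if c: "c \<in> ?t ` B" for c
    proof -
      obtain b where b: "b \<in> B" "c = ?t b" using c by auto
      have "1 \<in> int_poly_part Y 0" by (auto simp: int_poly_part_iff in_keys_iff lookup_one)
      then show ?thesis unfolding F gen_def b(2) u[OF b(1)]
        using dB[OF b(1)]
        by (intro generate.incl CollectI exI[of _ 1] exI[of _ b] conjI exI[of _ 0] exI[of _ "d b"]) auto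
    qed
    show "size m + d (u c) = k" if x: "x \<in> ?F k" and c: "c \<in> ?t ` B" and m: "m \<in> Poly_Mapping.keys
        (coord (u c) x)" for k x c m
    proof -
      obtain b where b: "b \<in> B" "c = ?t b" using c by auto
      have ch: "coord b \<in> hom (add_monoid RG) (add_monoid (int_poly Y))"
        using coord(1)[OF b(1)] by (auto simp: module_hom_def hom_def)
      interpret h: group_hom "add_monoid RG" "add_monoid (int_poly Y)" "coord b"
        by (rule group_homI[OF RG.a_group int_poly.a_group ch])
      \<comment> \<open>The polynomials of degree \<open>k - d b\<close>. They form a subgroup, so
        its preimage under \<open>coord b\<close> contains the whole degree \<open>k\<close> part
        once it contains the generating tensors.\<close>
      let ?T = "{p \<in> carrier (int_poly Y). \<forall>m \<in> Poly_Mapping.keys p. size m + d b = k}"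
      have T: "subgroup ?T (add_monoid (int_poly Y))"
      proof (rule int_poly.add.subgroupI)
        show "?T \<noteq> {}" by (auto intro!: exI[of _ 0])
      qed (auto dest!: subsetD[OF keys_add])
      have st: "subgroup {y \<in> carrier RG. coord b y \<in> ?T} (add_monoid RG)"
        using subgroup_vimage[OF RG.a_group int_poly.a_group ch T] by simp
      have gt: "coord b y \<in> ?T"
        if yy: "y \<in> gen k" for y
      proof -
        obtain r g i j where y: "y = tensor (int_poly Y) G r g" "r \<in> int_poly_part Y i" "g \<in> GD j"
            "i + j = k"
          using yy unfolding gen_def by blast
        have e: "coord b y = of_int (\<kappa> b g) * r"
          using y coord(2)[OF b(1)] GD by (auto simp: int_poly_part_iff mult.commute)
        have "size m + d b = k" if "m \<in> Poly_Mapping.keys (of_int (\<kappa> b g) * r)" for m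
        proof -
          have "\<kappa> b g \<noteq> 0" using that by auto
          then have "d b = j" using \<kappa>d b y by auto
          have "Poly_Mapping.lookup (of_int (\<kappa> b g) * r) m = \<kappa> b g * Poly_Mapping.lookup r m"
            by (rule lookup_of_int_mult)
          with that have "m \<in> Poly_Mapping.keys r" by (auto simp: in_keys_iff)
          then show ?thesis using y \<open>d b = j\<close> by (auto simp: int_poly_part_iff)
        qed
        then show ?thesis unfolding e using y by (auto simp: int_poly_part_iff)
      qed
      have "gen k \<subseteq> {y \<in> carrier RG. coord b y \<in> ?T}"
      proof (rule subsetI)
        fix y assume y: "y \<in> gen k"
        from subsetD[OF gens y] gt[OF y] show "y \<in> {y \<in> carrier RG. coord b y \<in> ?T}"
          by blast
      qed
      then have "?F k \<subseteq> {y \<in> carrier RG. coord b y \<in> ?T}"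
        unfolding F by (rule RG.add.generate_subgroup_incl[OF _ st])
      then have "coord b x \<in> ?T" using x by blast
      then show ?thesis using m unfolding b(2) u[OF b(1)] by blast
    qed
  qed
  then show ?thesis by blast
qed

end

lemma subgroup_comm_group:
  assumes "comm_group G" "subgroup H G"
  shows "comm_group (G\<lparr>carrier := H\<rparr>)"
proof -
  interpret G: comm_group G by fact
  interpret H: subgroup H G by fact
  show ?thesis
    by (rule group.group_comm_groupI[OF H.subgroup_is_group[OF G.is_group]]) (auto simp: G.m_comm)
qed

text \<open>The endomorphism \<open>?h\<close>, which rebuilds an element from its coordinates,
  fixes the basis and therefore everything; on \<open>w\<close> all its factors are trivial.\<close>

lemma zbasis_zero:
  assumes "comm_group G" "zbasis G B \<kappa>" "w \<in> carrier G" "\<And>b. b \<in> B \<Longrightarrow> \<kappa> b w = 0"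
  shows "w = \<one>\<^bsub>G\<^esub>"
proof -
  interpret G: comm_group G by fact
  have B: "finite B" "B \<subseteq> carrier G" "generate G B = carrier G"
    and k: "\<And>b. b \<in> B \<Longrightarrow> \<kappa> b \<in> hom G integer_group"
    and kb: "\<And>b b'. b \<in> B \<Longrightarrow> b' \<in> B \<Longrightarrow> \<kappa> b b' = (if b = b' then 1 else 0)"
    using assms(2) by (auto simp: zbasis_def)
  let ?h = "\<lambda>x. finprod G (\<lambda>b. b [^]\<^bsub>G\<^esub> \<kappa> b x) B"
  have "?h \<in> hom G G"
  proof (rule homI)
    fix x y assume xy: "x \<in> carrier G" "y \<in> carrier G"
    have "?h (x \<otimes>\<^bsub>G\<^esub> y) = finprod G (\<lambda>b. b [^]\<^bsub>G\<^esub> \<kappa> b x \<otimes>\<^bsub>G\<^esub> b [^]\<^bsub>G\<^esub> \<kappa> b y) B"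
    proof (rule G.finprod_cong')
      fix b assume b: "b \<in> B"
      have "\<kappa> b (x \<otimes>\<^bsub>G\<^esub> y) = \<kappa> b x + \<kappa> b y" using hom_mult[OF k[OF b] xy] by simp
      then show "b [^]\<^bsub>G\<^esub> \<kappa> b (x \<otimes>\<^bsub>G\<^esub> y) = b [^]\<^bsub>G\<^esub> \<kappa> b x \<otimes>\<^bsub>G\<^esub> b [^]\<^bsub>G\<^esub> \<kappa> b y"
        using B b by (auto simp: G.int_pow_mult)
    qed (use B in auto)
    also have "\<dots> = ?h x \<otimes>\<^bsub>G\<^esub> ?h y" using B by (intro G.finprod_multf) auto
    finally show "?h (x \<otimes>\<^bsub>G\<^esub> y) = ?h x \<otimes>\<^bsub>G\<^esub> ?h y" .
  qed (use B in \<open>auto intro!: G.finprod_closed\<close>)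
  moreover have "?h a = a" if "a \<in> B" for a
  proof -
    have "?h a = finprod G (\<lambda>b. if a = b then b else \<one>\<^bsub>G\<^esub>) B"
      using B that kb by (intro G.finprod_cong') auto
    also have "\<dots> = a" using G.finprod_singleton[of a B "\<lambda>b. b"] that B by auto
    finally show ?thesis .
  qed
  ultimately have "?h w = w"
    using hom_eq_on_generate[OF G.is_group G.is_group, of ?h "\<lambda>x. x" B w] B assms(3) by (auto simp: hom_def)
  moreover have "?h w = \<one>\<^bsub>G\<^esub>" using assms(4) B by (intro G.finprod_one_eqI) auto
  ultimately show ?thesis by simp
qed

text \<open>Subgroups of a free abelian group of finite rank are free. Instead of embedding the group,
  we only use finitely many homomorphisms to \<open>\<int>\<close> that separate its elements, which makes the
  induction step split off an element on which one of them takes its least positive value.\<close>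

lemma zbasis_separated:
  assumes "finite K" "comm_group H" "K \<subseteq> hom H integer_group"
    "\<And>x. x \<in> carrier H \<Longrightarrow> (\<And>k. k \<in> K \<Longrightarrow> k x = 0) \<Longrightarrow> x = \<one>\<^bsub>H\<^esub>"
  shows "\<exists>B \<kappa>. zbasis H B \<kappa>"
  using assms
proof (induction K arbitrary: H rule: finite_induct)
  case empty
  interpret H: comm_group H by fact
  have "carrier H = {\<one>\<^bsub>H\<^esub>}" using empty(3) by blast
  then have "zbasis H {} (\<lambda>_ _. 0)" by (simp add: zbasis_def H.generate_empty)
  then show ?case by blast
next
  case (insert k K)
  interpret H: comm_group H by fact
  have kh: "k \<in> hom H integer_group" using insert by auto
  interpret k: group_hom H integer_group k by (rule group_homI[OF H.is_group group_integer_group kh])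
  have km: "k (x \<otimes>\<^bsub>H\<^esub> y) = k x + k y" if "x \<in> carrier H" "y \<in> carrier H" for x y
    using k.hom_mult[OF that] by simp
  have ki: "k (inv\<^bsub>H\<^esub> x) = - k x" if "x \<in> carrier H" for x using k.hom_inv[OF that] by simp
  have kp: "k (x [^]\<^bsub>H\<^esub> (n::int)) = n * k x" if "x \<in> carrier H" for x n using k.hom_int_pow[OF that,
      of n] by simp
  show ?case
  proof (cases "\<forall>x \<in> carrier H. k x = 0")
    case True
    show ?thesis
    proof (rule insert.IH[OF insert.prems(1)])
      show "K \<subseteq> hom H integer_group" using insert.prems(2) by auto
      show "x = \<one>\<^bsub>H\<^esub>" if "x \<in> carrier H" "\<And>k. k \<in> K \<Longrightarrow> k x = 0" for x
        using insert.prems(3)[OF that(1)] that True by auto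
    qed
  next
    case False
    then obtain x0 where "x0 \<in> carrier H" "k x0 \<noteq> 0" by auto
    then have "\<exists>n x. x \<in> carrier H \<and> 0 < n \<and> k x = int n"
    proof (cases "k x0 > 0")
      case True
      then show ?thesis using \<open>x0 \<in> carrier H\<close> by (intro exI[of _ "nat (k x0)"] exI[of _ x0]) auto
    next
      case False
      then show ?thesis using \<open>x0 \<in> carrier H\<close> \<open>k x0 \<noteq> 0\<close> ki
        by (intro exI[of _ "nat (- k x0)"] exI[of _ "inv\<^bsub>H\<^esub> x0"]) auto
    qed
    then obtain m where m: "\<exists>x. x \<in> carrier H \<and> 0 < m \<and> k x = int m"
      and m_least: "\<And>n. n < m \<Longrightarrow> \<not> (\<exists>x. x \<in> carrier H \<and> 0 < n \<and> k x = int n)"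
      using exists_least_iff[of "\<lambda>n. \<exists>x. x \<in> carrier H \<and> 0 < n \<and> k x = int n"] by blast
    then obtain h where h: "h \<in> carrier H" "0 < m" "k h = int m" by blast
    \<comment> \<open>Division with remainder by the least positive value \<open>m\<close> of
      \<open>k\<close>. After removing the multiple of \<open>h\<close>, the value
      \<open>k (p x)\<close> is a remainder below \<open>m\<close> and hence zero. So
      \<open>q\<close> is a homomorphism and \<open>p\<close> is the projection onto the kernel of
      \<open>k\<close> along \<open>h\<close>.\<close>
    define q where "q x = k x div int m" for x
    define p where "p x = x \<otimes>\<^bsub>H\<^esub> inv\<^bsub>H\<^esub> (h [^]\<^bsub>H\<^esub> q x)" for x
    have pc: "p x \<in> carrier H" if "x \<in> carrier H" for x using that h by (simp add: p_def)
    have kpx: "k (p x) = 0" if x: "x \<in> carrier H" for x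
    proof -
      have e: "k (p x) = k x mod int m"
        using x h by (simp add: p_def q_def km ki kp minus_div_mult_eq_mod)
      then have "k (p x) \<ge> 0" "k (p x) < int m" using h by auto
      then have "nat (k (p x)) < m" using h by auto
      then show ?thesis using m_least[of "nat (k (p x))"] pc[OF x] \<open>k (p x) \<ge> 0\<close> by force
    qed
    have dvd: "k x = q x * int m" if "x \<in> carrier H" for x
    proof -
      have "k (p x) = k x mod int m"
        using that h by (simp add: p_def q_def km ki kp minus_div_mult_eq_mod)
      then show ?thesis using kpx[OF that] unfolding q_def by (simp add: mod_eq_0_iff_dvd)
    qed
    have qm: "q (x \<otimes>\<^bsub>H\<^esub> y) = q x + q y" if "x \<in> carrier H" "y \<in> carrier H" for x y
    proof -
      have "q (x \<otimes>\<^bsub>H\<^esub> y) * int m = (q x + q y) * int m"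
        using dvd[of x] dvd[of y] dvd[of "x \<otimes>\<^bsub>H\<^esub> y"] km that by (simp add: algebra_simps)
      then show ?thesis using h by simp
    qed
    define N where "N = {x \<in> carrier H. k x = 0}"
    have N: "subgroup N H" unfolding N_def
      by (rule H.subgroupI) (auto simp: km ki intro!: exI[of _ "\<one>\<^bsub>H\<^esub>"])
    have "comm_group (H\<lparr>carrier := N\<rparr>)" by (rule subgroup_comm_group[OF insert.prems(1) N])
    moreover have "K \<subseteq> hom (H\<lparr>carrier := N\<rparr>) integer_group"
      using insert.prems(2) subgroup.subset[OF N] by (auto simp: hom_def subset_iff)
    moreover have "x = \<one>\<^bsub>H\<lparr>carrier := N\<rparr>\<^esub>" if "x \<in> carrier (H\<lparr>carrier := N\<rparr>)" "\<And>k. k \<in> K \<Longrightarrow> k x = 0" for x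
    proof -
      have "x \<in> N" using that(1) by simp
      then have x: "x \<in> carrier H" "k x = 0" unfolding N_def by blast+
      have "k' x = 0" if "k' \<in> insert k K" for k'
        using that(1) x(2) \<open>\<And>k. k \<in> K \<Longrightarrow> k x = 0\<close> by (cases "k' = k") auto
      then have "x = \<one>\<^bsub>H\<^esub>" by (rule insert.prems(3)[OF x(1)])
      then show ?thesis by simp
    qed
    ultimately obtain B \<kappa> where zb: "zbasis (H\<lparr>carrier := N\<rparr>) B \<kappa>" using insert.IH by blast
    then have B: "finite B" "B \<subseteq> N" "generate (H\<lparr>carrier := N\<rparr>) B = N"
      and \<kappa>h: "\<And>b. b \<in> B \<Longrightarrow> \<kappa> b \<in> hom (H\<lparr>carrier := N\<rparr>) integer_group"
      and \<kappa>d: "\<And>b b'. b \<in> B \<Longrightarrow> b' \<in> B \<Longrightarrow> \<kappa> b b' = (if b = b' then 1 else 0)"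
      by (auto simp: zbasis_def)
    have \<kappa>m: "\<kappa> b (x \<otimes>\<^bsub>H\<^esub> y) = \<kappa> b x + \<kappa> b y" if "b \<in> B" "x \<in> N" "y \<in> N" for b x y
      using hom_mult[OF \<kappa>h[OF that(1)], of x y] that by simp
    have \<kappa>1: "\<kappa> b \<one>\<^bsub>H\<^esub> = 0" if "b \<in> B" for b
      using \<kappa>m[OF that, of "\<one>\<^bsub>H\<^esub>" "\<one>\<^bsub>H\<^esub>"] subgroup.one_closed[OF N] by simp
    have BH: "B \<subseteq> carrier H" using B(2) unfolding N_def by blast
    have BN: "k b = 0" if "b \<in> B" for b using B(2) that unfolding N_def by blast
    have hB: "h \<notin> B" using BN h(2,3) by force
    have qB: "q b = 0" if "b \<in> B" for b using BN[OF that] by (simp add: q_def)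
    have qh: "q h = 1" using h by (simp add: q_def)
    have pB: "p b = b" if "b \<in> B" for b using qB[OF that] that BH by (auto simp: p_def)
    have ph: "p h = \<one>\<^bsub>H\<^esub>" using qh h by (simp add: p_def)
    have pN: "p x \<in> N" if "x \<in> carrier H" for x using kpx pc that by (simp add: N_def)
    have pm: "p (x \<otimes>\<^bsub>H\<^esub> y) = p x \<otimes>\<^bsub>H\<^esub> p y" if "x \<in> carrier H" "y \<in> carrier H" for x y
      using that h unfolding p_def by (simp add: qm H.int_pow_mult H.inv_mult H.m_ac)
    \<comment> \<open>The coordinate of \<open>h\<close> is \<open>q\<close>; the coordinates on the
      kernel are extended by composing with the projection \<open>p\<close>.\<close>
    let ?\<mu> = "\<lambda>b x. if b = h then q x else \<kappa> b (p x)"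
    have "zbasis H (insert h B) ?\<mu>"
      unfolding zbasis_def
    proof (intro conjI ballI)
      show "finite (insert h B)" "insert h B \<subseteq> carrier H" using B h BH by auto
      show "generate H (insert h B) = carrier H"
      proof
        show "generate H (insert h B) \<subseteq> carrier H"
          using H.generate_in_carrier[of "insert h B"] h BH by blast
        show "carrier H \<subseteq> generate H (insert h B)"
        proof
          fix x assume x: "x \<in> carrier H"
          have sub: "subgroup (generate H (insert h B)) H"
            using h BH by (intro H.generate_is_subgroup) auto
          have "p x \<in> generate H B" using pN[OF x] B(3) H.generate_consistent[OF B(2) N] by simp
          then have "p x \<in> generate H (insert h B)" using H.mono_generate[of B "insert h B"] by blast
          moreover have "h [^]\<^bsub>H\<^esub> q x \<in> generate H (insert h B)"
            by (intro H.subgroup_int_pow_closed[OF sub] generate.incl) simp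
          ultimately have "p x \<otimes>\<^bsub>H\<^esub> h [^]\<^bsub>H\<^esub> q x \<in> generate H (insert h B)" by (rule generate.eng)
          moreover have "p x \<otimes>\<^bsub>H\<^esub> h [^]\<^bsub>H\<^esub> q x = x" using x h by (simp add: p_def H.m_assoc)
          ultimately show "x \<in> generate H (insert h B)" by simp
        qed
      qed
      fix b assume b: "b \<in> insert h B"
      show "?\<mu> b \<in> hom H integer_group"
        using b by (auto simp: hom_def qm pm \<kappa>m pN)
      fix b' assume "b' \<in> insert h B"
      then show "?\<mu> b b' = (if b = b' then 1 else 0)"
        using b hB by (auto simp: qB qh pB ph \<kappa>1 \<kappa>d)
    qed
    then show ?thesis by blast
  qed
qed

text \<open>A basis element of the product is recognised by the image in which it lies, and its
  functional reads only the corresponding component.\<close>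

lemma zbasis_DirProd:
  assumes G: "comm_group G" "zbasis G B \<kappa>" and H: "comm_group H" "zbasis H C \<nu>"
  defines "i \<equiv> \<lambda>b. (b, \<one>\<^bsub>H\<^esub>)" and "j \<equiv> \<lambda>c. (\<one>\<^bsub>G\<^esub>, c)"
  shows "zbasis (G \<times>\<times> H) (i ` B \<union> j ` C) (\<lambda>z w. if z \<in> i ` B then \<kappa> (fst z) (fst w) else \<nu> (snd z) (snd w))"
proof -
  interpret G: comm_group G by fact
  interpret H: comm_group H by fact
  interpret GH: group "G \<times>\<times> H" by (rule DirProd_group) unfold_locales
  have B: "finite B" "B \<subseteq> carrier G" "generate G B = carrier G" "\<And>b. b \<in> B \<Longrightarrow> \<kappa> b \<in> hom G integer_group"
    "\<And>b b'. b \<in> B \<Longrightarrow> b' \<in> B \<Longrightarrow> \<kappa> b b' = (if b = b' then 1 else 0)" using G(2) by (auto simp: zbasis_def)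
  have C: "finite C" "C \<subseteq> carrier H" "generate H C = carrier H" "\<And>b. b \<in> C \<Longrightarrow> \<nu> b \<in> hom H integer_group"
    "\<And>b b'. b \<in> C \<Longrightarrow> b' \<in> C \<Longrightarrow> \<nu> b b' = (if b = b' then 1 else 0)" using H(2) by (auto simp: zbasis_def)
  have k1: "\<kappa> b \<one>\<^bsub>G\<^esub> = 0" if "b \<in> B" for b
    using hom_one[OF B(4)[OF that]] G.is_group by simp
  have n1: "\<nu> b \<one>\<^bsub>H\<^esub> = 0" if "b \<in> C" for b
    using hom_one[OF C(4)[OF that]] H.is_group by simp
  \<comment> \<open>The two images could meet only in the pair of neutral elements, and a neutral
    element cannot be a basis element because functionals vanish on it.\<close>
  have nB: "\<one>\<^bsub>G\<^esub> \<notin> B" using k1 B(5) by force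
  have hi: "i \<in> hom G (G \<times>\<times> H)" and hj: "j \<in> hom H (G \<times>\<times> H)"
    unfolding i_def j_def by (auto simp: hom_def)
  interpret i: group_hom G "G \<times>\<times> H" i by (rule group_homI) (unfold_locales, rule hi)
  interpret j: group_hom H "G \<times>\<times> H" j by (rule group_homI) (unfold_locales, rule hj)
  show ?thesis
    unfolding zbasis_def
  proof (intro conjI ballI)
    show "finite (i ` B \<union> j ` C)" using B C by auto
    show sub: "i ` B \<union> j ` C \<subseteq> carrier (G \<times>\<times> H)" using B C by (auto simp: i_def j_def)
    show "generate (G \<times>\<times> H) (i ` B \<union> j ` C) = carrier (G \<times>\<times> H)"
    proof
      show "generate (G \<times>\<times> H) (i ` B \<union> j ` C) \<subseteq> carrier (G \<times>\<times> H)"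
        using GH.generate_in_carrier[OF sub] by blast
      show "carrier (G \<times>\<times> H) \<subseteq> generate (G \<times>\<times> H) (i ` B \<union> j ` C)"
      proof
        fix z assume "z \<in> carrier (G \<times>\<times> H)"
        then obtain g h where z: "z = (g, h)" "g \<in> carrier G" "h \<in> carrier H" by auto
        have "i g \<in> generate (G \<times>\<times> H) (i ` B)" using i.generate_img[OF B(2)] B(3) z by auto
        then have 1: "i g \<in> generate (G \<times>\<times> H) (i ` B \<union> j ` C)"
          using GH.mono_generate[of "i ` B" "i ` B \<union> j ` C"] by auto
        have "j h \<in> generate (G \<times>\<times> H) (j ` C)" using j.generate_img[OF C(2)] C(3) z by auto
        then have 2: "j h \<in> generate (G \<times>\<times> H) (i ` B \<union> j ` C)"
          using GH.mono_generate[of "j ` C" "i ` B \<union> j ` C"] by auto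
        have "i g \<otimes>\<^bsub>G \<times>\<times> H\<^esub> j h = z" using z by (simp add: i_def j_def)
        then show "z \<in> generate (G \<times>\<times> H) (i ` B \<union> j ` C)" using generate.eng[OF 1 2] by simp
      qed
    qed
    fix z assume z: "z \<in> i ` B \<union> j ` C"
    show "(\<lambda>w. if z \<in> i ` B then \<kappa> (fst z) (fst w) else \<nu> (snd z) (snd w)) \<in> hom (G \<times>\<times> H) integer_group"
    proof (cases "z \<in> i ` B")
      case True
      then show ?thesis using B(4)[of "fst z"] by (auto simp: hom_def i_def mult_DirProd')
    next
      case False
      then show ?thesis using z C(4)[of "snd z"] by (auto simp: hom_def j_def mult_DirProd')
    qed
    fix w assume w: "w \<in> i ` B \<union> j ` C"
    show "(if z \<in> i ` B then \<kappa> (fst z) (fst w) else \<nu> (snd z) (snd w)) = (if z = w then 1 else 0)"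
      using z w nB by (auto simp: i_def j_def B(5) C(5) k1 n1 split: if_splits)
  qed
qed

section \<open>Non-associative rings and their quotients\<close>

text \<open>Common ground for the free non-associative ring, the tensor algebra and Lie rings, so
  that quotients by two-sided ideals are treated once for all of them.\<close>

locale nonassoc_ring = abelian_group L for L (structure) +
  assumes prod_closed [simp, intro]: "x \<in> carrier L \<Longrightarrow> y \<in> carrier L \<Longrightarrow> x \<otimes> y \<in> carrier L"
    and prod_l_distr: "x \<in> carrier L \<Longrightarrow> y \<in> carrier L \<Longrightarrow> z \<in> carrier L \<Longrightarrow> (x \<oplus> y) \<otimes> z = x \<otimes> z \<oplus> y \<otimes> z"
    and prod_r_distr: "x \<in> carrier L \<Longrightarrow> y \<in> carrier L \<Longrightarrow> z \<in> carrier L \<Longrightarrow> z \<otimes> (x \<oplus> y) = z \<otimes> x \<oplus> z \<otimes> y"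
begin

lemma prod_hom_right: "x \<in> carrier L \<Longrightarrow> (\<lambda>y. x \<otimes> y) \<in> hom (add_monoid L) (add_monoid L)"
  by (rule homI) (auto simp: prod_r_distr)

lemma prod_hom_left: "x \<in> carrier L \<Longrightarrow> (\<lambda>y. y \<otimes> x) \<in> hom (add_monoid L) (add_monoid L)"
  by (rule homI) (auto simp: prod_l_distr)

lemma prod_zero [simp]: "x \<in> carrier L \<Longrightarrow> x \<otimes> \<zero> = \<zero>" "x \<in> carrier L \<Longrightarrow> \<zero> \<otimes> x = \<zero>"
  using hom_zero[OF abelian_group_axioms abelian_group_axioms prod_hom_right]
    hom_zero[OF abelian_group_axioms abelian_group_axioms prod_hom_left] by auto

lemma prod_minus:
  "x \<in> carrier L \<Longrightarrow> y \<in> carrier L \<Longrightarrow> x \<otimes> (\<ominus> y) = \<ominus> (x \<otimes> y)"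
  "x \<in> carrier L \<Longrightarrow> y \<in> carrier L \<Longrightarrow> (\<ominus> x) \<otimes> y = \<ominus> (x \<otimes> y)"
  using hom_a_inv[OF abelian_group_axioms abelian_group_axioms prod_hom_right]
    hom_a_inv[OF abelian_group_axioms abelian_group_axioms prod_hom_left] by auto

lemma bracket_ideal_carrier: "bracket_ideal L (carrier L)"
  using add.subgroup_self by (auto simp: bracket_ideal_def)

lemma bracket_ideal_gen_ideal:
  assumes "A \<subseteq> carrier L"
  shows "bracket_ideal L (bracket_ideal_gen L A)"
proof -
  have ne: "carrier L \<in> {I. bracket_ideal L I \<and> A \<subseteq> I}" using assms bracket_ideal_carrier by auto
  have "subgroup (\<Inter>{I. bracket_ideal L I \<and> A \<subseteq> I}) (add_monoid L)"
    using ne by (intro add.subgroups_Inter) (auto simp: bracket_ideal_def)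
  then show ?thesis unfolding bracket_ideal_gen_def by (auto simp: bracket_ideal_def)
qed

lemma bracket_ideal_gen_minimal: "bracket_ideal L I \<Longrightarrow> A \<subseteq> I \<Longrightarrow> bracket_ideal_gen L A \<subseteq> I"
  unfolding bracket_ideal_gen_def by auto

lemma bracket_ideal_gen_incl: "A \<subseteq> bracket_ideal_gen L A"
  unfolding bracket_ideal_gen_def by auto

end

locale nonassoc_quot = nonassoc_ring L for L (structure) +
  fixes I assumes I: "bracket_ideal L I"
begin

abbreviation Q where "Q \<equiv> L Quot I"

lemma I_sub: "subgroup I (add_monoid L)" using I by (simp add: bracket_ideal_def)

lemma I_carrier: "x \<in> I \<Longrightarrow> x \<in> carrier L" using subgroup.subset[OF I_sub] by auto

sublocale I: additive_subgroup I L by (rule additive_subgroupI[OF I_sub])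

lemma I_prod: "x \<in> carrier L \<Longrightarrow> a \<in> I \<Longrightarrow> x \<otimes> a \<in> I" "x \<in> carrier L \<Longrightarrow> a \<in> I \<Longrightarrow> a \<otimes> x \<in> I"
  using I by (auto simp: bracket_ideal_def)

sublocale AS: abelian_subgroup I L
  by (rule abelian_subgroupI3) unfold_locales

lemma carrier_Q: "carrier Q = (\<lambda>x. I +> x) ` carrier L"
  by (auto simp: FactRing_def A_RCOSETS_def')

lemma zero_Q: "\<zero>\<^bsub>Q\<^esub> = I" by (simp add: FactRing_def)

lemma add_Q: "x \<in> carrier L \<Longrightarrow> y \<in> carrier L \<Longrightarrow> (I +> x) \<oplus>\<^bsub>Q\<^esub> (I +> y) = I +> (x \<oplus> y)"
  by (simp add: FactRing_def AS.a_rcos_sum)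

lemma rcos_eq_iff:
  assumes "x \<in> carrier L" "y \<in> carrier L"
  shows "I +> x = I +> y \<longleftrightarrow> x \<ominus> y \<in> I"
proof -
  have "I +> x = I +> y \<longleftrightarrow> x \<in> I +> y"
    using a_repr_independence[OF _ assms(2) I_sub] AS.a_rcos_self[OF assms(1)] by blast
  then show ?thesis using AS.a_rcos_module[OF assms(2,1)] by (simp add: a_minus_def)
qed

lemma rcos_I_iff: "x \<in> carrier L \<Longrightarrow> I +> x = I \<longleftrightarrow> x \<in> I"
  using a_coset_join1[OF _ _ I_sub] a_coset_join2[OF _ I_sub] by blast

lemma rcos_closed [simp, intro]: "x \<in> carrier L \<Longrightarrow> I +> x \<in> carrier Q"
  by (auto simp: carrier_Q)

text \<open>The product of cosets is a union over representatives. It is a single coset since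
  \<open>(h \<oplus> x) \<otimes> (k \<oplus> y)\<close> differs from \<open>x \<otimes> y\<close>
  by \<open>h \<otimes> (k \<oplus> y) \<oplus> x \<otimes> k\<close>, which lies in the two-sided
  ideal.\<close>

lemma mult_Q:
  assumes "x \<in> carrier L" "y \<in> carrier L"
  shows "(I +> x) \<otimes>\<^bsub>Q\<^esub> (I +> y) = I +> (x \<otimes> y)"
proof -
  have "I +> (a \<otimes> b) = I +> (x \<otimes> y)" if ab: "a \<in> I +> x" "b \<in> I +> y" for a b
  proof -
    obtain h where h: "h \<in> I" "a = h \<oplus> x" using ab(1) by (auto simp: a_r_coset_def')
    obtain k where k: "k \<in> I" "b = k \<oplus> y" using ab(2) by (auto simp: a_r_coset_def')
    have hk: "h \<in> carrier L" "k \<in> carrier L" using h k I_carrier by auto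
    have "a \<otimes> b = (h \<otimes> (k \<oplus> y) \<oplus> x \<otimes> k) \<oplus> x \<otimes> y"
      using h k hk assms by (simp add: prod_l_distr prod_r_distr a_ac)
    moreover have "h \<otimes> (k \<oplus> y) \<oplus> x \<otimes> k \<in> I" using h k hk assms I_prod by auto
    ultimately have "a \<otimes> b \<in> I +> (x \<otimes> y)" by (auto simp: a_r_coset_def')
    then show ?thesis using a_repr_independence[OF _ _ I_sub] assms by blast
  qed
  moreover have "x \<in> I +> x" "y \<in> I +> y" using assms AS.a_rcos_self by auto
  ultimately have "(\<Union>a\<in>I +> x. \<Union>b\<in>I +> y. I +> (a \<otimes> b)) = I +> (x \<otimes> y)" by blast
  then show ?thesis by (simp add: FactRing_def rcoset_mult_def)
qed

lemma abelian_group_Q: "abelian_group Q"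
proof (rule abelian_groupI)
  fix x assume "x \<in> carrier Q"
  then obtain a where a: "a \<in> carrier L" "x = I +> a" by (auto simp: carrier_Q)
  then have "(I +> \<ominus> a) \<oplus>\<^bsub>Q\<^esub> x = \<zero>\<^bsub>Q\<^esub>"
    by (simp add: add_Q l_neg zero_Q rcos_I_iff)
  then show "\<exists>y \<in> carrier Q. y \<oplus>\<^bsub>Q\<^esub> x = \<zero>\<^bsub>Q\<^esub>" using a by blast
next
  have z: "\<zero>\<^bsub>Q\<^esub> = I +> \<zero>" using rcos_I_iff[of \<zero>] zero_Q by simp
  show "\<zero>\<^bsub>Q\<^esub> \<in> carrier Q" unfolding z by simp
  fix x assume "x \<in> carrier Q"
  then obtain a where a: "a \<in> carrier L" "x = I +> a" by (auto simp: carrier_Q)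
  then show "\<zero>\<^bsub>Q\<^esub> \<oplus>\<^bsub>Q\<^esub> x = x" unfolding z by (simp add: add_Q)
next
  fix x y assume "x \<in> carrier Q" "y \<in> carrier Q"
  then obtain a b where "a \<in> carrier L" "x = I +> a" "b \<in> carrier L" "y = I +> b" by (auto simp: carrier_Q)
  then show "x \<oplus>\<^bsub>Q\<^esub> y \<in> carrier Q" "x \<oplus>\<^bsub>Q\<^esub> y = y \<oplus>\<^bsub>Q\<^esub> x"
    using a_comm[of a b] by (auto simp add: add_Q)
next
  fix x y z assume "x \<in> carrier Q" "y \<in> carrier Q" "z \<in> carrier Q"
  then obtain a b c where "a \<in> carrier L" "x = I +> a" "b \<in> carrier L" "y = I +> b" "c \<in> carrier L"
      "z = I +> c"
    by (auto simp: carrier_Q)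
  then show "(x \<oplus>\<^bsub>Q\<^esub> y) \<oplus>\<^bsub>Q\<^esub> z = x \<oplus>\<^bsub>Q\<^esub> (y \<oplus>\<^bsub>Q\<^esub> z)"
    by (simp add: add_Q a_assoc)
qed

lemma nonassoc_ring_Q: "nonassoc_ring Q"
proof (intro nonassoc_ring.intro nonassoc_ring_axioms.intro abelian_group_Q)
  fix x y assume "x \<in> carrier Q" "y \<in> carrier Q"
  then obtain a b where "a \<in> carrier L" "x = I +> a" "b \<in> carrier L" "y = I +> b" by (auto simp: carrier_Q)
  then show "x \<otimes>\<^bsub>Q\<^esub> y \<in> carrier Q" by (simp add: mult_Q)
next
  fix x y z assume "x \<in> carrier Q" "y \<in> carrier Q" "z \<in> carrier Q"
  then obtain a b c where abc: "a \<in> carrier L" "x = I +> a" "b \<in> carrier L" "y = I +> b" "c \<in>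
      carrier L" "z = I +> c"
    by (auto simp: carrier_Q)
  show "(x \<oplus>\<^bsub>Q\<^esub> y) \<otimes>\<^bsub>Q\<^esub> z = x \<otimes>\<^bsub>Q\<^esub> z \<oplus>\<^bsub>Q\<^esub> y \<otimes>\<^bsub>Q\<^esub> z"
    using abc by (simp add: add_Q mult_Q prod_l_distr)
  show "z \<otimes>\<^bsub>Q\<^esub> (x \<oplus>\<^bsub>Q\<^esub> y) = z \<otimes>\<^bsub>Q\<^esub> x \<oplus>\<^bsub>Q\<^esub> z \<otimes>\<^bsub>Q\<^esub> y"
    using abc by (simp add: add_Q mult_Q prod_r_distr)
qed

lemma rcos_hom: "(\<lambda>x. I +> x) \<in> hom (add_monoid L) (add_monoid Q)"
  by (rule homI) (auto simp: add_Q)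

lemma rcos_minus: "x \<in> carrier L \<Longrightarrow> I +> (\<ominus> x) = \<ominus>\<^bsub>Q\<^esub> (I +> x)"
  by (rule hom_a_inv[OF abelian_group_axioms abelian_group_Q rcos_hom])

lemma rcos_diff: "x \<in> carrier L \<Longrightarrow> y \<in> carrier L \<Longrightarrow> I +> (x \<ominus> y) = (I +> x) \<ominus>\<^bsub>Q\<^esub> (I +> y)"
  by (rule hom_a_minus[OF abelian_group_axioms abelian_group_Q rcos_hom])

text \<open>Images of ideals are ideals because the projection is onto. This transports the kernel
  of the model from the free non-associative ring to the free Lie ring.\<close>

lemma bracket_ideal_image:
  assumes K: "bracket_ideal L K"
  shows "bracket_ideal Q ((\<lambda>x. I +> x) ` K)"
proof -
  interpret h: group_hom "add_monoid L" "add_monoid Q" "\<lambda>x. I +> x"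
    by (rule group_homI[OF a_group abelian_group.a_group[OF abelian_group_Q] rcos_hom])
  have Ks: "subgroup K (add_monoid L)" using K by (simp add: bracket_ideal_def)
  have Kc: "x \<in> carrier L" if "x \<in> K" for x using subgroup.subset[OF Ks] that by auto
  show ?thesis
    unfolding bracket_ideal_def
  proof (intro conjI ballI)
    show "subgroup ((\<lambda>x. I +> x) ` K) (add_monoid Q)" by (rule h.subgroup_img_is_subgroup[OF Ks])
    fix x a assume "x \<in> carrier Q" "a \<in> (\<lambda>x. I +> x) ` K"
    then obtain y k where y: "y \<in> carrier L" "x = I +> y" "k \<in> K" "a = I +> k" by (auto simp: carrier_Q)
    then have "y \<otimes> k \<in> K" "k \<otimes> y \<in> K" using K by (auto simp: bracket_ideal_def)
    then show "x \<otimes>\<^bsub>Q\<^esub> a \<in> (\<lambda>x. I +> x) ` K" "a \<otimes>\<^bsub>Q\<^esub> x \<in> (\<lambda>x. I +> x) ` K"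
      using y Kc by (auto simp: mult_Q)
  qed
qed

end

section \<open>Lie rings\<close>

locale lie_ring = nonassoc_ring +
  assumes alt: "x \<in> carrier L \<Longrightarrow> x \<otimes> x = \<zero>"
    and jacobi: "x \<in> carrier L \<Longrightarrow> y \<in> carrier L \<Longrightarrow> z \<in> carrier L \<Longrightarrow>
      x \<otimes> (y \<otimes> z) \<oplus> y \<otimes> (z \<otimes> x) \<oplus> z \<otimes> (x \<otimes> y) = \<zero>"
begin

lemma antisym:
  assumes "x \<in> carrier L" "y \<in> carrier L"
  shows "x \<otimes> y = \<ominus> (y \<otimes> x)"
proof -
  have "(x \<oplus> y) \<otimes> (x \<oplus> y) = \<zero>" using assms alt by simp
  then have "x \<otimes> y \<oplus> y \<otimes> x = \<zero>" using assms by (simp add: prod_l_distr prod_r_distr alt[OF assms(1)]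
      alt[OF assms(2)] a_comm[of "y \<otimes> x"])
  then show ?thesis using assms by (simp add: minus_equality)
qed

text \<open>The Jacobi identity with two terms turned around by \<open>antisym\<close>: bracketing
  with \<open>x\<close> is a derivation. In this form it shows that E'' is an ideal and that adjoint
  actions commute modulo E''.\<close>

lemma leibniz:
  assumes "x \<in> carrier L" "y \<in> carrier L" "z \<in> carrier L"
  shows "x \<otimes> (y \<otimes> z) = (x \<otimes> y) \<otimes> z \<oplus> y \<otimes> (x \<otimes> z)"
proof -
  have 1: "y \<otimes> (z \<otimes> x) = \<ominus> (y \<otimes> (x \<otimes> z))" using assms antisym[of z x] by (simp add: prod_minus)
  have 2: "z \<otimes> (x \<otimes> y) = \<ominus> ((x \<otimes> y) \<otimes> z)" using assms antisym[of z "x \<otimes> y"] by simp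
  have "x \<otimes> (y \<otimes> z) \<oplus> \<ominus> (y \<otimes> (x \<otimes> z)) \<oplus> \<ominus> ((x \<otimes> y) \<otimes> z) = \<zero>"
    using jacobi[OF assms] unfolding 1 2 .
  then have "x \<otimes> (y \<otimes> z) \<ominus> ((x \<otimes> y) \<otimes> z \<oplus> y \<otimes> (x \<otimes> z)) = \<zero>"
    using assms by (simp add: a_minus_def minus_add a_ac)
  then show ?thesis using assms by (subst (asm) minus_eq_zero_iff) auto
qed

lemma derived_subgroup: "H \<subseteq> carrier L \<Longrightarrow> subgroup (derived L H) (add_monoid L)"
  unfolding derived_def by (intro add.generate_is_subgroup) auto

lemma derived_incl: "x \<in> H \<Longrightarrow> y \<in> H \<Longrightarrow> x \<otimes> y \<in> derived L H"
  unfolding derived_def by (auto intro: generate.incl)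

lemma derived_carrier: "H \<subseteq> carrier L \<Longrightarrow> x \<in> derived L H \<Longrightarrow> x \<in> carrier L"
  using subgroup.subset[OF derived_subgroup] by auto

lemma derived_least:
  assumes "H \<subseteq> carrier L" "subgroup K (add_monoid L)" "\<And>x y. x \<in> H \<Longrightarrow> y \<in> H \<Longrightarrow> x \<otimes> y \<in> K"
  shows "derived L H \<subseteq> K"
  unfolding derived_def by (rule add.generate_subgroup_incl) (use assms in auto)

lemma derived1_ideal: "bracket_ideal L (derived1 L)"
  using derived_subgroup[of "carrier L"] derived_incl[of _ "carrier L"] derived_carrier[of "carrier L"]
  by (auto simp: bracket_ideal_def)

text \<open>By \<open>leibniz\<close> a bracket \<open>x \<otimes> (u \<otimes> v)\<close> with
  \<open>u\<close> and \<open>v\<close> in E' splits into two brackets of elements of E', since E'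
  is itself an ideal.\<close>

lemma derived2_ideal: "bracket_ideal L (derived2 L)"
proof -
  have d1: "derived1 L \<subseteq> carrier L" using derived_carrier[of "carrier L"] by auto
  have sub: "subgroup (derived2 L) (add_monoid L)" by (rule derived_subgroup[OF d1])
  have id: "x \<otimes> a \<in> derived1 L" if "x \<in> carrier L" "a \<in> derived1 L" for x a
    using derived1_ideal that by (simp add: bracket_ideal_def)
  have l: "x \<otimes> a \<in> derived2 L" if x: "x \<in> carrier L" and a: "a \<in> derived2 L" for x a
  proof -
    have "derived2 L \<subseteq> {a \<in> carrier (add_monoid L). x \<otimes> a \<in> derived2 L}"
    proof (rule derived_least[OF d1])
      show "subgroup {a \<in> carrier (add_monoid L). x \<otimes> a \<in> derived2 L} (add_monoid L)"
        by (rule subgroup_vimage[OF a_group a_group prod_hom_right[OF x] sub])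
      fix u v assume uv: "u \<in> derived1 L" "v \<in> derived1 L"
      then have c: "u \<in> carrier L" "v \<in> carrier L" using d1 by auto
      have "x \<otimes> (u \<otimes> v) = (x \<otimes> u) \<otimes> v \<oplus> u \<otimes> (x \<otimes> v)" by (rule leibniz[OF x c])
      moreover have "(x \<otimes> u) \<otimes> v \<in> derived2 L" "u \<otimes> (x \<otimes> v) \<in> derived2 L"
        using id[OF x] uv by (auto intro: derived_incl)
      ultimately have "x \<otimes> (u \<otimes> v) \<in> derived2 L" using subgroup.m_closed[OF sub] by simp
      then show "u \<otimes> v \<in> {a \<in> carrier (add_monoid L). x \<otimes> a \<in> derived2 L}" using c by simp
    qed
    then show ?thesis using a by auto
  qed
  have "a \<otimes> x \<in> derived2 L" if x: "x \<in> carrier L" and a: "a \<in> derived2 L" for x a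
  proof -
    have "a \<in> carrier L" using derived_carrier[OF d1 a] .
    then have "a \<otimes> x = \<ominus> (x \<otimes> a)" by (rule antisym[OF _ x])
    then show ?thesis using additive_subgroup.a_inv_closed[OF additive_subgroupI[OF sub]] l[OF x a]
      by (metis a_inv_def sub subgroup.m_inv_closed)
  qed
  with l sub show ?thesis by (auto simp: bracket_ideal_def)
qed

end

lemma lie_ring_Quot:
  assumes "lie_ring L" "bracket_ideal L I"
  shows "lie_ring (L Quot I)"
proof -
  interpret lie_ring L by fact
  interpret nonassoc_quot L I by unfold_locales fact
  show ?thesis
  proof (intro lie_ring.intro nonassoc_ring_Q lie_ring_axioms.intro)
    fix x assume "x \<in> carrier Q"
    then obtain a where "a \<in> carrier L" "x = I +>\<^bsub>L\<^esub> a" by (auto simp: carrier_Q)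
    then show "x \<otimes>\<^bsub>Q\<^esub> x = \<zero>\<^bsub>Q\<^esub>" by (simp add: mult_Q alt zero_Q rcos_I_iff)
  next
    fix x y z assume "x \<in> carrier Q" "y \<in> carrier Q" "z \<in> carrier Q"
    then obtain a b c where abc: "a \<in> carrier L" "x = I +>\<^bsub>L\<^esub> a" "b \<in> carrier L" "y = I +>\<^bsub>L\<^esub> b" "c
        \<in> carrier L" "z = I +>\<^bsub>L\<^esub> c"
      by (auto simp: carrier_Q)
    then show "x \<otimes>\<^bsub>Q\<^esub> (y \<otimes>\<^bsub>Q\<^esub> z) \<oplus>\<^bsub>Q\<^esub> y \<otimes>\<^bsub>Q\<^esub> (z \<otimes>\<^bsub>Q\<^esub> x) \<oplus>\<^bsub>Q\<^esub> z \<otimes>\<^bsub>Q\<^esub> (x \<otimes>\<^bsub>Q\<^esub> y) = \<zero>\<^bsub>Q\<^esub>"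
      using jacobi[of a b c] by (simp add: mult_Q add_Q zero_Q rcos_I_iff)
  qed
qed

section \<open>Bilinear extension\<close>

text \<open>The nested \<open>frag_extend\<close> that defines the products of both the tensor
  algebra and the free non-associative ring; distributivity is thereby proved once.\<close>

definition bilin :: "('a \<Rightarrow> 'b \<Rightarrow> 'c \<Rightarrow>\<^sub>0 int) \<Rightarrow> ('a \<Rightarrow>\<^sub>0 int) \<Rightarrow> ('b \<Rightarrow>\<^sub>0 int) \<Rightarrow> ('c \<Rightarrow>\<^sub>0 int)" where
  "bilin op f g = frag_extend (\<lambda>s. frag_extend (op s) g) f"

lemma frag_extend_fun_diff:
  "frag_extend (\<lambda>x. a x - b x) f = frag_extend a f - frag_extend b f"
  by (induction f rule: frag_induction[OF subset_UNIV]) (auto simp: frag_extend_diff)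

lemma frag_extend_fun_add:
  "frag_extend (\<lambda>x. a x + b x) f = frag_extend a f + frag_extend b f"
  by (induction f rule: frag_induction[OF subset_UNIV]) (auto simp: frag_extend_diff)

lemma frag_extend_fun_0 [simp]: "frag_extend (\<lambda>x. 0) f = 0"
  by (rule frag_extend_eq_0) simp

lemma bilin_simps:
  "bilin op (f + f') g = bilin op f g + bilin op f' g" "bilin op f (g + g') = bilin op f g + bilin op f g'"
  "bilin op (f - f') g = bilin op f g - bilin op f' g" "bilin op f (g - g') = bilin op f g - bilin op f g'"
  "bilin op 0 g = 0" "bilin op f 0 = 0" "bilin op (frag_of a) (frag_of b) = op a b"
  by (simp_all add: bilin_def frag_extend_add frag_extend_diff frag_extend_fun_add frag_extend_fun_diff)

lemma keys_bilin: "Poly_Mapping.keys (bilin op f g) \<subseteq> (\<Union>s \<in> Poly_Mapping.keys f. \<Union>t \<in>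
    Poly_Mapping.keys g. Poly_Mapping.keys (op s t))"
proof
  fix x assume "x \<in> Poly_Mapping.keys (bilin op f g)"
  then obtain s where "s \<in> Poly_Mapping.keys f" "x \<in> Poly_Mapping.keys (frag_extend (op s) g)"
    using subsetD[OF keys_frag_extend, of x "\<lambda>s. frag_extend (op s) g" f] unfolding bilin_def by blast
  moreover from this(2) obtain t where "t \<in> Poly_Mapping.keys g" "x \<in> Poly_Mapping.keys (op s t)"
    using subsetD[OF keys_frag_extend, of x "op s" g] by blast
  ultimately show "x \<in> (\<Union>s \<in> Poly_Mapping.keys f. \<Union>t \<in> Poly_Mapping.keys g. Poly_Mapping.keys (op s
      t))" by auto
qed

section \<open>The free Lie ring\<close>

abbreviation tmul where "tmul \<equiv> bilin (\<lambda>s t. frag_of (Br s t))"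

lemma free_nonassoc_simps [simp]:
  "f \<otimes>\<^bsub>free_nonassoc Y\<^esub> g = tmul f g" "f \<oplus>\<^bsub>free_nonassoc Y\<^esub> g = f + g" "\<zero>\<^bsub>free_nonassoc Y\<^esub> = 0"
  by (simp_all add: free_nonassoc_def bilin_def)

lemma carrier_free_nonassoc: "carrier (free_nonassoc Y) = carrier (free_Abelian_group {t. set_tree t \<subseteq> Y})"
  unfolding free_nonassoc_def free_Abelian_group_def by (simp, blast)

lemma free_nonassoc_iff: "f \<in> carrier (free_nonassoc Y) \<longleftrightarrow> (\<forall>t \<in> Poly_Mapping.keys f. set_tree t \<subseteq> Y)"
  by (simp add: free_nonassoc_def)

lemma nonassoc_ring_free: "nonassoc_ring (free_nonassoc Y)"
proof (intro nonassoc_ring.intro nonassoc_ring_axioms.intro abelian_groupI, simp_all)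
  fix x y assume xy: "x \<in> carrier (free_nonassoc Y)" "y \<in> carrier (free_nonassoc Y)"
  then show "x + y \<in> carrier (free_nonassoc Y)"
    by (auto simp: free_nonassoc_iff dest!: subsetD[OF keys_add])
  show "tmul x y \<in> carrier (free_nonassoc Y)"
    unfolding free_nonassoc_iff
  proof
    fix t assume "t \<in> Poly_Mapping.keys (tmul x y)"
    then obtain a b where "a \<in> Poly_Mapping.keys x" "b \<in> Poly_Mapping.keys y" "t = Br a b"
      by (auto dest!: subsetD[OF keys_bilin])
    then show "set_tree t \<subseteq> Y" using xy by (simp add: free_nonassoc_iff)
  qed
next
  fix x assume "x \<in> carrier (free_nonassoc Y)"
  then show "\<exists>y\<in>carrier (free_nonassoc Y). y + x = 0"
    by (intro bexI[of _ "- x"]) (auto simp: free_nonassoc_iff)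
qed (auto simp: free_nonassoc_iff bilin_simps algebra_simps)

interpretation FN: nonassoc_ring "free_nonassoc Y" for Y by (rule nonassoc_ring_free)

lemma free_nonassoc_inv [simp]: "f \<in> carrier (free_nonassoc Y) \<Longrightarrow> \<ominus>\<^bsub>free_nonassoc Y\<^esub> f = - f"
  by (rule FN.minus_equality) (auto simp: free_nonassoc_iff)

lemma free_nonassoc_minus [simp]: "g \<in> carrier (free_nonassoc Y) \<Longrightarrow> f \<ominus>\<^bsub>free_nonassoc Y\<^esub> g = f - g"
  by (simp add: a_minus_def)

lemma free_nonassoc_closed [intro]:
  "f \<in> carrier (free_nonassoc Y) \<Longrightarrow> g \<in> carrier (free_nonassoc Y) \<Longrightarrow> f + g \<in> carrier (free_nonassoc Y)"
  "f \<in> carrier (free_nonassoc Y) \<Longrightarrow> g \<in> carrier (free_nonassoc Y) \<Longrightarrow> f - g \<in> carrier (free_nonassoc Y)"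
  "f \<in> carrier (free_nonassoc Y) \<Longrightarrow> g \<in> carrier (free_nonassoc Y) \<Longrightarrow> tmul f g \<in> carrier (free_nonassoc Y)"
  "f \<in> carrier (free_nonassoc Y) \<Longrightarrow> - f \<in> carrier (free_nonassoc Y)"
  "0 \<in> carrier (free_nonassoc Y)"
  using FN.a_closed[of f Y g] FN.minus_closed[of f Y g] FN.prod_closed[of f Y g] FN.a_inv_closed[of f Y]
    FN.zero_closed[of Y] by auto

lemma free_nonassoc_induct [consumes 1, case_names zero diff tree]:
  assumes "f \<in> carrier (free_nonassoc Y)" "P 0"
    "\<And>f g. f \<in> carrier (free_nonassoc Y) \<Longrightarrow> g \<in> carrier (free_nonassoc Y) \<Longrightarrow> P f \<Longrightarrow> P g \<Longrightarrow> P (f - g)"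
    "\<And>t. set_tree t \<subseteq> Y \<Longrightarrow> P (frag_of t)"
  shows "P f"
  using assms(1) unfolding carrier_free_nonassoc
  by (induction rule: free_Abelian_induct) (use assms(2-) in \<open>simp_all only: carrier_free_nonassoc
      mem_Collect_eq\<close>)

definition lie_axioms :: "'y set \<Rightarrow> ('y bracket_tree \<Rightarrow>\<^sub>0 int) set" where
  "lie_axioms Y = {tmul f f | f. f \<in> carrier (free_nonassoc Y)} \<union>
     {tmul f (tmul g h) + tmul g (tmul h f) + tmul h (tmul f g) | f g h.
         f \<in> carrier (free_nonassoc Y) \<and> g \<in> carrier (free_nonassoc Y) \<and> h \<in> carrier (free_nonassoc Y)}"

lemma lie_axioms_carrier: "lie_axioms Y \<subseteq> carrier (free_nonassoc Y)"
  unfolding lie_axioms_def by auto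

lemma lie_relations_gen: "lie_relations Y = bracket_ideal_gen (free_nonassoc Y) (lie_axioms Y)"
  by (simp add: lie_relations_def lie_axioms_def)

lemma lie_relations_ideal: "bracket_ideal (free_nonassoc Y) (lie_relations Y)"
  unfolding lie_relations_gen by (rule FN.bracket_ideal_gen_ideal[OF lie_axioms_carrier])

interpretation FL: nonassoc_quot "free_nonassoc Y" "lie_relations Y" for Y
  by unfold_locales (rule lie_relations_ideal)

lemma lie_ring_free_lie: "lie_ring (free_lie Y)"
  unfolding free_lie_def
proof (intro lie_ring.intro FL.nonassoc_ring_Q lie_ring_axioms.intro)
  have inc: "lie_axioms Y \<subseteq> lie_relations Y" unfolding lie_relations_gen by (rule FN.bracket_ideal_gen_incl)
  fix x assume "x \<in> carrier (free_nonassoc Y Quot lie_relations Y)"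
  then obtain f where f: "f \<in> carrier (free_nonassoc Y)" "x = lie_relations Y +>\<^bsub>free_nonassoc Y\<^esub> f"
    by (auto simp: FL.carrier_Q)
  then have "tmul f f \<in> lie_relations Y" using inc unfolding lie_axioms_def by blast
  then show "x \<otimes>\<^bsub>free_nonassoc Y Quot lie_relations Y\<^esub> x = \<zero>\<^bsub>free_nonassoc Y Quot lie_relations Y\<^esub>"
    using f FL.rcos_I_iff[of "tmul f f" Y] by (simp add: FL.mult_Q FL.zero_Q free_nonassoc_closed)
  fix y z assume "y \<in> carrier (free_nonassoc Y Quot lie_relations Y)" "z \<in> carrier (free_nonassoc Y
      Quot lie_relations Y)"
  then obtain g h where g: "g \<in> carrier (free_nonassoc Y)" "y = lie_relations Y +>\<^bsub>free_nonassoc Y\<^esub> g"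
    and h: "h \<in> carrier (free_nonassoc Y)" "z = lie_relations Y +>\<^bsub>free_nonassoc Y\<^esub> h"
    by (auto simp: FL.carrier_Q)
  have "tmul f (tmul g h) + tmul g (tmul h f) + tmul h (tmul f g) \<in> lie_relations Y"
    using inc f g h unfolding lie_axioms_def by blast
  then show "x \<otimes>\<^bsub>free_nonassoc Y Quot lie_relations Y\<^esub> (y \<otimes>\<^bsub>free_nonassoc Y Quot lie_relations Y\<^esub> z)
      \<oplus>\<^bsub>free_nonassoc Y Quot lie_relations Y\<^esub>
    y \<otimes>\<^bsub>free_nonassoc Y Quot lie_relations Y\<^esub> (z \<otimes>\<^bsub>free_nonassoc Y Quot lie_relations Y\<^esub> x)
        \<oplus>\<^bsub>free_nonassoc Y Quot lie_relations Y\<^esub>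
    z \<otimes>\<^bsub>free_nonassoc Y Quot lie_relations Y\<^esub> (x \<otimes>\<^bsub>free_nonassoc Y Quot lie_relations Y\<^esub> y) =
        \<zero>\<^bsub>free_nonassoc Y Quot lie_relations Y\<^esub>"
    using f g h FL.rcos_I_iff[of "tmul f (tmul g h) + tmul g (tmul h f) + tmul h (tmul f g)" Y]
    by (simp add: FL.mult_Q FL.add_Q FL.zero_Q free_nonassoc_closed)
qed

section \<open>The exterior algebra\<close>

abbreviation cmul where "cmul \<equiv> bilin (\<lambda>u v. frag_of (u @ v))"

lemma tensor_algebra_simps [simp]:
  "f \<otimes>\<^bsub>tensor_algebra Y\<^esub> g = cmul f g" "f \<oplus>\<^bsub>tensor_algebra Y\<^esub> g = f + g"
  "\<zero>\<^bsub>tensor_algebra Y\<^esub> = 0" "\<one>\<^bsub>tensor_algebra Y\<^esub> = frag_of []"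
  by (simp_all add: tensor_algebra_def bilin_def)

lemma carrier_tensor_algebra: "carrier (tensor_algebra Y) = carrier (free_Abelian_group (lists Y))"
  by (simp add: tensor_algebra_def free_Abelian_group_def)

lemma tensor_algebra_iff: "f \<in> carrier (tensor_algebra Y) \<longleftrightarrow> Poly_Mapping.keys f \<subseteq> lists Y"
  by (simp add: tensor_algebra_def)

lemma cmul_assoc: "cmul (cmul f g) h = cmul f (cmul g h)"
proof (induction f rule: frag_induction[OF subset_UNIV])
  case (2 u)
  show ?case
  proof (induction g rule: frag_induction[OF subset_UNIV])
    case (2 v)
    show ?case
      by (induction h rule: frag_induction[OF subset_UNIV]) (simp_all add: bilin_simps)
  qed (simp_all add: bilin_simps)
qed (simp_all add: bilin_simps)

lemma cmul_Nil: "cmul (frag_of []) f = f" "cmul f (frag_of []) = f"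
  by (induction f rule: frag_induction[OF subset_UNIV]) (simp_all add: bilin_simps)

lemma cmul_closed: "f \<in> carrier (tensor_algebra Y) \<Longrightarrow> g \<in> carrier (tensor_algebra Y) \<Longrightarrow> cmul f g \<in>
    carrier (tensor_algebra Y)"
  unfolding tensor_algebra_iff
proof
  fix w assume fg: "Poly_Mapping.keys f \<subseteq> lists Y" "Poly_Mapping.keys g \<subseteq> lists Y"
    and "w \<in> Poly_Mapping.keys (cmul f g)"
  then obtain a b where "a \<in> Poly_Mapping.keys f" "b \<in> Poly_Mapping.keys g" "w = a @ b"
    by (auto dest!: subsetD[OF keys_bilin])
  then show "w \<in> lists Y" using fg by auto
qed

lemma ring_tensor_algebra: "ring (tensor_algebra Y)"
proof (rule ringI)
  show "abelian_group (tensor_algebra Y)"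
  proof (rule abelian_groupI, simp_all)
    fix x y assume "x \<in> carrier (tensor_algebra Y)" "y \<in> carrier (tensor_algebra Y)"
    then show "x + y \<in> carrier (tensor_algebra Y)"
      unfolding tensor_algebra_iff using keys_add[of x y] by blast
  next
    fix x assume "x \<in> carrier (tensor_algebra Y)"
    then show "\<exists>y\<in>carrier (tensor_algebra Y). y + x = 0"
      by (intro bexI[of _ "- x"]) (auto simp: tensor_algebra_iff)
  qed (auto simp: tensor_algebra_iff algebra_simps)
  show "Group.monoid (tensor_algebra Y)"
    by (rule monoidI) (auto simp: cmul_closed cmul_assoc cmul_Nil tensor_algebra_iff[of "frag_of []"])
qed (simp_all add: bilin_simps)

interpretation TA: ring "tensor_algebra Y" for Y by (rule ring_tensor_algebra)

lemma tensor_inv [simp]: "f \<in> carrier (tensor_algebra Y) \<Longrightarrow> \<ominus>\<^bsub>tensor_algebra Y\<^esub> f = - f"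
  by (rule TA.minus_equality) (auto simp: tensor_algebra_iff)

lemma nonassoc_ring_tensor: "nonassoc_ring (tensor_algebra Y)"
  by (intro nonassoc_ring.intro TA.abelian_group_axioms nonassoc_ring_axioms.intro)
    (simp_all add: bilin_simps cmul_closed)

lemma exterior_ideal_ideal: "ideal (exterior_ideal Y) (tensor_algebra Y)"
  unfolding exterior_ideal_def
  by (rule TA.genideal_ideal) (auto simp: tensor_part_def cmul_closed)

lemma exterior_bracket_ideal: "bracket_ideal (tensor_algebra Y) (exterior_ideal Y)"
proof -
  interpret ideal "exterior_ideal Y" "tensor_algebra Y" by (rule exterior_ideal_ideal)
  show ?thesis unfolding bracket_ideal_def using a_subgroup I_l_closed I_r_closed by simp
qed

interpretation EX: nonassoc_quot "tensor_algebra Y" "exterior_ideal Y" for Y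
  by (intro nonassoc_quot.intro nonassoc_ring_tensor nonassoc_quot_axioms.intro exterior_bracket_ideal)

definition ext_class :: "'y set \<Rightarrow> 'y list \<Rightarrow> ('y list \<Rightarrow>\<^sub>0 int) set" where
  "ext_class Y w = exterior_ideal Y +>\<^bsub>tensor_algebra Y\<^esub> frag_of w"

lemma frag_of_tensor: "w \<in> lists Y \<Longrightarrow> frag_of w \<in> carrier (tensor_algebra Y)"
  by (simp add: tensor_algebra_iff)

lemma wedge2_class: "x \<in> Y \<Longrightarrow> y \<in> Y \<Longrightarrow> wedge2 Y x y = ext_class Y [x, y]"
  unfolding wedge2_def ext_gen_def exterior_algebra_def ext_class_def
  by (subst EX.mult_Q) (simp_all add: frag_of_tensor bilin_simps)

lemma wedge3_class: "x \<in> Y \<Longrightarrow> y \<in> Y \<Longrightarrow> z \<in> Y \<Longrightarrow> wedge3 Y x y z = ext_class Y [x, y, z]"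
  unfolding wedge3_def wedge2_class unfolding ext_gen_def exterior_algebra_def ext_class_def
  by (subst EX.mult_Q) (simp_all add: frag_of_tensor bilin_simps)

lemma exterior_square: "v \<in> tensor_part Y 1 \<Longrightarrow> cmul v v \<in> exterior_ideal Y"
  unfolding exterior_ideal_def
  using TA.genideal_self[of "{v \<otimes>\<^bsub>tensor_algebra Y\<^esub> v | v. v \<in> tensor_part Y 1}" Y]
  by (force simp: tensor_part_def cmul_closed)

lemma exterior_context:
  assumes "f \<in> exterior_ideal Y" "u \<in> lists Y" "v \<in> lists Y"
  shows "cmul (frag_of u) (cmul f (frag_of v)) \<in> exterior_ideal Y"
proof -
  have "cmul f (frag_of v) \<in> exterior_ideal Y"
    using EX.I_prod(2)[of "frag_of v" Y f] assms by (simp add: frag_of_tensor)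
  then show ?thesis using EX.I_prod(1)[of "frag_of u" Y] assms by (simp add: frag_of_tensor)
qed

lemma frag_of_add_tensor_part: "x \<in> Y \<Longrightarrow> y \<in> Y \<Longrightarrow> frag_of [x] + frag_of [y] \<in> tensor_part Y 1"
  using keys_add[of "frag_of [x]" "frag_of [y]"]
  by (auto simp: tensor_part_def tensor_algebra_iff)

lemma ext_class_repeat:
  assumes "u @ [x, x] @ v \<in> lists Y"
  shows "frag_of (u @ [x, x] @ v) \<in> exterior_ideal Y"
proof -
  have "cmul (frag_of [x]) (frag_of [x]) \<in> exterior_ideal Y"
    using assms by (intro exterior_square) (auto simp: tensor_part_def tensor_algebra_iff)
  then have "cmul (frag_of u) (cmul (frag_of [x, x]) (frag_of v)) \<in> exterior_ideal Y"
    using assms by (intro exterior_context) (auto simp: bilin_simps)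
  then show ?thesis by (simp add: bilin_simps)
qed

text \<open>Polarization: the square of the sum of two letters, placed between \<open>u\<close> and
  \<open>v\<close>, lies in the ideal, and so do its two diagonal terms.\<close>

lemma ext_class_swap:
  assumes "u @ [x, y] @ v \<in> lists Y"
  shows "frag_of (u @ [x, y] @ v) + frag_of (u @ [y, x] @ v) \<in> exterior_ideal Y"
proof -
  have xy: "x \<in> Y" "y \<in> Y" "u \<in> lists Y" "v \<in> lists Y" using assms by auto
  have "cmul (frag_of u) (cmul (cmul (frag_of [x] + frag_of [y]) (frag_of [x] + frag_of [y]))
      (frag_of v)) \<in> exterior_ideal Y"
    using xy by (intro exterior_context exterior_square frag_of_add_tensor_part)
  then have "frag_of (u @ [x, x] @ v) + (frag_of (u @ [x, y] @ v) + frag_of (u @ [y, x] @ v))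
     + frag_of (u @ [y, y] @ v) \<in> exterior_ideal Y" (is "?a + ?b + ?c \<in> _")
    by (simp add: bilin_simps algebra_simps)
  moreover have "?a \<in> exterior_ideal Y" "?c \<in> exterior_ideal Y"
    using xy ext_class_repeat[of u x v Y] ext_class_repeat[of u y v Y] by simp_all
  moreover have "- p \<in> exterior_ideal Y" if "p \<in> exterior_ideal Y" for p
    using EX.I.a_inv_closed[OF that] EX.I_carrier[OF that] by simp
  moreover have "p + q \<in> exterior_ideal Y" if "p \<in> exterior_ideal Y" "q \<in> exterior_ideal Y" for p q
    using EX.I.a_closed[OF that] by simp
  ultimately have "(?a + ?b + ?c) + (- ?a + - ?c) \<in> exterior_ideal Y" by metis
  then show ?thesis by simp
qed

text \<open>Condition \<open>h_swap\<close> is not a consequence of \<open>h_repeat\<close>, since \<open>h\<close> is only defined on words in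
  the letters and not on their linear combinations.\<close>

locale alternating = comm_group A for A (structure) +
  fixes Y :: "'y set" and h :: "'y list \<Rightarrow> 'a"
  assumes h_closed: "\<And>w. w \<in> lists Y \<Longrightarrow> h w \<in> carrier A"
    and h_repeat: "\<And>u x v. u @ [x, x] @ v \<in> lists Y \<Longrightarrow> h (u @ [x, x] @ v) = \<one>"
    and h_swap: "\<And>u x y v. u @ [x, y] @ v \<in> lists Y \<Longrightarrow> h (u @ [x, y] @ v) \<otimes> h (u @ [y, x] @ v) = \<one>"
begin

text \<open>Evaluation by the linear extension of \<open>h\<close> after placing \<open>f\<close>
  between the words \<open>u\<close> and \<open>v\<close>. The exterior ideal is two-sided, so
  vanishing has to be controlled in every such context.\<close>

definition ctx :: "'y list \<Rightarrow> 'y list \<Rightarrow> ('y list \<Rightarrow>\<^sub>0 int) \<Rightarrow> 'a" where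
  "ctx u v f = zlift A h (frag_extend (\<lambda>w. frag_of (u @ w @ v)) f)"

lemma zh: "zlift A h \<in> hom (free_Abelian_group (lists Y)) A"
  by (rule zlift_hom) (auto simp: h_closed)

lemma ctx_hom: "u \<in> lists Y \<Longrightarrow> v \<in> lists Y \<Longrightarrow> ctx u v \<in> hom (free_Abelian_group (lists Y)) A"
proof (rule homI)
  assume uv: "u \<in> lists Y" "v \<in> lists Y"
  have c: "frag_extend (\<lambda>w. frag_of (u @ w @ v)) f \<in> carrier (free_Abelian_group (lists Y))"
    if "f \<in> carrier (free_Abelian_group (lists Y))" for f
    using that uv by (fastforce dest!: subsetD[OF keys_frag_extend])
  fix x assume x: "x \<in> carrier (free_Abelian_group (lists Y))"
  then show "ctx u v x \<in> carrier A" using hom_in_carrier[OF zh c] by (simp add: ctx_def)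
  fix y assume y: "y \<in> carrier (free_Abelian_group (lists Y))"
  show "ctx u v (x \<otimes>\<^bsub>free_Abelian_group (lists Y)\<^esub> y) = ctx u v x \<otimes> ctx u v y"
    using hom_mult[OF zh c[OF x] c[OF y]] by (simp add: ctx_def frag_extend_add)
qed

lemma ctx_closed: "u \<in> lists Y \<Longrightarrow> v \<in> lists Y \<Longrightarrow> f \<in> carrier (tensor_algebra Y) \<Longrightarrow> ctx u v f \<in> carrier A"
  using hom_in_carrier[OF ctx_hom] by (simp add: carrier_tensor_algebra)

lemma ctx_zero: "u \<in> lists Y \<Longrightarrow> v \<in> lists Y \<Longrightarrow> ctx u v 0 = \<one>"
  by (rule hom_free_Abelian_zero[OF is_group ctx_hom])

lemma ctx_add: "u \<in> lists Y \<Longrightarrow> v \<in> lists Y \<Longrightarrow> f \<in> carrier (tensor_algebra Y) \<Longrightarrow> g \<in> carrier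
    (tensor_algebra Y) \<Longrightarrow>
   ctx u v (f + g) = ctx u v f \<otimes> ctx u v g"
  using hom_mult[OF ctx_hom, of u v f g] by (simp add: carrier_tensor_algebra)

lemma ctx_minus: "u \<in> lists Y \<Longrightarrow> v \<in> lists Y \<Longrightarrow> f \<in> carrier (tensor_algebra Y) \<Longrightarrow> ctx u v (- f) = inv
    ctx u v f"
  using group_hom.hom_inv[OF group_homI[OF group_free_Abelian_group is_group ctx_hom], of u v f]
  by (simp add: carrier_tensor_algebra)

lemma tensor_minus_closed: "f \<in> carrier (tensor_algebra Y) \<Longrightarrow> - f \<in> carrier (tensor_algebra Y)"
  by (simp add: tensor_algebra_iff)

lemma ctx_diff: "u \<in> lists Y \<Longrightarrow> v \<in> lists Y \<Longrightarrow> f \<in> carrier (tensor_algebra Y) \<Longrightarrow> g \<in> carrier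
    (tensor_algebra Y) \<Longrightarrow>
   ctx u v (f - g) = ctx u v f \<otimes> inv ctx u v g"
  using ctx_add[of u v f "- g"] by (simp add: ctx_minus tensor_minus_closed)

lemma ctx_frag_of: "u \<in> lists Y \<Longrightarrow> v \<in> lists Y \<Longrightarrow> w \<in> lists Y \<Longrightarrow> ctx u v (frag_of w) = h (u @ w @ v)"
  by (simp add: ctx_def zlift_frag_of h_closed)

lemma ctx_mult: "ctx u v (cmul (frag_of w) f) = ctx (u @ w) v f" "ctx u v (cmul f (frag_of w)) = ctx
    u (w @ v) f"
proof -
  have "frag_extend (\<lambda>w. frag_of (u @ w @ v)) (cmul (frag_of w) f) = frag_extend (\<lambda>x. frag_of ((u @
      w) @ x @ v)) f"
    by (induction f rule: frag_induction[OF subset_UNIV]) (simp_all add: bilin_simps frag_extend_diff)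
  moreover have "frag_extend (\<lambda>w. frag_of (u @ w @ v)) (cmul f (frag_of w)) = frag_extend (\<lambda>x.
      frag_of (u @ x @ w @ v)) f"
    by (induction f rule: frag_induction[OF subset_UNIV]) (simp_all add: bilin_simps frag_extend_diff)
  ultimately show "ctx u v (cmul (frag_of w) f) = ctx (u @ w) v f" "ctx u v (cmul f (frag_of w)) =
      ctx u (w @ v) f"
    by (simp_all add: ctx_def)
qed

text \<open>The largest two-sided ideal of the tensor algebra on which the linear extension of
  \<open>h\<close> vanishes; quantifying over all contexts is what makes it an ideal.\<close>

definition radical :: "('y list \<Rightarrow>\<^sub>0 int) set" where
  "radical = {f \<in> carrier (tensor_algebra Y). \<forall>u \<in> lists Y. \<forall>v \<in> lists Y. ctx u v f = \<one>}"

lemma radical_subgroup: "subgroup radical (add_monoid (tensor_algebra Y))"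
proof (rule TA.add.subgroupI)
  have "0 \<in> radical" using ctx_zero by (simp add: radical_def tensor_algebra_iff)
  then show "radical \<noteq> {}" by blast
  fix a assume a: "a \<in> radical"
  then show "\<ominus>\<^bsub>tensor_algebra Y\<^esub> a \<in> radical" by (simp add: radical_def ctx_minus tensor_minus_closed)
  fix b assume b: "b \<in> radical"
  have "a + b \<in> carrier (tensor_algebra Y)" using TA.a_closed[of a Y b] a b by (simp add: radical_def)
  then show "a \<oplus>\<^bsub>tensor_algebra Y\<^esub> b \<in> radical" using a b by (simp add: radical_def ctx_add)
qed (auto simp: radical_def)

text \<open>Multiplying by a word merely enlarges the context, by \<open>ctx_mult\<close>; general
  factors follow by linearity.\<close>

lemma radical_mult:
  assumes f: "f \<in> radical" and a: "a \<in> carrier (tensor_algebra Y)"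
  shows "cmul a f \<in> radical \<and> cmul f a \<in> radical"
  using a unfolding carrier_tensor_algebra
proof (induction rule: free_Abelian_induct)
  have fc: "f \<in> carrier (tensor_algebra Y)" using f by (simp add: radical_def)
  {
    case zero
    show ?case using TA.add.subgroup_self subgroup.one_closed[OF radical_subgroup] by (simp add:
        bilin_simps)
  next
    case (diff x y)
    then have c: "x \<in> carrier (tensor_algebra Y)" "y \<in> carrier (tensor_algebra Y)" by (simp_all add:
        carrier_tensor_algebra)
    have "p - q \<in> radical" if "p \<in> radical" "q \<in> radical" for p q
    proof -
      have "p \<oplus>\<^bsub>tensor_algebra Y\<^esub> \<ominus>\<^bsub>tensor_algebra Y\<^esub> q \<in> radical"
        using additive_subgroup.a_closed[OF additive_subgroupI[OF radical_subgroup] that(1)]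
          subgroup.m_inv_closed[OF radical_subgroup that(2)] by (simp only: a_inv_def)
      moreover have "q \<in> carrier (tensor_algebra Y)" using that by (simp add: radical_def)
      ultimately show ?thesis by simp
    qed
    then show ?case using diff by (simp add: bilin_simps)
  next
    case (frag_of w)
    then show ?case using f cmul_closed[OF frag_of_tensor[OF frag_of] fc] cmul_closed[OF fc
        frag_of_tensor[OF frag_of]]
      by (simp add: radical_def ctx_mult)
  }
qed

lemma letters_carrier: "x \<in> carrier (free_Abelian_group {[y] | y. y \<in> Y}) \<Longrightarrow> x \<in> carrier (tensor_algebra Y)"
  by (auto simp: tensor_algebra_iff subset_iff)

text \<open>The claim is additive in both linear forms, and for letters it is
  \<open>h_swap\<close>.\<close>

lemma ctx_swap:
  assumes uv: "u \<in> lists Y" "v \<in> lists Y"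
    and ab: "a \<in> carrier (free_Abelian_group {[y] | y. y \<in> Y})" "b \<in> carrier (free_Abelian_group
        {[y] | y. y \<in> Y})"
  shows "ctx u v (cmul a b) \<otimes> ctx u v (cmul b a) = \<one>"
  using ab(1)
proof (induction a rule: free_Abelian_induct)
  case zero
  then show ?case by (simp add: bilin_simps ctx_zero uv)
next
  case (diff a a')
  note c = letters_carrier[OF diff(1)] letters_carrier[OF diff(2)] letters_carrier[OF ab(2)]
  note cl = cmul_closed[OF c(1,3)] cmul_closed[OF c(2,3)] cmul_closed[OF c(3,1)] cmul_closed[OF c(3,2)]
  note cc = ctx_closed[OF uv cl(1)] ctx_closed[OF uv cl(2)] ctx_closed[OF uv cl(3)] ctx_closed[OF uv cl(4)]
  have "ctx u v (cmul (a - a') b) \<otimes> ctx u v (cmul b (a - a')) =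
    (ctx u v (cmul a b) \<otimes> ctx u v (cmul b a)) \<otimes> inv (ctx u v (cmul a' b) \<otimes> ctx u v (cmul b a'))"
    using cc by (simp add: bilin_simps ctx_diff uv cl m_ac inv_mult)
  then show ?case using diff(3,4) by simp
next
  case (frag_of w)
  then obtain x where x: "w = [x]" "x \<in> Y" by auto
  show ?case
    using ab(2)
  proof (induction b rule: free_Abelian_induct)
    case zero
    then show ?case by (simp add: bilin_simps ctx_zero uv)
  next
    case (diff a a')
    have b: "frag_of w \<in> carrier (tensor_algebra Y)" using x by (simp add: frag_of_tensor)
    note c = letters_carrier[OF diff(1)] letters_carrier[OF diff(2)] b
    note cl = cmul_closed[OF c(1,3)] cmul_closed[OF c(2,3)] cmul_closed[OF c(3,1)] cmul_closed[OF c(3,2)]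
    note cc = ctx_closed[OF uv cl(1)] ctx_closed[OF uv cl(2)] ctx_closed[OF uv cl(3)] ctx_closed[OF
        uv cl(4)]
    have "ctx u v (cmul (frag_of w) (a - a')) \<otimes> ctx u v (cmul (a - a') (frag_of w)) =
      (ctx u v (cmul (frag_of w) a) \<otimes> ctx u v (cmul a (frag_of w))) \<otimes> inv (ctx u v (cmul (frag_of w)
          a') \<otimes> ctx u v (cmul a' (frag_of w)))"
      using cc by (simp add: bilin_simps ctx_diff uv cl m_ac inv_mult)
    then show ?case using diff(3,4) by simp
  next
    case (frag_of w')
    then obtain y where y: "w' = [y]" "y \<in> Y" by auto
    then show ?case using x h_swap[of u x y v] uv by (simp add: bilin_simps ctx_frag_of)
  qed
qed

text \<open>The ideal is generated by squares of arbitrary linear forms, whereas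
  \<open>h_repeat\<close> speaks of letters only. A square of a difference adds mixed terms, which
  \<open>ctx_swap\<close> cancels.\<close>

lemma ctx_square:
  assumes uv: "u \<in> lists Y" "v \<in> lists Y" and a: "a \<in> carrier (free_Abelian_group {[y] | y. y \<in> Y})"
  shows "ctx u v (cmul a a) = \<one>"
  using a
proof (induction a rule: free_Abelian_induct)
  case zero
  then show ?case by (simp add: bilin_simps ctx_zero uv)
next
  case (diff a b)
  note c = letters_carrier[OF diff(1)] letters_carrier[OF diff(2)]
  note cl = cmul_closed[OF c(1,1)] cmul_closed[OF c(1,2)] cmul_closed[OF c(2,1)] cmul_closed[OF c(2,2)]
  note cc = ctx_closed[OF uv cl(1)] ctx_closed[OF uv cl(2)] ctx_closed[OF uv cl(3)] ctx_closed[OF uv cl(4)]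
  have e: "cmul (a - b) (a - b) = (cmul a a + cmul b b) - (cmul a b + cmul b a)"
    by (simp add: bilin_simps)
  have s: "cmul a a + cmul b b \<in> carrier (tensor_algebra Y)" "cmul a b + cmul b a \<in> carrier
      (tensor_algebra Y)"
    using TA.a_closed[OF cl(1,4)] TA.a_closed[OF cl(2,3)] by simp_all
  have "ctx u v (cmul (a - b) (a - b)) = (ctx u v (cmul a a) \<otimes> ctx u v (cmul b b)) \<otimes> inv (ctx u v
      (cmul a b) \<otimes> ctx u v (cmul b a))"
    unfolding e by (simp add: ctx_diff ctx_add uv s cl)
  then show ?case using ctx_swap[OF uv diff(1,2)] diff(3,4) by simp
next
  case (frag_of w)
  then obtain x where x: "w = [x]" "x \<in> Y" by auto
  then show ?case using h_repeat[of u x v] uv by (simp add: bilin_simps ctx_frag_of)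
qed

lemma exterior_ideal_radical: "exterior_ideal Y \<subseteq> radical"
  unfolding exterior_ideal_def
proof (rule TA.genideal_minimal)
  show "ideal radical (tensor_algebra Y)"
    by (rule idealI[OF ring_tensor_algebra radical_subgroup]) (simp_all add: radical_mult)
  show "{v \<otimes>\<^bsub>tensor_algebra Y\<^esub> v |v. v \<in> tensor_part Y 1} \<subseteq> radical"
  proof
    fix p assume "p \<in> {v \<otimes>\<^bsub>tensor_algebra Y\<^esub> v |v. v \<in> tensor_part Y 1}"
    then obtain v where v: "v \<in> tensor_part Y 1" and p: "p = cmul v v" by auto
    have "v \<in> carrier (free_Abelian_group {[y] | y. y \<in> Y})"
    proof -
      have "t \<in> {[y] | y. y \<in> Y}" if t: "t \<in> Poly_Mapping.keys v" for t
      proof -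
        have "t \<in> lists Y" "length t = 1" using v t by (auto simp: tensor_part_def tensor_algebra_iff)
        then show ?thesis by (auto simp: length_Suc_conv)
      qed
      then show ?thesis by auto
    qed
    then show "p \<in> radical"
      unfolding p using ctx_square v by (auto simp: radical_def tensor_part_def cmul_closed)
  qed
qed

text \<open>The universal property of the exterior algebra as an abelian group. The linear extension
  of \<open>h\<close> is evaluation in the empty context, so it is trivial on \<open>radical\<close>
  and hence on the exterior ideal.\<close>

lemma exterior_lift:
  "\<exists>g \<in> hom (add_monoid (exterior_algebra Y)) A. \<forall>w \<in> lists Y. g (ext_class Y w) = h w"
proof -
  have N: "exterior_ideal Y \<lhd> add_monoid (tensor_algebra Y)"
    by (rule abelian_subgroup.a_normal) unfold_locales
  have zh': "zlift A h \<in> hom (add_monoid (tensor_algebra Y)) A"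
    using zh by (auto simp: hom_def carrier_tensor_algebra)
  have z0: "zlift A h f = \<one>" if "f \<in> exterior_ideal Y" for f
  proof -
    have "ctx [] [] f = \<one>" using that exterior_ideal_radical by (auto simp: radical_def)
    moreover have "frag_extend (\<lambda>w. frag_of ([] @ w @ [])) f = f" using frag_expansion[of f] by simp
    ultimately show ?thesis by (simp add: ctx_def)
  qed
  obtain g where g: "g \<in> hom (add_monoid (tensor_algebra Y) Mod exterior_ideal Y) A"
    "\<And>x. x \<in> carrier (add_monoid (tensor_algebra Y)) \<Longrightarrow> g (exterior_ideal Y #>\<^bsub>add_monoid
        (tensor_algebra Y)\<^esub> x) = zlift A h x"
  proof (rule FactGroup_universal[OF zh' N])
    fix x y assume x: "x \<in> carrier (add_monoid (tensor_algebra Y))" and y: "y \<in> carrier (add_monoid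
        (tensor_algebra Y))"
      and e: "exterior_ideal Y #>\<^bsub>add_monoid (tensor_algebra Y)\<^esub> x = exterior_ideal Y #>\<^bsub>add_monoid
          (tensor_algebra Y)\<^esub> y"
    have "x \<ominus>\<^bsub>tensor_algebra Y\<^esub> y \<in> exterior_ideal Y"
      using e x y EX.rcos_eq_iff[of x Y y] by (simp add: a_r_coset_def)
    then have "zlift A h (x - y) = \<one>" using z0 x y by (simp add: a_minus_def)
    moreover have c: "x - y \<in> carrier (tensor_algebra Y)" using x y TA.minus_closed[of x Y y] by
        (simp add: a_minus_def)
    ultimately show "zlift A h x = zlift A h y"
      using hom_mult[OF zh', of "x - y" y] hom_in_carrier[OF zh'] x y by simp
  qed blast
  have "g \<in> hom (add_monoid (exterior_algebra Y)) A"
    using g(1) by (auto simp: hom_def exterior_algebra_def FactRing_def FactGroup_def A_RCOSETS_def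
        set_add_def)
  moreover have "g (ext_class Y w) = h w" if "w \<in> lists Y" for w
    using g(2)[of "frag_of w"] that by (simp add: ext_class_def a_r_coset_def frag_of_tensor
        zlift_frag_of h_closed)
  ultimately show ?thesis by blast
qed

end

section \<open>Exterior powers as abelian groups\<close>

lemma carrier_exterior_power:
  "carrier (exterior_power Y k) = (\<lambda>f. exterior_ideal Y +>\<^bsub>tensor_algebra Y\<^esub> f) ` tensor_part Y k"
  by (simp add: exterior_power_def)

lemma exterior_power_mult [simp]: "x \<otimes>\<^bsub>exterior_power Y k\<^esub> y = x \<oplus>\<^bsub>exterior_algebra Y\<^esub> y"
  "\<one>\<^bsub>exterior_power Y k\<^esub> = \<zero>\<^bsub>exterior_algebra Y\<^esub>"
  by (simp_all add: exterior_power_def)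

lemma tensor_part_free: "tensor_part Y k = carrier (free_Abelian_group {w \<in> lists Y. length w = k})"
  unfolding tensor_part_def tensor_algebra_def free_Abelian_group_def by (simp del: lists_eq_set
      in_lists_conv_set, blast)

lemma tensor_part_subgroup: "subgroup (tensor_part Y k) (add_monoid (tensor_algebra Y))"
proof (rule TA.add.subgroupI)
  have "0 \<in> tensor_part Y k" by (simp add: tensor_part_free)
  then show "tensor_part Y k \<noteq> {}" by blast
  fix a assume a: "a \<in> tensor_part Y k"
  then have "a \<in> carrier (tensor_algebra Y)" by (simp add: tensor_part_def)
  then show "\<ominus>\<^bsub>tensor_algebra Y\<^esub> a \<in> tensor_part Y k" using a by (simp add: tensor_part_free)
  fix b assume "b \<in> tensor_part Y k"
  then show "a \<oplus>\<^bsub>tensor_algebra Y\<^esub> b \<in> tensor_part Y k"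
    using a keys_add[of a b] unfolding tensor_part_free by (simp del: mem_Collect_eq) blast
qed (auto simp: tensor_part_def)

lemma exterior_power_subgroup: "subgroup (carrier (exterior_power Y k)) (add_monoid (exterior_algebra Y))"
  unfolding carrier_exterior_power exterior_algebra_def
  by (rule group_hom.subgroup_img_is_subgroup[OF group_homI[OF TA.a_group abelian_group.a_group[OF
      EX.abelian_group_Q] EX.rcos_hom]
        tensor_part_subgroup])

lemma abelian_group_exterior: "abelian_group (exterior_algebra Y)"
  unfolding exterior_algebra_def by (rule EX.abelian_group_Q)

lemma comm_group_exterior_power: "comm_group (exterior_power Y k)"
  by (rule comm_group_cong[OF subgroup_comm_group[OF abelian_group.a_comm_group[OF
      abelian_group_exterior] exterior_power_subgroup]])
    (simp_all add: exterior_power_def)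

lemma ext_class_closed: "w \<in> lists Y \<Longrightarrow> length w = k \<Longrightarrow> ext_class Y w \<in> carrier (exterior_power Y k)"
  unfolding carrier_exterior_power ext_class_def by (rule imageI) (simp add: tensor_part_free)

lemma hom_exterior_power: "g \<in> hom (add_monoid (exterior_algebra Y)) A \<Longrightarrow> g \<in> hom (exterior_power Y k) A"
  using subgroup.subset[OF exterior_power_subgroup[of Y k]] by (auto simp: hom_def subset_iff Pi_iff)

lemma ext_class_zero: "u @ [x, x] @ v \<in> lists Y \<Longrightarrow> ext_class Y (u @ [x, x] @ v) = \<zero>\<^bsub>exterior_algebra Y\<^esub>"
  using EX.rcos_I_iff[OF frag_of_tensor, of "u @ [x, x] @ v" Y] ext_class_repeat[of u x v Y]
  by (simp add: ext_class_def exterior_algebra_def EX.zero_Q)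

lemma ext_class_anti:
  assumes "u @ [x, y] @ v \<in> lists Y"
  shows "ext_class Y (u @ [x, y] @ v) = \<ominus>\<^bsub>exterior_algebra Y\<^esub> ext_class Y (u @ [y, x] @ v)"
proof -
  interpret X: abelian_group "exterior_algebra Y" by (rule abelian_group_exterior)
  let ?a = "frag_of (u @ [x, y] @ v)" and ?b = "frag_of (u @ [y, x] @ v)"
  have c: "?a \<in> carrier (tensor_algebra Y)" "?b \<in> carrier (tensor_algebra Y)"
    using assms by (auto intro!: frag_of_tensor)
  have "exterior_ideal Y +>\<^bsub>tensor_algebra Y\<^esub> (?a \<oplus>\<^bsub>tensor_algebra Y\<^esub> ?b) = \<zero>\<^bsub>exterior_algebra Y\<^esub>"
    using EX.rcos_I_iff[OF TA.a_closed[OF c]] ext_class_swap[OF assms]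
    by (simp add: exterior_algebra_def EX.zero_Q)
  then have "ext_class Y (u @ [x, y] @ v) \<oplus>\<^bsub>exterior_algebra Y\<^esub> ext_class Y (u @ [y, x] @ v) =
      \<zero>\<^bsub>exterior_algebra Y\<^esub>"
    unfolding ext_class_def exterior_algebra_def using EX.add_Q[OF c] by simp
  then show ?thesis
    using EX.rcos_closed[OF c(1)] EX.rcos_closed[OF c(2)]
    by (intro X.minus_equality[symmetric]) (auto simp: ext_class_def exterior_algebra_def)
qed

lemma exterior_power_inv: "x \<in> carrier (exterior_power Y k) \<Longrightarrow> inv\<^bsub>exterior_power Y k\<^esub> x =
    \<ominus>\<^bsub>exterior_algebra Y\<^esub> x"
proof -
  assume x: "x \<in> carrier (exterior_power Y k)"
  interpret X: abelian_group "exterior_algebra Y" by (rule abelian_group_exterior)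
  interpret P: comm_group "exterior_power Y k" by (rule comm_group_exterior_power)
  have "x \<in> carrier (exterior_algebra Y)" using subgroup.subset[OF exterior_power_subgroup] x by auto
  moreover have "\<ominus>\<^bsub>exterior_algebra Y\<^esub> x \<in> carrier (exterior_power Y k)"
    using subgroup.m_inv_closed[OF exterior_power_subgroup x] by (simp add: a_inv_def)
  ultimately show ?thesis using x by (intro P.inv_equality) (auto simp: X.l_neg)
qed

lemma generate_exterior_power:
  assumes sub: "subgroup K (exterior_power Y k)" and K: "\<And>w. w \<in> lists Y \<Longrightarrow> length w = k \<Longrightarrow> ext_class Y w \<in> K"
  shows "K = carrier (exterior_power Y k)"
proof
  interpret P: comm_group "exterior_power Y k" by (rule comm_group_exterior_power)
  show "K \<subseteq> carrier (exterior_power Y k)" by (rule subgroup.subset[OF sub])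
  show "carrier (exterior_power Y k) \<subseteq> K"
  proof
    fix x assume "x \<in> carrier (exterior_power Y k)"
    then obtain f where f: "f \<in> carrier (free_Abelian_group {w \<in> lists Y. length w = k})"
      "x = exterior_ideal Y +>\<^bsub>tensor_algebra Y\<^esub> f" by (auto simp: carrier_exterior_power tensor_part_free)
    have "exterior_ideal Y +>\<^bsub>tensor_algebra Y\<^esub> f \<in> K"
      using f(1)
    proof (induction f rule: free_Abelian_induct)
      case zero
      then show ?case using subgroup.one_closed[OF sub] EX.rcos_I_iff[of 0 Y] EX.I.zero_closed[of Y]
        by (simp add: exterior_algebra_def EX.zero_Q tensor_algebra_iff)
    next
      case (diff f g)
      have c: "f \<in> carrier (tensor_algebra Y)" "g \<in> carrier (tensor_algebra Y)"
        using diff(1,2) by (auto simp: tensor_algebra_iff subset_iff)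
      have gK: "exterior_ideal Y +>\<^bsub>tensor_algebra Y\<^esub> g \<in> carrier (exterior_power Y k)"
        using diff(4) subgroup.subset[OF sub] by auto
      have "exterior_ideal Y +>\<^bsub>tensor_algebra Y\<^esub> (f - g) = (exterior_ideal Y +>\<^bsub>tensor_algebra Y\<^esub>
          f) \<otimes>\<^bsub>exterior_power Y k\<^esub>
        inv\<^bsub>exterior_power Y k\<^esub> (exterior_ideal Y +>\<^bsub>tensor_algebra Y\<^esub> g)"
        unfolding exterior_power_inv[OF gK] using EX.rcos_diff[OF c] c
        by (simp add: exterior_algebra_def a_minus_def)
      then show ?case using diff(3,4) subgroup.m_closed[OF sub] subgroup.m_inv_closed[OF sub] by simp
    next
      case (frag_of w)
      then show ?case using K by (simp add: ext_class_def)
    qed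
    then show "x \<in> K" using f by simp
  qed
qed

text \<open>\<open>\<beta>\<close> is continued by the neutral element to words of every other
  length. Repeats and swaps do not change the length of a word, so the alternating conditions hold
  in each length separately.\<close>

lemma exterior_lift2:
  fixes \<beta> :: "'y \<Rightarrow> 'y \<Rightarrow> 'a"
  assumes A: "comm_group A" and c: "\<And>x y. x \<in> Y \<Longrightarrow> y \<in> Y \<Longrightarrow> \<beta> x y \<in> carrier A"
    and r: "\<And>x. x \<in> Y \<Longrightarrow> \<beta> x x = \<one>\<^bsub>A\<^esub>"
    and s: "\<And>x y. x \<in> Y \<Longrightarrow> y \<in> Y \<Longrightarrow> \<beta> x y \<otimes>\<^bsub>A\<^esub> \<beta> y x = \<one>\<^bsub>A\<^esub>"
  shows "\<exists>g \<in> hom (exterior_power Y 2) A. \<forall>x \<in> Y. \<forall>y \<in> Y. g (ext_class Y [x, y]) = \<beta> x y"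
proof -
  interpret A: comm_group A by fact
  define h where "h w = (if length w = 2 then \<beta> (w ! 0) (w ! 1) else \<one>\<^bsub>A\<^esub>)" for w
  have "alternating A Y h"
  proof (intro alternating.intro A alternating_axioms.intro)
    fix w assume "w \<in> lists Y"
    then show "h w \<in> carrier A" by (auto simp: h_def c in_lists_conv_set)
  next
    fix u x v assume "u @ [x, x] @ v \<in> lists Y"
    then show "h (u @ [x, x] @ v) = \<one>\<^bsub>A\<^esub>" by (auto simp: h_def r)
  next
    fix u x y v assume "u @ [x, y] @ v \<in> lists Y"
    then show "h (u @ [x, y] @ v) \<otimes>\<^bsub>A\<^esub> h (u @ [y, x] @ v) = \<one>\<^bsub>A\<^esub>" by (auto simp: h_def s)
  qed
  from alternating.exterior_lift[OF this] obtain g where g: "g \<in> hom (add_monoid (exterior_algebra Y)) A"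
    "\<forall>w \<in> lists Y. g (ext_class Y w) = h w" by blast
  then show ?thesis by (intro bexI[of _ g] hom_exterior_power) (auto simp: h_def)
qed

lemma exterior_lift3:
  fixes \<beta> :: "'y \<Rightarrow> 'y \<Rightarrow> 'y \<Rightarrow> 'a"
  assumes A: "comm_group A" and c: "\<And>x y z. x \<in> Y \<Longrightarrow> y \<in> Y \<Longrightarrow> z \<in> Y \<Longrightarrow> \<beta> x y z \<in> carrier A"
    and r: "\<And>x y. x \<in> Y \<Longrightarrow> y \<in> Y \<Longrightarrow> \<beta> x x y = \<one>\<^bsub>A\<^esub>" "\<And>x y. x \<in> Y \<Longrightarrow> y \<in> Y \<Longrightarrow> \<beta> y x x = \<one>\<^bsub>A\<^esub>"
    and s: "\<And>x y z. x \<in> Y \<Longrightarrow> y \<in> Y \<Longrightarrow> z \<in> Y \<Longrightarrow> \<beta> x y z \<otimes>\<^bsub>A\<^esub> \<beta> y x z = \<one>\<^bsub>A\<^esub>"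
      "\<And>x y z. x \<in> Y \<Longrightarrow> y \<in> Y \<Longrightarrow> z \<in> Y \<Longrightarrow> \<beta> x y z \<otimes>\<^bsub>A\<^esub> \<beta> x z y = \<one>\<^bsub>A\<^esub>"
  shows "\<exists>g \<in> hom (exterior_power Y 3) A. \<forall>x \<in> Y. \<forall>y \<in> Y. \<forall>z \<in> Y. g (ext_class Y [x, y, z]) = \<beta> x y z"
proof -
  interpret A: comm_group A by fact
  define h where "h w = (if length w = 3 then \<beta> (w ! 0) (w ! 1) (w ! 2) else \<one>\<^bsub>A\<^esub>)" for w
  \<comment> \<open>In a word of length three an adjacent pair sits at the front or at the back;
    these are the two versions of each hypothesis.\<close>
  have ctx: "(\<exists>a. u = [a] \<and> v = []) \<or> (\<exists>a. u = [] \<and> v = [a])" if "length (u @ [x, y] @ v) = 3" for u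
      v :: "'y list" and x y
    using that by (cases u; cases v) auto
  have "alternating A Y h"
  proof (intro alternating.intro A alternating_axioms.intro)
    fix w assume "w \<in> lists Y"
    then show "h w \<in> carrier A" by (auto simp: h_def c in_lists_conv_set)
  next
    fix u x v assume a: "u @ [x, x] @ v \<in> lists Y"
    show "h (u @ [x, x] @ v) = \<one>\<^bsub>A\<^esub>"
    proof (cases "length (u @ [x, x] @ v) = 3")
      case True
      from ctx[OF this] show ?thesis using a r by (auto simp: h_def)
    qed (simp add: h_def)
  next
    fix u x y v assume a: "u @ [x, y] @ v \<in> lists Y"
    show "h (u @ [x, y] @ v) \<otimes>\<^bsub>A\<^esub> h (u @ [y, x] @ v) = \<one>\<^bsub>A\<^esub>"
    proof (cases "length (u @ [x, y] @ v) = 3")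
      case True
      from ctx[OF this] show ?thesis using a s by (auto simp: h_def)
    qed (simp add: h_def)
  qed
  from alternating.exterior_lift[OF this] obtain g where g: "g \<in> hom (add_monoid (exterior_algebra Y)) A"
    "\<forall>w \<in> lists Y. g (ext_class Y w) = h w" by blast
  then show ?thesis by (intro bexI[of _ g] hom_exterior_power) (auto simp: h_def)
qed

text \<open>Duality forces \<open>e\<close> to be injective, so the functionals can be moved from
  the index set to the basis elements themselves.\<close>

lemma zbasis_family:
  assumes "finite P" "\<And>p. p \<in> P \<Longrightarrow> e p \<in> carrier G" "\<And>p. p \<in> P \<Longrightarrow> c p \<in> hom G integer_group"
    "\<And>p q. p \<in> P \<Longrightarrow> q \<in> P \<Longrightarrow> c p (e q) = (if p = q then 1 else 0)" "generate G (e ` P) = carrier G"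
  shows "\<exists>\<kappa>. zbasis G (e ` P) \<kappa> \<and> (\<forall>p \<in> P. \<kappa> (e p) = c p)"
proof -
  have inj: "inj_on e P"
  proof (rule inj_onI)
    fix p q assume "p \<in> P" "q \<in> P" "e p = e q"
    then show "p = q" using assms(4)[of p p] assms(4)[of p q] by (auto split: if_splits)
  qed
  let ?\<kappa> = "\<lambda>b. c (inv_into P e b)"
  have k: "?\<kappa> (e p) = c p" if "p \<in> P" for p using inv_into_f_f[OF inj that] by simp
  have "zbasis G (e ` P) ?\<kappa>"
    unfolding zbasis_def
  proof (intro conjI ballI)
    show "finite (e ` P)" using assms(1) by simp
    show "e ` P \<subseteq> carrier G" using assms(2) by auto
    show "generate G (e ` P) = carrier G" by fact
    fix b assume "b \<in> e ` P"
    then obtain p where p: "p \<in> P" "b = e p" by auto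
    show "?\<kappa> b \<in> hom G integer_group" using k[OF p(1)] p assms(3) by simp
    fix b' assume "b' \<in> e ` P"
    then obtain q where q: "q \<in> P" "b' = e q" by auto
    show "?\<kappa> b b' = (if b = b' then 1 else 0)"
      unfolding p(2) q(2) k[OF p(1)] using assms(4)[OF p(1) q(1)] inj_on_eq_iff[OF inj p(1) q(1)] by simp
  qed
  with k show ?thesis by blast
qed

lemma generate_exterior_2: "generate (exterior_power Y 2) {ext_class Y [x, y] | x y. x \<in> Y \<and> y \<in> Y}
    = carrier (exterior_power Y 2)"
proof (rule generate_exterior_power)
  interpret P: comm_group "exterior_power Y 2" by (rule comm_group_exterior_power)
  show "subgroup (generate (exterior_power Y 2) {ext_class Y [x, y] | x y. x \<in> Y \<and> y \<in> Y})
      (exterior_power Y 2)"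
    by (rule P.generate_is_subgroup) (auto intro!: ext_class_closed)
  fix w assume "w \<in> lists Y" "length w = 2"
  then obtain x y where "w = [x, y]" "x \<in> Y" "y \<in> Y" by (auto simp: numeral_2_eq_2 length_Suc_conv)
  then show "ext_class Y w \<in> generate (exterior_power Y 2) {ext_class Y [x, y] | x y. x \<in> Y \<and> y \<in> Y}"
    by (intro generate.incl) blast
qed

lemma generate_exterior_3: "generate (exterior_power Y 3) {ext_class Y [x, y, z] | x y z. x \<in> Y \<and> y
    \<in> Y \<and> z \<in> Y} = carrier (exterior_power Y 3)"
proof (rule generate_exterior_power)
  interpret P: comm_group "exterior_power Y 3" by (rule comm_group_exterior_power)
  show "subgroup (generate (exterior_power Y 3) {ext_class Y [x, y, z] | x y z. x \<in> Y \<and> y \<in> Y \<and> z \<in>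
      Y}) (exterior_power Y 3)"
    by (rule P.generate_is_subgroup) (auto intro!: ext_class_closed)
  fix w assume "w \<in> lists Y" "length w = 3"
  then obtain x y z where "w = [x, y, z]" "x \<in> Y" "y \<in> Y" "z \<in> Y" by (auto simp: numeral_3_eq_3
      length_Suc_conv)
  then show "ext_class Y w \<in> generate (exterior_power Y 3) {ext_class Y [x, y, z] | x y z. x \<in> Y \<and> y
      \<in> Y \<and> z \<in> Y}"
    by (intro generate.incl) blast
qed

section \<open>Minors as coordinates, and bases of the second and third exterior power\<close>

definition delta :: "'y \<Rightarrow> 'y \<Rightarrow> int" where "delta x y = (if x = y then 1 else 0)"

text \<open>The determinant of the Kronecker deltas with rows \<open>a\<close>, \<open>b\<close> and
  columns \<open>x\<close>, \<open>y\<close>, that is, the coordinate of the product of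
  \<open>x\<close> and \<open>y\<close> at the product of \<open>a\<close> and
  \<open>b\<close>.\<close>

definition minor2 :: "'y \<Rightarrow> 'y \<Rightarrow> 'y \<Rightarrow> 'y \<Rightarrow> int" where
  "minor2 a b x y = delta a x * delta b y - delta a y * delta b x"

text \<open>The three-by-three determinant of Kronecker deltas, expanded along the row of
  \<open>a\<close>.\<close>

definition minor3 :: "'y \<Rightarrow> 'y \<Rightarrow> 'y \<Rightarrow> 'y \<Rightarrow> 'y \<Rightarrow> 'y \<Rightarrow> int" where
  "minor3 a b c x y z = delta a x * minor2 b c y z - delta a y * minor2 b c x z + delta a z * minor2
      b c x y"

lemma ext_coord2:
  "\<exists>c \<in> hom (exterior_power Y 2) integer_group. \<forall>x \<in> Y. \<forall>y \<in> Y. c (ext_class Y [x, y]) = minor2 a b x y"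
  by (rule exterior_lift2[OF abelian_integer_group]) (auto simp: minor2_def)

lemma ext_coord3:
  "\<exists>k \<in> hom (exterior_power Y 3) integer_group. \<forall>x \<in> Y. \<forall>y \<in> Y. \<forall>z \<in> Y. k (ext_class Y [x, y, z]) =
      minor3 a b c x y z"
  by (rule exterior_lift3[OF abelian_integer_group]) (auto simp: minor3_def minor2_def algebra_simps)

text \<open>An enumeration of the finite set orders the letters; increasing pairs span by
  antisymmetry, and the minors are dual to them. That the functionals are minors is recorded because
  the same minors are available on the Lie side.\<close>

lemma zbasis_exterior_2:
  assumes "finite Y"
  shows "\<exists>B \<kappa>. zbasis (exterior_power Y 2) B \<kappa> \<and> B \<subseteq> {ext_class Y [x, y] | x y. x \<in> Y \<and> y \<in> Y} \<and>
    (\<forall>b \<in> B. \<exists>u v. u \<in> Y \<and> v \<in> Y \<and> (\<forall>x \<in> Y. \<forall>y \<in> Y. \<kappa> b (ext_class Y [x, y]) = minor2 u v x y))"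
proof -
  interpret P: comm_group "exterior_power Y 2" by (rule comm_group_exterior_power)
  obtain idx :: "'a \<Rightarrow> nat" where idx: "inj_on idx Y" using finite_imp_inj_to_nat_seg[OF assms] by blast
  define Q where "Q = {(x, y). x \<in> Y \<and> y \<in> Y \<and> idx x < idx y}"
  define e where "e = (\<lambda>(x, y). ext_class Y [x, y])"
  obtain c where c: "\<And>a b. c a b \<in> hom (exterior_power Y 2) integer_group"
    "\<And>a b x y. x \<in> Y \<Longrightarrow> y \<in> Y \<Longrightarrow> c a b (ext_class Y [x, y]) = minor2 a b x y"
    using ext_coord2[of Y] by metis
  have "\<exists>\<kappa>. zbasis (exterior_power Y 2) (e ` Q) \<kappa> \<and> (\<forall>p \<in> Q. \<kappa> (e p) = (\<lambda>(a, b). c a b) p)"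
  proof (rule zbasis_family)
    show "finite Q" by (rule finite_subset[of _ "Y \<times> Y"]) (auto simp: Q_def assms)
    show "e p \<in> carrier (exterior_power Y 2)" if "p \<in> Q" for p
      using that by (auto simp: Q_def e_def intro!: ext_class_closed)
    show "(\<lambda>(a, b). c a b) p \<in> hom (exterior_power Y 2) integer_group" for p
      using c(1) by (cases p) auto
    show "(\<lambda>(a, b). c a b) p (e q) = (if p = q then 1 else 0)" if "p \<in> Q" "q \<in> Q" for p q
      using that by (auto simp: Q_def e_def c(2) minor2_def delta_def split: if_splits)
    show "generate (exterior_power Y 2) (e ` Q) = carrier (exterior_power Y 2)"
    proof (rule generate_exterior_power)
      show sub: "subgroup (generate (exterior_power Y 2) (e ` Q)) (exterior_power Y 2)"
        by (rule P.generate_is_subgroup) (auto simp: Q_def e_def intro!: ext_class_closed)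
      fix w assume "w \<in> lists Y" "length w = 2"
      then obtain x y where w: "w = [x, y]" "x \<in> Y" "y \<in> Y" by (auto simp: numeral_2_eq_2 length_Suc_conv)
      have srt: "ext_class Y [x, y] \<in> generate (exterior_power Y 2) (e ` Q)" if "x \<in> Y" "y \<in> Y" "idx
          x < idx y" for x y
        using that by (intro generate.incl) (auto simp: Q_def e_def image_iff)
      consider "idx x < idx y" | "idx y < idx x" | "x = y"
        using idx w by (metis inj_onD linorder_neqE_nat)
      then show "ext_class Y w \<in> generate (exterior_power Y 2) (e ` Q)"
      proof cases
        case 1
        then show ?thesis using srt w by simp
      next
        case 2
        then have "ext_class Y [y, x] \<in> generate (exterior_power Y 2) (e ` Q)" using srt w by simp
        then have "inv\<^bsub>exterior_power Y 2\<^esub> ext_class Y [y, x] \<in> generate (exterior_power Y 2) (e ` Q)"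
          by (rule subgroup.m_inv_closed[OF sub])
        then show ?thesis using ext_class_anti[of "[]" x y "[]" Y] w
          by (simp add: exterior_power_inv ext_class_closed)
      next
        case 3
        then show ?thesis using ext_class_zero[of "[]" x "[]" Y] w subgroup.one_closed[OF sub] by simp
      qed
    qed
  qed
  then obtain \<kappa> where "zbasis (exterior_power Y 2) (e ` Q) \<kappa>" "\<And>p. p \<in> Q \<Longrightarrow> \<kappa> (e p) = (\<lambda>(a, b). c a
      b) p" by blast
  then show ?thesis using c(2)
    by (intro exI[of _ "e ` Q"] exI[of _ \<kappa>]) (fastforce simp: Q_def e_def)
qed

text \<open>Increasing triples are dual to the three-by-three minors. They span because a word of
  length three can be sorted by adjacent swaps, each costing a sign, and words with a repeated
  letter vanish.\<close>

lemma zbasis_exterior_3: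
  assumes "finite Y"
  shows "\<exists>B \<kappa>. zbasis (exterior_power Y 3) B \<kappa>"
proof -
  interpret P: comm_group "exterior_power Y 3" by (rule comm_group_exterior_power)
  obtain idx :: "'a \<Rightarrow> nat" where idx: "inj_on idx Y" using finite_imp_inj_to_nat_seg[OF assms] by blast
  define Q where "Q = {(x, y, z). x \<in> Y \<and> y \<in> Y \<and> z \<in> Y \<and> idx x < idx y \<and> idx y < idx z}"
  define e where "e = (\<lambda>(x, y, z). ext_class Y [x, y, z])"
  obtain c where c: "\<And>a b d. c a b d \<in> hom (exterior_power Y 3) integer_group"
    "\<And>a b d x y z. x \<in> Y \<Longrightarrow> y \<in> Y \<Longrightarrow> z \<in> Y \<Longrightarrow> c a b d (ext_class Y [x, y, z]) = minor3 a b d x y z"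
    using ext_coord3[of Y] by metis
  have "\<exists>\<kappa>. zbasis (exterior_power Y 3) (e ` Q) \<kappa> \<and> (\<forall>p \<in> Q. \<kappa> (e p) = (\<lambda>(a, b, d). c a b d) p)"
  proof (rule zbasis_family)
    show "finite Q" by (rule finite_subset[of _ "Y \<times> Y \<times> Y"]) (auto simp: Q_def assms)
    show "e p \<in> carrier (exterior_power Y 3)" if "p \<in> Q" for p
      using that by (auto simp: Q_def e_def intro!: ext_class_closed)
    show "(\<lambda>(a, b, d). c a b d) p \<in> hom (exterior_power Y 3) integer_group" for p
      using c(1) by (cases p) auto
    show "(\<lambda>(a, b, d). c a b d) p (e q) = (if p = q then 1 else 0)" if "p \<in> Q" "q \<in> Q" for p q
      using that by (auto simp: Q_def e_def c(2) minor3_def minor2_def delta_def split: if_splits)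
    show "generate (exterior_power Y 3) (e ` Q) = carrier (exterior_power Y 3)"
    proof (rule generate_exterior_power)
      let ?G = "generate (exterior_power Y 3) (e ` Q)"
      show sub: "subgroup ?G (exterior_power Y 3)"
        by (rule P.generate_is_subgroup) (auto simp: Q_def e_def intro!: ext_class_closed)
      fix w assume "w \<in> lists Y" "length w = 3"
      then obtain x y z where w: "w = [x, y, z]" "x \<in> Y" "y \<in> Y" "z \<in> Y" by (auto simp:
          numeral_3_eq_3 length_Suc_conv)
      have srt: "ext_class Y [x, y, z] \<in> ?G"
        if "x \<in> Y" "y \<in> Y" "z \<in> Y" "idx x < idx y" "idx y < idx z" for x y z
        using that by (intro generate.incl) (auto simp: Q_def e_def image_iff)
      have inv: "\<ominus>\<^bsub>exterior_algebra Y\<^esub> ext_class Y [x, y, z] \<in> ?G" if "x \<in> Y" "y \<in> Y" "z \<in> Y"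
          "ext_class Y [x, y, z] \<in> ?G" for x y z
        using subgroup.m_inv_closed[OF sub that(4)] exterior_power_inv[of "ext_class Y [x, y, z]" Y 3] that
        by (simp add: ext_class_closed)
      have sw1: "ext_class Y [y, x, z] \<in> ?G" if "x \<in> Y" "y \<in> Y" "z \<in> Y" "ext_class Y [x, y, z] \<in> ?G"
          for x y z
        using ext_class_anti[of "[]" y x "[z]" Y] inv[OF that] that by simp
      have sw2: "ext_class Y [x, z, y] \<in> ?G" if "x \<in> Y" "y \<in> Y" "z \<in> Y" "ext_class Y [x, y, z] \<in> ?G"
          for x y z
        using ext_class_anti[of "[x]" z y "[]" Y] inv[OF that] that by simp
      have r1: "ext_class Y [x, x, z] \<in> ?G" if "x \<in> Y" "z \<in> Y" for x z
        using ext_class_zero[of "[]" x "[z]" Y] subgroup.one_closed[OF sub] that by simp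
      have r2: "ext_class Y [x, z, z] \<in> ?G" if "x \<in> Y" "z \<in> Y" for x z
        using ext_class_zero[of "[x]" z "[]" Y] subgroup.one_closed[OF sub] that by simp
      have lin: "idx x < idx y \<or> idx y < idx x \<or> x = y" if "x \<in> Y" "y \<in> Y" for x y
        using idx that by (metis inj_onD linorder_neqE_nat)
      \<comment> \<open>Insertion of \<open>z\<close> into the already ordered pair
        \<open>x\<close>, \<open>y\<close>.\<close>
      have up: "ext_class Y [x, y, z] \<in> ?G" if "x \<in> Y" "y \<in> Y" "z \<in> Y" "idx x < idx y" for x y z
        using lin[OF that(2,3)] lin[OF that(1,3)]
      proof (elim disjE)
        assume "idx z < idx y" "idx x < idx z"
        then show ?thesis using sw2[OF that(1,3,2)] srt that by blast
      next
        assume "idx z < idx y" "idx z < idx x"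
        then show ?thesis using sw2[OF that(1,3,2)] sw1[OF that(3,1,2)] srt that by blast
      next
        assume "idx z < idx y" "x = z"
        then show ?thesis using sw2[OF that(1,3,2)] r1 that by blast
      qed (use srt r2 that in auto)
      show "ext_class Y w \<in> ?G"
        unfolding w(1) using lin[OF w(2,3)] up sw1[OF w(3,2,4)] r1 w by blast
    qed
  qed
  then show ?thesis by blast
qed

section \<open>The module structure of the infinitesimal Alexander invariant\<close>

locale alexander = lie_ring E for E (structure) +
  fixes Y :: "'y set" and g :: "'y \<Rightarrow> 'a"
  assumes g_closed: "\<And>y. y \<in> Y \<Longrightarrow> g y \<in> carrier E"
begin

abbreviation D1 where "D1 \<equiv> derived1 E"
abbreviation D2 where "D2 \<equiv> derived2 E"
abbreviation A where "A \<equiv> alexander_group E"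
abbreviation cl where "cl \<equiv> alexander_class E"

sublocale D2: nonassoc_quot E D2 by unfold_locales (rule derived2_ideal)

lemma D1_carrier: "u \<in> D1 \<Longrightarrow> u \<in> carrier E"
  by (rule derived_carrier[of "carrier E"]) auto

lemma D1_subgroup: "subgroup D1 (add_monoid E)"
  by (rule derived_subgroup) auto

sublocale D1: additive_subgroup D1 E by (rule additive_subgroupI[OF D1_subgroup])

lemma D1_prod: "x \<in> carrier E \<Longrightarrow> y \<in> carrier E \<Longrightarrow> x \<otimes> y \<in> D1"
  by (rule derived_incl)

lemma cl_def: "cl u = D2 +> u" by (simp add: alexander_class_def)

lemma A_simps: "carrier A = cl ` D1" "\<zero>\<^bsub>A\<^esub> = D2" "X \<oplus>\<^bsub>A\<^esub> X' = X \<oplus>\<^bsub>D2.Q\<^esub> X'"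
  by (simp_all add: alexander_group_def FactRing_def)

lemma cl_closed [simp, intro]: "u \<in> D1 \<Longrightarrow> cl u \<in> carrier A"
  by (simp add: A_simps)

lemma cl_add: "u \<in> carrier E \<Longrightarrow> v \<in> carrier E \<Longrightarrow> cl u \<oplus>\<^bsub>A\<^esub> cl v = cl (u \<oplus> v)"
  by (simp add: A_simps cl_def D2.add_Q)

lemma cl_zero_iff: "u \<in> carrier E \<Longrightarrow> cl u = \<zero>\<^bsub>A\<^esub> \<longleftrightarrow> u \<in> D2"
  by (simp add: cl_def A_simps D2.rcos_I_iff)

lemma carrier_A_E: "X \<in> carrier A \<Longrightarrow> (\<And>u. u \<in> D1 \<Longrightarrow> X = cl u \<Longrightarrow> P) \<Longrightarrow> P"
  by (auto simp: A_simps)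

lemma abelian_group_A: "abelian_group A"
proof (rule abelian_groupI)
  show "\<zero>\<^bsub>A\<^esub> \<in> carrier A" using cl_zero_iff[of \<zero>] cl_closed[of \<zero>] by simp
next
  fix X assume X: "X \<in> carrier A"
  from X show "\<zero>\<^bsub>A\<^esub> \<oplus>\<^bsub>A\<^esub> X = X"
  proof (rule carrier_A_E)
    fix u assume u: "u \<in> D1" "X = cl u"
    then have "cl \<zero> \<oplus>\<^bsub>A\<^esub> cl u = cl u" using D1_carrier by (subst cl_add) auto
    then show ?thesis using u cl_zero_iff[of \<zero>] by simp
  qed
  from X show "\<exists>X'\<in>carrier A. X' \<oplus>\<^bsub>A\<^esub> X = \<zero>\<^bsub>A\<^esub>"
  proof (rule carrier_A_E)
    fix u assume u: "u \<in> D1" "X = cl u"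
    then have "cl (\<ominus> u) \<oplus>\<^bsub>A\<^esub> cl u = \<zero>\<^bsub>A\<^esub>" using D1_carrier cl_zero_iff[of \<zero>] by (simp add: cl_add l_neg)
    then show ?thesis using u by blast
  qed
next
  fix X X' assume "X \<in> carrier A" "X' \<in> carrier A"
  then obtain u v where uv: "u \<in> D1" "X = cl u" "v \<in> D1" "X' = cl v" by (auto simp: A_simps)
  then show "X \<oplus>\<^bsub>A\<^esub> X' \<in> carrier A" "X \<oplus>\<^bsub>A\<^esub> X' = X' \<oplus>\<^bsub>A\<^esub> X"
    using D1_carrier a_comm[of u v] by (auto simp: cl_add)
next
  fix X X' X'' assume "X \<in> carrier A" "X' \<in> carrier A" "X'' \<in> carrier A"
  then obtain u v w where "u \<in> D1" "X = cl u" "v \<in> D1" "X' = cl v" "w \<in> D1" "X'' = cl w" by (auto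
      simp: A_simps)
  then show "X \<oplus>\<^bsub>A\<^esub> X' \<oplus>\<^bsub>A\<^esub> X'' = X \<oplus>\<^bsub>A\<^esub> (X' \<oplus>\<^bsub>A\<^esub> X'')"
    using D1_carrier by (simp add: cl_add a_assoc)
qed

sublocale A: abelian_group A by (rule abelian_group_A)

abbreviation ad where "ad \<equiv> alexander_ad E"

text \<open>The union over representatives is a single class because E'' is an ideal.\<close>

lemma ad_cl:
  assumes e: "e \<in> carrier E" and u: "u \<in> carrier E"
  shows "ad e (cl u) = cl (e \<otimes> u)"
proof -
  have "cl (e \<otimes> v) = cl (e \<otimes> u)" if v: "v \<in> cl u" for v
  proof -
    obtain h where h: "h \<in> D2" "v = h \<oplus> u" using v by (auto simp: cl_def a_r_coset_def')
    have hc: "h \<in> carrier E" using D2.I_carrier[OF h(1)] .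
    have "e \<otimes> v = e \<otimes> h \<oplus> e \<otimes> u" using h hc e u by (simp add: prod_r_distr)
    moreover have "cl (e \<otimes> h) = \<zero>\<^bsub>A\<^esub>" using cl_zero_iff D2.I_prod(1)[OF e h(1)] e hc by simp
    ultimately show ?thesis using cl_add[of "e \<otimes> h" "e \<otimes> u"] e u hc D1_prod[OF e u] by simp
  qed
  moreover have "u \<in> cl u" using D2.AS.a_rcos_self[OF u] by (simp add: cl_def)
  ultimately have "(\<Union>v \<in> cl u. cl (e \<otimes> v)) = cl (e \<otimes> u)" by blast
  then show ?thesis by (simp add: alexander_ad_def)
qed

lemma ad_closed: "e \<in> carrier E \<Longrightarrow> X \<in> carrier A \<Longrightarrow> ad e X \<in> carrier A"
  by (erule carrier_A_E) (simp add: ad_cl D1_carrier D1_prod)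

lemma ad_add:
  assumes "e \<in> carrier E" "X \<in> carrier A" "X' \<in> carrier A"
  shows "ad e (X \<oplus>\<^bsub>A\<^esub> X') = ad e X \<oplus>\<^bsub>A\<^esub> ad e X'"
proof -
  obtain u v where uv: "u \<in> D1" "X = cl u" "v \<in> D1" "X' = cl v" using assms by (auto simp: A_simps)
  have "u \<in> carrier E" "v \<in> carrier E" using uv D1_carrier by auto
  then show ?thesis using assms(1) by (simp add: uv cl_add ad_cl prod_r_distr)
qed

text \<open>By \<open>leibniz\<close> the two orders differ by
  \<open>(e \<otimes> f) \<otimes> u\<close>, a bracket of two elements of E'. This is why the
  action on E'/E'' is one of a commutative polynomial ring.\<close>

lemma ad_commute:
  assumes "e \<in> carrier E" "f \<in> carrier E" "X \<in> carrier A"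
  shows "ad e (ad f X) = ad f (ad e X)"
proof -
  obtain u where u: "u \<in> D1" "X = cl u" using assms by (auto simp: A_simps)
  have uc: "u \<in> carrier E" using D1_carrier[OF u(1)] .
  have "(e \<otimes> f) \<otimes> u \<in> D2" using D1_prod[OF assms(1,2)] u(1) by (rule derived_incl)
  then have "cl ((e \<otimes> f) \<otimes> u) = \<zero>\<^bsub>A\<^esub>" using cl_zero_iff assms uc by simp
  moreover have "e \<otimes> (f \<otimes> u) = (e \<otimes> f) \<otimes> u \<oplus> f \<otimes> (e \<otimes> u)" by (rule leibniz[OF assms(1,2) uc])
  ultimately have "cl (e \<otimes> (f \<otimes> u)) = \<zero>\<^bsub>A\<^esub> \<oplus>\<^bsub>A\<^esub> cl (f \<otimes> (e \<otimes> u))"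
    using cl_add[of "(e \<otimes> f) \<otimes> u" "f \<otimes> (e \<otimes> u)"] assms uc by (metis prod_closed)
  also have "\<dots> = cl (f \<otimes> (e \<otimes> u))"
    using assms uc by (intro A.l_zero cl_closed D1_prod) auto
  finally have "cl (e \<otimes> (f \<otimes> u)) = cl (f \<otimes> (e \<otimes> u))" .
  then show ?thesis using assms uc by (simp add: u ad_cl)
qed

abbreviation word where "word ys \<equiv> foldr (\<lambda>y. ad (g y)) ys"

lemma word_closed: "set ys \<subseteq> Y \<Longrightarrow> X \<in> carrier A \<Longrightarrow> word ys X \<in> carrier A"
  by (induction ys) (auto simp: ad_closed g_closed)

lemma word_remove: "set ys \<subseteq> Y \<Longrightarrow> y \<in> set ys \<Longrightarrow> X \<in> carrier A \<Longrightarrow> word ys X = ad (g y) (word (remove1 y ys) X)"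
proof (induction ys)
  case (Cons z ys)
  show ?case
  proof (cases "z = y")
    case False
    then have IH: "word ys X = ad (g y) (word (remove1 y ys) X)" using Cons by auto
    have "word (remove1 y ys) X \<in> carrier A"
      using Cons.prems set_remove1_subset[of y ys] by (intro word_closed) auto
    from ad_commute[OF g_closed g_closed this, of z y] show ?thesis using False Cons.prems IH by auto
  qed simp
qed simp

text \<open>Commuting actions allow any letter to be brought to the front, and induction handles the
  rest.\<close>

lemma word_perm: "set ys \<subseteq> Y \<Longrightarrow> mset ys = mset zs \<Longrightarrow> X \<in> carrier A \<Longrightarrow> word ys X = word zs X"
proof (induction ys arbitrary: zs)
  case (Cons y ys)
  have y: "y \<in> set zs" using Cons.prems(2) by (metis list.set_intros(1) set_mset_mset)
  have "mset ys = mset (remove1 y zs)" using Cons.prems(2) by (metis add_mset_remove_trivial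
      mset.simps(2) mset_remove1)
  then have "word ys X = word (remove1 y zs) X" using Cons by auto
  moreover have "set zs \<subseteq> Y" using Cons.prems by (metis set_mset_mset)
  ultimately show ?case using word_remove[OF _ y Cons.prems(3)] by simp
qed simp

abbreviation mact where "mact \<equiv> alexander_monomial_action E g"

text \<open>Frees the monomial action from the order picked by \<open>SOME\<close>: any enumeration
  of the variables may be used.\<close>

lemma mact_word: "set ys \<subseteq> Y \<Longrightarrow> X \<in> carrier A \<Longrightarrow> mact (mset ys) X = word ys X"
  unfolding alexander_monomial_action_def
  using someI[of "\<lambda>zs. mset zs = mset ys" ys]
  by (intro word_perm[symmetric]) (auto simp: eq_commute)

lemma mact_closed: "set_mset m \<subseteq> Y \<Longrightarrow> X \<in> carrier A \<Longrightarrow> mact m X \<in> carrier A"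
proof -
  assume a: "set_mset m \<subseteq> Y" "X \<in> carrier A"
  obtain ys where "mset ys = m" using ex_mset by blast
  then show ?thesis using a mact_word[of ys X] word_closed[of ys X] by auto
qed

lemma mact_empty: "X \<in> carrier A \<Longrightarrow> mact {#} X = X"
  using mact_word[of "[]" X] by simp

lemma mact_union: "set_mset m \<subseteq> Y \<Longrightarrow> set_mset n \<subseteq> Y \<Longrightarrow> X \<in> carrier A \<Longrightarrow> mact (m + n) X = mact m (mact n X)"
proof -
  assume a: "set_mset m \<subseteq> Y" "set_mset n \<subseteq> Y" "X \<in> carrier A"
  obtain ys zs where yz: "mset ys = m" "mset zs = n" using ex_mset by metis
  have "mact (mset (ys @ zs)) X = word (ys @ zs) X" using a yz by (intro mact_word) auto
  moreover have "mact (mset zs) X = word zs X" using a yz by (intro mact_word) auto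
  moreover have "mact (mset ys) (word zs X) = word ys (word zs X)"
    using a yz by (intro mact_word word_closed) auto
  ultimately show ?thesis using yz by simp
qed

lemma mact_single: "y \<in> Y \<Longrightarrow> X \<in> carrier A \<Longrightarrow> mact {#y#} X = ad (g y) X"
  using mact_word[of "[y]" X] by simp

lemma mact_add:
  assumes "set_mset m \<subseteq> Y" "X \<in> carrier A" "X' \<in> carrier A"
  shows "mact m (X \<oplus>\<^bsub>A\<^esub> X') = mact m X \<oplus>\<^bsub>A\<^esub> mact m X'"
proof -
  obtain ys where ys: "mset ys = m" using ex_mset by metis
  have "set ys \<subseteq> Y \<Longrightarrow> word ys (X \<oplus>\<^bsub>A\<^esub> X') = word ys X \<oplus>\<^bsub>A\<^esub> word ys X'"
    by (induction ys) (use assms in \<open>auto simp: ad_add word_closed g_closed\<close>)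
  then show ?thesis using assms ys mact_word[of ys] by auto
qed

lemma mact_hom: "set_mset m \<subseteq> Y \<Longrightarrow> mact m \<in> hom (add_monoid A) (add_monoid A)"
  by (rule homI) (auto simp: mact_closed mact_add)

abbreviation BB where "BB \<equiv> alexander_invariant E g"

lemma BB_simps [simp]: "carrier BB = carrier A" "\<zero>\<^bsub>BB\<^esub> = \<zero>\<^bsub>A\<^esub>" "X \<oplus>\<^bsub>BB\<^esub> X' = X \<oplus>\<^bsub>A\<^esub> X'"
  by (simp_all add: alexander_invariant_def ring.defs)

text \<open>For a fixed class the action is the linear extension, in the polynomial, of the monomial
  action; additivity in the scalar is then an instance of \<open>zlift_hom\<close>.\<close>

lemma BB_smult: "p \<odot>\<^bsub>BB\<^esub> X = zlift (add_monoid A) (\<lambda>m. mact m X) p"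
  by (simp add: alexander_invariant_def ring.defs module.defs zlift_def finsum_def add_pow_def)

lemma abelian_group_BB: "abelian_group BB"
  by (rule comm_group_abelian_groupI, rule comm_group_cong[OF A.a_comm_group]) (simp_all add: fun_eq_iff)

lemma BB_smult_hom:
  assumes "X \<in> carrier A"
  shows "(\<lambda>p. p \<odot>\<^bsub>BB\<^esub> X) \<in> hom (add_monoid (int_poly Y)) (add_monoid A)"
proof -
  have "zlift (add_monoid A) (\<lambda>m. mact m X) \<in> hom (free_Abelian_group {m. set_mset m \<subseteq> Y}) (add_monoid A)"
    by (rule comm_group.zlift_hom[OF A.a_comm_group]) (use assms mact_closed in auto)
  then show ?thesis unfolding BB_smult by (auto simp: hom_def carrier_int_poly simp del:
      carrier_free_Abelian_group_iff)
qed

lemma BB_smult_closed: "X \<in> carrier A \<Longrightarrow> p \<in> carrier (int_poly Y) \<Longrightarrow> p \<odot>\<^bsub>BB\<^esub> X \<in> carrier A"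
  using hom_in_carrier[OF BB_smult_hom] by simp

lemma BB_smult_add: "X \<in> carrier A \<Longrightarrow> p \<in> carrier (int_poly Y) \<Longrightarrow> q \<in> carrier (int_poly Y) \<Longrightarrow>
    (p + q) \<odot>\<^bsub>BB\<^esub> X = p \<odot>\<^bsub>BB\<^esub> X \<oplus>\<^bsub>A\<^esub> q \<odot>\<^bsub>BB\<^esub> X"
  using hom_mult[OF BB_smult_hom, of X p q] by simp

lemma BB_smult_zero: "X \<in> carrier A \<Longrightarrow> 0 \<odot>\<^bsub>BB\<^esub> X = \<zero>\<^bsub>A\<^esub>"
  using hom_zero[OF int_poly.abelian_group_axioms abelian_group_A BB_smult_hom] by simp

lemma BB_smult_diff: "X \<in> carrier A \<Longrightarrow> p \<in> carrier (int_poly Y) \<Longrightarrow> q \<in> carrier (int_poly Y) \<Longrightarrow>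
    (p - q) \<odot>\<^bsub>BB\<^esub> X = p \<odot>\<^bsub>BB\<^esub> X \<ominus>\<^bsub>A\<^esub> q \<odot>\<^bsub>BB\<^esub> X"
  using hom_a_minus[OF int_poly.abelian_group_axioms abelian_group_A BB_smult_hom, of X p q] by simp

lemma BB_smult_monom: "X \<in> carrier A \<Longrightarrow> set_mset m \<subseteq> Y \<Longrightarrow> frag_of m \<odot>\<^bsub>BB\<^esub> X = mact m X"
  unfolding BB_smult using comm_group.zlift_frag_of[OF A.a_comm_group, of "\<lambda>m. mact m X" m]
      mact_closed[of m X] by simp

lemma BB_smult_right_hom:
  assumes "p \<in> carrier (int_poly Y)" "X \<in> carrier A" "X' \<in> carrier A"
  shows "p \<odot>\<^bsub>BB\<^esub> (X \<oplus>\<^bsub>A\<^esub> X') = p \<odot>\<^bsub>BB\<^esub> X \<oplus>\<^bsub>A\<^esub> p \<odot>\<^bsub>BB\<^esub> X'"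
  using assms(1)
proof (induction p rule: int_poly_induct)
  case zero
  then show ?case using assms by (simp add: BB_smult_zero)
next
  case (diff p q)
  then show ?case using assms by (simp add: BB_smult_diff BB_smult_closed A.diff_add_diff)
next
  case (monom m)
  then show ?case using assms by (simp add: BB_smult_monom mact_add)
qed

lemma mact_diff: "set_mset m \<subseteq> Y \<Longrightarrow> X \<in> carrier A \<Longrightarrow> X' \<in> carrier A \<Longrightarrow> mact m (X \<ominus>\<^bsub>A\<^esub> X') = mact m X
    \<ominus>\<^bsub>A\<^esub> mact m X'"
  by (rule hom_a_minus[OF abelian_group_A abelian_group_A mact_hom])

text \<open>Associativity of the action is additive in both polynomials and so reduces to monomials,
  where it says that the action of a concatenated word is a composition.\<close>

lemma module_BB: "module (int_poly Y) BB"
proof (rule moduleI)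
  show "cring (int_poly Y)" by (rule cring_int_poly)
  show "abelian_group BB" by (rule abelian_group_BB)
  show "(p \<otimes>\<^bsub>int_poly Y\<^esub> q) \<odot>\<^bsub>BB\<^esub> X = p \<odot>\<^bsub>BB\<^esub> (q \<odot>\<^bsub>BB\<^esub> X)"
    if p: "p \<in> carrier (int_poly Y)" and q: "q \<in> carrier (int_poly Y)" and X: "X \<in> carrier BB" for p q X
    using p
  proof (induction p rule: int_poly_induct)
    case zero
    then show ?case using X q by (simp add: BB_smult_zero BB_smult_closed)
  next
    case (diff p p')
    then show ?case using X q by (simp add: BB_smult_diff BB_smult_closed left_diff_distrib)
  next
    case (monom m)
    have mc: "frag_of m \<in> carrier (int_poly Y)" using monom by (simp add: int_poly_iff)
    show ?case
      using q
    proof (induction q rule: int_poly_induct)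
      case zero
      have "mact m \<zero>\<^bsub>A\<^esub> = \<zero>\<^bsub>A\<^esub>" by (rule hom_zero[OF abelian_group_A abelian_group_A mact_hom[OF monom]])
      then show ?case using X monom by (simp add: BB_smult_zero BB_smult_monom)
    next
      case (diff q q')
      then show ?case using X monom mc
        by (simp add: BB_smult_diff BB_smult_closed right_diff_distrib BB_smult_monom mact_diff)
    next
      case (monom n)
      have "frag_of m * frag_of n = frag_of (m + n)" by (simp add: mult_single)
      then show ?case using X monom \<open>set_mset m \<subseteq> Y\<close> by (simp add: BB_smult_monom mact_union mact_closed)
    qed
  qed
  show "\<one>\<^bsub>int_poly Y\<^esub> \<odot>\<^bsub>BB\<^esub> X = X" if "X \<in> carrier BB" for X
    using that BB_smult_monom[of X "{#}"] mact_empty[of X] by (simp add: frag_of_zero_mset)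
qed (simp_all add: BB_smult_closed BB_smult_add BB_smult_right_hom)

lemma BB_smult_var: "y \<in> Y \<Longrightarrow> u \<in> D1 \<Longrightarrow> var y \<odot>\<^bsub>BB\<^esub> cl u = cl (g y \<otimes> u)"
  unfolding var_def using BB_smult_monom[of "cl u" "{#y#}"] by (simp add: mact_single ad_cl g_closed
      D1_carrier)

end

lemma (in nonassoc_quot) quot_universal:
  assumes H: "group H" and h: "h \<in> hom (add_monoid L) H" and hI: "\<And>x. x \<in> I \<Longrightarrow> h x = \<one>\<^bsub>H\<^esub>"
  shows "\<exists>k \<in> hom (add_monoid Q) H. \<forall>x \<in> carrier L. k (I +> x) = h x"
proof -
  interpret h: group_hom "add_monoid L" H h by (rule group_homI[OF a_group H h])
  obtain k where k: "k \<in> hom (add_monoid L Mod I) H"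
    "\<And>x. x \<in> carrier (add_monoid L) \<Longrightarrow> k (I #>\<^bsub>add_monoid L\<^esub> x) = h x"
  proof (rule FactGroup_universal[OF h AS.a_normal])
    fix x y assume x: "x \<in> carrier (add_monoid L)" and y: "y \<in> carrier (add_monoid L)"
      and e: "I #>\<^bsub>add_monoid L\<^esub> x = I #>\<^bsub>add_monoid L\<^esub> y"
    have xy: "x \<in> carrier L" "y \<in> carrier L" using x y by simp_all
    have "x \<ominus> y \<in> I" using e rcos_eq_iff[OF xy] by (simp add: a_r_coset_def)
    then have 1: "h (x \<ominus> y) = \<one>\<^bsub>H\<^esub>" by (rule hI)
    have "x = (x \<ominus> y) \<oplus> y" using xy by (simp add: a_minus_def a_assoc l_neg)
    then have "h x = h (x \<ominus> y) \<otimes>\<^bsub>H\<^esub> h y"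
      using h.hom_mult[of "x \<ominus> y" y] xy by (metis minus_closed monoid.select_convs(1)
          partial_object.select_convs(1))
    then show "h x = h y" using 1 h.hom_closed[OF y] group.is_monoid[OF H] by (simp add: monoid.l_one)
  qed blast
  have "k \<in> hom (add_monoid Q) H"
    using k(1) by (auto simp: hom_def FactRing_def FactGroup_def A_RCOSETS_def set_add_def)
  moreover have "k (I +> x) = h x" if "x \<in> carrier L" for x
    using k(2)[of x] that by (simp add: a_r_coset_def)
  ultimately show ?thesis by blast
qed

lemma DirProd_comm_group: "comm_group G \<Longrightarrow> comm_group H \<Longrightarrow> comm_group (G \<times>\<times> H)"
proof -
  assume G: "comm_group G" and H: "comm_group H"
  interpret G: comm_group G by fact
  interpret H: comm_group H by fact
  show ?thesis
    by (rule group.group_comm_groupI[OF DirProd_group[OF G.is_group H.is_group]])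
      (auto simp: G.m_comm H.m_comm)
qed

section \<open>Gradings of quotients\<close>

text \<open>Both composites are homomorphisms, so they need to be compared on homogeneous elements
  only, where each projection is the identity or zero.\<close>

lemma graded_proj_commute:
  assumes g: "graded_proj M D P" and g': "graded_proj M' D' P'"
    and h: "h \<in> hom (add_monoid M) (add_monoid M')" and hD: "\<And>k. h ` D k \<subseteq> D' k" and x: "x \<in> carrier M"
  shows "P' k (h x) = h (P k x)"
proof -
  interpret M: abelian_group M using g by (simp add: graded_proj_def)
  interpret M': abelian_group M' using g' by (simp add: graded_proj_def)
  have P: "P k \<in> hom (add_monoid M) (add_monoid M)" and P': "P' k \<in> hom (add_monoid M') (add_monoid M')"
    using g g' by (auto simp: graded_proj_def)
  have "x \<in> generate (add_monoid M) (\<Union>k. D k)" using g x by (auto simp: graded_proj_def)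
  then have "(P' k \<circ> h) x = (h \<circ> P k) x"
  proof (rule hom_eq_on_generate[OF M.a_group M'.a_group, rotated -1])
    show "P' k \<circ> h \<in> hom (add_monoid M) (add_monoid M')" by (rule hom_compose[OF h P'])
    show "h \<circ> P k \<in> hom (add_monoid M) (add_monoid M')" by (rule hom_compose[OF P h])
    show "(\<Union>k. D k) \<subseteq> carrier (add_monoid M)"
      using g subgroup.subset by (fastforce simp: graded_proj_def)
    fix y assume "y \<in> (\<Union>k. D k)"
    then obtain j where y: "y \<in> D j" "h y \<in> D' j" using hD by blast
    show "(P' k \<circ> h) y = (h \<circ> P k) y"
    proof (cases "j = k")
      case True
      then show ?thesis using y g g' by (simp add: graded_proj_def)
    next
      case False
      then have "P k y = \<zero>\<^bsub>M\<^esub>" "P' k (h y) = \<zero>\<^bsub>M'\<^esub>" using y g g' by (auto simp: graded_proj_def)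
      then show ?thesis using hom_zero[OF M.abelian_group_axioms M'.abelian_group_axioms h] by simp
    qed
  qed
  then show ?thesis by simp
qed

text \<open>The kernel of \<open>\<psi>\<close> is the image of a homogeneous map and is therefore
  stable under the projections, which consequently descend to \<open>N\<close>.\<close>

lemma graded_quotient:
  assumes g: "graded_proj M D P" and g': "graded_proj M' D' P'"
    and h: "h \<in> hom (add_monoid M') (add_monoid M)" and hD: "\<And>k. h ` D' k \<subseteq> D k"
    and N: "abelian_group N" and \<psi>: "\<psi> \<in> hom (add_monoid M) (add_monoid N)"
    and surj: "\<psi> ` carrier M = carrier N"
    and ker: "\<And>x. x \<in> carrier M \<Longrightarrow> \<psi> x = \<zero>\<^bsub>N\<^esub> \<longleftrightarrow> x \<in> h ` carrier M'"
  shows "graded_group N (\<lambda>k. \<psi> ` D k)"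
proof -
  interpret M: abelian_group M using g by (simp add: graded_proj_def)
  interpret M': abelian_group M' using g' by (simp add: graded_proj_def)
  interpret N: abelian_group N by fact
  have P: "P k \<in> hom (add_monoid M) (add_monoid M)" for k using g by (auto simp: graded_proj_def)
  have D: "subgroup (D k) (add_monoid M)" for k using g by (auto simp: graded_proj_def)
  have Dc: "D k \<subseteq> carrier M" for k using subgroup.subset[OF D] by simp
  have Pc: "P k x \<in> carrier M" if "x \<in> carrier M" for k x using hom_in_carrier[OF P] that by simp
  have \<psi>c: "\<psi> x \<in> carrier N" if "x \<in> carrier M" for x using hom_in_carrier[OF \<psi>] that by simp
  \<comment> \<open>Two preimages differ by some \<open>h z\<close>, and projecting gives
    \<open>h (P' k z)\<close>, which \<open>\<psi>\<close> kills again.\<close>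
  have wd: "\<psi> (P k x) = \<psi> (P k y)" if xy: "x \<in> carrier M" "y \<in> carrier M" and e: "\<psi> x = \<psi> y" for k x y
  proof -
    have "\<psi> (x \<ominus>\<^bsub>M\<^esub> y) = \<zero>\<^bsub>N\<^esub>"
      using hom_a_minus[OF M.abelian_group_axioms N \<psi> xy] e \<psi>c xy by (simp add: N.minus_eq_zero_iff)
    then obtain z where z: "z \<in> carrier M'" "x \<ominus>\<^bsub>M\<^esub> y = h z" using ker xy M.minus_closed by blast
    have "P k (x \<ominus>\<^bsub>M\<^esub> y) = h (P' k z)" unfolding z(2) by (rule graded_proj_commute[OF g' g h hD z(1)])
    moreover have "P' k z \<in> carrier M'" using g' z hom_in_carrier by (fastforce simp: graded_proj_def)
    ultimately have "\<psi> (P k (x \<ominus>\<^bsub>M\<^esub> y)) = \<zero>\<^bsub>N\<^esub>" using ker[OF Pc[OF M.minus_closed[OF xy]]] by blast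
    then have "\<psi> (P k x) \<ominus>\<^bsub>N\<^esub> \<psi> (P k y) = \<zero>\<^bsub>N\<^esub>"
      using hom_a_minus[OF M.abelian_group_axioms M.abelian_group_axioms P xy]
        hom_a_minus[OF M.abelian_group_axioms N \<psi> Pc[OF xy(1)] Pc[OF xy(2)]] by simp
    then show ?thesis using \<psi>c Pc xy by (simp add: N.minus_eq_zero_iff)
  qed
  define s where "s X = (SOME x. x \<in> carrier M \<and> \<psi> x = X)" for X
  have s: "s X \<in> carrier M \<and> \<psi> (s X) = X" if "X \<in> carrier N" for X
    unfolding s_def by (rule someI_ex) (use that in \<open>unfold surj[symmetric], blast\<close>)
  define R where "R k X = \<psi> (P k (s X))" for k X
  have R: "R k (\<psi> x) = \<psi> (P k x)" if "x \<in> carrier M" for k x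
    unfolding R_def by (rule wd) (use s[OF \<psi>c[OF that]] that in auto)
  show ?thesis
  proof (rule graded_groupI[where P = R, OF N])
    show "subgroup (\<psi> ` D k) (add_monoid N)" for k
      by (rule group_hom.subgroup_img_is_subgroup[OF group_homI[OF M.a_group N.a_group \<psi>] D])
    show "R k \<in> hom (add_monoid N) (add_monoid N)" for k
    proof (rule homI)
      fix X assume X: "X \<in> carrier (add_monoid N)"
      then show "R k X \<in> carrier (add_monoid N)" using s \<psi>c Pc by (simp add: R_def)
      fix X' assume X': "X' \<in> carrier (add_monoid N)"
      have c: "s X \<in> carrier M" "\<psi> (s X) = X" "s X' \<in> carrier M" "\<psi> (s X') = X'" using s X X' by auto
      have "R k (\<psi> (s X \<oplus>\<^bsub>M\<^esub> s X')) = R k X \<oplus>\<^bsub>N\<^esub> R k X'"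
        unfolding R[OF M.a_closed[OF c(1,3)]]
        using c hom_mult[OF P, of "s X" "s X'"] hom_mult[OF \<psi>, of "P k (s X)" "P k (s X')"] Pc by
            (simp add: R_def)
      then show "R k (X \<otimes>\<^bsub>add_monoid N\<^esub> X') = R k X \<otimes>\<^bsub>add_monoid N\<^esub> R k X'"
        using c hom_mult[OF \<psi>, of "s X" "s X'"] by simp
    qed
    show "R k X = X" if "X \<in> \<psi> ` D k" for k X
      using that R Dc g by (auto simp: graded_proj_def subset_iff)
    show "R k X = \<zero>\<^bsub>N\<^esub>" if XX: "X \<in> \<psi> ` D j" "j \<noteq> k" for k j X
    proof -
      obtain x where x: "x \<in> D j" "X = \<psi> x" using XX by auto
      then have "P k x = \<zero>\<^bsub>M\<^esub>" using g XX(2) by (auto simp: graded_proj_def)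
      then show ?thesis using x R[of x k] Dc[of j] hom_zero[OF M.abelian_group_axioms N \<psi>] by auto
    qed
    show "carrier N \<subseteq> generate (add_monoid N) (\<Union>k. \<psi> ` D k)"
    proof -
      interpret \<psi>: group_hom "add_monoid M" "add_monoid N" \<psi> by (rule group_homI[OF M.a_group N.a_group \<psi>])
      have "generate (add_monoid N) (\<psi> ` (\<Union>k. D k)) = \<psi> ` generate (add_monoid M) (\<Union>k. D k)"
        by (rule \<psi>.generate_img) (use Dc in auto)
      moreover have "carrier M \<subseteq> generate (add_monoid M) (\<Union>k. D k)" using g by (auto simp: graded_proj_def)
      ultimately show ?thesis unfolding surj[symmetric] image_UN[symmetric] by blast
    qed
  qed
qed

section \<open>Degree two of the free Lie ring\<close>

abbreviation lcl :: "'y set \<Rightarrow> ('y bracket_tree \<Rightarrow>\<^sub>0 int) \<Rightarrow> ('y bracket_tree \<Rightarrow>\<^sub>0 int) set" where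
  "lcl Y f \<equiv> lie_relations Y +>\<^bsub>free_nonassoc Y\<^esub> f"

text \<open>A tree splits in at most one way as a product, so no coefficients are added up.\<close>

lemma lookup_tmul:
  "Poly_Mapping.lookup (tmul f g) (Leaf a) = 0"
  "Poly_Mapping.lookup (tmul f g) (Br s t) = Poly_Mapping.lookup f s * Poly_Mapping.lookup g t"
proof -
  show "Poly_Mapping.lookup (tmul f g) (Leaf a) = 0"
    by (auto simp flip: not_in_keys_iff_lookup_eq_zero dest!: subsetD[OF keys_bilin])
  show "Poly_Mapping.lookup (tmul f g) (Br s t) = Poly_Mapping.lookup f s * Poly_Mapping.lookup g t"
  proof (induction f rule: frag_induction[OF subset_UNIV])
    case (2 u)
    show ?case
      by (induction g rule: frag_induction[OF subset_UNIV])
        (auto simp: bilin_simps lookup_minus algebra_simps)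
  qed (simp_all add: bilin_simps lookup_minus algebra_simps)
qed

interpretation FLie: lie_ring "free_lie Y" for Y by (rule lie_ring_free_lie)

lemma free_lie_simps:
  "carrier (free_lie Y) = lcl Y ` carrier (free_nonassoc Y)" "\<zero>\<^bsub>free_lie Y\<^esub> = lie_relations Y"
  "f \<in> carrier (free_nonassoc Y) \<Longrightarrow> g \<in> carrier (free_nonassoc Y) \<Longrightarrow> lcl Y f \<oplus>\<^bsub>free_lie Y\<^esub> lcl Y g =
      lcl Y (f + g)"
  "f \<in> carrier (free_nonassoc Y) \<Longrightarrow> g \<in> carrier (free_nonassoc Y) \<Longrightarrow> lcl Y f \<otimes>\<^bsub>free_lie Y\<^esub> lcl Y g =
      lcl Y (tmul f g)"
  "f \<in> carrier (free_nonassoc Y) \<Longrightarrow> \<ominus>\<^bsub>free_lie Y\<^esub> lcl Y f = lcl Y (- f)"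
  "f \<in> carrier (free_nonassoc Y) \<Longrightarrow> g \<in> carrier (free_nonassoc Y) \<Longrightarrow> lcl Y f \<ominus>\<^bsub>free_lie Y\<^esub> lcl Y g =
      lcl Y (f - g)"
  "f \<in> carrier (free_nonassoc Y) \<Longrightarrow> g \<in> carrier (free_nonassoc Y) \<Longrightarrow> lcl Y f = lcl Y g \<longleftrightarrow> f - g \<in>
      lie_relations Y"
  "f \<in> carrier (free_nonassoc Y) \<Longrightarrow> lcl Y f = \<zero>\<^bsub>free_lie Y\<^esub> \<longleftrightarrow> f \<in> lie_relations Y"
  unfolding free_lie_def
  using FL.carrier_Q[of Y] FL.zero_Q[of Y] FL.add_Q[of f Y g] FL.mult_Q[of f Y g] FL.rcos_minus[of f
      Y] FL.rcos_diff[of f Y g]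
    FL.rcos_eq_iff[of f Y g] FL.rcos_I_iff[of f Y]
  by simp_all

lemma lcl_closed [intro]: "f \<in> carrier (free_nonassoc Y) \<Longrightarrow> lcl Y f \<in> carrier (free_lie Y)"
  by (simp add: free_lie_simps)

definition hom_trees :: "'y set \<Rightarrow> nat \<Rightarrow> 'y bracket_tree set" where
  "hom_trees Y k = {t. set_tree t \<subseteq> Y \<and> leaves t = k}"

lemma free_lie_part_eq: "free_lie_part Y k = lcl Y ` carrier (free_Abelian_group (hom_trees Y k))"
proof -
  have "{f \<in> carrier (free_nonassoc Y). \<forall>t \<in> Poly_Mapping.keys f. leaves t = k} = carrier
      (free_Abelian_group (hom_trees Y k))"
    unfolding free_nonassoc_def free_Abelian_group_def hom_trees_def by (simp, blast)
  then show ?thesis unfolding free_lie_part_def by simp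
qed

lemma hom_trees_carrier: "f \<in> carrier (free_Abelian_group (hom_trees Y k)) \<Longrightarrow> f \<in> carrier (free_nonassoc Y)"
  unfolding free_nonassoc_iff by (auto simp: hom_trees_def)

lemma free_lie_part_subgroup: "subgroup (free_lie_part Y k) (add_monoid (free_lie Y))"
proof -
  have "subgroup (carrier (free_Abelian_group (hom_trees Y k))) (add_monoid (free_nonassoc Y))"
  proof (rule FN.add.subgroupI)
    have "0 \<in> carrier (free_Abelian_group (hom_trees Y k))" by simp
    then show "carrier (free_Abelian_group (hom_trees Y k)) \<noteq> {}" by blast
    fix a assume a: "a \<in> carrier (free_Abelian_group (hom_trees Y k))"
    then show "\<ominus>\<^bsub>free_nonassoc Y\<^esub> a \<in> carrier (free_Abelian_group (hom_trees Y k))"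
      using hom_trees_carrier[OF a] by simp
    fix b assume b: "b \<in> carrier (free_Abelian_group (hom_trees Y k))"
    show "a \<oplus>\<^bsub>free_nonassoc Y\<^esub> b \<in> carrier (free_Abelian_group (hom_trees Y k))"
      using group.is_monoid[OF group_free_Abelian_group, THEN monoid.m_closed, OF a b] by simp
  qed (auto intro: hom_trees_carrier simp del: carrier_free_Abelian_group_iff)
  then show ?thesis unfolding free_lie_part_eq free_lie_def
    by (rule group_hom.subgroup_img_is_subgroup[OF group_homI[OF FN.a_group abelian_group.a_group[OF
        FL.abelian_group_Q] FL.rcos_hom]])
qed

lemma comm_group_lie_degree2: "comm_group (lie_degree2 Y)"
  by (rule comm_group_cong[OF subgroup_comm_group[OF FLie.a_comm_group free_lie_part_subgroup[of Y 2]]])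
    (simp_all add: lie_degree2_def)

lemma lie_degree2_simps [simp]: "carrier (lie_degree2 Y) = free_lie_part Y 2"
  "x \<otimes>\<^bsub>lie_degree2 Y\<^esub> y = x \<oplus>\<^bsub>free_lie Y\<^esub> y" "\<one>\<^bsub>lie_degree2 Y\<^esub> = \<zero>\<^bsub>free_lie Y\<^esub>"
  by (simp_all add: lie_degree2_def)

lemma leaves_pos: "leaves t \<ge> 1"
  by (induction t) auto

lemma hom_trees_2: "t \<in> hom_trees Y 2 \<Longrightarrow> \<exists>x \<in> Y. \<exists>y \<in> Y. t = Br (Leaf x) (Leaf y)"
proof -
  assume t: "t \<in> hom_trees Y 2"
  have one: "\<exists>x. s = Leaf x" if "leaves s = 1" for s :: "'a bracket_tree"
  proof (cases s)
    case (Br u v)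
    then show ?thesis using that leaves_pos[of u] leaves_pos[of v] by simp
  qed auto
  show ?thesis
  proof (cases t)
    case (Leaf y)
    then show ?thesis using t by (simp add: hom_trees_def)
  next
    case (Br u v)
    then have "leaves u = 1" "leaves v = 1" using t leaves_pos[of u] leaves_pos[of v] by (auto simp:
        hom_trees_def)
    then show ?thesis using one[of u] one[of v] Br t by (auto simp: hom_trees_def)
  qed
qed

text \<open>The antisymmetrised coefficient of the bracket of two letters. It is the functional on
  degree two that corresponds to \<open>minor2 a b\<close> on the exterior square.\<close>

definition lam :: "'y \<Rightarrow> 'y \<Rightarrow> ('y bracket_tree \<Rightarrow>\<^sub>0 int) \<Rightarrow> int" where
  "lam a b f = Poly_Mapping.lookup f (Br (Leaf a) (Leaf b)) - Poly_Mapping.lookup f (Br (Leaf b) (Leaf a))"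

lemma lam_gen: "lam a b (frag_of (Br (Leaf x) (Leaf y))) = minor2 a b x y"
  unfolding lam_def minor2_def delta_def lookup_frag_of
  by (cases "a = x"; cases "b = y"; cases "a = y"; cases "b = x") simp_all

lemma lam_tmul: "lam a b (tmul f g) = Poly_Mapping.lookup f (Leaf a) * Poly_Mapping.lookup g (Leaf b)
    - Poly_Mapping.lookup f (Leaf b) * Poly_Mapping.lookup g (Leaf a)"
  by (simp add: lam_def lookup_tmul)

text \<open>\<open>lam\<close> of a product depends only on the letter coefficients of the factors.
  Asking in addition that those coefficients vanish gives an ideal \<open>?K\<close>; it contains
  squares, where the two products of coefficients cancel, and Jacobi sums, whose inner products
  contain no letters.\<close>

lemma lam_lie_relations:
  assumes "f \<in> lie_relations Y"
  shows "lam a b f = 0"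
proof -
  let ?K = "{f \<in> carrier (free_nonassoc Y). (\<forall>a. Poly_Mapping.lookup f (Leaf a) = 0) \<and> (\<forall>a b. lam a
      b f = 0)}"
  have "bracket_ideal (free_nonassoc Y) ?K"
    unfolding bracket_ideal_def
  proof (intro conjI ballI)
    show "subgroup ?K (add_monoid (free_nonassoc Y))"
    proof (rule FN.add.subgroupI)
      have "0 \<in> ?K" by (auto simp: lam_def)
      then show "?K \<noteq> {}" by blast
    qed (auto simp: lam_def lookup_add)
  qed (auto simp: lam_tmul lookup_tmul)
  moreover have "lie_axioms Y \<subseteq> ?K"
    unfolding lie_axioms_def by (auto simp: lam_tmul lookup_tmul lookup_add lam_def)
  ultimately have "lie_relations Y \<subseteq> ?K"
    unfolding lie_relations_gen by (rule FN.bracket_ideal_gen_minimal)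
  with assms show ?thesis by auto
qed

abbreviation gen2 :: "'y set \<Rightarrow> 'y \<Rightarrow> 'y \<Rightarrow> ('y bracket_tree \<Rightarrow>\<^sub>0 int) set" where
  "gen2 Y x y \<equiv> lcl Y (frag_of (Br (Leaf x) (Leaf y)))"

lemma frag_of_tree: "set_tree t \<subseteq> Y \<Longrightarrow> frag_of t \<in> carrier (free_nonassoc Y)"
  by (simp add: free_nonassoc_iff)

lemma gen2_lie: "x \<in> Y \<Longrightarrow> y \<in> Y \<Longrightarrow> gen2 Y x y = lie_gen Y x \<otimes>\<^bsub>free_lie Y\<^esub> lie_gen Y y"
  unfolding lie_gen_def by (simp add: free_lie_simps frag_of_tree bilin_simps)

lemma lie_gen_closed: "x \<in> Y \<Longrightarrow> lie_gen Y x \<in> carrier (free_lie Y)"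
  unfolding lie_gen_def by (rule lcl_closed) (simp add: frag_of_tree)

lemma gen2_part: "x \<in> Y \<Longrightarrow> y \<in> Y \<Longrightarrow> gen2 Y x y \<in> free_lie_part Y 2"
  unfolding free_lie_part_eq by (rule imageI) (simp add: hom_trees_def)

text \<open>The map exists because the bracket alternates, and it is onto because a tree with two
  leaves is a bracket of two letters. For injectivity, \<open>lam u v\<close> descends to the free
  Lie ring and pulls back to the coordinate \<open>minor2 u v\<close>, so an element with trivial
  image has only zero coordinates.\<close>

lemma lie_degree2_iso:
  assumes "finite Y"
  shows "\<exists>\<theta> \<in> iso (exterior_power Y 2) (lie_degree2 Y). \<forall>x \<in> Y. \<forall>y \<in> Y. \<theta> (ext_class Y [x, y]) = gen2 Y x y"
proof -
  interpret A: comm_group "lie_degree2 Y" by (rule comm_group_lie_degree2)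
  interpret X: comm_group "exterior_power Y 2" by (rule comm_group_exterior_power)
  have "\<exists>\<theta> \<in> hom (exterior_power Y 2) (lie_degree2 Y). \<forall>x \<in> Y. \<forall>y \<in> Y. \<theta> (ext_class Y [x, y]) = gen2 Y x y"
  proof (rule exterior_lift2[OF comm_group_lie_degree2])
    fix x assume x: "x \<in> Y"
    show "gen2 Y x x = \<one>\<^bsub>lie_degree2 Y\<^esub>" unfolding gen2_lie[OF x x] using FLie.alt[OF
        lie_gen_closed[OF x]] by simp
    fix y assume y: "y \<in> Y"
    show "gen2 Y x y \<in> carrier (lie_degree2 Y)" using gen2_part x y by simp
    show "gen2 Y x y \<otimes>\<^bsub>lie_degree2 Y\<^esub> gen2 Y y x = \<one>\<^bsub>lie_degree2 Y\<^esub>"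
      unfolding gen2_lie[OF x y] gen2_lie[OF y x]
      using FLie.antisym[OF lie_gen_closed[OF x] lie_gen_closed[OF y]]
        FLie.l_neg[OF FLie.prod_closed[OF lie_gen_closed[OF y] lie_gen_closed[OF x]]]
      by simp
  qed
  then obtain \<theta> where \<theta>: "\<theta> \<in> hom (exterior_power Y 2) (lie_degree2 Y)"
    "\<And>x y. x \<in> Y \<Longrightarrow> y \<in> Y \<Longrightarrow> \<theta> (ext_class Y [x, y]) = gen2 Y x y" by blast
  interpret \<theta>: group_hom "exterior_power Y 2" "lie_degree2 Y" \<theta> by (rule group_homI[OF X.is_group
      A.is_group \<theta>(1)])
  have surj: "carrier (lie_degree2 Y) \<subseteq> \<theta> ` carrier (exterior_power Y 2)"
  proof
    fix x assume "x \<in> carrier (lie_degree2 Y)"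
    then obtain f where f: "f \<in> carrier (free_Abelian_group (hom_trees Y 2))" "x = lcl Y f"
      by (auto simp: free_lie_part_eq simp del: carrier_free_Abelian_group_iff)
    have sub: "subgroup (\<theta> ` carrier (exterior_power Y 2)) (lie_degree2 Y)" by (rule \<theta>.img_is_subgroup)
    from f(1) have "lcl Y f \<in> \<theta> ` carrier (exterior_power Y 2)"
    proof (induction f rule: free_Abelian_induct)
      case zero
      have "lcl Y 0 = \<one>\<^bsub>lie_degree2 Y\<^esub>" using free_lie_simps(8)[of 0 Y] FL.I.zero_closed[of Y] by simp
      then show ?case using subgroup.one_closed[OF sub] by simp
    next
      case (diff f g)
      have c: "f \<in> carrier (free_nonassoc Y)" "g \<in> carrier (free_nonassoc Y)" using
          hom_trees_carrier diff by blast+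
      have gA: "lcl Y g \<in> carrier (lie_degree2 Y)" "lcl Y (- g) \<in> carrier (lie_degree2 Y)"
        using diff(2) by (auto simp: free_lie_part_eq simp del: carrier_free_Abelian_group_iff)
          (metis carrier_free_Abelian_group_iff imageI keys_minus)
      have "inv\<^bsub>lie_degree2 Y\<^esub> lcl Y g = lcl Y (- g)"
        using gA c FL.I.zero_closed[of Y] free_lie_simps(8)[of 0 Y]
        by (intro A.inv_equality) (auto simp: free_lie_simps(3) free_nonassoc_closed)
      then have "lcl Y (f - g) = lcl Y f \<otimes>\<^bsub>lie_degree2 Y\<^esub> inv\<^bsub>lie_degree2 Y\<^esub> lcl Y g"
        using c by (simp add: free_lie_simps free_nonassoc_closed)
      then show ?case using diff(3,4) subgroup.m_closed[OF sub] subgroup.m_inv_closed[OF sub] by simp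
    next
      case (frag_of t)
      then obtain x y where "x \<in> Y" "y \<in> Y" "t = Br (Leaf x) (Leaf y)" using hom_trees_2 by blast
      then show ?case using \<theta>(2) ext_class_closed[of "[x, y]" Y 2] by (metis image_eqI length_Cons
          list.size(3) lists.simps numeral_2_eq_2)
    qed
    then show "x \<in> \<theta> ` carrier (exterior_power Y 2)" using f by simp
  qed
  have inj: "w = \<one>\<^bsub>exterior_power Y 2\<^esub>" if w: "w \<in> carrier (exterior_power Y 2)" and w0: "\<theta> w =
      \<one>\<^bsub>lie_degree2 Y\<^esub>" for w
  proof -
    obtain B \<kappa> where zb: "zbasis (exterior_power Y 2) B \<kappa>"
      and \<kappa>: "\<forall>b \<in> B. \<exists>u v. u \<in> Y \<and> v \<in> Y \<and> (\<forall>x \<in> Y. \<forall>y \<in> Y. \<kappa> b (ext_class Y [x, y]) = minor2 u v x y)"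
      using zbasis_exterior_2[OF assms] by (elim exE conjE)
    show ?thesis
    proof (rule zbasis_zero[OF comm_group_exterior_power zb w])
      fix b assume b: "b \<in> B"
      from bspec[OF \<kappa> b] obtain u v where "\<forall>x \<in> Y. \<forall>y \<in> Y. \<kappa> b (ext_class Y [x, y]) = minor2 u v x y"
        by (elim exE conjE)
      then have uv: "\<kappa> b (ext_class Y [x, y]) = minor2 u v x y" if "x \<in> Y" "y \<in> Y" for x y
        using that by simp
      have "lam u v \<in> hom (add_monoid (free_nonassoc Y)) integer_group"
        by (rule homI) (auto simp: lam_def lookup_add)
      then obtain l where l: "l \<in> hom (add_monoid (free_lie Y)) integer_group"
        "\<And>f. f \<in> carrier (free_nonassoc Y) \<Longrightarrow> l (lcl Y f) = lam u v f"
        using FL.quot_universal[of integer_group "lam u v" Y] lam_lie_relations[of _ Y u v]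
        unfolding free_lie_def by (metis group_integer_group one_integer_group)
      have l2: "l \<in> hom (lie_degree2 Y) integer_group"
        using l(1) subgroup.subset[OF free_lie_part_subgroup[of Y 2]] by (auto simp: hom_def subset_iff)
      have "\<kappa> b w = (l \<circ> \<theta>) w"
      proof (rule hom_eq_on_generate[OF X.is_group group_integer_group])
        show "\<kappa> b \<in> hom (exterior_power Y 2) integer_group" using zb b by (auto simp: zbasis_def)
        show "l \<circ> \<theta> \<in> hom (exterior_power Y 2) integer_group" by (rule hom_compose[OF \<theta>(1) l2])
        show "w \<in> generate (exterior_power Y 2) {ext_class Y [x, y] | x y. x \<in> Y \<and> y \<in> Y}"
          unfolding generate_exterior_2 by (rule w)
        show "{ext_class Y [x, y] | x y. x \<in> Y \<and> y \<in> Y} \<subseteq> carrier (exterior_power Y 2)"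
          by (auto intro!: ext_class_closed)
        fix a assume "a \<in> {ext_class Y [x, y] | x y. x \<in> Y \<and> y \<in> Y}"
        then obtain x y where a: "a = ext_class Y [x, y]" "x \<in> Y" "y \<in> Y" by blast
        have "frag_of (Br (Leaf x) (Leaf y)) \<in> carrier (free_nonassoc Y)" using a by (intro
            frag_of_tree) simp
        then show "\<kappa> b a = (l \<circ> \<theta>) a"
          unfolding a(1) uv[OF a(2,3)] o_apply \<theta>(2)[OF a(2,3)] by (simp only: l(2) lam_gen)
      qed
      then show "\<kappa> b w = 0" using w0 hom_one[OF l2] A.is_group by simp
    qed
  qed
  have "\<theta> \<in> iso (exterior_power Y 2) (lie_degree2 Y)"
    unfolding \<theta>.iso_iff using surj inj by blast
  with \<theta>(2) show ?thesis by blast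
qed

section \<open>The metabelian model\<close>

text \<open>The homomorphism to the model \<open>\<int>\<^sup>Y \<oplus> M\<close>, evaluated on a bracketing: \<open>leafc\<close> gives the
  component in \<open>\<int>\<^sup>Y\<close>, \<open>eps\<close> the same as a linear form in \<open>S\<close>, and \<open>tau a b\<close> the \<open>(a,
  b)\<close>-coordinate of a representative in \<open>S \<otimes> \<And>\<^sup>2\<close> of the component in \<open>M\<close>. Coordinates are used
  because they live in a commutative ring type, where the Jacobi identity is a ring identity.\<close>

fun eps :: "'y bracket_tree \<Rightarrow> 'y multiset \<Rightarrow>\<^sub>0 int" where
  "eps (Leaf y) = var y"
| "eps (Br s t) = 0"

fun leafc :: "'y bracket_tree \<Rightarrow> 'y \<Rightarrow> int" where
  "leafc (Leaf y) a = delta a y"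
| "leafc (Br s t) a = 0"

fun tau :: "'y \<Rightarrow> 'y \<Rightarrow> 'y bracket_tree \<Rightarrow> 'y multiset \<Rightarrow>\<^sub>0 int" where
  "tau a b (Leaf y) = 0"
| "tau a b (Br s t) = of_int (leafc s a * leafc t b - leafc s b * leafc t a) + eps s * tau a b t -
    eps t * tau a b s"

abbreviation lin :: "('y bracket_tree \<Rightarrow>\<^sub>0 int) \<Rightarrow> 'y \<Rightarrow> int" where
  "lin f a \<equiv> Poly_Mapping.lookup f (Leaf a)"

abbreviation EP where "EP \<equiv> frag_extend eps"
abbreviation TP where "TP a b \<equiv> frag_extend (tau a b)"

lemma lin_frag_of: "lin (frag_of t) a = leafc t a"
  by (cases t) (auto simp: delta_def)

lemma EP_tmul: "EP (tmul f g) = 0"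
  by (rule frag_extend_eq_0) (auto dest!: subsetD[OF keys_bilin])

text \<open>The bracket of the model in coordinates: the three summands are
  \<open>a \<and> b\<close>, \<open>a n\<close> and \<open>- b m\<close>.\<close>

lemma TP_tmul: "TP a b (tmul f g) = of_int (lin f a * lin g b - lin f b * lin g a) + EP f * TP a b g
    - EP g * TP a b f"
proof (induction f rule: frag_induction[OF subset_UNIV])
  case (2 s)
  show ?case
  proof (induction g rule: frag_induction[OF subset_UNIV])
    case (2 t)
    show ?case unfolding lin_frag_of by (simp add: bilin_simps)
  next
    case (3 f g)
    show ?case unfolding bilin_simps frag_extend_diff lookup_minus 3 by (simp add: algebra_simps)
  qed (simp add: bilin_simps)
next
  case (3 f h)
  show ?case unfolding bilin_simps frag_extend_diff lookup_minus 3 by (simp add: algebra_simps)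
qed (simp add: bilin_simps)

lemma EP_lin_zero: "(\<And>a. lin f a = 0) \<Longrightarrow> EP f = 0"
proof (rule frag_extend_eq_0)
  fix t assume "\<And>a. lin f a = 0" "t \<in> Poly_Mapping.keys f"
  then show "eps t = 0" by (cases t) (auto simp: in_keys_iff)
qed

lemma EP_closed: "f \<in> carrier (free_nonassoc Y) \<Longrightarrow> EP f \<in> carrier (int_poly Y)"
proof (induction f rule: free_nonassoc_induct)
  case (tree t)
  then show ?case by (cases t) auto
qed (auto simp: frag_extend_diff)

lemma lie_mult_closed: "x \<in> Y \<Longrightarrow> y \<in> Y \<Longrightarrow> frag_of (Br (Leaf x) (Leaf y)) \<in> carrier (free_nonassoc Y)"
  by (rule frag_of_tree) simp

section \<open>The presented Lie ring\<close>

locale quadratic_presentation =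
  fixes Y :: "'y set" and I :: "('y bracket_tree \<Rightarrow>\<^sub>0 int) set set"
  assumes fin: "finite Y" and quad: "quadratic_ideal Y I"
begin

abbreviation "S \<equiv> int_poly Y"
abbreviation "J \<equiv> quadratic_relators Y I"
abbreviation "X2 \<equiv> exterior_power Y 2"
abbreviation "X3 \<equiv> exterior_power Y 3"
abbreviation "FN \<equiv> free_nonassoc Y"
abbreviation "FL \<equiv> free_lie Y"
abbreviation "E \<equiv> presented_lie Y I"
abbreviation "e \<equiv> presented_gen Y I"
abbreviation "M0 \<equiv> scalar_extension S X2"
abbreviation "M1 \<equiv> scalar_extension S (X3 \<times>\<times> J)"
abbreviation "M3 \<equiv> scalar_extension S X3"
abbreviation "B \<equiv> alexander_invariant E e"
abbreviation "w2 x y \<equiv> ext_class Y [x, y]"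
abbreviation "w3 x y z \<equiv> ext_class Y [x, y, z]"
abbreviation "ecl f \<equiv> I +>\<^bsub>FL\<^esub> lcl Y f"

lemma I_ideal: "bracket_ideal FL I"
  and I_gen: "I = bracket_ideal_gen FL (I \<inter> free_lie_part Y 2)"
  using quad unfolding quadratic_ideal_def by blast+

sublocale IQ: nonassoc_quot FL I
  by unfold_locales (rule I_ideal)

lemma lie_ring_E: "lie_ring E"
  unfolding presented_lie_def by (rule lie_ring_Quot[OF lie_ring_free_lie I_ideal])

text \<open>Elements of \<open>E\<close> are handled through representatives in the free
  non-associative ring; these rules unwind the two nested quotients.\<close>

lemma ecl_simps:
  "carrier E = (\<lambda>f. ecl f) ` carrier FN" "\<zero>\<^bsub>E\<^esub> = I"
  "f \<in> carrier FN \<Longrightarrow> g \<in> carrier FN \<Longrightarrow> ecl f \<oplus>\<^bsub>E\<^esub> ecl g = ecl (f + g)"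
  "f \<in> carrier FN \<Longrightarrow> g \<in> carrier FN \<Longrightarrow> ecl f \<otimes>\<^bsub>E\<^esub> ecl g = ecl (tmul f g)"
  "f \<in> carrier FN \<Longrightarrow> \<ominus>\<^bsub>E\<^esub> ecl f = ecl (- f)"
  "f \<in> carrier FN \<Longrightarrow> g \<in> carrier FN \<Longrightarrow> ecl f \<ominus>\<^bsub>E\<^esub> ecl g = ecl (f - g)"
  "f \<in> carrier FN \<Longrightarrow> g \<in> carrier FN \<Longrightarrow> ecl f = ecl g \<longleftrightarrow> lcl Y (f - g) \<in> I"
proof -
  show "carrier E = (\<lambda>f. ecl f) ` carrier FN" "\<zero>\<^bsub>E\<^esub> = I"
    unfolding presented_lie_def using IQ.carrier_Q IQ.zero_Q free_lie_simps(1)[of Y] by auto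
  note c = lcl_closed[of f Y] lcl_closed[of g Y]
  assume f: "f \<in> carrier FN"
  show "\<ominus>\<^bsub>E\<^esub> ecl f = ecl (- f)"
    unfolding presented_lie_def IQ.rcos_minus[OF c(1)[OF f], symmetric] free_lie_simps(5)[OF f] ..
  assume g: "g \<in> carrier FN"
  show "ecl f \<oplus>\<^bsub>E\<^esub> ecl g = ecl (f + g)"
    unfolding presented_lie_def IQ.add_Q[OF c(1)[OF f] c(2)[OF g]] free_lie_simps(3)[OF f g] ..
  show "ecl f \<otimes>\<^bsub>E\<^esub> ecl g = ecl (tmul f g)"
    unfolding presented_lie_def IQ.mult_Q[OF c(1)[OF f] c(2)[OF g]] free_lie_simps(4)[OF f g] ..
  show "ecl f \<ominus>\<^bsub>E\<^esub> ecl g = ecl (f - g)"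
    unfolding presented_lie_def IQ.rcos_diff[OF c(1)[OF f] c(2)[OF g], symmetric]
        free_lie_simps(6)[OF f g] ..
  show "ecl f = ecl g \<longleftrightarrow> lcl Y (f - g) \<in> I"
    unfolding IQ.rcos_eq_iff[OF c(1)[OF f] c(2)[OF g]] free_lie_simps(6)[OF f g] ..
qed

lemma ecl_closed [intro]: "f \<in> carrier FN \<Longrightarrow> ecl f \<in> carrier E"
  by (simp add: ecl_simps)

lemma leaf_closed: "y \<in> Y \<Longrightarrow> frag_of (Leaf y) \<in> carrier FN"
  by (rule frag_of_tree) simp

lemma e_ecl: "e y = ecl (frag_of (Leaf y))"
  by (simp add: presented_gen_def lie_gen_def)

sublocale AL: alexander E Y e
  by (intro alexander.intro lie_ring_E alexander_axioms.intro) (simp add: e_ecl ecl_closed leaf_closed)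

abbreviation "cl u \<equiv> alexander_class E u"

lemma BAL: "carrier B = AL.cl ` AL.D1" by (simp add: AL.A_simps)

lemma part2_I_subgroup: "subgroup (I \<inter> free_lie_part Y 2) (add_monoid FL)"
  using FLie.add.subgroups_Inter[of "{I, free_lie_part Y 2}"] IQ.I_sub free_lie_part_subgroup[of Y
      2] by auto

lemma J_simps: "carrier J = I \<inter> free_lie_part Y 2" "x \<otimes>\<^bsub>J\<^esub> y = x \<oplus>\<^bsub>FL\<^esub> y" "\<one>\<^bsub>J\<^esub> = \<zero>\<^bsub>FL\<^esub>"
  by (simp_all add: quadratic_relators_def)

lemma comm_group_J: "comm_group J"
  by (rule comm_group_cong[OF subgroup_comm_group[OF FLie.a_comm_group part2_I_subgroup]])
    (simp_all add: quadratic_relators_def)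

sublocale X2: comm_group X2 by (rule comm_group_exterior_power)
sublocale X3: comm_group X3 by (rule comm_group_exterior_power)
sublocale JG: comm_group J by (rule comm_group_J)
sublocale F0: scalar_ext S X2 by unfold_locales
sublocale F3: scalar_ext S X3 by unfold_locales
sublocale X3J: comm_group "X3 \<times>\<times> J" by (rule DirProd_comm_group[OF comm_group_exterior_power comm_group_J])
sublocale F1: scalar_ext S "X3 \<times>\<times> J" by unfold_locales
sublocale BM: module S B by (rule AL.module_BB)

abbreviation "t0 r w \<equiv> tensor S X2 r w"
abbreviation "t1 r w \<equiv> tensor S (X3 \<times>\<times> J) r w"
abbreviation "t3 r w \<equiv> tensor S X3 r w"

lemma w2_closed [intro, simp]: "x \<in> Y \<Longrightarrow> y \<in> Y \<Longrightarrow> w2 x y \<in> carrier X2"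
  by (rule ext_class_closed) auto

lemma w3_closed [intro, simp]: "x \<in> Y \<Longrightarrow> y \<in> Y \<Longrightarrow> z \<in> Y \<Longrightarrow> w3 x y z \<in> carrier X3"
  by (rule ext_class_closed) auto

text \<open>One functional is provided for every pair of letters, whatever their order, so that
  formulas stay symmetric. They separate points because the coordinates of a basis occur among
  them.\<close>

lemma kc_exists:
  "\<exists>kc. (\<forall>a b. kc a b \<in> module_hom S M0 (self_module S)) \<and>
     (\<forall>a b. \<forall>r \<in> carrier S. \<forall>x \<in> Y. \<forall>y \<in> Y. kc a b (t0 r (w2 x y)) = r * of_int (minor2 a b x y)) \<and>
     (\<forall>u \<in> carrier M0. \<forall>v \<in> carrier M0. (\<forall>a \<in> Y. \<forall>b \<in> Y. kc a b u = kc a b v) \<longrightarrow> u = v)"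
proof -
  obtain C \<kappa> where zb: "zbasis X2 C \<kappa>"
    and \<kappa>: "\<forall>b \<in> C. \<exists>u v. u \<in> Y \<and> v \<in> Y \<and> (\<forall>x \<in> Y. \<forall>y \<in> Y. \<kappa> b (ext_class Y [x, y]) = minor2 u v x y)"
    using zbasis_exterior_2[OF fin] by (elim exE conjE)
  interpret P: poly_ext X2 Y C \<kappa>
    by (intro poly_ext.intro poly_ext_axioms.intro comm_group_exterior_power zb)
  have "\<exists>h. h \<in> module_hom S M0 (self_module S) \<and>
     (\<forall>r \<in> carrier S. \<forall>x \<in> Y. \<forall>y \<in> Y. h (t0 r (w2 x y)) = r * of_int (minor2 a b x y))" for a b
  proof -
    obtain c where c: "c \<in> hom X2 integer_group" "\<forall>x \<in> Y. \<forall>y \<in> Y. c (ext_class Y [x, y]) = minor2 a b x y"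
      using ext_coord2[of Y a b] by (elim bexE)
    from P.coord_ex[OF c(1)] obtain h where "h \<in> module_hom S M0 (self_module S)"
      "\<forall>r \<in> carrier S. \<forall>g \<in> carrier X2. h (t0 r g) = r * of_int (c g)" by (elim bexE)
    with c(2) show ?thesis by (intro exI[of _ h]) simp
  qed
  then obtain kc where kc: "\<And>a b. kc a b \<in> module_hom S M0 (self_module S)"
    "\<And>a b r x y. r \<in> carrier S \<Longrightarrow> x \<in> Y \<Longrightarrow> y \<in> Y \<Longrightarrow> kc a b (t0 r (w2 x y)) = r * of_int (minor2 a b x y)"
    by metis
  have "u = v" if u: "u \<in> carrier M0" and v: "v \<in> carrier M0" and eq: "\<And>a b. a \<in> Y \<Longrightarrow> b \<in> Y \<Longrightarrow> kc a b
      u = kc a b v" for u v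
  proof (rule P.RG_eqI_coord[OF u v])
    fix b assume b: "b \<in> C"
    from bspec[OF \<kappa> b] obtain p q where pq: "p \<in> Y" "q \<in> Y"
      "\<forall>x \<in> Y. \<forall>y \<in> Y. \<kappa> b (ext_class Y [x, y]) = minor2 p q x y" by (elim exE conjE)
    \<comment> \<open>Each basis coordinate is one of the minors: the two linear maps agree on the
      products of two letters, which span the module.\<close>
    have same: "P.coord b x = kc p q x" if "x \<in> carrier M0" for x
    proof (rule F0.RG_hom_eqI[OF int_poly.module_self_module P.coord(1)[OF b] kc(1)
        generate_exterior_2 _ _ that])
      show "{ext_class Y [x, y] | x y. x \<in> Y \<and> y \<in> Y} \<subseteq> carrier X2" by auto
      fix a assume "a \<in> {ext_class Y [x, y] | x y. x \<in> Y \<and> y \<in> Y}"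
      then obtain x y where a: "a = w2 x y" "x \<in> Y" "y \<in> Y" by blast
      have o: "\<one>\<^bsub>S\<^esub> \<in> carrier S" by simp
      show "P.coord b (t0 \<one>\<^bsub>S\<^esub> a) = kc p q (t0 \<one>\<^bsub>S\<^esub> a)"
        unfolding a(1) P.coord(2)[OF b o w2_closed[OF a(2,3)]] kc(2)[OF o a(2,3)] using pq a by simp
    qed
    show "P.coord b u = P.coord b v" unfolding same[OF u] same[OF v] by (rule eq[OF pq(1,2)])
  qed
  with kc show ?thesis by (intro exI[of _ kc]) blast
qed

end

text \<open>The isomorphism and the coordinates enter as parameters characterised by their values on
  generators; \<open>lie_degree2_iso\<close> and \<open>kc_exists\<close> provide instances.\<close>

locale presentation_coords = quadratic_presentation +
  fixes \<theta> kc
  assumes \<theta>: "\<theta> \<in> iso X2 (lie_degree2 Y)"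
    and \<theta>_gen: "\<And>x y. x \<in> Y \<Longrightarrow> y \<in> Y \<Longrightarrow> \<theta> (w2 x y) = gen2 Y x y"
    and kc: "\<And>a b. kc a b \<in> module_hom S M0 (self_module S)"
    and kc_gen: "\<And>a b r x y. r \<in> carrier S \<Longrightarrow> x \<in> Y \<Longrightarrow> y \<in> Y \<Longrightarrow> kc a b (t0 r (w2 x y)) = r * of_int
        (minor2 a b x y)"
    and kc_sep: "\<And>u v. u \<in> carrier M0 \<Longrightarrow> v \<in> carrier M0 \<Longrightarrow> (\<And>a b. a \<in> Y \<Longrightarrow> b \<in> Y \<Longrightarrow> kc a b u = kc a b v)
        \<Longrightarrow> u = v"
begin

lemma self_abelian: "abelian_group (self_module S)"
  using int_poly.module_self_module[of Y] by (simp add: module_def)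

lemma kc_hom: "kc a b \<in> hom (add_monoid M0) (add_monoid (self_module S))"
  by (rule module_hom_hom[OF kc])

lemma kc_add: "u \<in> carrier M0 \<Longrightarrow> v \<in> carrier M0 \<Longrightarrow> kc a b (u \<oplus>\<^bsub>M0\<^esub> v) = kc a b u + kc a b v"
  using module_hom_add[OF kc] by simp

lemma kc_smult: "r \<in> carrier S \<Longrightarrow> u \<in> carrier M0 \<Longrightarrow> kc a b (r \<odot>\<^bsub>M0\<^esub> u) = r * kc a b u"
  using module_hom_smult[OF kc] by simp

lemma kc_zero: "kc a b \<zero>\<^bsub>M0\<^esub> = 0"
  using hom_zero[OF F0.abelian_group_RG self_abelian kc_hom] by simp

lemma kc_minus: "u \<in> carrier M0 \<Longrightarrow> kc a b (\<ominus>\<^bsub>M0\<^esub> u) = - kc a b u"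
proof -
  assume u: "u \<in> carrier M0"
  have "kc a b (u \<oplus>\<^bsub>M0\<^esub> \<ominus>\<^bsub>M0\<^esub> u) = 0" using u kc_zero by (simp add: F0.RG.r_neg)
  then have "kc a b u + kc a b (\<ominus>\<^bsub>M0\<^esub> u) = 0" using u by (simp add: kc_add)
  then show ?thesis by (simp add: eq_neg_iff_add_eq_0 add.commute)
qed

lemma kc_diff: "u \<in> carrier M0 \<Longrightarrow> v \<in> carrier M0 \<Longrightarrow> kc a b (u \<ominus>\<^bsub>M0\<^esub> v) = kc a b u - kc a b v"
  by (simp add: a_minus_def kc_add kc_minus)

lemma t0_closed [intro, simp]: "r \<in> carrier S \<Longrightarrow> x \<in> Y \<Longrightarrow> y \<in> Y \<Longrightarrow> t0 r (w2 x y) \<in> carrier M0"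
  by (intro F0.tensor_closed) auto

abbreviation "koszul x y z \<equiv> t0 (var x) (w2 y z) \<ominus>\<^bsub>M0\<^esub> t0 (var y) (w2 x z) \<oplus>\<^bsub>M0\<^esub> t0 (var z) (w2 x y)"

lemma koszul_closed [intro, simp]: "x \<in> Y \<Longrightarrow> y \<in> Y \<Longrightarrow> z \<in> Y \<Longrightarrow> koszul x y z \<in> carrier M0"
  by (intro F0.RG.a_closed F0.RG.minus_closed t0_closed) auto

lemma kc_koszul: "x \<in> Y \<Longrightarrow> y \<in> Y \<Longrightarrow> z \<in> Y \<Longrightarrow> kc a b (koszul x y z) =
   var x * of_int (minor2 a b y z) - var y * of_int (minor2 a b x z) + var z * of_int (minor2 a b x y)"
  by (simp add: kc_add kc_diff kc_gen)

text \<open>That the formula for \<open>d3\<close> alternates in the letters is checked in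
  coordinates, where it becomes an identity between minors with polynomial coefficients;
  \<open>kc_sep\<close> brings it back to the module.\<close>

lemma d3_exists: "\<exists>d3 \<in> module_hom S M3 M0. \<forall>x \<in> Y. \<forall>y \<in> Y. \<forall>z \<in> Y. d3 (t3 1 (w3 x y z)) = koszul x y z"
proof -
  have minor: "minor2 a b x x = 0" "minor2 a b x y = - minor2 a b y x" for a b x y :: 'y
    by (simp_all add: minor2_def algebra_simps)
  have "\<exists>g \<in> hom X3 (add_monoid M0). \<forall>x \<in> Y. \<forall>y \<in> Y. \<forall>z \<in> Y. g (ext_class Y [x, y, z]) = koszul x y z"
  proof (rule exterior_lift3[OF F0.RG.a_comm_group])
    fix x y assume xy: "x \<in> Y" "y \<in> Y"
    have "koszul x x y = \<zero>\<^bsub>M0\<^esub>"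
      by (rule kc_sep) (use xy in \<open>simp_all add: kc_koszul kc_zero minor(1)\<close>)
    then show "koszul x x y = \<one>\<^bsub>add_monoid M0\<^esub>" by simp
    have "koszul y x x = \<zero>\<^bsub>M0\<^esub>"
      by (rule kc_sep) (use xy in \<open>simp_all add: kc_koszul kc_zero minor(1)\<close>)
    then show "koszul y x x = \<one>\<^bsub>add_monoid M0\<^esub>" by simp
    fix z assume z: "z \<in> Y"
    show "koszul x y z \<in> carrier (add_monoid M0)" using xy z by simp
    have "koszul x y z \<oplus>\<^bsub>M0\<^esub> koszul y x z = \<zero>\<^bsub>M0\<^esub>"
      using xy z by (intro kc_sep) (simp_all add: kc_add[OF koszul_closed koszul_closed] kc_koszul
          kc_zero minor(2)[of _ _ y x])
    then show "koszul x y z \<otimes>\<^bsub>add_monoid M0\<^esub> koszul y x z = \<one>\<^bsub>add_monoid M0\<^esub>" by simp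
    have "koszul x y z \<oplus>\<^bsub>M0\<^esub> koszul x z y = \<zero>\<^bsub>M0\<^esub>"
      using xy z by (intro kc_sep) (simp_all add: kc_add[OF koszul_closed koszul_closed] kc_koszul
          kc_zero minor(2)[of _ _ z y])
    then show "koszul x y z \<otimes>\<^bsub>add_monoid M0\<^esub> koszul x z y = \<one>\<^bsub>add_monoid M0\<^esub>" by simp
  qed
  then obtain g where g: "g \<in> hom X3 (add_monoid M0)"
    "\<forall>x \<in> Y. \<forall>y \<in> Y. \<forall>z \<in> Y. g (ext_class Y [x, y, z]) = koszul x y z" by (elim bexE)
  from F3.tensor_universal[OF F0.module_RG g(1)] obtain h where h: "h \<in> module_hom S M3 M0"
    "\<forall>r \<in> carrier S. \<forall>w \<in> carrier X3. h (t3 r w) = r \<odot>\<^bsub>M0\<^esub> g w" by (elim bexE)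
  have "h (t3 1 (w3 x y z)) = koszul x y z" if "x \<in> Y" "y \<in> Y" "z \<in> Y" for x y z
  proof -
    have "h (t3 1 (w3 x y z)) = \<one>\<^bsub>S\<^esub> \<odot>\<^bsub>M0\<^esub> g (w3 x y z)" using h(2) that by simp
    also have "\<dots> = koszul x y z" using g(2) that F0.RG.smult_one[OF koszul_closed[OF that]] by simp
    finally show ?thesis .
  qed
  with h(1) show ?thesis by blast
qed

text \<open>Inverse of the identification of the exterior square with degree two of the free Lie
  ring. On \<open>J\<close> it is the inclusion called \<partial> in the overview.\<close>

definition \<delta> where "\<delta> j = inv_into (carrier X2) \<theta> j"

lemma \<theta>_bij: "bij_betw \<theta> (carrier X2) (free_lie_part Y 2)"
  using \<theta> by (simp add: iso_def)

lemma \<theta>_hom: "\<theta> \<in> hom X2 (lie_degree2 Y)"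
  using \<theta> by (simp add: iso_def)

lemma \<delta>_closed: "j \<in> free_lie_part Y 2 \<Longrightarrow> \<delta> j \<in> carrier X2"
  unfolding \<delta>_def using \<theta>_bij by (metis bij_betw_imp_surj_on inv_into_into)

lemma \<theta>_\<delta>: "j \<in> free_lie_part Y 2 \<Longrightarrow> \<theta> (\<delta> j) = j"
  unfolding \<delta>_def using \<theta>_bij by (metis bij_betw_imp_surj_on f_inv_into_f)

lemma \<delta>_\<theta>: "w \<in> carrier X2 \<Longrightarrow> \<delta> (\<theta> w) = w"
  unfolding \<delta>_def using \<theta>_bij by (simp add: bij_betw_def inv_into_f_f)

lemma \<delta>_add: "i \<in> free_lie_part Y 2 \<Longrightarrow> j \<in> free_lie_part Y 2 \<Longrightarrow> \<delta> (i \<oplus>\<^bsub>FL\<^esub> j) = \<delta> i \<otimes>\<^bsub>X2\<^esub> \<delta> j"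
proof -
  assume ij: "i \<in> free_lie_part Y 2" "j \<in> free_lie_part Y 2"
  have "\<theta> (\<delta> i \<otimes>\<^bsub>X2\<^esub> \<delta> j) = i \<oplus>\<^bsub>FL\<^esub> j"
    using hom_mult[OF \<theta>_hom \<delta>_closed[OF ij(1)] \<delta>_closed[OF ij(2)]] ij by (simp add: \<theta>_\<delta>)
  then show ?thesis using \<delta>_\<theta>[OF X2.m_closed[OF \<delta>_closed[OF ij(1)] \<delta>_closed[OF ij(2)]]] by simp
qed

lemma \<delta>_hom: "\<delta> \<in> hom J X2"
  by (rule homI) (auto simp: J_simps \<delta>_closed \<delta>_add simp del: exterior_power_mult)

lemma \<theta>_one: "\<theta> \<one>\<^bsub>X2\<^esub> = \<zero>\<^bsub>FL\<^esub>"
  using hom_one[OF \<theta>_hom X2.is_group] comm_group_lie_degree2[of Y] by (simp add: comm_group_def)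

lemma \<delta>_one: "\<delta> \<zero>\<^bsub>FL\<^esub> = \<one>\<^bsub>X2\<^esub>"
  using \<delta>_\<theta>[OF X2.one_closed] \<theta>_one by simp

text \<open>The source extends the scalars of the product group, so the two maps are first added on
  \<open>X3 \<times>\<times> J\<close> and the sum is then extended linearly.\<close>

lemma D_exists:
  assumes d3: "d3 \<in> module_hom S M3 M0"
  shows "\<exists>D \<in> module_hom S M1 M0. \<forall>s \<in> carrier S. \<forall>w \<in> carrier X3. \<forall>j \<in> carrier J.
     D (t1 s (w, j)) = d3 (t3 s w) \<oplus>\<^bsub>M0\<^esub> t0 s (\<delta> j)"
proof -
  let ?\<phi> = "\<lambda>p. d3 (t3 1 (fst p)) \<oplus>\<^bsub>M0\<^esub> t0 1 (\<delta> (snd p))"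
  have o: "1 \<in> carrier S" by simp
  have dc: "d3 x \<in> carrier M0" if "x \<in> carrier M3" for x using module_hom_closed[OF d3 that] .
  have \<delta>c: "\<delta> j \<in> carrier X2" if "j \<in> carrier J" for j using that \<delta>_closed by (simp add: J_simps)
  have c1: "d3 (t3 1 w) \<in> carrier M0" if "w \<in> carrier X3" for w by (rule dc[OF F3.tensor_closed[OF o that]])
  have c2: "t0 1 (\<delta> j) \<in> carrier M0" if "j \<in> carrier J" for j by (rule F0.tensor_closed[OF o \<delta>c[OF that]])
  have "?\<phi> \<in> hom (X3 \<times>\<times> J) (add_monoid M0)"
  proof (rule homI)
    fix p assume p: "p \<in> carrier (X3 \<times>\<times> J)"
    then have p': "fst p \<in> carrier X3" "snd p \<in> carrier J" by auto
    show "?\<phi> p \<in> carrier (add_monoid M0)" using c1[OF p'(1)] c2[OF p'(2)] by simp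
    fix q assume q: "q \<in> carrier (X3 \<times>\<times> J)"
    then have q': "fst q \<in> carrier X3" "snd q \<in> carrier J" by auto
    have "d3 (t3 1 (fst p \<otimes>\<^bsub>X3\<^esub> fst q)) = d3 (t3 1 (fst p)) \<oplus>\<^bsub>M0\<^esub> d3 (t3 1 (fst q))"
      unfolding F3.tensor_add_right[OF o p'(1) q'(1)]
      by (rule module_hom_add[OF d3 F3.tensor_closed[OF o p'(1)] F3.tensor_closed[OF o q'(1)]])
    moreover have "t0 1 (\<delta> (snd p \<otimes>\<^bsub>J\<^esub> snd q)) = t0 1 (\<delta> (snd p)) \<oplus>\<^bsub>M0\<^esub> t0 1 (\<delta> (snd q))"
      unfolding hom_mult[OF \<delta>_hom p'(2) q'(2)] by (rule F0.tensor_add_right[OF o \<delta>c[OF p'(2)] \<delta>c[OF q'(2)]])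
    ultimately show "?\<phi> (p \<otimes>\<^bsub>X3 \<times>\<times> J\<^esub> q) = ?\<phi> p \<otimes>\<^bsub>add_monoid M0\<^esub> ?\<phi> q"
      using c1[OF p'(1)] c1[OF q'(1)] c2[OF p'(2)] c2[OF q'(2)]
      by (simp add: mult_DirProd' F0.RG.a_ac del: exterior_power_mult)
  qed
  from F1.tensor_universal[OF F0.module_RG this] obtain D where D: "D \<in> module_hom S M1 M0"
    "\<forall>s \<in> carrier S. \<forall>g \<in> carrier (X3 \<times>\<times> J). D (t1 s g) = s \<odot>\<^bsub>M0\<^esub> ?\<phi> g" by (elim bexE)
  have "D (t1 s (w, j)) = d3 (t3 s w) \<oplus>\<^bsub>M0\<^esub> t0 s (\<delta> j)" if s: "s \<in> carrier S" and w: "w \<in> carrier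
      X3" and j: "j \<in> carrier J" for s w j
  proof -
    have "D (t1 s (w, j)) = s \<odot>\<^bsub>M0\<^esub> (d3 (t3 1 w) \<oplus>\<^bsub>M0\<^esub> t0 1 (\<delta> j))" using D(2) s w j by simp
    also have "\<dots> = s \<odot>\<^bsub>M0\<^esub> d3 (t3 1 w) \<oplus>\<^bsub>M0\<^esub> s \<odot>\<^bsub>M0\<^esub> t0 1 (\<delta> j)"
      by (rule F0.RG.smult_r_distr[OF s c1[OF w] c2[OF j]])
    also have "s \<odot>\<^bsub>M0\<^esub> d3 (t3 1 w) = d3 (t3 s w)"
      unfolding module_hom_smult[OF d3 s F3.tensor_closed[OF o w], symmetric] using
          F3.smult_tensor[OF s o w] by simp
    also have "s \<odot>\<^bsub>M0\<^esub> t0 1 (\<delta> j) = t0 s (\<delta> j)"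
      using F0.smult_tensor[OF s o \<delta>c[OF j]] by simp
    finally show ?thesis .
  qed
  with D(1) show ?thesis by blast
qed

lemma part2_D1: "u \<in> free_lie_part Y 2 \<Longrightarrow> I +>\<^bsub>FL\<^esub> u \<in> AL.D1"
proof -
  assume "u \<in> free_lie_part Y 2"
  then obtain f where f: "f \<in> carrier (free_Abelian_group (hom_trees Y 2))" "u = lcl Y f"
    by (auto simp: free_lie_part_eq simp del: carrier_free_Abelian_group_iff)
  from f(1) have "ecl f \<in> AL.D1"
  proof (induction f rule: free_Abelian_induct)
    case zero
    have "ecl 0 = \<zero>\<^bsub>E\<^esub>" using ecl_simps(6)[of 0 0] ecl_closed[of 0] free_nonassoc_closed(5)[of Y] AL.r_neg
      by (simp add: a_minus_def)
    then show ?case using AL.D1.zero_closed by simp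
  next
    case (diff f g)
    have c: "f \<in> carrier FN" "g \<in> carrier FN" using diff(1,2) hom_trees_carrier by blast+
    have "ecl f \<oplus>\<^bsub>E\<^esub> \<ominus>\<^bsub>E\<^esub> ecl g \<in> AL.D1" using diff(3,4) by (intro AL.D1.a_closed AL.D1.a_inv_closed)
    then show ?case using ecl_simps(6)[OF c] by (simp add: a_minus_def)
  next
    case (frag_of t)
    then obtain x y where xy: "x \<in> Y" "y \<in> Y" "t = Br (Leaf x) (Leaf y)" using hom_trees_2 by blast
    have "ecl (frag_of t) = ecl (frag_of (Leaf x)) \<otimes>\<^bsub>E\<^esub> ecl (frag_of (Leaf y))"
      unfolding ecl_simps(4)[OF leaf_closed[OF xy(1)] leaf_closed[OF xy(2)]] xy(3) by (simp add:
          bilin_simps)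
    then show ?case using AL.D1_prod[of "ecl (frag_of (Leaf x))" "ecl (frag_of (Leaf y))"]
        ecl_closed leaf_closed xy by simp
  qed
  then show ?thesis using f by simp
qed

text \<open>Degree two of \<open>E\<close> lies in E', so taking classes after
  \<open>\<theta>\<close> is a homomorphism into B(E), which then extends linearly.\<close>

lemma \<psi>_exists:
  "\<exists>\<psi> \<in> module_hom S M0 B. \<forall>s \<in> carrier S. \<forall>w \<in> carrier X2. \<psi> (t0 s w) = s \<odot>\<^bsub>B\<^esub> cl (I +>\<^bsub>FL\<^esub> \<theta> w)"
proof -
  have p2: "\<theta> w \<in> free_lie_part Y 2" if "w \<in> carrier X2" for w using hom_in_carrier[OF \<theta>_hom that] by simp
  have p2c: "\<theta> w \<in> carrier FL" if "w \<in> carrier X2" for w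
    using p2[OF that] subgroup.subset[OF free_lie_part_subgroup[of Y 2]] by auto
  have "(\<lambda>w. cl (I +>\<^bsub>FL\<^esub> \<theta> w)) \<in> hom X2 (add_monoid B)"
  proof (rule homI)
    fix w assume w: "w \<in> carrier X2"
    show "cl (I +>\<^bsub>FL\<^esub> \<theta> w) \<in> carrier (add_monoid B)" using part2_D1[OF p2[OF w]] by simp
    fix v assume v: "v \<in> carrier X2"
    have "I +>\<^bsub>FL\<^esub> \<theta> (w \<otimes>\<^bsub>X2\<^esub> v) = (I +>\<^bsub>FL\<^esub> \<theta> w) \<oplus>\<^bsub>E\<^esub> (I +>\<^bsub>FL\<^esub> \<theta> v)"
      using hom_mult[OF \<theta>_hom w v] IQ.add_Q[OF p2c[OF w] p2c[OF v]] by (simp add: presented_lie_def)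
    then show "cl (I +>\<^bsub>FL\<^esub> \<theta> (w \<otimes>\<^bsub>X2\<^esub> v)) = cl (I +>\<^bsub>FL\<^esub> \<theta> w) \<otimes>\<^bsub>add_monoid B\<^esub> cl (I +>\<^bsub>FL\<^esub> \<theta> v)"
      using AL.cl_add[OF AL.D1_carrier[OF part2_D1[OF p2[OF w]]] AL.D1_carrier[OF part2_D1[OF p2[OF
          v]]]] by simp
  qed
  from F0.tensor_universal[OF AL.module_BB this] show ?thesis .
qed

end

locale presentation_maps = presentation_coords +
  fixes d3 D \<psi>
  assumes d3: "d3 \<in> module_hom S M3 M0"
    and d3_gen: "\<And>x y z. x \<in> Y \<Longrightarrow> y \<in> Y \<Longrightarrow> z \<in> Y \<Longrightarrow> d3 (t3 1 (w3 x y z)) = koszul x y z"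
    and D: "D \<in> module_hom S M1 M0"
    and D_t: "\<And>s w j. s \<in> carrier S \<Longrightarrow> w \<in> carrier X3 \<Longrightarrow> j \<in> carrier J \<Longrightarrow>
       D (t1 s (w, j)) = d3 (t3 s w) \<oplus>\<^bsub>M0\<^esub> t0 s (\<delta> j)"
    and \<psi>: "\<psi> \<in> module_hom S M0 B"
    and \<psi>_t: "\<And>s w. s \<in> carrier S \<Longrightarrow> w \<in> carrier X2 \<Longrightarrow> \<psi> (t0 s w) = s \<odot>\<^bsub>B\<^esub> cl (I +>\<^bsub>FL\<^esub> \<theta> w)"
begin

abbreviation "img \<equiv> D ` carrier M1"

lemma one_S [simp, intro]: "1 \<in> carrier S" by simp

lemma D_hom: "D \<in> hom (add_monoid M1) (add_monoid M0)" by (rule module_hom_hom[OF D])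
lemma \<psi>_hom: "\<psi> \<in> hom (add_monoid M0) (add_monoid B)" by (rule module_hom_hom[OF \<psi>])
lemma d3_hom: "d3 \<in> hom (add_monoid M3) (add_monoid M0)" by (rule module_hom_hom[OF d3])

lemma \<psi>_zero: "\<psi> \<zero>\<^bsub>M0\<^esub> = \<zero>\<^bsub>B\<^esub>"
  by (rule hom_zero[OF F0.abelian_group_RG BM.M.abelian_group_axioms \<psi>_hom])

lemma \<psi>_minus: "x \<in> carrier M0 \<Longrightarrow> \<psi> (\<ominus>\<^bsub>M0\<^esub> x) = \<ominus>\<^bsub>B\<^esub> \<psi> x"
  by (rule hom_a_inv[OF F0.abelian_group_RG BM.M.abelian_group_axioms \<psi>_hom])

lemma \<psi>_diff: "x \<in> carrier M0 \<Longrightarrow> y \<in> carrier M0 \<Longrightarrow> \<psi> (x \<ominus>\<^bsub>M0\<^esub> y) = \<psi> x \<ominus>\<^bsub>B\<^esub> \<psi> y"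
  by (rule hom_a_minus[OF F0.abelian_group_RG BM.M.abelian_group_axioms \<psi>_hom])

lemma D_zero: "D \<zero>\<^bsub>M1\<^esub> = \<zero>\<^bsub>M0\<^esub>"
  by (rule hom_zero[OF F1.abelian_group_RG F0.abelian_group_RG D_hom])

lemma d3_zero: "d3 \<zero>\<^bsub>M3\<^esub> = \<zero>\<^bsub>M0\<^esub>"
  by (rule hom_zero[OF F3.abelian_group_RG F0.abelian_group_RG d3_hom])

lemma D_closed: "x \<in> carrier M1 \<Longrightarrow> D x \<in> carrier M0" by (rule module_hom_closed[OF D])
lemma \<psi>_closed: "x \<in> carrier M0 \<Longrightarrow> \<psi> x \<in> carrier B" by (rule module_hom_closed[OF \<psi>])

lemma img_closed: "n \<in> img \<Longrightarrow> n \<in> carrier M0" using D_closed by auto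

lemma img_zero: "\<zero>\<^bsub>M0\<^esub> \<in> img"
  using D_zero F1.RG.zero_closed by (metis image_eqI)

lemma img_add: "m \<in> img \<Longrightarrow> n \<in> img \<Longrightarrow> m \<oplus>\<^bsub>M0\<^esub> n \<in> img"
proof -
  assume "m \<in> img" "n \<in> img"
  then obtain x y where "x \<in> carrier M1" "m = D x" "y \<in> carrier M1" "n = D y" by blast
  then show ?thesis using module_hom_add[OF D, of x y] F1.RG.a_closed[of x y] by (metis image_eqI)
qed

lemma img_minus: "m \<in> img \<Longrightarrow> \<ominus>\<^bsub>M0\<^esub> m \<in> img"
proof -
  assume "m \<in> img"
  then obtain x where "x \<in> carrier M1" "m = D x" by blast
  then show ?thesis using hom_a_inv[OF F1.abelian_group_RG F0.abelian_group_RG D_hom, of x]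
      F1.RG.a_inv_closed[of x]
    by (metis image_eqI)
qed

lemma img_smult: "r \<in> carrier S \<Longrightarrow> m \<in> img \<Longrightarrow> r \<odot>\<^bsub>M0\<^esub> m \<in> img"
proof -
  assume r: "r \<in> carrier S" and "m \<in> img"
  then obtain x where "x \<in> carrier M1" "m = D x" by blast
  then show ?thesis using module_hom_smult[OF D r, of x] F1.RG.smult_closed[OF r, of x] by (metis image_eqI)
qed

section \<open>Relations in the cokernel of \<open>D\<close> and the Jacobi identity of the
  model\<close>

lemma J_zero: "\<zero>\<^bsub>FL\<^esub> \<in> carrier J" using JG.one_closed by (simp add: J_simps)

lemma koszul_img: "x \<in> Y \<Longrightarrow> y \<in> Y \<Longrightarrow> z \<in> Y \<Longrightarrow> koszul x y z \<in> img"
proof -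
  assume xyz: "x \<in> Y" "y \<in> Y" "z \<in> Y"
  have "D (t1 1 (w3 x y z, \<zero>\<^bsub>FL\<^esub>)) = koszul x y z \<oplus>\<^bsub>M0\<^esub> t0 1 \<one>\<^bsub>X2\<^esub>"
    unfolding D_t[OF one_S w3_closed[OF xyz] J_zero] d3_gen[OF xyz] \<delta>_one ..
  also have "\<dots> = koszul x y z"
    unfolding F0.tensor_one_right[OF one_S] by (rule F0.RG.r_zero[OF koszul_closed[OF xyz]])
  finally have e: "D (t1 1 (w3 x y z, \<zero>\<^bsub>FL\<^esub>)) = koszul x y z" .
  have "t1 1 (w3 x y z, \<zero>\<^bsub>FL\<^esub>) \<in> carrier M1"
    using w3_closed[OF xyz] J_zero by (intro F1.tensor_closed) auto
  then show ?thesis using e by (metis image_eqI)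
qed

lemma relator_img: "j \<in> carrier J \<Longrightarrow> t0 1 (\<delta> j) \<in> img"
proof -
  assume j: "j \<in> carrier J"
  have c: "t0 1 (\<delta> j) \<in> carrier M0" using j \<delta>_closed by (intro F0.tensor_closed) (auto simp: J_simps)
  have "D (t1 1 (\<one>\<^bsub>X3\<^esub>, j)) = d3 (t3 1 \<one>\<^bsub>X3\<^esub>) \<oplus>\<^bsub>M0\<^esub> t0 1 (\<delta> j)"
    by (rule D_t[OF one_S X3.one_closed j])
  also have "\<dots> = t0 1 (\<delta> j)"
    unfolding F3.tensor_one_right[OF one_S] d3_zero
    by (rule F0.RG.l_zero[OF c])
  finally have e: "D (t1 1 (\<one>\<^bsub>X3\<^esub>, j)) = t0 1 (\<delta> j)" .
  have "t1 1 (\<one>\<^bsub>X3\<^esub>, j) \<in> carrier M1" using j X3.one_closed by (intro F1.tensor_closed) auto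
  then show ?thesis using e by (metis image_eqI)
qed

text \<open>Stands in for vanishing in the cokernel, which is not constructed as a quotient.
  Elements are replaced by coordinate families because those can be added and multiplied in the
  polynomial ring.\<close>

definition reach :: "('a \<Rightarrow> 'a \<Rightarrow> 'a multiset \<Rightarrow>\<^sub>0 int) \<Rightarrow> bool" where
  "reach v \<longleftrightarrow> (\<exists>n \<in> img. \<forall>a \<in> Y. \<forall>b \<in> Y. kc a b n = v a b)"

lemma reach_zero: "reach (\<lambda>a b. 0)"
  unfolding reach_def using img_zero kc_zero by blast

lemma reach_add: "reach v \<Longrightarrow> reach w \<Longrightarrow> reach (\<lambda>a b. v a b + w a b)"
  unfolding reach_def
proof (elim bexE)
  fix m n assume "m \<in> img" "\<forall>a \<in> Y. \<forall>b \<in> Y. kc a b m = v a b" "n \<in> img" "\<forall>a \<in> Y. \<forall>b \<in> Y. kc a b n = w a b"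
  then show "\<exists>n\<in>img. \<forall>a\<in>Y. \<forall>b\<in>Y. kc a b n = v a b + w a b"
    using kc_add[OF img_closed img_closed, of m n] by (intro bexI[of _ "m \<oplus>\<^bsub>M0\<^esub> n"] img_add) simp_all
qed

lemma reach_minus: "reach v \<Longrightarrow> reach (\<lambda>a b. - v a b)"
  unfolding reach_def
proof (elim bexE)
  fix m assume "m \<in> img" "\<forall>a \<in> Y. \<forall>b \<in> Y. kc a b m = v a b"
  then show "\<exists>n\<in>img. \<forall>a\<in>Y. \<forall>b\<in>Y. kc a b n = - v a b"
    using kc_minus[OF img_closed, of m] by (intro bexI[of _ "\<ominus>\<^bsub>M0\<^esub> m"] img_minus) simp_all
qed

lemma reach_diff: "reach v \<Longrightarrow> reach w \<Longrightarrow> reach (\<lambda>a b. v a b - w a b)"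
  using reach_add[OF _ reach_minus, of v w] by simp

lemma reach_smult: "r \<in> carrier S \<Longrightarrow> reach v \<Longrightarrow> reach (\<lambda>a b. r * v a b)"
  unfolding reach_def
proof (elim bexE)
  fix m assume r: "r \<in> carrier S" and "m \<in> img" "\<forall>a \<in> Y. \<forall>b \<in> Y. kc a b m = v a b"
  then show "\<exists>n\<in>img. \<forall>a\<in>Y. \<forall>b\<in>Y. kc a b n = r * v a b"
    using kc_smult[OF r img_closed, of m] by (intro bexI[of _ "r \<odot>\<^bsub>M0\<^esub> m"] img_smult) simp_all
qed

text \<open>The coordinate at \<open>a\<close>, \<open>b\<close> of the exterior product of the
  linear parts of \<open>f\<close> and \<open>g\<close>.\<close>

definition area :: "('a bracket_tree \<Rightarrow>\<^sub>0 int) \<Rightarrow> ('a bracket_tree \<Rightarrow>\<^sub>0 int) \<Rightarrow> 'a \<Rightarrow> 'a \<Rightarrow> 'a multiset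
    \<Rightarrow>\<^sub>0 int" where
  "area f g a b = of_int (lin f a * lin g b - lin f b * lin g a)"

text \<open>What remains of the Jacobi sum in the model: the coordinates of \<open>d3\<close>
  applied to the three linear parts.\<close>

definition jac where
  "jac f g h a b = EP f * area g h a b + EP g * area h f a b + EP h * area f g a b"

lemma area_diff: "area (f - f') g a b = area f g a b - area f' g a b" "area f (g - g') a b = area f
    g a b - area f g' a b"
  by (simp_all add: area_def lookup_minus algebra_simps)

lemma area_Br: "area (frag_of (Br s t)) g a b = 0" "area g (frag_of (Br s t)) a b = 0"
  by (simp_all add: area_def)

lemma area_Leaf: "area (frag_of (Leaf x)) (frag_of (Leaf y)) a b = of_int (minor2 a b x y)"
  unfolding area_def lin_frag_of minor2_def leafc.simps by (simp add: mult.commute)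

lemma jac_diff:
  "jac (f - f') g h = (\<lambda>a b. jac f g h a b - jac f' g h a b)"
  "jac f (g - g') h = (\<lambda>a b. jac f g h a b - jac f g' h a b)"
  "jac f g (h - h') = (\<lambda>a b. jac f g h a b - jac f g h' a b)"
  by (simp_all add: fun_eq_iff jac_def area_diff frag_extend_diff algebra_simps)

lemma jac_zero: "jac 0 g h = (\<lambda>a b. 0)" "jac f 0 h = (\<lambda>a b. 0)" "jac f g 0 = (\<lambda>a b. 0)"
  by (simp_all add: fun_eq_iff jac_def area_def)

lemma minor2_swap: "minor2 a b x y = - minor2 a b y x"
  by (simp add: minor2_def)

text \<open>Every summand of \<open>jac\<close> uses the linear part of all three arguments, so it
  vanishes unless all are letters; for letters it is the Koszul relation.\<close>

lemma reach_jac_tree: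
  assumes "set_tree s \<subseteq> Y" "set_tree t \<subseteq> Y" "set_tree u \<subseteq> Y"
  shows "reach (jac (frag_of s) (frag_of t) (frag_of u))"
proof (cases "\<exists>x y z. s = Leaf x \<and> t = Leaf y \<and> u = Leaf z")
  case True
  then obtain x y z where l: "s = Leaf x" "t = Leaf y" "u = Leaf z" by blast
  have xyz: "x \<in> Y" "y \<in> Y" "z \<in> Y" using assms l by auto
  \<comment> \<open>The cyclic sum contains the product of \<open>z\<close> and \<open>x\<close>
    where \<open>d3\<close> has that of \<open>x\<close> and \<open>z\<close>; swapping them
    accounts for the minus sign in \<open>d3\<close>.\<close>
  have "kc a b (koszul x y z) = jac (frag_of s) (frag_of t) (frag_of u) a b" for a b
    unfolding kc_koszul[OF xyz] jac_def l area_Leaf frag_extend_of eps.simps minor2_swap[of a b z x] by simp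
  then show ?thesis unfolding reach_def using koszul_img[OF xyz] by blast
next
  case False
  then have "jac (frag_of s) (frag_of t) (frag_of u) = (\<lambda>a b. 0)"
    by (cases s; cases t; cases u) (simp_all add: jac_def area_Br fun_eq_iff)
  then show ?thesis using reach_zero by simp
qed

text \<open>\<open>jac\<close> is additive in each argument and \<open>reach\<close> is closed under
  differences, so single trees suffice.\<close>

lemma reach_jac:
  assumes "f \<in> carrier FN" "g \<in> carrier FN" "h \<in> carrier FN"
  shows "reach (jac f g h)"
  using assms(1)
proof (induction f rule: free_nonassoc_induct)
  case (tree s)
  note s = tree
  show ?case
    using assms(2)
  proof (induction g rule: free_nonassoc_induct)
    case (tree t)
    note t = tree
    show ?case
      using assms(3)
    proof (induction h rule: free_nonassoc_induct)
      case (tree u)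
      then show ?case by (rule reach_jac_tree[OF s t])
    qed (simp_all only: jac_zero jac_diff reach_zero reach_diff)
  qed (simp_all only: jac_zero jac_diff reach_zero reach_diff)
qed (simp_all only: jac_zero jac_diff reach_zero reach_diff)

text \<open>The kernel of the homomorphism to the model, as an ideal of the free non-associative ring;
  \<open>reach v\<close> says that \<open>v\<close> is the coordinate family of an element that vanishes in \<open>M\<close>.\<close>

definition model_kernel :: "('a bracket_tree \<Rightarrow>\<^sub>0 int) set" where
  "model_kernel = {f \<in> carrier FN. (\<forall>a. lin f a = 0) \<and> reach (\<lambda>a b. TP a b f)}"

text \<open>If \<open>f\<close> has no linear part, then by \<open>TP_tmul\<close> a product with
  \<open>g\<close> on either side has coordinates \<open>EP g * TP a b f\<close> up to sign, and the
  image of \<open>D\<close> is closed under multiplication by polynomials.\<close>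

lemma model_kernel_ideal: "bracket_ideal FN model_kernel"
  unfolding bracket_ideal_def
proof (intro conjI ballI)
  show "subgroup model_kernel (add_monoid FN)"
  proof (rule FN.add.subgroupI)
    have "0 \<in> model_kernel" using reach_zero by (simp add: model_kernel_def free_nonassoc_closed)
    then show "model_kernel \<noteq> {}" by blast
    fix f assume f: "f \<in> model_kernel"
    then show "\<ominus>\<^bsub>FN\<^esub> f \<in> model_kernel" using reach_minus by (auto simp: model_kernel_def
        free_nonassoc_closed frag_extend_minus)
    fix g assume "g \<in> model_kernel"
    then show "f \<oplus>\<^bsub>FN\<^esub> g \<in> model_kernel" using f reach_add
      by (auto simp: model_kernel_def free_nonassoc_closed frag_extend_add lookup_add)
  qed (auto simp: model_kernel_def)
  fix g f assume g: "g \<in> carrier FN" and f: "f \<in> model_kernel"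
  then have f': "f \<in> carrier FN" "\<And>a. lin f a = 0" "reach (\<lambda>a b. TP a b f)" by (auto simp: model_kernel_def)
  have r: "reach (\<lambda>a b. EP g * TP a b f)" by (rule reach_smult[OF EP_closed[OF g] f'(3)])
  have e: "EP f = 0" by (rule EP_lin_zero[OF f'(2)])
  have "reach (\<lambda>a b. TP a b (tmul g f))" using r by (simp add: TP_tmul f'(2) e)
  then show "g \<otimes>\<^bsub>FN\<^esub> f \<in> model_kernel" using g f' by (simp add: model_kernel_def lookup_tmul
      free_nonassoc_closed)
  have "reach (\<lambda>a b. TP a b (tmul f g))" using reach_minus[OF r] by (simp add: TP_tmul f'(2) e)
  then show "f \<otimes>\<^bsub>FN\<^esub> g \<in> model_kernel" using g f' by (simp add: model_kernel_def lookup_tmul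
      free_nonassoc_closed)
qed

text \<open>Inner products have no linear part, so the outer brackets only multiply by linear forms.
  The terms with two such factors, like \<open>EP f * EP g * TP a b h\<close>, occur twice with
  opposite signs and cancel since polynomials commute.\<close>

lemma TP_jacobi: "TP a b (tmul f (tmul g h) + tmul g (tmul h f) + tmul h (tmul f g)) = jac f g h a b"
  unfolding frag_extend_add TP_tmul EP_tmul lookup_tmul jac_def area_def by (simp add: algebra_simps)

lemma lie_axioms_model_kernel: "lie_axioms Y \<subseteq> model_kernel"
proof
  fix p assume "p \<in> lie_axioms Y"
  then consider (sq) f where "f \<in> carrier FN" "p = tmul f f"
    | (jac) f g h where "f \<in> carrier FN" "g \<in> carrier FN" "h \<in> carrier FN"
        "p = tmul f (tmul g h) + tmul g (tmul h f) + tmul h (tmul f g)"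
    unfolding lie_axioms_def by blast
  then show "p \<in> model_kernel"
  proof cases
    case sq
    then have "TP a b p = 0" for a b by (simp add: TP_tmul)
    then show ?thesis using sq reach_zero by (simp add: model_kernel_def lookup_tmul free_nonassoc_closed)
  next
    case jac
    have "reach (\<lambda>a b. TP a b p)" unfolding jac(4) TP_jacobi using reach_jac[OF jac(1-3)] by simp
    moreover have "p \<in> carrier FN" unfolding jac(4) using jac(1-3) by (intro free_nonassoc_closed)
    ultimately show ?thesis by (simp add: model_kernel_def jac(4) lookup_tmul lookup_add)
  qed
qed

lemma lie_relations_model_kernel: "lie_relations Y \<subseteq> model_kernel"
  unfolding lie_relations_gen by (rule FN.bracket_ideal_gen_minimal[OF model_kernel_ideal
      lie_axioms_model_kernel])

lemma model_kernel_add: "f \<in> model_kernel \<Longrightarrow> g \<in> model_kernel \<Longrightarrow> f + g \<in> model_kernel"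
  using subgroup.m_closed[of model_kernel "add_monoid FN" f g] model_kernel_ideal by (simp add:
      bracket_ideal_def)

text \<open>Links the coordinates of tensors with those of trees: both sides are additive in
  \<open>f\<close>, and on a bracket of two letters both are the minor.\<close>

lemma kc_\<delta>:
  assumes "f \<in> carrier (free_Abelian_group (hom_trees Y 2))"
  shows "kc a b (t0 1 (\<delta> (lcl Y f))) = TP a b f"
proof -
  let ?k = "\<lambda>f. kc a b (t0 1 (\<delta> (lcl Y f)))"
  have pt: "lcl Y f \<in> free_lie_part Y 2" if "f \<in> carrier (free_Abelian_group (hom_trees Y 2))" for f
    unfolding free_lie_part_eq using that by blast
  have add: "?k (f + g) = ?k f + ?k g"
    if f: "f \<in> carrier (free_Abelian_group (hom_trees Y 2))" and g: "g \<in> carrier (free_Abelian_group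
        (hom_trees Y 2))" for f g
  proof -
    have "lcl Y (f + g) = lcl Y f \<oplus>\<^bsub>FL\<^esub> lcl Y g"
      using free_lie_simps(3)[OF hom_trees_carrier[OF f] hom_trees_carrier[OF g]] by simp
    then show ?thesis
      unfolding \<delta>_add[OF pt[OF f] pt[OF g]]
      using F0.tensor_add_right[OF one_S \<delta>_closed[OF pt[OF f]] \<delta>_closed[OF pt[OF g]]]
        kc_add[OF F0.tensor_closed[OF one_S \<delta>_closed[OF pt[OF f]]] F0.tensor_closed[OF one_S
            \<delta>_closed[OF pt[OF g]]]]
        \<delta>_add[OF pt[OF f] pt[OF g]]
      by metis
  qed
  show ?thesis
    using assms
  proof (induction f rule: free_Abelian_induct)
    case zero
    show ?case using add[of 0 0] by simp
  next
    case (diff f g)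
    have "f - g \<in> carrier (free_Abelian_group (hom_trees Y 2))"
      using diff(1,2) keys_diff[of f g] by auto
    then have "?k f = ?k (f - g) + ?k g" using add[of "f - g" g] diff(2) by simp
    then show ?case using diff(3,4) by (simp add: frag_extend_diff algebra_simps)
  next
    case (frag_of t)
    then obtain x y where xy: "x \<in> Y" "y \<in> Y" "t = Br (Leaf x) (Leaf y)" using hom_trees_2 by blast
    have "\<delta> (lcl Y (frag_of t)) = w2 x y"
      unfolding xy(3) \<theta>_gen[OF xy(1,2), symmetric] by (rule \<delta>_\<theta>[OF w2_closed[OF xy(1,2)]])
    then show ?case
      using kc_gen[OF one_S xy(1,2), of a b] unfolding xy(3) by (simp add: minor2_def mult.commute)
  qed
qed

lemma deg2_lin: "f \<in> carrier (free_Abelian_group (hom_trees Y 2)) \<Longrightarrow> lin f a = 0"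
proof (rule ccontr)
  assume f: "f \<in> carrier (free_Abelian_group (hom_trees Y 2))" and "lin f a \<noteq> 0"
  then have "Leaf a \<in> hom_trees Y 2" by (auto simp: in_keys_iff subset_iff)
  then show False by (simp add: hom_trees_def)
qed

text \<open>The classes of the model kernel form an ideal of the free Lie ring, so it is enough that
  they contain the degree two relators, which \<open>D\<close> hits by construction. Returning from
  classes to representatives is harmless as the kernel contains the Lie relations.\<close>

lemma I_model_kernel:
  assumes f: "f \<in> carrier FN" and fI: "lcl Y f \<in> I"
  shows "f \<in> model_kernel"
proof -
  have "bracket_ideal FL ((\<lambda>f. lcl Y f) ` model_kernel)"
    unfolding free_lie_def by (rule FL.bracket_ideal_image[OF model_kernel_ideal])
  moreover have "I \<inter> free_lie_part Y 2 \<subseteq> (\<lambda>f. lcl Y f) ` model_kernel"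
  proof
    fix j assume j: "j \<in> I \<inter> free_lie_part Y 2"
    then obtain g where g: "g \<in> carrier (free_Abelian_group (hom_trees Y 2))" "j = lcl Y g"
      by (auto simp: free_lie_part_eq simp del: carrier_free_Abelian_group_iff)
    have "j \<in> carrier J" using j by (simp add: J_simps)
    then have n: "t0 1 (\<delta> j) \<in> img" by (rule relator_img)
    have "reach (\<lambda>a b. TP a b g)"
      unfolding reach_def by (rule bexI[OF _ n]) (simp add: kc_\<delta>[OF g(1), folded g(2)])
    then have "g \<in> model_kernel" using deg2_lin[OF g(1)] hom_trees_carrier[OF g(1)] by (simp add:
        model_kernel_def)
    then show "j \<in> (\<lambda>f. lcl Y f) ` model_kernel" using g(2) by blast
  qed
  ultimately have "I \<subseteq> (\<lambda>f. lcl Y f) ` model_kernel"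
    using I_gen FLie.bracket_ideal_gen_minimal by metis
  then obtain g where g: "g \<in> model_kernel" "lcl Y f = lcl Y g" using fI by blast
  then have gc: "g \<in> carrier FN" by (simp add: model_kernel_def)
  have "f - g \<in> model_kernel" using free_lie_simps(7)[OF f gc] g(2) lie_relations_model_kernel by blast
  then show ?thesis using model_kernel_add[OF _ g(1), of "f - g"] by simp
qed

text \<open>The trees that are proper brackets. Their combinations are exactly those with no linear
  part, and they represent the elements of E'.\<close>

definition "brackets = {t. set_tree t \<subseteq> Y \<and> (\<forall>y. t \<noteq> Leaf y)}"

lemma brackets_carrier: "f \<in> carrier (free_Abelian_group brackets) \<Longrightarrow> f \<in> carrier FN"
  unfolding free_nonassoc_iff by (auto simp: brackets_def)

lemma brackets_iff: "f \<in> carrier FN \<Longrightarrow> (\<And>a. lin f a = 0) \<Longrightarrow> f \<in> carrier (free_Abelian_group brackets)"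
  unfolding free_nonassoc_iff brackets_def by (auto simp: in_keys_iff)

lemma brackets_lin: "f \<in> carrier (free_Abelian_group brackets) \<Longrightarrow> lin f a = 0"
  unfolding brackets_def by (auto simp: in_keys_iff subset_iff)

lemma ecl_hom: "(\<lambda>f. ecl f) \<in> hom (add_monoid FN) (add_monoid E)"
  by (rule homI) (simp_all add: ecl_closed ecl_simps(3))

lemma D1_rep:
  assumes "u \<in> AL.D1"
  shows "\<exists>f \<in> carrier (free_Abelian_group brackets). u = ecl f"
proof -
  have sub: "subgroup (carrier (free_Abelian_group brackets)) (add_monoid FN)"
  proof (rule FN.add.subgroupI)
    have "0 \<in> carrier (free_Abelian_group brackets)" by simp
    then show "carrier (free_Abelian_group brackets) \<noteq> {}" by blast
    show "carrier (free_Abelian_group brackets) \<subseteq> carrier FN" using brackets_carrier by blast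
    fix f assume f: "f \<in> carrier (free_Abelian_group brackets)"
    then show "\<ominus>\<^bsub>FN\<^esub> f \<in> carrier (free_Abelian_group brackets)" using brackets_carrier[OF f] by simp
    fix g assume "g \<in> carrier (free_Abelian_group brackets)"
    then show "f \<oplus>\<^bsub>FN\<^esub> g \<in> carrier (free_Abelian_group brackets)"
      using f keys_add[of f g] by auto
  qed
  have "AL.D1 \<subseteq> (\<lambda>f. ecl f) ` carrier (free_Abelian_group brackets)"
  proof (rule AL.derived_least)
    show "subgroup ((\<lambda>f. ecl f) ` carrier (free_Abelian_group brackets)) (add_monoid E)"
      by (rule group_hom.subgroup_img_is_subgroup[OF group_homI[OF FN.a_group AL.a_group ecl_hom] sub])
    fix x y assume "x \<in> carrier E" "y \<in> carrier E"
    then obtain f g where fg: "f \<in> carrier FN" "x = ecl f" "g \<in> carrier FN" "y = ecl g" by (auto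
        simp: ecl_simps(1))
    then have "tmul f g \<in> carrier (free_Abelian_group brackets)"
      by (intro brackets_iff free_nonassoc_closed) (simp_all add: lookup_tmul)
    then show "x \<otimes>\<^bsub>E\<^esub> y \<in> (\<lambda>f. ecl f) ` carrier (free_Abelian_group brackets)"
      using fg ecl_simps(4)[of f g] by blast
  qed simp
  with assms show ?thesis by blast
qed

text \<open>Any representative of an element of E' will do: two of them differ by an element of the
  model kernel, which has no linear part.\<close>

lemma D1_lin:
  assumes f: "f \<in> carrier FN" and "ecl f \<in> AL.D1"
  shows "lin f a = 0"
proof -
  obtain g where g: "g \<in> carrier (free_Abelian_group brackets)" "ecl f = ecl g" using D1_rep[OF
      assms(2)] by blast
  note gc = brackets_carrier[OF g(1)]
  have "lcl Y (f - g) \<in> I" using ecl_simps(7)[OF f gc] g(2) by simp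
  then have "f - g \<in> model_kernel" using f gc by (intro I_model_kernel free_nonassoc_closed)
  then show ?thesis using brackets_lin[OF g(1), of a] by (simp add: model_kernel_def lookup_minus)
qed

text \<open>If neither factor has a linear part, all three terms of \<open>TP_tmul\<close> vanish:
  in the model, brackets between elements of the second component are zero.\<close>

lemma D2_model_kernel:
  assumes f: "f \<in> carrier FN" and "ecl f \<in> AL.D2"
  shows "f \<in> model_kernel"
proof -
  have "AL.D2 \<subseteq> (\<lambda>f. ecl f) ` model_kernel"
  proof (rule AL.derived_least)
    show "AL.D1 \<subseteq> carrier E" using AL.D1_carrier by blast
    have "subgroup model_kernel (add_monoid FN)" using model_kernel_ideal by (simp add: bracket_ideal_def)
    then show "subgroup ((\<lambda>f. ecl f) ` model_kernel) (add_monoid E)"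
      by (rule group_hom.subgroup_img_is_subgroup[OF group_homI[OF FN.a_group AL.a_group ecl_hom]])
    fix x y assume "x \<in> AL.D1" "y \<in> AL.D1"
    then obtain f g where fg: "f \<in> carrier (free_Abelian_group brackets)" "x = ecl f"
      "g \<in> carrier (free_Abelian_group brackets)" "y = ecl g" using D1_rep by metis
    note l = brackets_lin[OF fg(1)] brackets_lin[OF fg(3)]
    note c = brackets_carrier[OF fg(1)] brackets_carrier[OF fg(3)]
    have "EP f = 0" "EP g = 0" using EP_lin_zero l by blast+
    then have "TP a b (tmul f g) = 0" for a b by (simp add: TP_tmul l)
    then have "tmul f g \<in> model_kernel" using reach_zero c by (simp add: model_kernel_def
        lookup_tmul free_nonassoc_closed)
    then show "x \<otimes>\<^bsub>E\<^esub> y \<in> (\<lambda>f. ecl f) ` model_kernel" using fg ecl_simps(4)[OF c] by blast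
  qed
  then obtain g where g: "g \<in> model_kernel" "ecl f = ecl g" using assms(2) by blast
  then have gc: "g \<in> carrier FN" by (simp add: model_kernel_def)
  have "lcl Y (f - g) \<in> I" using ecl_simps(7)[OF f gc] g(2) by simp
  then have "f - g \<in> model_kernel" using f gc by (intro I_model_kernel free_nonassoc_closed)
  then show ?thesis using model_kernel_add[OF _ g(1), of "f - g"] by simp
qed

section \<open>Exactness\<close>

lemma \<psi>_gen:
  assumes xy: "x \<in> Y" "y \<in> Y"
  shows "\<psi> (t0 1 (w2 x y)) = cl (ecl (frag_of (Br (Leaf x) (Leaf y))))"
    "ecl (frag_of (Br (Leaf x) (Leaf y))) = e x \<otimes>\<^bsub>E\<^esub> e y"
proof -
  show 2: "ecl (frag_of (Br (Leaf x) (Leaf y))) = e x \<otimes>\<^bsub>E\<^esub> e y"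
    unfolding e_ecl ecl_simps(4)[OF leaf_closed[OF xy(1)] leaf_closed[OF xy(2)]] by (simp add: bilin_simps)
  have "cl (ecl (frag_of (Br (Leaf x) (Leaf y)))) \<in> carrier B"
    unfolding 2 using AL.D1_prod AL.g_closed xy by simp
  then show "\<psi> (t0 1 (w2 x y)) = cl (ecl (frag_of (Br (Leaf x) (Leaf y))))"
    unfolding \<psi>_t[OF one_S w2_closed[OF xy]] \<theta>_gen[OF xy] using BM.smult_one by simp
qed

lemma cl_minus: "u \<in> AL.D1 \<Longrightarrow> cl (\<ominus>\<^bsub>E\<^esub> u) = \<ominus>\<^bsub>B\<^esub> cl u"
proof -
  assume u: "u \<in> AL.D1"
  have "cl (\<ominus>\<^bsub>E\<^esub> u) \<oplus>\<^bsub>B\<^esub> cl u = \<zero>\<^bsub>B\<^esub>"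
    using AL.cl_add[of "\<ominus>\<^bsub>E\<^esub> u" u] AL.D1_carrier[OF u] AL.cl_zero_iff[of "\<zero>\<^bsub>E\<^esub>"] by (simp add: AL.l_neg)
  then show ?thesis using u AL.D1.a_inv_closed[OF u] by (intro BM.M.minus_equality[symmetric]) auto
qed

text \<open>\<open>f\<close> represents \<open>\<psi> x\<close>, and its image in the model is the class of \<open>x\<close>: this makes the map to
  the model a left inverse of the one induced by \<open>\<psi>\<close>.\<close>

definition lifts :: "(('a multiset \<Rightarrow>\<^sub>0 int) \<times> ('a list \<Rightarrow>\<^sub>0 int) set \<Rightarrow>\<^sub>0 int) set \<Rightarrow> bool" where
  "lifts x \<longleftrightarrow> x \<in> carrier M0 \<and> (\<exists>f \<in> carrier FN. ecl f \<in> AL.D1 \<and> \<psi> x = cl (ecl f) \<and> reach (\<lambda>a b. kc a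
      b x - TP a b f))"

lemma liftsI: "x \<in> carrier M0 \<Longrightarrow> f \<in> carrier FN \<Longrightarrow> ecl f \<in> AL.D1 \<Longrightarrow> \<psi> x = cl (ecl f) \<Longrightarrow>
   reach (\<lambda>a b. kc a b x - TP a b f) \<Longrightarrow> lifts x"
  unfolding lifts_def by blast

lemma lifts_gen: "x \<in> Y \<Longrightarrow> y \<in> Y \<Longrightarrow> lifts (t0 1 (w2 x y))"
proof (rule liftsI)
  assume xy: "x \<in> Y" "y \<in> Y"
  show "t0 1 (w2 x y) \<in> carrier M0" using xy by simp
  show "frag_of (Br (Leaf x) (Leaf y)) \<in> carrier FN" by (rule lie_mult_closed[OF xy])
  show "ecl (frag_of (Br (Leaf x) (Leaf y))) \<in> AL.D1" unfolding \<psi>_gen(2)[OF xy] using AL.D1_prod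
      AL.g_closed xy by simp
  show "\<psi> (t0 1 (w2 x y)) = cl (ecl (frag_of (Br (Leaf x) (Leaf y))))" by (rule \<psi>_gen(1)[OF xy])
  have "kc a b (t0 1 (w2 x y)) - TP a b (frag_of (Br (Leaf x) (Leaf y))) = 0" for a b
    using kc_gen[OF one_S xy, of a b] by (simp add: minor2_def mult.commute)
  then show "reach (\<lambda>a b. kc a b (t0 1 (w2 x y)) - TP a b (frag_of (Br (Leaf x) (Leaf y))))"
    using reach_zero by simp
qed

lemma lifts_add: "lifts x \<Longrightarrow> lifts y \<Longrightarrow> lifts (x \<oplus>\<^bsub>M0\<^esub> y)"
proof -
  assume "lifts x" "lifts y"
  then obtain f g where f: "f \<in> carrier FN" "ecl f \<in> AL.D1" "\<psi> x = cl (ecl f)" "reach (\<lambda>a b. kc a b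
      x - TP a b f)" "x \<in> carrier M0"
    and g: "g \<in> carrier FN" "ecl g \<in> AL.D1" "\<psi> y = cl (ecl g)" "reach (\<lambda>a b. kc a b y - TP a b g)"
        "y \<in> carrier M0"
    unfolding lifts_def by blast
  show ?thesis
  proof (rule liftsI)
    show "x \<oplus>\<^bsub>M0\<^esub> y \<in> carrier M0" using f g by simp
    show "f + g \<in> carrier FN" using f g by (intro free_nonassoc_closed)
    have s: "ecl (f + g) = ecl f \<oplus>\<^bsub>E\<^esub> ecl g" using ecl_simps(3)[OF f(1) g(1)] by simp
    then show "ecl (f + g) \<in> AL.D1" using AL.D1.a_closed[OF f(2) g(2)] by simp
    show "\<psi> (x \<oplus>\<^bsub>M0\<^esub> y) = cl (ecl (f + g))"
      unfolding s module_hom_add[OF \<psi> f(5) g(5)] f(3) g(3)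
      using AL.cl_add[OF AL.D1_carrier[OF f(2)] AL.D1_carrier[OF g(2)]] by simp
    have "kc a b (x \<oplus>\<^bsub>M0\<^esub> y) - TP a b (f + g) = (kc a b x - TP a b f) + (kc a b y - TP a b g)" for a b
      using kc_add[OF f(5) g(5)] by (simp add: frag_extend_add)
    then show "reach (\<lambda>a b. kc a b (x \<oplus>\<^bsub>M0\<^esub> y) - TP a b (f + g))" using reach_add[OF f(4) g(4)] by simp
  qed
qed

lemma lifts_minus: "lifts x \<Longrightarrow> lifts (\<ominus>\<^bsub>M0\<^esub> x)"
proof -
  assume "lifts x"
  then obtain f where f: "f \<in> carrier FN" "ecl f \<in> AL.D1" "\<psi> x = cl (ecl f)" "reach (\<lambda>a b. kc a b x
      - TP a b f)" "x \<in> carrier M0"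
    unfolding lifts_def by blast
  show ?thesis
  proof (rule liftsI)
    show "\<ominus>\<^bsub>M0\<^esub> x \<in> carrier M0" using f by simp
    show "- f \<in> carrier FN" using f by (intro free_nonassoc_closed)
    have s: "ecl (- f) = \<ominus>\<^bsub>E\<^esub> ecl f" using ecl_simps(5)[OF f(1)] by simp
    then show "ecl (- f) \<in> AL.D1" using AL.D1.a_inv_closed[OF f(2)] by simp
    show "\<psi> (\<ominus>\<^bsub>M0\<^esub> x) = cl (ecl (- f))"
      unfolding s cl_minus[OF f(2)] \<psi>_minus[OF f(5)] f(3) ..
    have "kc a b (\<ominus>\<^bsub>M0\<^esub> x) - TP a b (- f) = - (kc a b x - TP a b f)" for a b
      using kc_minus[OF f(5)] by (simp add: frag_extend_minus)
    then show "reach (\<lambda>a b. kc a b (\<ominus>\<^bsub>M0\<^esub> x) - TP a b (- f))" using reach_minus[OF f(4)] by simp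
  qed
qed

lemma lifts_zero: "lifts \<zero>\<^bsub>M0\<^esub>"
proof (rule liftsI)
  have "ecl 0 = \<zero>\<^bsub>E\<^esub>" by (rule hom_zero[OF FN.abelian_group_axioms AL.abelian_group_axioms ecl_hom,
      simplified])
  then show "ecl 0 \<in> AL.D1" "\<psi> \<zero>\<^bsub>M0\<^esub> = cl (ecl 0)"
    using \<psi>_zero AL.cl_zero_iff[of "\<zero>\<^bsub>E\<^esub>"] by simp_all
  show "reach (\<lambda>a b. kc a b \<zero>\<^bsub>M0\<^esub> - TP a b 0)" using reach_zero by (simp add: kc_zero)
qed (auto simp: free_nonassoc_closed)

text \<open>The variable corresponds to bracketing the representative with the letter. As
  \<open>f\<close> has no linear part, \<open>TP_tmul\<close> reduces to multiplication by
  \<open>var y\<close>.\<close>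

lemma lifts_var: "y \<in> Y \<Longrightarrow> lifts x \<Longrightarrow> lifts (var y \<odot>\<^bsub>M0\<^esub> x)"
proof -
  assume y: "y \<in> Y" and "lifts x"
  then obtain f where f: "f \<in> carrier FN" "ecl f \<in> AL.D1" "\<psi> x = cl (ecl f)" "reach (\<lambda>a b. kc a b x
      - TP a b f)" "x \<in> carrier M0"
    unfolding lifts_def by blast
  have v: "var y \<in> carrier S" using y by simp
  let ?g = "tmul (frag_of (Leaf y)) f"
  show ?thesis
  proof (rule liftsI)
    show "var y \<odot>\<^bsub>M0\<^esub> x \<in> carrier M0" using f v by simp
    show "?g \<in> carrier FN" using f leaf_closed[OF y] by (intro free_nonassoc_closed)
    have s: "ecl ?g = e y \<otimes>\<^bsub>E\<^esub> ecl f" unfolding e_ecl using ecl_simps(4)[OF leaf_closed[OF y] f(1)] by simp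
    show "ecl ?g \<in> AL.D1" unfolding s using AL.D1_prod AL.g_closed[OF y] AL.D1_carrier[OF f(2)] by simp
    show "\<psi> (var y \<odot>\<^bsub>M0\<^esub> x) = cl (ecl ?g)"
      unfolding s module_hom_smult[OF \<psi> v f(5)] f(3) by (rule AL.BB_smult_var[OF y f(2)])
    have l: "lin f a = 0" for a by (rule D1_lin[OF f(1,2)])
    have "kc a b (var y \<odot>\<^bsub>M0\<^esub> x) - TP a b ?g = var y * (kc a b x - TP a b f)" for a b
      unfolding TP_tmul l EP_lin_zero[OF l] kc_smult[OF v f(5)] by (simp add: algebra_simps)
    then show "reach (\<lambda>a b. kc a b (var y \<odot>\<^bsub>M0\<^esub> x) - TP a b ?g)" using reach_smult[OF v f(4)] by simp
  qed
qed

lemma lifts_closed: "lifts x \<Longrightarrow> x \<in> carrier M0" by (simp add: lifts_def)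

lemma lifts_smult:
  assumes r: "r \<in> carrier S" and x: "lifts x"
  shows "lifts (r \<odot>\<^bsub>M0\<^esub> x)"
  using r
proof (induction r rule: int_poly_induct)
  case zero
  then show ?case using lifts_zero F0.RG.smult_l_null[OF lifts_closed[OF x]] by simp
next
  case (diff p q)
  have "(p - q) \<odot>\<^bsub>M0\<^esub> x = p \<odot>\<^bsub>M0\<^esub> x \<oplus>\<^bsub>M0\<^esub> \<ominus>\<^bsub>M0\<^esub> (q \<odot>\<^bsub>M0\<^esub> x)"
    using F0.RG.smult_l_distr[of p "- q" x] F0.RG.smult_l_minus[of q x] diff lifts_closed[OF x] by simp
  then show ?case using lifts_add lifts_minus diff by simp
next
  case (monom m)
  then show ?case
  proof (induction m)
    case empty
    then show ?case using x F0.RG.smult_one[OF lifts_closed[OF x]] by (simp add: frag_of_zero_mset)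
  next
    case (add y m)
    have "frag_of m \<in> carrier S" using add by (simp add: int_poly_iff)
    then have "frag_of (add_mset y m) \<odot>\<^bsub>M0\<^esub> x = var y \<odot>\<^bsub>M0\<^esub> (frag_of m \<odot>\<^bsub>M0\<^esub> x)"
      unfolding frag_of_add_mset using F0.RG.smult_assoc1[of "var y" "frag_of m" x] add
          lifts_closed[OF x] by simp
    then show ?case using lifts_var add by simp
  qed
qed

lemma lifts_all:
  assumes "x \<in> carrier M0"
  shows "lifts x"
proof -
  have sub: "{ext_class Y [x, y] | x y. x \<in> Y \<and> y \<in> Y} \<subseteq> carrier X2" by auto
  show ?thesis
    using assms generate_exterior_2 sub
  proof (induction x rule: F0.RG_generated_induct)
    case (gen a)
    then show ?case using lifts_gen by auto
  qed (auto intro: lifts_zero lifts_add lifts_smult)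
qed

text \<open>A representative \<open>f\<close> of a vanishing class lies over E'', so its coordinates
  vanish in the cokernel; they also agree there with those of \<open>x\<close>. Adding the two facts
  produces an element of the image with the coordinates of \<open>x\<close>.\<close>

lemma ker_img:
  assumes x: "x \<in> carrier M0" and "\<psi> x = \<zero>\<^bsub>B\<^esub>"
  shows "x \<in> img"
proof -
  obtain f where f: "f \<in> carrier FN" "ecl f \<in> AL.D1" "\<psi> x = cl (ecl f)" "reach (\<lambda>a b. kc a b x - TP a b f)"
    using lifts_all[OF x] unfolding lifts_def by blast
  have "ecl f \<in> AL.D2" using f(3) assms(2) AL.cl_zero_iff[OF AL.D1_carrier[OF f(2)]] by simp
  then have "reach (\<lambda>a b. TP a b f)" using D2_model_kernel[OF f(1)] by (simp add: model_kernel_def)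
  from reach_add[OF f(4) this] obtain n where n: "n \<in> img" "\<forall>a \<in> Y. \<forall>b \<in> Y. kc a b n = kc a b x"
    unfolding reach_def by auto
  have "x = n" by (rule kc_sep[OF x img_closed[OF n(1)]]) (use n(2) in simp)
  then show ?thesis using n by simp
qed

text \<open>Each variable becomes a bracket, and antisymmetry absorbs the minus sign of the middle
  term, leaving the class of the Jacobi sum.\<close>

lemma \<psi>_koszul: "x \<in> Y \<Longrightarrow> y \<in> Y \<Longrightarrow> z \<in> Y \<Longrightarrow> \<psi> (koszul x y z) = \<zero>\<^bsub>B\<^esub>"
proof -
  assume xyz: "x \<in> Y" "y \<in> Y" "z \<in> Y"
  have trm: "\<psi> (t0 (var x) (w2 y z)) = cl (e x \<otimes>\<^bsub>E\<^esub> (e y \<otimes>\<^bsub>E\<^esub> e z))" if "x \<in> Y" "y \<in> Y" "z \<in> Y" for x y z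
  proof -
    have "t0 (var x) (w2 y z) = var x \<odot>\<^bsub>M0\<^esub> t0 1 (w2 y z)"
      using F0.smult_tensor[of "var x" 1 "w2 y z"] that by simp
    then have "\<psi> (t0 (var x) (w2 y z)) = var x \<odot>\<^bsub>B\<^esub> \<psi> (t0 1 (w2 y z))"
      using module_hom_smult[OF \<psi>, of "var x" "t0 1 (w2 y z)"] that by simp
    then show ?thesis
      unfolding \<psi>_gen[OF that(2,3)] using AL.BB_smult_var[OF that(1) AL.D1_prod[OF AL.g_closed[OF
          that(2)] AL.g_closed[OF that(3)]]] by simp
  qed
  note g = AL.g_closed[OF xyz(1)] AL.g_closed[OF xyz(2)] AL.g_closed[OF xyz(3)]
  have c: "t0 (var x) (w2 y z) \<in> carrier M0" "t0 (var y) (w2 x z) \<in> carrier M0" "t0 (var z) (w2 x y)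
      \<in> carrier M0"
    using xyz by auto
  have "\<psi> (koszul x y z) = cl (e x \<otimes>\<^bsub>E\<^esub> (e y \<otimes>\<^bsub>E\<^esub> e z)) \<oplus>\<^bsub>B\<^esub> \<ominus>\<^bsub>B\<^esub> cl (e y \<otimes>\<^bsub>E\<^esub> (e x \<otimes>\<^bsub>E\<^esub> e z)) \<oplus>\<^bsub>B\<^esub>
      cl (e z \<otimes>\<^bsub>E\<^esub> (e x \<otimes>\<^bsub>E\<^esub> e y))"
    using module_hom_add[OF \<psi> F0.RG.minus_closed[OF c(1,2)] c(3)]
      \<psi>_diff[OF c(1,2)] xyz trm
    by (simp add: a_minus_def)
  also have "\<ominus>\<^bsub>B\<^esub> cl (e y \<otimes>\<^bsub>E\<^esub> (e x \<otimes>\<^bsub>E\<^esub> e z)) = cl (e y \<otimes>\<^bsub>E\<^esub> (e z \<otimes>\<^bsub>E\<^esub> e x))"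
  proof -
    have "e y \<otimes>\<^bsub>E\<^esub> (e z \<otimes>\<^bsub>E\<^esub> e x) = \<ominus>\<^bsub>E\<^esub> (e y \<otimes>\<^bsub>E\<^esub> (e x \<otimes>\<^bsub>E\<^esub> e z))"
      using AL.antisym[OF g(3,1)] AL.prod_minus(1)[OF g(2) AL.prod_closed[OF g(1,3)]] by simp
    then show ?thesis using cl_minus[OF AL.D1_prod[OF g(2) AL.prod_closed[OF g(1,3)]]] by simp
  qed
  also have "cl (e x \<otimes>\<^bsub>E\<^esub> (e y \<otimes>\<^bsub>E\<^esub> e z)) \<oplus>\<^bsub>B\<^esub> cl (e y \<otimes>\<^bsub>E\<^esub> (e z \<otimes>\<^bsub>E\<^esub> e x)) \<oplus>\<^bsub>B\<^esub> cl (e z \<otimes>\<^bsub>E\<^esub> (e x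
      \<otimes>\<^bsub>E\<^esub> e y)) =
     cl (e x \<otimes>\<^bsub>E\<^esub> (e y \<otimes>\<^bsub>E\<^esub> e z) \<oplus>\<^bsub>E\<^esub> e y \<otimes>\<^bsub>E\<^esub> (e z \<otimes>\<^bsub>E\<^esub> e x) \<oplus>\<^bsub>E\<^esub> e z \<otimes>\<^bsub>E\<^esub> (e x \<otimes>\<^bsub>E\<^esub> e y))"
    using g by (simp add: AL.cl_add)
  also have "\<dots> = \<zero>\<^bsub>B\<^esub>" unfolding AL.jacobi[OF g] using AL.cl_zero_iff[of "\<zero>\<^bsub>E\<^esub>"] by simp
  finally show ?thesis .
qed

text \<open>The source of \<open>D\<close> is spanned by tensors \<open>1 \<otimes> (w, j)\<close>.
  The first component is handled by \<open>\<psi>_koszul\<close> on generators, and a relator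
  \<open>j\<close> is zero in \<open>E\<close>.\<close>

lemma \<psi>_img: "n \<in> img \<Longrightarrow> \<psi> n = \<zero>\<^bsub>B\<^esub>"
proof -
  have d3z: "\<psi> (d3 (t3 1 w)) = \<zero>\<^bsub>B\<^esub>" if w: "w \<in> carrier X3" for w
  proof -
    have h: "\<psi> \<circ> (d3 \<circ> t3 1) \<in> hom X3 (add_monoid B)"
      by (rule hom_compose[OF hom_compose[OF F3.tensor_hom_right[OF one_S] d3_hom] \<psi>_hom])
    have "(\<psi> \<circ> (d3 \<circ> t3 1)) w = \<one>\<^bsub>add_monoid B\<^esub>"
    proof (rule hom_trivial_on_generate[OF X3.is_group BM.M.a_group h])
      show "{ext_class Y [x, y, z] | x y z. x \<in> Y \<and> y \<in> Y \<and> z \<in> Y} \<subseteq> carrier X3" by auto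
      show "w \<in> generate X3 {ext_class Y [x, y, z] | x y z. x \<in> Y \<and> y \<in> Y \<and> z \<in> Y}"
        unfolding generate_exterior_3 by (rule w)
      fix a assume "a \<in> {ext_class Y [x, y, z] | x y z. x \<in> Y \<and> y \<in> Y \<and> z \<in> Y}"
      then obtain x y z where "a = w3 x y z" "x \<in> Y" "y \<in> Y" "z \<in> Y" by blast
      then show "(\<psi> \<circ> (d3 \<circ> t3 1)) a = \<one>\<^bsub>add_monoid B\<^esub>" using d3_gen \<psi>_koszul by simp
    qed
    then show ?thesis by simp
  qed
  have rel: "\<psi> (t0 1 (\<delta> j)) = \<zero>\<^bsub>B\<^esub>" if j: "j \<in> carrier J" for j
  proof -
    have j': "j \<in> I" "j \<in> free_lie_part Y 2" using j by (auto simp: J_simps)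
    have "I +>\<^bsub>FL\<^esub> \<theta> (\<delta> j) = \<zero>\<^bsub>E\<^esub>"
      unfolding \<theta>_\<delta>[OF j'(2)] ecl_simps(2) using IQ.rcos_I_iff[OF IQ.I_carrier[OF j'(1)]] j'(1) by simp
    then have "\<psi> (t0 1 (\<delta> j)) = 1 \<odot>\<^bsub>B\<^esub> cl \<zero>\<^bsub>E\<^esub>" using \<psi>_t[OF one_S \<delta>_closed[OF j'(2)]] by simp
    also have "cl \<zero>\<^bsub>E\<^esub> = \<zero>\<^bsub>B\<^esub>" using AL.cl_zero_iff[of "\<zero>\<^bsub>E\<^esub>"] by simp
    also have "1 \<odot>\<^bsub>B\<^esub> \<zero>\<^bsub>B\<^esub> = \<zero>\<^bsub>B\<^esub>" by (rule BM.smult_r_null[OF one_S])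
    finally show ?thesis .
  qed
  have "generate (X3 \<times>\<times> J) (carrier (X3 \<times>\<times> J)) = carrier (X3 \<times>\<times> J)"
    using X3J.generate_in_carrier[of "carrier (X3 \<times>\<times> J)"] generate.incl[of _ "carrier (X3 \<times>\<times> J)" "X3
        \<times>\<times> J"] by blast
  note gX = this
  have main: "\<psi> (D x) = \<zero>\<^bsub>B\<^esub>" if "x \<in> carrier M1" for x
    using that gX subset_refl[of "carrier (X3 \<times>\<times> J)"]
  proof (induction x rule: F1.RG_generated_induct)
    case zero
    then show ?case using D_zero
        \<psi>_zero by simp
  next
    case (gen a)
    then obtain w j where a: "a = (w, j)" "w \<in> carrier X3" "j \<in> carrier J" by auto
    have c: "d3 (t3 1 w) \<in> carrier M0" "t0 1 (\<delta> j) \<in> carrier M0"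
      using module_hom_closed[OF d3 F3.tensor_closed[OF one_S a(2)]] img_closed[OF relator_img[OF
          a(3)]] by auto
    have "\<psi> (D (t1 1 a)) = \<psi> (d3 (t3 1 w)) \<oplus>\<^bsub>B\<^esub> \<psi> (t0 1 (\<delta> j))"
      unfolding a(1) D_t[OF one_S a(2,3)] by (rule module_hom_add[OF \<psi> c])
    then show ?case using d3z[OF a(2)] rel[OF a(3)] by simp
  next
    case (add x y)
    then show ?case using module_hom_add[OF D add(1,2)] module_hom_add[OF \<psi> D_closed[OF add(1)]
        D_closed[OF add(2)]] by simp
  next
    case (smult r x)
    then show ?case using module_hom_smult[OF D smult(1,2)] module_hom_smult[OF \<psi> smult(1)
        D_closed[OF smult(2)]]
        BM.smult_r_null[OF smult(1)] by simp
  qed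
  show "n \<in> img \<Longrightarrow> \<psi> n = \<zero>\<^bsub>B\<^esub>" using main by blast
qed

lemma exact: "img = a_kernel M0 B \<psi>"
proof -
  have "a_kernel M0 B \<psi> = {x \<in> carrier M0. \<psi> x = \<zero>\<^bsub>B\<^esub>}" by (simp add: a_kernel_def kernel_def)
  also have "\<dots> = img"
  proof (intro equalityI subsetI)
    fix x assume "x \<in> {x \<in> carrier M0. \<psi> x = \<zero>\<^bsub>B\<^esub>}"
    then show "x \<in> img" using ker_img by blast
  next
    fix x assume "x \<in> img"
    then show "x \<in> {x \<in> carrier M0. \<psi> x = \<zero>\<^bsub>B\<^esub>}" using \<psi>_img[of x] img_closed[of x] by (intro
        CollectI conjI)
  qed
  finally show ?thesis by (rule sym)
qed

end

context presentation_maps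
begin

section \<open>Gradings\<close>

abbreviation "SD \<equiv> int_poly_part Y"
abbreviation "F0D \<equiv> scalar_extension_part S SD X2 (concentrated X2 2)"
abbreviation "F1D \<equiv> scalar_extension_part S SD (X3 \<times>\<times> J) (\<lambda>k. concentrated X3 3 k \<times> concentrated J 2 k)"
abbreviation "BD \<equiv> alexander_part E (presented_part Y I)"

lemma F0_graded_basis: "\<exists>C K d. graded_basis Y M0 F0D C K d"
proof -
  obtain C \<kappa> where zb: "zbasis X2 C \<kappa>" using zbasis_exterior_2[OF fin] by (elim exE conjE)
  interpret P: poly_ext X2 Y C \<kappa>
    by (intro poly_ext.intro poly_ext_axioms.intro comm_group_exterior_power zb)
  have k1: "\<kappa> b \<one>\<^bsub>X2\<^esub> = 0" if "b \<in> C" for b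
    using hom_one[OF P.\<kappa>(1)[OF that] X2.is_group] by simp
  have "\<exists>K d'. graded_basis Y M0 F0D (tensor S X2 1 ` C) K d'"
  proof (rule P.graded_basis_RG[where d = "\<lambda>_. 2"])
    show "concentrated X2 2 k \<subseteq> carrier X2" for k
      using X2.one_closed by (auto simp: concentrated_def simp del: exterior_power_mult)
    show "b \<in> concentrated X2 2 2" if "b \<in> C" for b using that P.B(2) by (auto simp: concentrated_def)
    show "2 = j" if "b \<in> C" "g \<in> concentrated X2 2 j" "\<kappa> b g \<noteq> 0" for b g j
      using that k1 by (auto simp: concentrated_def simp del: exterior_power_mult split: if_splits)
  qed
  then show ?thesis by blast
qed

text \<open>The coordinates of the exterior square, composed with the injective
  \<open>\<delta>\<close>, are finitely many functionals that separate the elements of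
  \<open>J\<close>.\<close>

lemma zbasis_J: "\<exists>C \<kappa>. zbasis J C \<kappa>"
proof -
  obtain C \<kappa> where zb: "zbasis X2 C \<kappa>" using zbasis_exterior_2[OF fin] by (elim exE conjE)
  then have C: "finite C" "\<And>b. b \<in> C \<Longrightarrow> \<kappa> b \<in> hom X2 integer_group" by (auto simp: zbasis_def)
  show ?thesis
  proof (rule zbasis_separated[of "(\<lambda>b. \<kappa> b \<circ> \<delta>) ` C", OF _ comm_group_J])
    show "finite ((\<lambda>b. \<kappa> b \<circ> \<delta>) ` C)" using C by simp
    show "(\<lambda>b. \<kappa> b \<circ> \<delta>) ` C \<subseteq> hom J integer_group" using hom_compose[OF \<delta>_hom C(2)] by blast
    fix j assume j: "j \<in> carrier J" and z: "\<And>k. k \<in> (\<lambda>b. \<kappa> b \<circ> \<delta>) ` C \<Longrightarrow> k j = 0"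
    have p: "j \<in> free_lie_part Y 2" using j by (simp add: J_simps)
    have "\<delta> j = \<one>\<^bsub>X2\<^esub>"
    proof (rule zbasis_zero[OF comm_group_exterior_power zb \<delta>_closed[OF p]])
      fix b assume "b \<in> C"
      then have "(\<kappa> b \<circ> \<delta>) j = 0" by (intro z) blast
      then show "\<kappa> b (\<delta> j) = 0" by simp
    qed
    then show "j = \<one>\<^bsub>J\<^esub>" using \<theta>_\<delta>[OF p] \<theta>_one by (simp add: J_simps)
  qed
qed

lemma F1_graded_basis: "\<exists>C K d. graded_basis Y M1 F1D C K d"
proof -
  obtain C3 \<kappa>3 where zb3: "zbasis X3 C3 \<kappa>3" using zbasis_exterior_3[OF fin] by blast
  obtain CJ \<kappa>J where zbJ: "zbasis J CJ \<kappa>J" using zbasis_J by blast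
  let ?i = "\<lambda>b. (b, \<one>\<^bsub>J\<^esub>)" and ?j = "\<lambda>c. (\<one>\<^bsub>X3\<^esub>, c)"
  let ?\<kappa> = "\<lambda>z w. if z \<in> ?i ` C3 then \<kappa>3 (fst z) (fst w) else \<kappa>J (snd z) (snd w)"
  \<comment> \<open>Basis elements from the third exterior power have degree three, those from
    \<open>J\<close> degree two.\<close>
  let ?d = "\<lambda>z. if z \<in> ?i ` C3 then 3 else 2 :: nat"
  have zb: "zbasis (X3 \<times>\<times> J) (?i ` C3 \<union> ?j ` CJ) ?\<kappa>"
    by (rule zbasis_DirProd[OF comm_group_exterior_power zb3 comm_group_J zbJ])
  interpret P: poly_ext "X3 \<times>\<times> J" Y "?i ` C3 \<union> ?j ` CJ" ?\<kappa>
    by (intro poly_ext.intro poly_ext_axioms.intro zb DirProd_comm_group comm_group_exterior_power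
        comm_group_J)
  have C3: "C3 \<subseteq> carrier X3" "\<And>b. b \<in> C3 \<Longrightarrow> \<kappa>3 b \<in> hom X3 integer_group" using zb3 by (auto simp: zbasis_def)
  have CJ: "CJ \<subseteq> carrier J" "\<And>b. b \<in> CJ \<Longrightarrow> \<kappa>J b \<in> hom J integer_group" using zbJ by (auto simp: zbasis_def)
  have k3: "\<kappa>3 b \<one>\<^bsub>X3\<^esub> = 0" if "b \<in> C3" for b using hom_one[OF C3(2)[OF that] X3.is_group] by simp
  have kJ: "\<kappa>J b \<one>\<^bsub>J\<^esub> = 0" if "b \<in> CJ" for b using hom_one[OF CJ(2)[OF that] JG.is_group] by simp
  have "\<exists>K d'. graded_basis Y M1 F1D (tensor S (X3 \<times>\<times> J) 1 ` (?i ` C3 \<union> ?j ` CJ)) K d'"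
  proof (rule P.graded_basis_RG[where d = ?d])
    fix k
    show "concentrated X3 3 k \<times> concentrated J 2 k \<subseteq> carrier (X3 \<times>\<times> J)"
      using X3.one_closed JG.one_closed unfolding concentrated_def carrier_DirProd by auto
  next
    fix b assume b: "b \<in> ?i ` C3 \<union> ?j ` CJ"
    show "b \<in> concentrated X3 3 (?d b) \<times> concentrated J 2 (?d b)"
    proof (cases "b \<in> ?i ` C3")
      case True
      then have "b \<in> carrier X3 \<times> {\<one>\<^bsub>J\<^esub>}" using C3(1) by blast
      then show ?thesis using True by (simp only: concentrated_def if_True) simp
    next
      case False
      then have "b \<in> {\<one>\<^bsub>X3\<^esub>} \<times> carrier J" using b CJ(1) by blast
      then show ?thesis using False by (simp only: concentrated_def if_False) simp
    qed
    fix g j assume g: "g \<in> concentrated X3 3 j \<times> concentrated J 2 j" and nz: "?\<kappa> b g \<noteq> 0"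
    show "?d b = j"
    proof (cases "b \<in> ?i ` C3")
      case True
      from True obtain c where c: "b = (c, \<one>\<^bsub>J\<^esub>)" "c \<in> C3" by blast
      from nz True have "\<kappa>3 (fst b) (fst g) \<noteq> 0" by (simp only: if_True not_False_eq_True)
      moreover have "fst b \<in> C3" using c by simp
      ultimately have "fst g \<noteq> \<one>\<^bsub>X3\<^esub>" using k3 by metis
      then have "j = 3" using g by (auto simp only: concentrated_def mem_Times_iff singleton_iff
          split: if_splits)
      then show ?thesis using True by simp
    next
      case False
      from False b obtain c where c: "b = (\<one>\<^bsub>X3\<^esub>, c)" "c \<in> CJ" by blast
      from nz False have "\<kappa>J (snd b) (snd g) \<noteq> 0" by (simp only: if_False not_False_eq_True)
      moreover have "snd b \<in> CJ" using c by simp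
      ultimately have "snd g \<noteq> \<one>\<^bsub>J\<^esub>" using kJ by metis
      then have "j = 2" using g by (auto simp only: concentrated_def mem_Times_iff singleton_iff
          split: if_splits)
      then show ?thesis using False by simp
    qed
  qed
  then show ?thesis by blast
qed

lemma F0D_subgroup: "subgroup (F0D k) (add_monoid M0)"
proof -
  obtain C K d where "graded_basis Y M0 F0D C K d" using F0_graded_basis by (elim exE)
  then show ?thesis by (rule graded_basis.D_sub)
qed

lemma F0D_smult: "r \<in> SD i \<Longrightarrow> x \<in> F0D j \<Longrightarrow> r \<odot>\<^bsub>M0\<^esub> x \<in> F0D (i + j)"
proof -
  obtain C K d where "graded_basis Y M0 F0D C K d" using F0_graded_basis by (elim exE)
  then show "r \<in> SD i \<Longrightarrow> x \<in> F0D j \<Longrightarrow> r \<odot>\<^bsub>M0\<^esub> x \<in> F0D (i + j)" by (rule graded_basis.D_smult)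
qed

lemma F0D_additive: "additive_subgroup (F0D k) M0"
  by (rule additive_subgroupI[OF F0D_subgroup])

lemma F0D_zero: "\<zero>\<^bsub>M0\<^esub> \<in> F0D k"
  by (rule additive_subgroup.zero_closed[OF F0D_additive])

lemma F0D_add: "x \<in> F0D k \<Longrightarrow> y \<in> F0D k \<Longrightarrow> x \<oplus>\<^bsub>M0\<^esub> y \<in> F0D k"
  by (rule additive_subgroup.a_closed[OF F0D_additive])

lemma F0D_minus: "x \<in> F0D k \<Longrightarrow> \<ominus>\<^bsub>M0\<^esub> x \<in> F0D k"
  using subgroup.m_inv_closed[OF F0D_subgroup, of x k] by (simp add: a_inv_def)

lemma F0D_carrier: "x \<in> F0D k \<Longrightarrow> x \<in> carrier M0"
  using subgroup.subset[OF F0D_subgroup[of k]] by auto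

lemma F0D_tensor: "r \<in> SD i \<Longrightarrow> w \<in> carrier X2 \<Longrightarrow> i + 2 = k \<Longrightarrow> t0 r w \<in> F0D k"
  unfolding scalar_extension_part_def
  by (intro generate.incl CollectI exI[of _ r] exI[of _ w] conjI exI[of _ i] exI[of _ 2]) (simp_all
      add: concentrated_def)

lemma var_SD: "y \<in> Y \<Longrightarrow> var y \<in> SD 1"
  by (simp add: int_poly_part_iff var_def int_poly_iff)

lemma one_SD: "1 \<in> SD 0"
  by (auto simp: int_poly_part_iff in_keys_iff lookup_one)

lemma SD_carrier: "r \<in> SD i \<Longrightarrow> r \<in> carrier S"
  by (simp add: int_poly_part_iff)

lemma koszul_F0D: "x \<in> Y \<Longrightarrow> y \<in> Y \<Longrightarrow> z \<in> Y \<Longrightarrow> koszul x y z \<in> F0D 3"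
proof -
  assume xyz: "x \<in> Y" "y \<in> Y" "z \<in> Y"
  have t: "t0 (var x) (w2 y z) \<in> F0D 3" if "x \<in> Y" "y \<in> Y" "z \<in> Y" for x y z
    by (rule F0D_tensor[OF var_SD[OF that(1)] w2_closed[OF that(2,3)]]) simp
  show ?thesis unfolding a_minus_def using t xyz by (intro F0D_add F0D_minus)
qed

lemma d3_F0D: "w \<in> carrier X3 \<Longrightarrow> d3 (t3 1 w) \<in> F0D 3"
proof -
  assume w: "w \<in> carrier X3"
  have h: "d3 \<circ> t3 1 \<in> hom X3 (add_monoid M0)"
    by (rule hom_compose[OF F3.tensor_hom_right[OF one_S] d3_hom])
  have "generate X3 {ext_class Y [x, y, z] | x y z. x \<in> Y \<and> y \<in> Y \<and> z \<in> Y} \<subseteq> {w \<in> carrier X3. (d3 \<circ>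
      t3 1) w \<in> F0D 3}"
  proof (rule X3.generate_subgroup_incl)
    show "subgroup {w \<in> carrier X3. (d3 \<circ> t3 1) w \<in> F0D 3} X3"
      by (rule subgroup_vimage[OF X3.is_group F0.RG.a_group h F0D_subgroup])
    show "{ext_class Y [x, y, z] | x y z. x \<in> Y \<and> y \<in> Y \<and> z \<in> Y} \<subseteq> {w \<in> carrier X3. (d3 \<circ> t3 1) w \<in> F0D 3}"
    proof
      fix a assume "a \<in> {ext_class Y [x, y, z] | x y z. x \<in> Y \<and> y \<in> Y \<and> z \<in> Y}"
      then obtain x y z where a: "a = w3 x y z" "x \<in> Y" "y \<in> Y" "z \<in> Y" by blast
      have "(d3 \<circ> t3 1) a \<in> F0D 3" unfolding a(1) o_apply d3_gen[OF a(2-4)] by (rule koszul_F0D[OF a(2-4)])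
      moreover have "a \<in> carrier X3" using a by simp
      ultimately show "a \<in> {w \<in> carrier X3. (d3 \<circ> t3 1) w \<in> F0D 3}" by (intro CollectI conjI)
    qed
  qed
  then have "w \<in> {w \<in> carrier X3. (d3 \<circ> t3 1) w \<in> F0D 3}" unfolding generate_exterior_3 using w by
      (rule subsetD)
  then show ?thesis by simp
qed

text \<open>Checked on generating tensors: away from degree three the component \<open>w\<close> is
  trivial, away from degree two the component \<open>j\<close> is, and a trivial component
  contributes zero, which lies in every degree.\<close>

lemma D_homogeneous: "D ` F1D k \<subseteq> F0D k"
proof -
  let ?gen = "{t1 r g |r g. \<exists>i j. r \<in> SD i \<and> g \<in> concentrated X3 3 j \<times> concentrated J 2 j \<and> i + j = k}"
  have "D (t1 r (w, j)) \<in> F0D (i + l)" and "t1 r (w, j) \<in> carrier M1"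
    if r: "r \<in> SD i" and w: "w \<in> concentrated X3 3 l" and j: "j \<in> concentrated J 2 l" for r i l w j
  proof -
    note rc = SD_carrier[OF r]
    have wc: "w \<in> carrier X3" using w X3.one_closed by (auto simp only: concentrated_def
        singleton_iff split: if_splits)
    have jc: "j \<in> carrier J" using j JG.one_closed by (auto simp only: concentrated_def
        singleton_iff split: if_splits)
    show "t1 r (w, j) \<in> carrier M1" using rc wc jc by (intro F1.tensor_closed) auto
    have "t0 r (\<delta> j) \<in> F0D (i + l)"
    proof (cases "l = 2")
      case True
      have "\<delta> j \<in> carrier X2" using jc by (intro \<delta>_closed) (simp add: J_simps)
      then show ?thesis using True by (intro F0D_tensor[OF r]) simp_all
    next
      case False
      then have "j = \<zero>\<^bsub>FL\<^esub>" using j by (simp add: concentrated_def J_simps)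
      then show ?thesis using F0D_zero F0.tensor_one_right[OF rc] by (simp only: \<delta>_one)
    qed
    moreover have "d3 (t3 r w) \<in> F0D (i + l)"
    proof (cases "l = 3")
      case True
      have "t3 r w = r \<odot>\<^bsub>M3\<^esub> t3 1 w" using F3.smult_tensor[OF rc one_S wc] by simp
      then have "d3 (t3 r w) = r \<odot>\<^bsub>M0\<^esub> d3 (t3 1 w)"
        using module_hom_smult[OF d3 rc F3.tensor_closed[OF one_S wc]] by simp
      then show ?thesis using F0D_smult[OF r d3_F0D[OF wc]] True by simp
    next
      case False
      then have "w = \<one>\<^bsub>X3\<^esub>" using w by (simp only: concentrated_def if_False singleton_iff)
      then have "t3 r w = \<zero>\<^bsub>M3\<^esub>" using F3.tensor_one_right[OF rc] by (simp only:)
      then show ?thesis using F0D_zero d3_zero by simp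
    qed
    ultimately show "D (t1 r (w, j)) \<in> F0D (i + l)"
      unfolding D_t[OF rc wc jc] by (intro F0D_add)
  qed
  then have "?gen \<subseteq> {x \<in> carrier (add_monoid M1). D x \<in> F0D k}" by fastforce
  then have "F1D k \<subseteq> {x \<in> carrier (add_monoid M1). D x \<in> F0D k}"
    unfolding scalar_extension_part_def[of _ _ "X3 \<times>\<times> J"]
    by (rule F1.RG.add.generate_subgroup_incl[OF _ subgroup_vimage[OF F1.RG.a_group F0.RG.a_group
        D_hom F0D_subgroup]])
  then show ?thesis by blast
qed

section \<open>The inherited grading of B(E) and its compatibility with the action\<close>

lemma presented_part_eq: "presented_part Y I k = (\<lambda>f. ecl f) ` carrier (free_Abelian_group (hom_trees Y k))"
  by (simp add: presented_part_def free_lie_part_eq image_image)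

lemma presented_part_subgroup: "subgroup (presented_part Y I k) (add_monoid E)"
  unfolding presented_part_def presented_lie_def
  by (rule group_hom.subgroup_img_is_subgroup[OF group_homI[OF FLie.a_group abelian_group.a_group[OF
      IQ.abelian_group_Q] IQ.rcos_hom]
        free_lie_part_subgroup])

lemma BD_eq: "BD k = AL.cl ` (AL.D1 \<inter> presented_part Y I k)"
  by (simp add: alexander_part_def)

lemma BD_subgroup: "subgroup (BD k) (add_monoid B)"
proof (rule BM.M.add.subgroupI)
  have P: "additive_subgroup (presented_part Y I k) E" by (rule additive_subgroupI[OF
      presented_part_subgroup])
  show "BD k \<subseteq> carrier B" unfolding BD_eq BAL by blast
  have "cl \<zero>\<^bsub>E\<^esub> \<in> BD k" unfolding BD_eq using additive_subgroup.zero_closed[OF P] AL.D1.zero_closed by blast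
  then show "BD k \<noteq> {}" by blast
  fix X assume "X \<in> BD k"
  then obtain u where u: "u \<in> AL.D1" "u \<in> presented_part Y I k" "X = cl u" unfolding BD_eq by blast
  have "\<ominus>\<^bsub>E\<^esub> u \<in> presented_part Y I k"
    using subgroup.m_inv_closed[OF presented_part_subgroup u(2)] by (simp add: a_inv_def)
  then show "\<ominus>\<^bsub>B\<^esub> X \<in> BD k" unfolding u(3) cl_minus[OF u(1), symmetric] BD_eq using
      AL.D1.a_inv_closed[OF u(1)] by blast
  fix X' assume "X' \<in> BD k"
  then obtain v where v: "v \<in> AL.D1" "v \<in> presented_part Y I k" "X' = cl v" unfolding BD_eq by blast
  have "X \<oplus>\<^bsub>B\<^esub> X' = cl (u \<oplus>\<^bsub>E\<^esub> v)" unfolding u(3) v(3) using AL.cl_add[OF AL.D1_carrier[OF u(1)]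
      AL.D1_carrier[OF v(1)]] by simp
  then show "X \<oplus>\<^bsub>B\<^esub> X' \<in> BD k" unfolding BD_eq
    using AL.D1.a_closed[OF u(1) v(1)] additive_subgroup.a_closed[OF P u(2) v(2)] by blast
qed

lemma BD_additive: "additive_subgroup (BD k) B"
  by (rule additive_subgroupI[OF BD_subgroup])

lemma BD_carrier: "X \<in> BD k \<Longrightarrow> X \<in> carrier B"
  using subgroup.subset[OF BD_subgroup[of k]] by auto

lemma tmul_leaf_part:
  assumes y: "y \<in> Y"
  shows "f \<in> carrier (free_Abelian_group (hom_trees Y k)) \<Longrightarrow> tmul (frag_of (Leaf y)) f \<in> carrier
      (free_Abelian_group (hom_trees Y (Suc k)))"
proof (induction f rule: free_Abelian_induct)
  case (diff f g)
  then show ?case using keys_diff[of "tmul (frag_of (Leaf y)) f" "tmul (frag_of (Leaf y)) g"] by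
      (auto simp: bilin_simps)
qed (use y in \<open>auto simp: bilin_simps hom_trees_def\<close>)

text \<open>Bracketing with a letter adds one leaf to every tree of a homogeneous
  representative.\<close>

lemma BD_var:
  assumes y: "y \<in> Y" and X: "X \<in> BD k"
  shows "var y \<odot>\<^bsub>B\<^esub> X \<in> BD (Suc k)"
proof -
  obtain u where u: "u \<in> AL.D1" "u \<in> presented_part Y I k" "X = cl u" using X unfolding BD_eq by blast
  obtain f where f: "f \<in> carrier (free_Abelian_group (hom_trees Y k))" "u = ecl f"
    using u(2) unfolding presented_part_eq by blast
  have "e y \<otimes>\<^bsub>E\<^esub> u = ecl (tmul (frag_of (Leaf y)) f)"
    unfolding f(2) e_ecl by (rule ecl_simps(4)[OF leaf_closed[OF y] hom_trees_carrier[OF f(1)]])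
  then have "e y \<otimes>\<^bsub>E\<^esub> u \<in> presented_part Y I (Suc k)"
    unfolding presented_part_eq using tmul_leaf_part[OF y f(1)] by blast
  moreover have "e y \<otimes>\<^bsub>E\<^esub> u \<in> AL.D1" using AL.D1_prod[OF AL.g_closed[OF y] AL.D1_carrier[OF u(1)]] .
  ultimately show ?thesis unfolding u(3) AL.BB_smult_var[OF y u(1)] BD_eq by blast
qed

lemma BD_monom: "set_mset m \<subseteq> Y \<Longrightarrow> X \<in> BD k \<Longrightarrow> frag_of m \<odot>\<^bsub>B\<^esub> X \<in> BD (size m + k)"
proof (induction m)
  case empty
  then show ?case using BM.smult_one[OF BD_carrier[OF empty(2)]] by (simp add: frag_of_zero_mset)
next
  case (add y m)
  have m: "frag_of m \<in> carrier S" using add by (simp add: int_poly_iff)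
  have "frag_of (add_mset y m) \<odot>\<^bsub>B\<^esub> X = var y \<odot>\<^bsub>B\<^esub> (frag_of m \<odot>\<^bsub>B\<^esub> X)"
    unfolding frag_of_add_mset using BM.smult_assoc1[of "var y" "frag_of m" X] m add.prems
        BD_carrier[OF add.prems(2)] by simp
  then show ?case using BD_var[of y "frag_of m \<odot>\<^bsub>B\<^esub> X" "size m + k"] add by simp
qed

lemma BD_smult:
  assumes r: "r \<in> SD i" and X: "X \<in> BD j"
  shows "r \<odot>\<^bsub>B\<^esub> X \<in> BD (i + j)"
proof -
  have "r \<in> carrier (free_Abelian_group {m. set_mset m \<subseteq> Y \<and> size m = i})"
    using r by (auto simp only: int_poly_part_iff int_poly_iff carrier_free_Abelian_group_iff)
  then show ?thesis
  proof (induction r rule: free_Abelian_induct)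
    case zero
    have "0 \<odot>\<^bsub>B\<^esub> X = \<zero>\<^bsub>B\<^esub>" using BM.smult_l_null[OF BD_carrier[OF X]] by simp
    then show ?case using additive_subgroup.zero_closed[OF BD_additive] by simp
  next
    case (diff p q)
    have c: "p \<in> carrier S" "q \<in> carrier S" using diff(1,2) unfolding int_poly_iff by auto
    have "(p - q) \<odot>\<^bsub>B\<^esub> X = p \<odot>\<^bsub>B\<^esub> X \<oplus>\<^bsub>B\<^esub> \<ominus>\<^bsub>B\<^esub> (q \<odot>\<^bsub>B\<^esub> X)"
      using BM.smult_l_distr[of p "- q" X] BM.smult_l_minus[of q X] c BD_carrier[OF X] by simp
    moreover have "\<ominus>\<^bsub>B\<^esub> (q \<odot>\<^bsub>B\<^esub> X) \<in> BD (i + j)"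
      using subgroup.m_inv_closed[OF BD_subgroup diff(4)] by (simp only: a_inv_def)
    ultimately show ?case using additive_subgroup.a_closed[OF BD_additive diff(3)] by simp
  next
    case (frag_of m)
    then show ?case using BD_monom[of m X j] X by simp
  qed
qed

lemma \<psi>_homogeneous: "\<psi> ` F0D k \<subseteq> BD k"
proof -
  let ?gen = "{t0 r g |r g. \<exists>i j. r \<in> SD i \<and> g \<in> concentrated X2 2 j \<and> i + j = k}"
  have g: "\<psi> (t0 r w) \<in> BD (i + l) \<and> t0 r w \<in> carrier M0"
    if r: "r \<in> SD i" and w: "w \<in> concentrated X2 2 l" for r i l w
  proof
    note rc = SD_carrier[OF r]
    have wc: "w \<in> carrier X2" using w X2.one_closed by (auto simp only: concentrated_def
        singleton_iff split: if_splits)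
    show "t0 r w \<in> carrier M0" by (rule F0.tensor_closed[OF rc wc])
    show "\<psi> (t0 r w) \<in> BD (i + l)"
    proof (cases "l = 2")
      case True
      have p: "\<theta> w \<in> free_lie_part Y 2" using hom_in_carrier[OF \<theta>_hom wc] by simp
      have "cl (I +>\<^bsub>FL\<^esub> \<theta> w) \<in> BD 2"
        unfolding BD_eq presented_part_def using part2_D1[OF p] p by blast
      then show ?thesis unfolding \<psi>_t[OF rc wc] True by (rule BD_smult[OF r])
    next
      case False
      then have "w = \<one>\<^bsub>X2\<^esub>" using w by (simp only: concentrated_def if_False singleton_iff)
      then have "t0 r w = \<zero>\<^bsub>M0\<^esub>" using F0.tensor_one_right[OF rc] by (simp only:)
      then show ?thesis using additive_subgroup.zero_closed[OF BD_additive]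
          \<psi>_zero by simp
    qed
  qed
  have "?gen \<subseteq> {x \<in> carrier (add_monoid M0). \<psi> x \<in> BD k}"
  proof
    fix x assume "x \<in> ?gen"
    then obtain r w i l where "x = t0 r w" "r \<in> SD i" "w \<in> concentrated X2 2 l" "i + l = k" by blast
    then show "x \<in> {x \<in> carrier (add_monoid M0). \<psi> x \<in> BD k}" using g[of r i w l] by simp
  qed
  then have "generate (add_monoid M0) ?gen \<subseteq> {x \<in> carrier (add_monoid M0). \<psi> x \<in> BD k}"
    by (rule F0.RG.add.generate_subgroup_incl[OF _ subgroup_vimage[OF F0.RG.a_group BM.M.a_group
        \<psi>_hom BD_subgroup]])
  then show ?thesis unfolding scalar_extension_part_def by blast
qed

section \<open>Surjectivity of \<open>\<psi>\<close>, degree by degree\<close>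

lemma Br_D1: "set_tree s \<subseteq> Y \<Longrightarrow> set_tree u \<subseteq> Y \<Longrightarrow>
   ecl (frag_of (Br s u)) = ecl (frag_of s) \<otimes>\<^bsub>E\<^esub> ecl (frag_of u) \<and> ecl (frag_of (Br s u)) \<in> AL.D1"
proof -
  assume su: "set_tree s \<subseteq> Y" "set_tree u \<subseteq> Y"
  have e: "ecl (frag_of (Br s u)) = ecl (frag_of s) \<otimes>\<^bsub>E\<^esub> ecl (frag_of u)"
    unfolding ecl_simps(4)[OF frag_of_tree[OF su(1)] frag_of_tree[OF su(2)]] by (simp add: bilin_simps)
  then show ?thesis using AL.D1_prod[OF ecl_closed[OF frag_of_tree[OF su(1)]] ecl_closed[OF
      frag_of_tree[OF su(2)]]] by simp
qed

lemma bracket_D1: "t \<in> brackets \<Longrightarrow> ecl (frag_of t) \<in> AL.D1"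
proof (cases t)
  case (Br s u)
  assume "t \<in> brackets"
  then have "set_tree s \<subseteq> Y" "set_tree u \<subseteq> Y" using Br by (auto simp: brackets_def)
  then show ?thesis unfolding Br by (rule conjunct2[OF Br_D1])
qed (simp add: brackets_def)

text \<open>Induction on the tree. A bracket of two letters comes from a product of letters; a
  letter bracketed with a proper bracket comes from multiplying the lift by a variable, with a sign
  if the letter stands on the right; a bracket of two proper brackets lies in E'' and lifts to
  zero.\<close>

lemma tree_lift: "t \<in> brackets \<Longrightarrow> cl (ecl (frag_of t)) \<in> \<psi> ` F0D (leaves t)"
proof (induction t)
  case (Leaf y)
  then show ?case by (simp add: brackets_def)
next
  case (Br s u)
  have su: "set_tree s \<subseteq> Y" "set_tree u \<subseteq> Y" using Br.prems by (auto simp: brackets_def)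
  note e = Br_D1[OF su]
  have left: "cl (e y \<otimes>\<^bsub>E\<^esub> ecl (frag_of v)) \<in> \<psi> ` F0D (Suc (leaves v))"
    if y: "y \<in> Y" and v: "ecl (frag_of v) \<in> AL.D1" and IH: "cl (ecl (frag_of v)) \<in> \<psi> ` F0D (leaves
        v)" for y and v :: "'a bracket_tree"
  proof -
    from IH obtain x where x': "cl (ecl (frag_of v)) = \<psi> x" and x: "x \<in> F0D (leaves v)" by (rule imageE)
    have "\<psi> (var y \<odot>\<^bsub>M0\<^esub> x) = cl (e y \<otimes>\<^bsub>E\<^esub> ecl (frag_of v))"
      unfolding module_hom_smult[OF \<psi> SD_carrier[OF var_SD[OF y]] F0D_carrier[OF x]] x'[symmetric]
      by (rule AL.BB_smult_var[OF y v])
    moreover have "var y \<odot>\<^bsub>M0\<^esub> x \<in> F0D (Suc (leaves v))" using F0D_smult[OF var_SD[OF y] x] by simp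
    ultimately show ?thesis by (metis image_eqI)
  qed
  show ?case
  proof (cases "\<exists>x. s = Leaf x")
    case True
    then obtain x where x: "s = Leaf x" "x \<in> Y" using su by auto
    show ?thesis
    proof (cases u)
      case (Leaf y)
      then have y: "y \<in> Y" using su by simp
      have "t0 1 (w2 x y) \<in> F0D (leaves (Br s u))"
        by (rule F0D_tensor[OF one_SD w2_closed[OF x(2) y]]) (simp add: x Leaf)
      then have "\<psi> (t0 1 (w2 x y)) \<in> \<psi> ` F0D (leaves (Br s u))" by (rule imageI)
      then show ?thesis unfolding \<psi>_gen(1)[OF x(2) y] by (simp only: x(1) Leaf)
    next
      case (Br p q)
      then have u: "u \<in> brackets" using su by (auto simp: brackets_def)
      note IHu = bracket_D1[OF u] Br.IH(2)[OF u]
      have "cl (e x \<otimes>\<^bsub>E\<^esub> ecl (frag_of u)) \<in> \<psi> ` F0D (Suc (leaves u))" by (intro left[OF x(2)] IHu)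
      then show ?thesis using e unfolding x(1) by (simp add: e_ecl)
    qed
  next
    case False
    then have s: "s \<in> brackets" using su by (auto simp: brackets_def)
    have sD: "ecl (frag_of s) \<in> AL.D1" by (rule bracket_D1[OF s])
    show ?thesis
    proof (cases u)
      case (Leaf y)
      then have y: "y \<in> Y" using su by simp
      from left[OF y sD Br.IH(1)[OF s]]
      obtain x where x': "cl (e y \<otimes>\<^bsub>E\<^esub> ecl (frag_of s)) = \<psi> x" and x: "x \<in> F0D (Suc (leaves s))"
        by (rule imageE)
      have "ecl (frag_of (Br s u)) = \<ominus>\<^bsub>E\<^esub> (e y \<otimes>\<^bsub>E\<^esub> ecl (frag_of s))"
        using e AL.antisym[OF AL.D1_carrier[OF sD] AL.g_closed[OF y]] unfolding Leaf by (simp add: e_ecl)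
      then have "cl (ecl (frag_of (Br s u))) = \<psi> (\<ominus>\<^bsub>M0\<^esub> x)"
        using cl_minus[OF AL.D1_prod[OF AL.g_closed[OF y] AL.D1_carrier[OF sD]]] x'
          \<psi>_minus[OF F0D_carrier[OF x]] by simp
      moreover have "\<ominus>\<^bsub>M0\<^esub> x \<in> F0D (leaves (Br s u))" using F0D_minus[OF x] Leaf by simp
      ultimately show ?thesis by blast
    next
      case (Br p q)
      then have "u \<in> brackets" using su by (auto simp: brackets_def)
      then have "ecl (frag_of u) \<in> AL.D1" by (rule bracket_D1)
      then have "ecl (frag_of (Br s u)) \<in> AL.D2" using e AL.derived_incl[OF sD] by simp
      then have "cl (ecl (frag_of (Br s u))) = \<psi> \<zero>\<^bsub>M0\<^esub>"
        using AL.cl_zero_iff[of "ecl (frag_of (Br s u))"] AL.D1_carrier e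
          \<psi>_zero by simp
      then show ?thesis using F0D_zero by blast
    qed
  qed
qed

text \<open>The subgroup \<open>K\<close> is a parameter so that the same linear extension serves
  for the whole module and for a single graded part.\<close>

lemma lift_free:
  assumes T: "T \<subseteq> brackets" and K: "subgroup K (add_monoid M0)"
    and t: "\<And>t. t \<in> T \<Longrightarrow> cl (ecl (frag_of t)) \<in> \<psi> ` K"
    and f: "f \<in> carrier (free_Abelian_group T)"
  shows "ecl f \<in> AL.D1 \<and> cl (ecl f) \<in> \<psi> ` K"
  using f
proof (induction f rule: free_Abelian_induct)
  case zero
  have "ecl 0 = \<zero>\<^bsub>E\<^esub>" by (rule hom_zero[OF FN.abelian_group_axioms AL.abelian_group_axioms ecl_hom,
      simplified])
  moreover have "cl \<zero>\<^bsub>E\<^esub> = \<psi> \<zero>\<^bsub>M0\<^esub>"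
    using \<psi>_zero AL.cl_zero_iff[of "\<zero>\<^bsub>E\<^esub>"] by simp
  moreover have "\<zero>\<^bsub>M0\<^esub> \<in> K" using subgroup.one_closed[OF K] by simp
  ultimately show ?case using AL.D1.zero_closed by simp
next
  case (diff f g)
  have c: "f \<in> carrier FN" "g \<in> carrier FN"
    using diff(1,2) T brackets_carrier[of f] brackets_carrier[of g] by auto
  from conjunct2[OF diff(3)] obtain x where x: "cl (ecl f) = \<psi> x" "x \<in> K" by (rule imageE)
  from conjunct2[OF diff(4)] obtain y where y: "cl (ecl g) = \<psi> y" "y \<in> K" by (rule imageE)
  have xc: "x \<in> carrier M0" "y \<in> carrier M0" using x y subgroup.subset[OF K] by auto
  have s: "ecl (f - g) = ecl f \<oplus>\<^bsub>E\<^esub> \<ominus>\<^bsub>E\<^esub> ecl g" using ecl_simps(6)[OF c] by (simp add: a_minus_def)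
  have d: "ecl f \<in> AL.D1" "ecl g \<in> AL.D1" "\<ominus>\<^bsub>E\<^esub> ecl g \<in> AL.D1" using diff(3,4) AL.D1.a_inv_closed by auto
  have "cl (ecl (f - g)) = cl (ecl f) \<oplus>\<^bsub>B\<^esub> \<ominus>\<^bsub>B\<^esub> cl (ecl g)"
    unfolding s cl_minus[OF d(2), symmetric] using AL.cl_add[OF AL.D1_carrier[OF d(1)]
        AL.D1_carrier[OF d(3)]] by simp
  also have "\<dots> = \<psi> (x \<ominus>\<^bsub>M0\<^esub> y)"
    unfolding \<psi>_diff[OF xc] x(1) y(1) by (simp add: a_minus_def)
  finally have "cl (ecl (f - g)) = \<psi> (x \<ominus>\<^bsub>M0\<^esub> y)" .
  moreover have "x \<ominus>\<^bsub>M0\<^esub> y \<in> K"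
    unfolding a_minus_def using subgroup.m_closed[OF K x(2) subgroup.m_inv_closed[OF K y(2)]] by
        (simp add: a_inv_def)
  ultimately show ?case unfolding s using AL.D1.a_closed[OF d(1,3)] by blast
next
  case (frag_of t)
  then have "t \<in> brackets" using T by auto
  then have "ecl (frag_of t) \<in> AL.D1" by (rule bracket_D1)
  then show ?case using t[OF frag_of] by simp
qed

lemma \<psi>_surj: "\<psi> ` carrier M0 = carrier B"
proof
  show "\<psi> ` carrier M0 \<subseteq> carrier B" using \<psi>_closed by blast
  show "carrier B \<subseteq> \<psi> ` carrier M0"
  proof
    fix X assume "X \<in> carrier B"
    then obtain u where u: "u \<in> AL.D1" "X = cl u" unfolding BAL by blast
    obtain f where f: "f \<in> carrier (free_Abelian_group brackets)" "u = ecl f" using D1_rep[OF u(1)] by blast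
    have "cl (ecl f) \<in> \<psi> ` carrier M0"
    proof (rule conjunct2[OF lift_free[OF subset_refl _ _ f(1)]])
      show "subgroup (carrier M0) (add_monoid M0)" using F0.RG.add.subgroup_self by simp
      show "cl (ecl (frag_of t)) \<in> \<psi> ` carrier M0" if "t \<in> brackets" for t
        using tree_lift[OF that] F0D_carrier by blast
    qed
    then show "X \<in> \<psi> ` carrier M0" using u f by simp
  qed
qed

text \<open>The point is that a homogeneous class has a homogeneous lift. Its homogeneous
  representative has no linear part by \<open>D1_lin\<close>, so it is a combination of proper
  brackets with \<open>k\<close> leaves, and \<open>tree_lift\<close> keeps track of the
  degree.\<close>

lemma BD_image: "BD k = \<psi> ` F0D k"
proof
  show "\<psi> ` F0D k \<subseteq> BD k" by (rule \<psi>_homogeneous)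
  show "BD k \<subseteq> \<psi> ` F0D k"
  proof
    fix X assume "X \<in> BD k"
    then obtain u where u: "u \<in> AL.D1" "u \<in> presented_part Y I k" "X = cl u" unfolding BD_eq by blast
    obtain f where f: "f \<in> carrier (free_Abelian_group (hom_trees Y k))" "u = ecl f"
      using u(2) unfolding presented_part_eq by blast
    have "lin f a = 0" for a by (rule D1_lin[OF hom_trees_carrier[OF f(1)]]) (use u f in simp)
    then have "f \<in> carrier (free_Abelian_group brackets)" by (rule brackets_iff[OF
        hom_trees_carrier[OF f(1)]])
    then have "f \<in> carrier (free_Abelian_group {t \<in> brackets. leaves t = k})"
      using f(1) by (auto simp: hom_trees_def subset_iff)
    then have "cl (ecl f) \<in> \<psi> ` F0D k"
      by (rule conjunct2[OF lift_free[OF _ F0D_subgroup, rotated -1]]) (use tree_lift in auto)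
    then show "X \<in> \<psi> ` F0D k" using u f by simp
  qed
qed

text \<open>Exactness makes B(E) a quotient by the image of the homogeneous map \<open>D\<close>,
  which grades it by the images of the parts of \<open>M0\<close>; by \<open>BD_image\<close> this
  is the grading inherited from \<open>E\<close>.\<close>

lemma graded_module_B: "graded_module S SD B BD"
proof -
  obtain C0 K0 c0 where g0: "graded_basis Y M0 F0D C0 K0 c0" using F0_graded_basis by blast
  obtain C1 K1 c1 where g1: "graded_basis Y M1 F1D C1 K1 c1" using F1_graded_basis by blast
  have "graded_group B (\<lambda>k. \<psi> ` F0D k)"
  proof (rule graded_quotient[OF graded_basis.graded_proj_D[OF g0] graded_basis.graded_proj_D[OF g1]
      D_hom D_homogeneous
        BM.M.abelian_group_axioms \<psi>_hom \<psi>_surj])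
    show "\<psi> x = \<zero>\<^bsub>B\<^esub> \<longleftrightarrow> x \<in> img" if "x \<in> carrier M0" for x
      using ker_img[OF that] \<psi>_img[of x] by blast
  qed
  moreover have "(\<lambda>k. \<psi> ` F0D k) = BD" using BD_image by (intro ext) simp
  ultimately have "graded_group B BD" by simp
  then show ?thesis
    unfolding graded_module_def using BM.module_axioms graded_group_int_poly BD_smult by blast
qed

end

theorem theorem6p2:
  fixes Y :: "'y set" and I :: "('y bracket_tree \<Rightarrow>\<^sub>0 int) set set"
  assumes "finite Y" and "quadratic_ideal Y I"
  shows
   "let S = int_poly Y; SD = int_poly_part Y;
        J = quadratic_relators Y I;
        \<Lambda>2 = exterior_power Y 2; \<Lambda>3 = exterior_power Y 3;
        E = presented_lie Y I; e = presented_gen Y I;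
        F1 = scalar_extension S (\<Lambda>3 \<times>\<times> J);
        F1D = scalar_extension_part S SD (\<Lambda>3 \<times>\<times> J)
                (\<lambda>k. concentrated \<Lambda>3 3 k \<times> concentrated J 2 k);
        F0 = scalar_extension S \<Lambda>2;
        F0D = scalar_extension_part S SD \<Lambda>2 (concentrated \<Lambda>2 2);
        B = alexander_invariant E e;
        BD = alexander_part E (presented_part Y I)
    in graded_module S SD F1 F1D \<and> finite_graded_free S F1 F1D \<and>
       graded_module S SD F0 F0D \<and> finite_graded_free S F0 F0D \<and>
       graded_module S SD B BD \<and>
       (\<exists>\<theta> d3 \<delta> D \<psi>.
          \<theta> \<in> iso \<Lambda>2 (lie_degree2 Y) \<and>
          (\<forall>x\<in>Y. \<forall>y\<in>Y. \<theta> (wedge2 Y x y) = lie_gen Y x \<otimes>\<^bsub>free_lie Y\<^esub> lie_gen Y y) \<and>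
          \<delta> \<in> carrier J \<rightarrow> carrier \<Lambda>2 \<and> (\<forall>j\<in>carrier J. \<theta> (\<delta> j) = j) \<and>
          d3 \<in> module_hom S (scalar_extension S \<Lambda>3) F0 \<and>
          (\<forall>x\<in>Y. \<forall>y\<in>Y. \<forall>z\<in>Y.
             d3 (tensor S \<Lambda>3 \<one>\<^bsub>S\<^esub> (wedge3 Y x y z)) =
               tensor S \<Lambda>2 (var x) (wedge2 Y y z)
                 \<ominus>\<^bsub>F0\<^esub> tensor S \<Lambda>2 (var y) (wedge2 Y x z)
                 \<oplus>\<^bsub>F0\<^esub> tensor S \<Lambda>2 (var z) (wedge2 Y x y)) \<and>
          D \<in> module_hom S F1 F0 \<and>
          (\<forall>s\<in>carrier S. \<forall>w\<in>carrier \<Lambda>3. \<forall>j\<in>carrier J.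
             D (tensor S (\<Lambda>3 \<times>\<times> J) s (w, j)) =
               d3 (tensor S \<Lambda>3 s w) \<oplus>\<^bsub>F0\<^esub> tensor S \<Lambda>2 s (\<delta> j)) \<and>
          \<psi> \<in> module_hom S F0 B \<and>
          (\<forall>x\<in>Y. \<forall>y\<in>Y.
             \<psi> (tensor S \<Lambda>2 \<one>\<^bsub>S\<^esub> (wedge2 Y x y)) = alexander_class E (e x \<otimes>\<^bsub>E\<^esub> e y)) \<and>
          homogeneous_map F1D F0D D \<and> homogeneous_map F0D BD \<psi> \<and>
          D ` carrier F1 = a_kernel F0 B \<psi> \<and>
          \<psi> ` carrier F0 = carrier B)"
proof -
  interpret P: quadratic_presentation Y I using assms by (rule quadratic_presentation.intro)
  obtain \<theta> where \<theta>: "\<theta> \<in> iso P.X2 (lie_degree2 Y)" "\<forall>x \<in> Y. \<forall>y \<in> Y. \<theta> (ext_class Y [x, y]) = gen2 Y x y"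
    using lie_degree2_iso[OF assms(1)] by (elim bexE)
  obtain kc where kc: "\<forall>a b. kc a b \<in> module_hom P.S P.M0 (self_module P.S)"
     "\<forall>a b. \<forall>r \<in> carrier P.S. \<forall>x \<in> Y. \<forall>y \<in> Y. kc a b (P.t0 r (P.w2 x y)) = r * of_int (minor2 a b x y)"
     "\<forall>u \<in> carrier P.M0. \<forall>v \<in> carrier P.M0. (\<forall>a \<in> Y. \<forall>b \<in> Y. kc a b u = kc a b v) \<longrightarrow> u = v"
    using P.kc_exists by (elim exE conjE)
  \<comment> \<open>The maps are fixed in stages, since the existence of \<open>d3\<close> and
    \<open>D\<close> is proved with the coordinates, and that of \<open>D\<close> for a given
    \<open>d3\<close>.\<close>
  interpret P: presentation_coords Y I \<theta> kc
    by (intro presentation_coords.intro P.quadratic_presentation_axioms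
        presentation_coords_axioms.intro) (use \<theta> kc in simp_all)
  obtain d3 where d3: "d3 \<in> module_hom P.S P.M3 P.M0"
    "\<forall>x \<in> Y. \<forall>y \<in> Y. \<forall>z \<in> Y. d3 (P.t3 1 (P.w3 x y z)) = P.koszul x y z"
    using P.d3_exists by (elim bexE)
  obtain D where D: "D \<in> module_hom P.S P.M1 P.M0" "\<forall>s \<in> carrier P.S. \<forall>w \<in> carrier P.X3. \<forall>j \<in> carrier P.J.
     D (P.t1 s (w, j)) = d3 (P.t3 s w) \<oplus>\<^bsub>P.M0\<^esub> P.t0 s (P.\<delta> j)"
    using P.D_exists[OF d3(1)] by (elim bexE)
  obtain \<psi> where \<psi>: "\<psi> \<in> module_hom P.S P.M0 P.B"
    "\<forall>s \<in> carrier P.S. \<forall>w \<in> carrier P.X2. \<psi> (P.t0 s w) = s \<odot>\<^bsub>P.B\<^esub> P.cl (I +>\<^bsub>P.FL\<^esub> \<theta> w)"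
    using P.\<psi>_exists by (elim bexE)
  interpret P: presentation_maps Y I \<theta> kc d3 D \<psi>
    by (intro presentation_maps.intro P.presentation_coords_axioms presentation_maps_axioms.intro)
        (use d3 D \<psi> in simp_all)
  obtain C0 K0 c0 where g0: "graded_basis Y P.M0 P.F0D C0 K0 c0" using P.F0_graded_basis by blast
  obtain C1 K1 c1 where g1: "graded_basis Y P.M1 P.F1D C1 K1 c1" using P.F1_graded_basis by blast
  show ?thesis
    unfolding Let_def
  proof (intro conjI exI)
    show "graded_module P.S P.SD P.M1 P.F1D" by (rule graded_basis.graded_module_D[OF g1])
    show "finite_graded_free P.S P.M1 P.F1D" by (rule graded_basis.finite_graded_free_D[OF g1])
    show "graded_module P.S P.SD P.M0 P.F0D" by (rule graded_basis.graded_module_D[OF g0])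
    show "finite_graded_free P.S P.M0 P.F0D" by (rule graded_basis.finite_graded_free_D[OF g0])
    show "graded_module P.S P.SD P.B P.BD" by (rule P.graded_module_B)
    show "\<theta> \<in> iso P.X2 (lie_degree2 Y)" by (rule \<theta>(1))
    show "\<forall>x\<in>Y. \<forall>y\<in>Y. \<theta> (wedge2 Y x y) = lie_gen Y x \<otimes>\<^bsub>free_lie Y\<^esub> lie_gen Y y"
    proof (intro ballI)
      fix x y assume xy: "x \<in> Y" "y \<in> Y"
      show "\<theta> (wedge2 Y x y) = lie_gen Y x \<otimes>\<^bsub>free_lie Y\<^esub> lie_gen Y y"
        unfolding wedge2_class[OF xy] gen2_lie[OF xy, symmetric] by (rule P.\<theta>_gen[OF xy])
    qed
    show "P.\<delta> \<in> carrier P.J \<rightarrow> carrier P.X2" using P.\<delta>_closed by (simp add: P.J_simps)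
    show "\<forall>j\<in>carrier P.J. \<theta> (P.\<delta> j) = j" using P.\<theta>_\<delta> by (simp add: P.J_simps)
    show "d3 \<in> module_hom P.S P.M3 P.M0" by (rule d3(1))
    show "\<forall>x\<in>Y. \<forall>y\<in>Y. \<forall>z\<in>Y. d3 (tensor P.S P.X3 \<one>\<^bsub>P.S\<^esub> (wedge3 Y x y z)) =
       tensor P.S P.X2 (var x) (wedge2 Y y z) \<ominus>\<^bsub>P.M0\<^esub> tensor P.S P.X2 (var y) (wedge2 Y x z)
         \<oplus>\<^bsub>P.M0\<^esub> tensor P.S P.X2 (var z) (wedge2 Y x y)"
      using P.d3_gen by (simp add: wedge2_class wedge3_class)
    show "D \<in> module_hom P.S P.M1 P.M0" by (rule D(1))
    show "\<forall>s\<in>carrier P.S. \<forall>w\<in>carrier P.X3. \<forall>j\<in>carrier P.J.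
       D (tensor P.S (P.X3 \<times>\<times> P.J) s (w, j)) = d3 (tensor P.S P.X3 s w) \<oplus>\<^bsub>P.M0\<^esub> tensor P.S P.X2 s (P.\<delta> j)"
      by (rule D(2))
    show "\<psi> \<in> module_hom P.S P.M0 P.B" by (rule \<psi>(1))
    show "\<forall>x\<in>Y. \<forall>y\<in>Y. \<psi> (tensor P.S P.X2 \<one>\<^bsub>P.S\<^esub> (wedge2 Y x y)) = alexander_class P.E (P.e x \<otimes>\<^bsub>P.E\<^esub> P.e y)"
      using P.\<psi>_gen by (simp add: wedge2_class)
    show "homogeneous_map P.F1D P.F0D D" unfolding homogeneous_map_def using P.D_homogeneous by blast
    show "homogeneous_map P.F0D P.BD \<psi>" unfolding homogeneous_map_def using P.\<psi>_homogeneous by blast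
    show "D ` carrier P.M1 = a_kernel P.M0 P.B \<psi>" by (rule P.exact)
    show "\<psi> ` carrier P.M0 = carrier P.B" by (rule P.\<psi>_surj)
  qed
qed

end
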